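(* The Shalika model has multiplicity one: for every irreducible representation $\pi$ of $G^F$, $S(\pi)=\dim\mathrm{Hom}_{\mathrm S^F}(\pi,\psi_{\mathrm S})\le1$.
   Context: $\mathbb F_q$ is a finite field, $\mathrm k$ an algebraic closure, $\ell$ a prime different from the characteristic; representations are over $\overline{\mathbb Q}_\ell$. $G=\mathrm{GL}_{2\mathfrak n}$ over $\mathrm k$ with Frobenius $F$ equal either to $F_{\mathrm{GL}}$ (raising entries to the $q$-th power) or to $F_{\mathrm U}:g\mapsto E({}^tF_{\mathrm{GL}}(g))^{-1}E^{-1}$, $E=\begin{pmatrix}0&1_{\mathfrak n}\\-1_{\mathfrak n}&0\end{pmatrix}$; so $G^F$ is $\mathrm{GL}_{2\mathfrak n}(\mathbb F_q)$ or $\mathrm U_{2\mathfrak n}(\mathbb F_q)$. $\mathrm S=\left\{\begin{pmatrix}g&x\\0&g\end{pmatrix}:g\in\mathrm{GL}_{\mathfrak n},x\in\mathrm M_{\mathfrak n}\right\}\subset G$ (it is $F$-stable), $\psi:\mathbb F_q\to\overline{\mathbb Q}_\ell^\times$ is a fixed nontrivial character, and $\psi_{\mathrm S}\begin{pmatrix}g&x\\0&g\end{pmatrix}=\psi(\mathrm{tr}(g^{-1}x))$ on $\mathrm S^F$. *)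

theory Defs
  imports
    "HOL-Algebra.Algebraic_Closure_Type"
    "HOL-Computational_Algebra.Fraction_Field"
    "HOL-Library.Function_Algebras"
    "Jordan_Normal_Form.Matrix"
    "Berlekamp_Zassenhaus.Finite_Field"
begin

section \<open>The field of coefficients\<close>

text \<open>
  The prime \<open>\<ell>\<close> is \<open>CARD('l)\<close> for a type \<open>'l\<close> of class \<^class>\<open>prime_card\<close>. The ring of \<open>\<ell>\<close>-adic
  integers is the inverse limit of the rings of integers modulo \<open>\<ell> ^ n\<close>: the \<open>n\<close>-th member of a
  coherent sequence is the representative in \<open>{0..<\<ell> ^ n}\<close> of the residue modulo \<open>\<ell> ^ n\<close>.
\<close>

typedef (overloaded) ('l :: prime_card) padic_int =
  "{x :: nat \<Rightarrow> int. \<forall>n. x n \<in> {0..<int CARD('l) ^ n} \<and> x (Suc n) mod int CARD('l) ^ n = x n}"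
  morphisms residue_mod_power Abs_padic_int
  by (rule exI[of _ "\<lambda>_. 0"]) (auto simp: prime_card prime_gt_0_nat)

setup_lifting type_definition_padic_int

lemma padic_pow_pos: "int CARD('l::prime_card) ^ n > 0"
  by (simp add: prime_card prime_gt_0_nat)

lemma mod_mod_power_Suc: "(a mod (m::int) ^ Suc n) mod m ^ n = a mod m ^ n"
  by (rule mod_mod_cancel) (simp add: le_imp_power_dvd)

instantiation padic_int :: (prime_card) comm_ring_1
begin

lift_definition zero_padic_int :: "'a padic_int" is "\<lambda>_. 0"
  by (simp add: padic_pow_pos)

lift_definition one_padic_int :: "'a padic_int" is "\<lambda>n. 1 mod int CARD('a) ^ n"
  by (simp only: mod_mod_power_Suc) (simp add: padic_pow_pos)

lift_definition plus_padic_int :: "'a padic_int \<Rightarrow> 'a padic_int \<Rightarrow> 'a padic_int"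
  is "\<lambda>x y n. (x n + y n) mod int CARD('a) ^ n"
  by (simp only: mod_mod_power_Suc) (simp add: padic_pow_pos, metis mod_add_eq)

lift_definition minus_padic_int :: "'a padic_int \<Rightarrow> 'a padic_int \<Rightarrow> 'a padic_int"
  is "\<lambda>x y n. (x n - y n) mod int CARD('a) ^ n"
  by (simp only: mod_mod_power_Suc) (simp add: padic_pow_pos, metis mod_diff_eq)

lift_definition uminus_padic_int :: "'a padic_int \<Rightarrow> 'a padic_int"
  is "\<lambda>x n. (- x n) mod int CARD('a) ^ n"
  by (simp only: mod_mod_power_Suc) (simp add: padic_pow_pos, metis mod_minus_eq)

lift_definition times_padic_int :: "'a padic_int \<Rightarrow> 'a padic_int \<Rightarrow> 'a padic_int"
  is "\<lambda>x y n. (x n * y n) mod int CARD('a) ^ n"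
  by (simp only: mod_mod_power_Suc) (simp add: padic_pow_pos, metis mod_mult_eq)

instance
proof
  fix a b c :: "'a padic_int"
  show "a * b * c = a * (b * c)"
    by transfer (simp add: fun_eq_iff mod_simps mult.assoc)
  show "a * b = b * a"
    by transfer (simp add: fun_eq_iff mult.commute)
  show "1 * a = a"
    by transfer (simp add: fun_eq_iff mod_simps)
  show "a + b + c = a + (b + c)"
    by transfer (simp add: fun_eq_iff mod_simps add.assoc)
  show "a + b = b + a"
    by transfer (simp add: fun_eq_iff add.commute)
  show "0 + a = a"
    by transfer (simp add: fun_eq_iff)
  show "- a + a = 0"
    by transfer (simp add: fun_eq_iff mod_simps)
  show "a - b = a + - b"
    by transfer (simp add: fun_eq_iff mod_simps)
  show "(a + b) * c = a * c + b * c"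
    by transfer (simp add: fun_eq_iff mod_simps distrib_right)
  show "(0 :: 'a padic_int) \<noteq> 1"
  proof (transfer, rule notI)
    assume "(\<lambda>_. 0) = (\<lambda>n. 1 mod int CARD('a) ^ n)"
    then have "0 = 1 mod int CARD('a) ^ 1" by (rule fun_cong)
    then show False using prime_gt_1_nat[OF prime_card[where 'a='a]] by simp
  qed
qed

end

lemma residue_mod_power_mod:
  fixes x :: "'l :: prime_card padic_int"
  shows "residue_mod_power x (m + k) mod int CARD('l) ^ m = residue_mod_power x m"
proof (induction k)
  case 0
  then show ?case using residue_mod_power[of x] by simp
next
  case (Suc k)
  let ?p = "int CARD('l)"
  have "residue_mod_power x (m + Suc k) mod ?p ^ m
      = residue_mod_power x (Suc (m + k)) mod ?p ^ (m + k) mod ?p ^ m"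
    by (simp add: mod_mod_cancel le_imp_power_dvd)
  also have "\<dots> = residue_mod_power x (m + k) mod ?p ^ m"
    using residue_mod_power[of x] by simp
  finally show ?case using Suc.IH by simp
qed

lemma residue_mod_power_not_dvd:
  fixes x :: "'l :: prime_card padic_int"
  assumes "residue_mod_power x m \<noteq> 0"
  shows "\<not> int CARD('l) ^ m dvd residue_mod_power x (m + k)"
  using residue_mod_power_mod[of x m k] assms by (metis mod_0_imp_dvd dvd_imp_mod_0)

instance padic_int :: (prime_card) idom
proof
  fix x y :: "'a padic_int"
  assume "x \<noteq> 0" "y \<noteq> 0"
  let ?p = "int CARD('a)"
  obtain a where a: "residue_mod_power x a \<noteq> 0"
    using \<open>x \<noteq> 0\<close> by (transfer) (auto simp: fun_eq_iff)
  obtain b where b: "residue_mod_power y b \<noteq> 0"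
    using \<open>y \<noteq> 0\<close> by (transfer) (auto simp: fun_eq_iff)
  let ?u = "residue_mod_power x (a + b)" and ?v = "residue_mod_power y (a + b)"
  have u: "\<not> ?p ^ a dvd ?u" using residue_mod_power_not_dvd[OF a] .
  have v: "\<not> ?p ^ b dvd ?v" using residue_mod_power_not_dvd[OF b, of a] by (simp add: add.commute)
  have nz: "?u \<noteq> 0" "?v \<noteq> 0" using u v by auto
  have pr: "prime ?p" using prime_card[where 'a='a] by simp
  have "multiplicity ?p ?u < a" "multiplicity ?p ?v < b"
    using u v multiplicity_dvd' not_less by blast+
  then have "multiplicity ?p (?u * ?v) < a + b"
    using nz pr by (simp add: prime_elem_multiplicity_mult_distrib)
  moreover have "\<not> is_unit ?p" using not_prime_unit pr by blast
  ultimately have "\<not> ?p ^ (a + b) dvd ?u * ?v"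
    using nz by (meson mult_eq_0_iff multiplicity_geI not_less)
  then have "residue_mod_power (x * y) (a + b) \<noteq> 0"
    by (simp add: times_padic_int.rep_eq dvd_eq_mod_eq_0)
  then show "x * y \<noteq> 0" by (auto simp: zero_padic_int.rep_eq)
qed

lemma residue_mod_power_of_nat:
  "residue_mod_power (of_nat k :: 'l::prime_card padic_int) n = int k mod int CARD('l) ^ n"
  by (induction k) (simp_all add: zero_padic_int.rep_eq one_padic_int.rep_eq
      plus_padic_int.rep_eq mod_simps add.commute)

instance padic_int :: (prime_card) ring_char_0
proof
  show "inj (of_nat :: nat \<Rightarrow> 'a padic_int)"
  proof (rule injI)
    fix a b :: nat
    assume eq: "(of_nat a :: 'a padic_int) = of_nat b"
    let ?p = "CARD('a)"
    have lt: "k < ?p ^ (a + b)" if "k \<le> a + b" for k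
      using that less_exp[of "a + b"] power_mono[of 2 ?p "a + b"] prime_ge_2_nat[OF prime_card[where 'a='a]]
      by linarith
    have "int a mod int ?p ^ (a + b) = int b mod int ?p ^ (a + b)"
      using arg_cong[OF eq, of "\<lambda>z. residue_mod_power z (a + b)"]
      by (simp only: residue_mod_power_of_nat)
    then have "a mod ?p ^ (a + b) = b mod ?p ^ (a + b)"
      by (metis of_nat_power of_nat_mod of_nat_eq_iff)
    then show "a = b" using lt[of a] lt[of b] by simp
  qed
qed

type_synonym 'l Q_l = "'l padic_int fract"
type_synonym 'l Q_l_bar = "'l Q_l alg_closure"


section \<open>Representations on abstract vector spaces\<close>

locale representation = vector_space scale
  for G :: "('g, 'm) monoid_scheme" (structure)
    and scale :: "'c::field \<Rightarrow> 'v::ab_group_add \<Rightarrow> 'v"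
    and \<pi> :: "'g \<Rightarrow> 'v \<Rightarrow> 'v" +
  assumes finite_dim: "\<exists>B. finite B \<and> span B = UNIV"
    and linear_rep: "g \<in> carrier G \<Longrightarrow> Vector_Spaces.linear scale scale (\<pi> g)"
    and rep_one: "\<pi> \<one> = id"
    and rep_mult: "\<lbrakk>g \<in> carrier G; h \<in> carrier G\<rbrakk> \<Longrightarrow> \<pi> (g \<otimes> h) = \<pi> g \<circ> \<pi> h"

locale irreducible_representation = representation G scale \<pi>
  for G :: "('g, 'm) monoid_scheme" (structure)
    and scale :: "'c::field \<Rightarrow> 'v::ab_group_add \<Rightarrow> 'v"
    and \<pi> :: "'g \<Rightarrow> 'v \<Rightarrow> 'v" +
  assumes nonzero: "\<exists>v::'v. v \<noteq> 0"
    and irreducible: "\<lbrakk>subspace W; \<And>g. g \<in> carrier G \<Longrightarrow> \<pi> g ` W \<subseteq> W\<rbrakk> \<Longrightarrow> W = {0} \<or> W = UNIV"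

definition rep_hom ::
  "('g, 'm) monoid_scheme \<Rightarrow> ('c::field \<Rightarrow> 'v::ab_group_add \<Rightarrow> 'v) \<Rightarrow> ('g \<Rightarrow> 'v \<Rightarrow> 'v)
    \<Rightarrow> ('c \<Rightarrow> 'w::ab_group_add \<Rightarrow> 'w) \<Rightarrow> ('g \<Rightarrow> 'w \<Rightarrow> 'w) \<Rightarrow> ('v \<Rightarrow> 'w) set" where
  "rep_hom H scale1 \<rho>1 scale2 \<rho>2 =
    {f. Vector_Spaces.linear scale1 scale2 f \<and> (\<forall>h\<in>carrier H. \<forall>v. f (\<rho>1 h v) = \<rho>2 h (f v))}"


section \<open>General linear and unitary groups as fixed points of Frobenius maps\<close>

definition GL :: "nat \<Rightarrow> 'a::field mat monoid" where
  "GL m = units_of (ring_mat TYPE('a) m ())"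

text \<open>
  For a finite field \<open>'q\<close> with \<open>q = CARD('q)\<close> elements, \<open>'q alg_closure\<close> is the algebraic closure.
\<close>

definition F_GL :: "'q::{finite,field} alg_closure mat \<Rightarrow> 'q alg_closure mat" where
  "F_GL = map_mat (\<lambda>x. x ^ CARD('q))"

definition E_mat :: "nat \<Rightarrow> 'a::field mat" where
  "E_mat n = four_block_mat (0\<^sub>m n n) (1\<^sub>m n) (- 1\<^sub>m n) (0\<^sub>m n n)"

definition F_U :: "nat \<Rightarrow> 'q::{finite,field} alg_closure mat \<Rightarrow> 'q alg_closure mat" where
  "F_U n g = E_mat n \<otimes>\<^bsub>GL (2 * n)\<^esub> inv\<^bsub>GL (2 * n)\<^esub> (transpose_mat (F_GL g))
    \<otimes>\<^bsub>GL (2 * n)\<^esub> inv\<^bsub>GL (2 * n)\<^esub> (E_mat n)"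

definition fixed_points :: "('g, 'm) monoid_scheme \<Rightarrow> ('g \<Rightarrow> 'g) \<Rightarrow> ('g, 'm) monoid_scheme" where
  "fixed_points G F = G\<lparr>carrier := {g \<in> carrier G. F g = g}\<rparr>"


section \<open>The Shalika subgroup, its character, and the multiplicity\<close>

definition Shalika :: "nat \<Rightarrow> 'a::field mat monoid" where
  "Shalika n = (GL (2 * n))\<lparr>carrier :=
    {four_block_mat g x (0\<^sub>m n n) g | g x. g \<in> carrier (GL n) \<and> x \<in> carrier_mat n n}\<rparr>"

definition mat_trace :: "'a::comm_monoid_add mat \<Rightarrow> 'a" where
  "mat_trace A = (\<Sum>i<dim_row A. A $$ (i, i))"

definition nontrivial_additive_character :: "('q::ab_group_add \<Rightarrow> 'c::field) \<Rightarrow> bool" where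
  "nontrivial_additive_character \<psi> \<longleftrightarrow>
    (\<forall>x. \<psi> x \<noteq> 0) \<and> (\<forall>x y. \<psi> (x + y) = \<psi> x * \<psi> y) \<and> (\<exists>x. \<psi> x \<noteq> 1)"

text \<open>
  The entries of \<open>s\<close> lie in the algebraic closure, but for \<open>s\<close> fixed by \<^const>\<open>F_GL\<close> or by
  \<^const>\<open>F_U\<close> the trace lies in the finite field: for the block matrix \<open>s'\<close> with blocks \<open>g'\<close>, \<open>x'\<close>
  obtained from \<open>s\<close> by applying either map, \<open>tr (g'\<^sup>-\<^sup>1 x') = (tr (g\<^sup>-\<^sup>1 x)) ^ q\<close>. There \<^const>\<open>of_ac\<close> is the
  inverse of the embedding \<^const>\<open>to_ac\<close>.
\<close>

definition psi_S :: "nat \<Rightarrow> ('q::{finite,field} \<Rightarrow> 'c::field) \<Rightarrow> 'q alg_closure mat \<Rightarrow> 'c" where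
  "psi_S n \<psi> s = (case split_block s n n of (g, x, _, _) \<Rightarrow>
    \<psi> (of_ac (mat_trace (inv\<^bsub>GL n\<^esub> g * x))))"

definition shalika_multiplicity ::
  "nat \<Rightarrow> ('q::{finite,field} alg_closure mat \<Rightarrow> 'q alg_closure mat) \<Rightarrow> ('q \<Rightarrow> 'c::field)
    \<Rightarrow> ('c \<Rightarrow> 'v::ab_group_add \<Rightarrow> 'v) \<Rightarrow> ('q alg_closure mat \<Rightarrow> 'v \<Rightarrow> 'v) \<Rightarrow> nat" where
  "shalika_multiplicity n F \<psi> scale \<pi> =
    vector_space.dim (\<lambda>c f v. c * f v)
      (rep_hom (fixed_points (Shalika n) F) scale \<pi> (*) (\<lambda>s z. psi_S n \<psi> s * z))"

end

theory Submission
  imports Defs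
begin

text \<open>
  Gelfand's trick with the anti-automorphism \<open>\<tau> g = W g\<^sup>T W\<close>, where \<open>W\<close> swaps the two halves of the
  basis, reduces the claim to a dichotomy for \<open>g \<in> G\<^sup>F\<close>: either \<open>\<psi>\<^sub>S s \<noteq> \<psi>\<^sub>S (g\<inverse> s g)\<close> for some
  \<open>s \<in> S\<^sup>F \<inter> g S\<^sup>F g\<inverse>\<close>, or \<open>\<tau> g = s g s'\<inverse>\<close> with \<open>s, s' \<in> S\<^sup>F\<close> and \<open>\<psi>\<^sub>S s = \<psi>\<^sub>S s'\<close>.

  The group \<open>S\<close> is the centraliser of a square-zero matrix \<open>x\<close>, so that \<open>S \<inter> g S g\<inverse>\<close> centralises \<open>x\<close> and
  \<open>y = g x g\<inverse>\<close>, and the logarithm of \<open>\<psi>\<^sub>S s\<close> is \<open>tr (s\<inverse> x h s h)\<close> for every \<open>h\<close> with \<open>h\<^sup>2 = 0\<close> and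
  \<open>x h + h x = 1\<close>. Put \<open>D = x - y\<close>; then \<open>x\<close> and \<open>y\<close> act on \<open>V\<^sub>i = D\<^sup>i V\<close>. Suppose that \<open>ker x = im x\<close> and
  \<open>ker y = im y\<close> hold on \<open>V\<^sub>0, \<dots>, V\<^sub>i\<close> but not on \<open>V\<^sub>i\<^sub>+\<^sub>1\<close>. Automorphisms of \<open>V\<^sub>i\<close> that differ from the identity
  by a map from the top to the socle of \<open>V\<^sub>i\<close> extend to \<open>V\<close>, and the difference of the two logarithms is a
  nonzero linear function of that map; this gives the first alternative. If exactness never fails, this
  difference vanishes identically and there is a nondegenerate symmetric form for which \<open>y\<close> is adjoint
  to \<open>x\<close>. Its Gram matrix \<open>\<Phi>\<close> gives \<open>s = W g\<^sup>T \<Phi>\<close> and \<open>s' = W \<Phi> g\<close>, satisfying \<open>\<tau> g = s g s'\<inverse>\<close> and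
  \<open>\<tau> s' = s\<close>, hence the second alternative.

  In the unitary case the elements so obtained are corrected by some \<open>b\<close> with \<open>b b\<^sup>\<dagger> = c\<close>, where \<open>c\<close> is a
  hermitian element of the centraliser and \<open>b\<close> is a polynomial in \<open>c\<close>.
\<close>

section \<open>Linear algebra relative to a finite subspace\<close>

text \<open>Pairs of square-zero operators form families with parameters; exactness along the
  filtration V_i takes the place of a classification. One step of it suffices for the following
  reason. Homotopies \<open>h\<close> of \<open>x\<close> and \<open>k\<close> of \<open>y\<close>
  can be chosen to agree modulo V_(j+1) on V_j for all j < i. Then the difference s' x h s h - s' y
  k s k, whose trace is the difference of the logarithms, raises the filtration down to V_i, so that
  its trace is a trace on V_i alone. Failure of exactness on V_(i+1) means that some socle vector
  \<open>w\<close> of V_i has \<open>h w - k w\<close> outside the radical, and this is what makes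
  the linear function nonzero.

  The unitary correction \<open>b\<close> must stay in the centraliser and must not change the
  logarithm. It is therefore P(c) for one polynomial P with P times its conjugate equal to X modulo
  X^M - 1, where c^M = 1; nothing about the spectrum of \<open>c\<close> is needed. Where
  \<open>c\<close> acts as 1, \<open>b\<close> acts as the scalar P(1), and automorphisms that are
  scalar on V_i have trivial logarithm. Only the 2-part of M is an obstacle to finding P: square
  roots split idempotents when 2 is invertible, and characteristic 2 needs a separate
  descent.\<close>

locale vs = vector_space scale for scale :: "'k::field \<Rightarrow> 'v::ab_group_add \<Rightarrow> 'v"
begin

text \<open>Linearity on \<open>U\<close> only: maps are total functions with arbitrary values
  elsewhere, so restriction to a smaller subspace needs no new function.\<close>

definition lin :: "'v set \<Rightarrow> ('v \<Rightarrow> 'v) \<Rightarrow> bool" where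
  "lin U f \<longleftrightarrow> (\<forall>u\<in>U. \<forall>v\<in>U. f (u + v) = f u + f v) \<and> (\<forall>c. \<forall>u\<in>U. f (scale c u) = scale c (f u))"

definition funl :: "'v set \<Rightarrow> ('v \<Rightarrow> 'k) \<Rightarrow> bool" where
  "funl U f \<longleftrightarrow> (\<forall>u\<in>U. \<forall>v\<in>U. f (u + v) = f u + f v) \<and> (\<forall>c. \<forall>u\<in>U. f (scale c u) = c * f u)"

definition direct_sum :: "'v set \<Rightarrow> 'v set \<Rightarrow> 'v set \<Rightarrow> bool" where
  "direct_sum U A B \<longleftrightarrow> subspace U \<and> subspace A \<and> subspace B \<and> A \<subseteq> U \<and> B \<subseteq> U \<and> A \<inter> B = {0}
    \<and> (\<forall>u\<in>U. \<exists>a\<in>A. \<exists>b\<in>B. u = a + b)"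

lemma linI:
  assumes "\<And>u v. u \<in> U \<Longrightarrow> v \<in> U \<Longrightarrow> f (u + v) = f u + f v"
    and "\<And>c u. u \<in> U \<Longrightarrow> f (scale c u) = scale c (f u)"
  shows "lin U f"
  using assms by (simp add: lin_def)

lemma lin_add: "lin U f \<Longrightarrow> u \<in> U \<Longrightarrow> v \<in> U \<Longrightarrow> f (u + v) = f u + f v"
  by (simp add: lin_def)

lemma lin_scale: "lin U f \<Longrightarrow> u \<in> U \<Longrightarrow> f (scale c u) = scale c (f u)"
  by (simp add: lin_def)

lemma lin_mono: "lin U f \<Longrightarrow> W \<subseteq> U \<Longrightarrow> lin W f"
  unfolding lin_def by blast

lemma lin_0: "lin U f \<Longrightarrow> subspace U \<Longrightarrow> f 0 = 0"
  using lin_scale[of U f 0 0] subspace_0 by simp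

lemma lin_minus: "lin U f \<Longrightarrow> subspace U \<Longrightarrow> u \<in> U \<Longrightarrow> f (- u) = - f u"
  using lin_scale[of U f u "-1"] by simp

lemma lin_diff:
  "lin U f \<Longrightarrow> subspace U \<Longrightarrow> u \<in> U \<Longrightarrow> v \<in> U \<Longrightarrow> f (u - v) = f u - f v"
  using lin_add[of U f u "-v"] lin_minus[of U f v] subspace_neg[of U v] by simp

lemma lin_compose:
  "lin U f \<Longrightarrow> f ` U \<subseteq> W \<Longrightarrow> lin W g \<Longrightarrow> lin U (\<lambda>u. g (f u))"
  by (auto simp: lin_def image_subset_iff)

lemma lin_plus: "lin U f \<Longrightarrow> lin U g \<Longrightarrow> lin U (\<lambda>u. f u + g u)"
  by (auto simp: lin_def scale_right_distrib)

lemma lin_minus_fun: "lin U f \<Longrightarrow> lin U g \<Longrightarrow> lin U (\<lambda>u. f u - g u)"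
  by (auto simp: lin_def scale_right_diff_distrib)

lemma lin_id: "lin U (\<lambda>u. u)"
  by (auto simp: lin_def)

lemma subspace_linear_image:
  assumes "lin U f" "subspace U" shows "subspace (f ` U)"
proof (rule subspaceI)
  show "0 \<in> f ` U" using lin_0[OF assms] subspace_0[OF assms(2)] by force
  show "a + b \<in> f ` U" if ab: "a \<in> f ` U" "b \<in> f ` U" for a b
  proof -
    obtain u v where uv: "u \<in> U" "v \<in> U" "a = f u" "b = f v" using ab by blast
    then have "a + b = f (u + v)" using lin_add[OF assms(1), of u v] by simp
    then show ?thesis using uv subspace_add[OF assms(2)] by blast
  qed
  show "scale c a \<in> f ` U" if a: "a \<in> f ` U" for c a
  proof -
    obtain u where u: "u \<in> U" "a = f u" using a by blast
    then have "scale c a = f (scale c u)" using lin_scale[OF assms(1), of u] by simp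
    then show ?thesis using u subspace_scale[OF assms(2)] by blast
  qed
qed

lemma subspace_linear_kernel:
  assumes "lin U f" "subspace U" shows "subspace {u \<in> U. f u = 0}"
  using assms by (auto intro!: subspaceI simp: subspace_add subspace_scale subspace_0 lin_0
      lin_add lin_scale)

lemma subspace_linear_preimage:
  assumes "lin U f" "subspace U" "subspace W" shows "subspace {u \<in> U. f u \<in> W}"
  using assms by (auto intro!: subspaceI simp: subspace_add subspace_scale subspace_0 lin_0
      lin_add lin_scale)

lemma lin_inj:
  assumes "lin U f" "subspace U" "\<And>u. u \<in> U \<Longrightarrow> f u = 0 \<Longrightarrow> u = 0" shows "inj_on f U"
  by (rule inj_onI) (metis assms lin_diff subspace_diff eq_iff_diff_eq_0)

section \<open>Complements, projections, sections and functionals\<close>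

lemma ex_complement_containing:
  assumes U: "subspace U" "finite U" and A: "subspace A" "A \<subseteq> U"
    and C: "subspace C" "C \<subseteq> U" "A \<inter> C = {0}"
  shows "\<exists>C'. C \<subseteq> C' \<and> direct_sum U A C'"
proof -
  let ?F = "{C'. subspace C' \<and> C \<subseteq> C' \<and> C' \<subseteq> U \<and> A \<inter> C' = {0}}"
  \<comment> \<open>Since \<open>U\<close> is a finite set it has finitely many subspaces, and a
    maximal one among those that contain \<open>C\<close> and meet \<open>A\<close> trivially is the
    complement.\<close>
  have "finite ?F" using U(2) by (auto intro: finite_subset[of _ "Pow U"])
  moreover have "C \<in> ?F" using C by auto
  ultimately obtain M where M: "M \<in> ?F" "\<And>M'. M' \<in> ?F \<Longrightarrow> M \<subseteq> M' \<Longrightarrow> M = M'"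
    using finite_has_maximal2[of ?F C] by auto
  have sM: "subspace M" "C \<subseteq> M" "M \<subseteq> U" "A \<inter> M = {0}" using M(1) by auto
  have "\<exists>a\<in>A. \<exists>m\<in>M. u = a + m" if u: "u \<in> U" for u
  proof (rule ccontr)
    assume neg: "\<not> ?thesis"
    let ?M = "{m + scale c u |m c. m \<in> M}"
    have sub: "subspace ?M"
    proof (rule subspaceI)
      have "0 = 0 + scale 0 u" by simp
      then show "0 \<in> ?M" using subspace_0[OF sM(1)] by blast
    next
      show "a + b \<in> ?M" if abM: "a \<in> ?M" "b \<in> ?M" for a b
      proof -
        obtain m c m' c' where "a = m + scale c u" "b = m' + scale c' u" "m \<in> M" "m' \<in> M"
          using abM by blast
        then have "a + b = (m + m') + scale (c + c') u" "m + m' \<in> M"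
          by (auto simp: scale_left_distrib subspace_add[OF sM(1)])
        then show ?thesis by blast
      qed
      show "scale d a \<in> ?M" if aM: "a \<in> ?M" for d a
      proof -
        obtain m c where "a = m + scale c u" "m \<in> M" using aM by blast
        then have "scale d a = scale d m + scale (d * c) u" "scale d m \<in> M"
          by (auto simp: scale_right_distrib subspace_scale[OF sM(1)])
        then show ?thesis by blast
      qed
    qed
    have le: "M \<subseteq> ?M"
    proof
      fix m assume "m \<in> M"
      moreover have "m = m + scale 0 u" by simp
      ultimately show "m \<in> ?M" by blast
    qed
    have leU: "?M \<subseteq> U" using sM(3) u subspace_add[OF U(1)] subspace_scale[OF U(1)] by blast
    have "A \<inter> ?M \<subseteq> {0}"
    proof
      fix a assume "a \<in> A \<inter> ?M"
      then obtain m c where a: "a \<in> A" "a = m + scale c u" "m \<in> M" by blast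
      show "a \<in> {0}"
      proof (cases "c = 0")
        case True then show ?thesis using a sM(4) by auto
      next
        case False
        have "u = scale (inverse c) a + scale (- inverse c) m"
          using a(2) False by (simp add: scale_right_distrib)
        then show ?thesis using neg a subspace_scale[OF A(1)] subspace_scale[OF sM(1)] by blast
      qed
    qed
    then have "A \<inter> ?M = {0}" using subspace_0[OF A(1)] subspace_0[OF sub] by blast
    then have "?M \<in> ?F" using sub le leU sM(2) by auto
    then have "M = ?M" using M(2) le by blast
    moreover have "u \<in> ?M"
    proof -
      have "u = 0 + scale 1 u" by simp
      then show ?thesis using subspace_0[OF sM(1)] by blast
    qed
    ultimately have "u \<in> M" by blast
    moreover have "u = 0 + u" by simp
    ultimately show False using neg subspace_0[OF A(1)] by blast
  qed
  then show ?thesis using sM U A by (auto simp: direct_sum_def)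
qed

lemma ex_complement:
  assumes "subspace U" "finite U" "subspace A" "A \<subseteq> U"
  shows "\<exists>C. direct_sum U A C"
  using ex_complement_containing[OF assms, of "{0}"] assms subspace_0 by auto

lemma direct_sum_commute: "direct_sum U A B \<Longrightarrow> direct_sum U B A"
  unfolding direct_sum_def by (metis Int_commute add.commute)

lemma direct_sum_unique:
  assumes "direct_sum U A B" "a + b = a' + b'" "a \<in> A" "a' \<in> A" "b \<in> B" "b' \<in> B"
  shows "a = a' \<and> b = b'"
proof -
  have "a - a' = b' - b" using assms(2) by (simp add: algebra_simps)
  moreover have "a - a' \<in> A" "b' - b \<in> B" using assms subspace_diff unfolding direct_sum_def by auto
  ultimately have "a - a' \<in> A \<inter> B" by auto
  then have "a - a' = 0" using assms(1) unfolding direct_sum_def by auto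
  then show ?thesis using assms(2) by auto
qed

lemma ex_projection:
  assumes d: "direct_sum U A B"
  shows "\<exists>p. lin U p \<and> (\<forall>u\<in>U. p u \<in> A \<and> u - p u \<in> B) \<and> (\<forall>a\<in>A. p a = a) \<and> (\<forall>b\<in>B. p b = 0)"
proof -
  have sub: "subspace U" "subspace A" "subspace B" "A \<subseteq> U" "B \<subseteq> U" using d by (auto simp: direct_sum_def)
  define p where "p u = (THE a. a \<in> A \<and> u - a \<in> B)" for u
  have eq: "p (a + b) = a" if "a \<in> A" "b \<in> B" for a b
    unfolding p_def
  proof (rule the_equality)
    show "a \<in> A \<and> a + b - a \<in> B" using that by simp
    fix a' assume a': "a' \<in> A \<and> a + b - a' \<in> B"
    have "a' + (a + b - a') = a + b" by simp
    from direct_sum_unique[OF d this] a' that show "a' = a" by blast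
  qed
  have dec: "\<exists>a\<in>A. \<exists>b\<in>B. u = a + b" if "u \<in> U" for u using d that by (auto simp: direct_sum_def)
  have "lin U p"
  proof (rule linI)
    fix u v assume "u \<in> U" "v \<in> U"
    then obtain a b a' b' where ab: "a \<in> A" "b \<in> B" "a' \<in> A" "b' \<in> B" "u = a + b" "v = a' + b'"
      using dec by metis
    have "u + v = (a + a') + (b + b')" using ab by simp
    then have "p (u + v) = a + a'"
      by (simp only: eq[of "a + a'" "b + b'"] ab subspace_add[OF sub(2)] subspace_add[OF sub(3)])
    then show "p (u + v) = p u + p v" using eq[of a b] eq[of a' b'] ab by simp
  next
    fix c u assume "u \<in> U"
    then obtain a b where ab: "a \<in> A" "b \<in> B" "u = a + b" using dec by metis
    then show "p (scale c u) = scale c (p u)"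
      using eq[of "scale c a" "scale c b"] eq[of a b] sub subspace_scale by (simp add: scale_right_distrib)
  qed
  moreover have "p u \<in> A \<and> u - p u \<in> B" if "u \<in> U" for u
    using dec[OF that] eq by auto
  moreover have "p a = a" if "a \<in> A" for a using eq[OF that, of 0] subspace_0[OF sub(3)] by simp
  moreover have "p b = 0" if "b \<in> B" for b using eq[of 0 b] that subspace_0[OF sub(2)] by simp
  ultimately show ?thesis by blast
qed

lemma ex_lin_direct_sum:
  assumes d: "direct_sum U A B" and f: "lin A f" and g: "lin B g"
  shows "\<exists>h. lin U h \<and> (\<forall>a\<in>A. h a = f a) \<and> (\<forall>b\<in>B. h b = g b)"
proof -
  obtain p where p: "lin U p" "\<forall>u\<in>U. p u \<in> A \<and> u - p u \<in> B" "\<forall>a\<in>A. p a = a" "\<forall>b\<in>B. p b = 0"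
    using ex_projection[OF d] by blast
  have sub: "subspace U" "subspace A" "subspace B" "A \<subseteq> U" "B \<subseteq> U" using d by (auto simp: direct_sum_def)
  let ?h = "\<lambda>u. f (p u) + g (u - p u)"
  have "lin U (\<lambda>u. f (p u))"
    by (rule lin_compose[OF p(1) _ f]) (use p in auto)
  moreover have "lin U (\<lambda>u. g (u - p u))"
    by (rule lin_compose[OF lin_minus_fun[OF lin_id p(1)] _ g]) (use p in auto)
  ultimately have "lin U ?h" by (rule lin_plus)
  moreover have "\<forall>a\<in>A. ?h a = f a" using p lin_0[OF g sub(3)] by simp
  moreover have "\<forall>b\<in>B. ?h b = g b" using p lin_0[OF f sub(2)] by simp
  ultimately show ?thesis by blast
qed

text \<open>A complement of the kernel maps bijectively onto the image; the section is the inverse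
  of that bijection.\<close>

lemma ex_linear_section:
  assumes f: "lin U f" and U: "subspace U" "finite U"
  shows "\<exists>g. lin (f ` U) g \<and> (\<forall>z\<in>f ` U. g z \<in> U \<and> f (g z) = z)"
proof -
  let ?N = "{u \<in> U. f u = 0}"
  obtain C where C: "direct_sum U ?N C"
    using ex_complement[OF U subspace_linear_kernel[OF f U(1)]] by auto
  have sub: "subspace C" "C \<subseteq> U" "?N \<inter> C = {0}" using C by (auto simp: direct_sum_def)
  have fC: "lin C f" using lin_mono[OF f sub(2)] .
  have inj: "inj_on f C" using lin_inj[OF fC sub(1)] sub by blast
  have img: "f ` U = f ` C"
  proof
    show "f ` U \<subseteq> f ` C"
    proof
      fix z assume "z \<in> f ` U"
      then obtain u where u: "u \<in> U" "z = f u" by blast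
      then obtain k c where kc: "k \<in> ?N" "c \<in> C" "u = k + c" using C unfolding direct_sum_def by blast
      then have "f u = f k + f c" using lin_add[OF f] sub(2) by auto
      then show "z \<in> f ` C" using kc u by auto
    qed
  qed (use sub in auto)
  let ?g = "inv_into C f"
  have g: "?g z \<in> C" "f (?g z) = z" if "z \<in> f ` C" for z
    using that by (auto intro: inv_into_into f_inv_into_f)
  have "lin (f ` C) ?g"
  proof (rule linI)
    fix z w assume zw: "z \<in> f ` C" "w \<in> f ` C"
    have "f (?g z + ?g w) = z + w" using g zw lin_add[OF fC] by simp
    then show "?g (z + w) = ?g z + ?g w"
      using inj g zw subspace_add[OF sub(1)] by (metis inv_into_f_f)
  next
    fix c z assume z: "z \<in> f ` C"
    have "f (scale c (?g z)) = scale c z" using g z lin_scale[OF fC] by simp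
    then show "?g (scale c z) = scale c (?g z)"
      using inj g z subspace_scale[OF sub(1)] by (metis inv_into_f_f)
  qed
  then show ?thesis using img g sub(2) by (metis subset_iff)
qed

text \<open>The line through \<open>w\<close> has a complement that contains \<open>A\<close>; the
  functional is the coordinate along this line.\<close>

lemma ex_functional:
  assumes U: "subspace U" "finite U" and A: "subspace A" "A \<subseteq> U" and w: "w \<in> U" "w \<notin> A"
  shows "\<exists>\<phi>. funl U \<phi> \<and> (\<forall>a\<in>A. \<phi> a = 0) \<and> \<phi> w = 1"
proof -
  let ?L = "range (\<lambda>c. scale c w)"
  have L: "subspace ?L"
  proof (rule subspaceI)
    show "0 \<in> ?L" by (rule range_eqI[of _ _ 0]) simp
    show "a + b \<in> ?L" if "a \<in> ?L" "b \<in> ?L" for a b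
      using that by (auto simp: scale_left_distrib[symmetric])
    show "scale c a \<in> ?L" if "a \<in> ?L" for c a
      using that by auto
  qed
  have w0: "w \<noteq> 0" using w subspace_0[OF A(1)] by auto
  have LU: "?L \<subseteq> U" using w U subspace_scale by auto
  have "?L \<inter> A \<subseteq> {0}"
  proof
    fix z assume "z \<in> ?L \<inter> A"
    then obtain c where c: "z = scale c w" "scale c w \<in> A" by auto
    show "z \<in> {0}"
    proof (cases "c = 0")
      case True then show ?thesis using c by simp
    next
      case False then show ?thesis using subspace_scale[OF A(1) c(2), of "inverse c"] w(2) by simp
    qed
  qed
  then have "?L \<inter> A = {0}" using subspace_0[OF A(1)] subspace_0[OF L] by auto
  then obtain C where C: "A \<subseteq> C" "direct_sum U ?L C"
    using ex_complement_containing[OF U L LU A] by auto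
  obtain p where p: "lin U p" "\<forall>u\<in>U. p u \<in> ?L \<and> u - p u \<in> C" "\<forall>a\<in>?L. p a = a" "\<forall>b\<in>C. p b = 0"
    using ex_projection[OF C(2)] by blast
  define \<phi> where "\<phi> u = (THE c. p u = scale c w)" for u
  have eq: "\<phi> u = c" if "p u = scale c w" for u c
    unfolding \<phi>_def
  proof (rule the_equality[of _ c])
    show "p u = scale c w" by (rule that)
    show "d = c" if "p u = scale d w" for d
      by (rule scale_right_imp_eq[OF w0]) (simp only: that[symmetric] \<open>p u = scale c w\<close>)
  qed
  have ex: "p u = scale (\<phi> u) w" if u: "u \<in> U" for u
  proof -
    have "p u \<in> ?L" using p(2) u by simp
    then obtain c where c: "p u = scale c w" by (rule rangeE)
    show ?thesis unfolding eq[OF c] by (rule c)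
  qed
  have "funl U \<phi>"
    unfolding funl_def
  proof (intro conjI ballI allI)
    fix u v assume uv: "u \<in> U" "v \<in> U"
    show "\<phi> (u + v) = \<phi> u + \<phi> v"
      by (rule eq) (simp only: lin_add[OF p(1) uv] ex[OF uv(1), symmetric] ex[OF uv(2), symmetric] scale_left_distrib)
  next
    fix c u assume u: "u \<in> U"
    show "\<phi> (scale c u) = c * \<phi> u"
      by (rule eq) (simp only: lin_scale[OF p(1) u] ex[OF u, symmetric] scale_scale[symmetric])
  qed
  moreover have "\<forall>a\<in>A. \<phi> a = 0"
  proof
    fix a assume "a \<in> A"
    then have "p a = scale 0 w" using p(4) C(1) by auto
    then show "\<phi> a = 0" by (rule eq)
  qed
  moreover have "\<phi> w = 1"
  proof (rule eq)
    have "w \<in> ?L" by (rule range_eqI[of _ _ 1]) simp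
    then have "p w = w" by (rule bspec[OF p(3)])
    then show "p w = scale 1 w" by simp
  qed
  ultimately show ?thesis by blast
qed

end

section \<open>Pairs of square-zero operators\<close>

text \<open>\<open>V\<close> is finite as a set, so that cardinality can serve in place of dimension
  in every termination argument.\<close>

locale nilpair = vs scale for scale :: "'k::field \<Rightarrow> 'v::ab_group_add \<Rightarrow> 'v" +
  fixes V :: "'v set" and x y :: "'v \<Rightarrow> 'v"
  assumes V: "subspace V" "finite V"
    and lin_x: "lin V x" and lin_y: "lin V y"
    and x_V: "v \<in> V \<Longrightarrow> x v \<in> V" and y_V: "v \<in> V \<Longrightarrow> y v \<in> V"
    and xx: "v \<in> V \<Longrightarrow> x (x v) = 0" and yy: "v \<in> V \<Longrightarrow> y (y v) = 0"
begin

definition D :: "'v \<Rightarrow> 'v" where "D v = x v - y v"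

definition stable :: "'v set \<Rightarrow> bool" where
  "stable U \<longleftrightarrow> subspace U \<and> U \<subseteq> V \<and> x ` U \<subseteq> U \<and> y ` U \<subseteq> U"

definition exact :: "'v set \<Rightarrow> bool" where
  "exact U \<longleftrightarrow> (\<forall>u\<in>U. x u = 0 \<longrightarrow> u \<in> x ` U) \<and> (\<forall>u\<in>U. y u = 0 \<longrightarrow> u \<in> y ` U)"

text \<open>\<open>U\<close> modulo this subspace is the top of \<open>U\<close> in the sense of the
  overview; the socle is the common kernel of \<open>x\<close> and \<open>y\<close>.\<close>

definition rad :: "'v set \<Rightarrow> 'v set" where
  "rad U = {x u + y u' |u u'. u \<in> U \<and> u' \<in> U}"

definition commuting :: "'v set \<Rightarrow> ('v \<Rightarrow> 'v) \<Rightarrow> bool" where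
  "commuting U s \<longleftrightarrow> lin U s \<and> s ` U \<subseteq> U \<and> (\<forall>u\<in>U. s (x u) = x (s u) \<and> s (y u) = y (s u))"

text \<open>A contracting homotopy of the differential \<open>z\<close>. For a square-zero
  \<open>z\<close> it exists on \<open>U\<close> when kernel and image of \<open>z\<close> coincide
  there, and it exhibits \<open>U\<close> as a free module over the dual numbers k[z].\<close>

definition homotopy :: "('v \<Rightarrow> 'v) \<Rightarrow> 'v set \<Rightarrow> ('v \<Rightarrow> 'v) \<Rightarrow> bool" where
  "homotopy z U h \<longleftrightarrow> lin U h \<and> h ` U \<subseteq> U \<and> (\<forall>u\<in>U. h (h u) = 0 \<and> z (h u) + h (z u) = u)"

lemmas V_closed [simp] = x_V y_V subspace_0[OF V(1)] subspace_add[OF V(1)] subspace_diff[OF V(1)]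
  subspace_neg[OF V(1)] subspace_scale[OF V(1)]

lemmas x_simps [simp] = lin_add[OF lin_x] lin_diff[OF lin_x V(1)] lin_0[OF lin_x V(1)]
  lin_minus[OF lin_x V(1)] lin_scale[OF lin_x] xx
lemmas y_simps [simp] = lin_add[OF lin_y] lin_diff[OF lin_y V(1)] lin_0[OF lin_y V(1)]
  lin_minus[OF lin_y V(1)] lin_scale[OF lin_y] yy

lemma D_V [simp]: "v \<in> V \<Longrightarrow> D v \<in> V" by (simp add: D_def)

lemma lin_D: "lin V D" unfolding D_def by (rule lin_minus_fun[OF lin_x lin_y])

lemmas D_simps [simp] = lin_add[OF lin_D] lin_diff[OF lin_D V(1)] lin_0[OF lin_D V(1)]
  lin_minus[OF lin_D V(1)] lin_scale[OF lin_D]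

text \<open>Both sides are products of \<open>x\<close> and \<open>y\<close> because the squares
  vanish. Thus \<open>D\<close> commutes with the pair up to sign and exchange of \<open>x\<close>
  and \<open>y\<close>, which makes all images of powers of \<open>D\<close> stable.\<close>

lemma x_D: "v \<in> V \<Longrightarrow> x (D v) = - D (y v)"
  and y_D: "v \<in> V \<Longrightarrow> y (D v) = - D (x v)"
  by (simp_all add: D_def)

lemma stableD:
  assumes "stable U"
  shows "subspace U" "U \<subseteq> V" "\<And>u. u \<in> U \<Longrightarrow> x u \<in> U" "\<And>u. u \<in> U \<Longrightarrow> y u \<in> U" "finite U"
    "\<And>u. u \<in> U \<Longrightarrow> D u \<in> U"
proof -
  show s: "subspace U" "U \<subseteq> V" "\<And>u. u \<in> U \<Longrightarrow> x u \<in> U" "\<And>u. u \<in> U \<Longrightarrow> y u \<in> U"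
    using assms by (auto simp: stable_def)
  show "finite U" using s(2) V(2) finite_subset by blast
  show "\<And>u. u \<in> U \<Longrightarrow> D u \<in> U" unfolding D_def using s subspace_diff[OF s(1)] by blast
qed

lemma exactD:
  assumes "exact U" "u \<in> U"
  shows "x u = 0 \<Longrightarrow> \<exists>u'\<in>U. u = x u'" "y u = 0 \<Longrightarrow> \<exists>u'\<in>U. u = y u'"
  using assms unfolding exact_def by blast+

lemma stable_V: "stable V" using V by (auto simp: stable_def)

lemma subspace_D: assumes "subspace U" "U \<subseteq> V" shows "subspace (D ` U)"
  using subspace_linear_image[OF lin_mono[OF lin_D]] assms by blast

lemma stable_D:
  assumes U: "stable U" shows "stable (D ` U)"
  unfolding stable_def
proof (intro conjI)
  note sU = stableD[OF U]
  show "subspace (D ` U)" by (rule subspace_D[OF sU(1,2)])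
  show "D ` U \<subseteq> V" using sU by auto
  show "x ` D ` U \<subseteq> D ` U"
  proof safe
    fix u assume u: "u \<in> U"
    then have "x (D u) = D (- y u)" using subsetD[OF sU(2) u] by (simp add: x_D)
    then show "x (D u) \<in> D ` U" using imageI[OF subspace_neg[OF sU(1) sU(4)[OF u]], of D] by (simp only:)
  qed
  show "y ` D ` U \<subseteq> D ` U"
  proof safe
    fix u assume u: "u \<in> U"
    then have "y (D u) = D (- x u)" using subsetD[OF sU(2) u] by (simp add: y_D)
    then show "y (D u) \<in> D ` U" using imageI[OF subspace_neg[OF sU(1) sU(3)[OF u]], of D] by (simp only:)
  qed
qed

lemma D_subset: "stable U \<Longrightarrow> D ` U \<subseteq> U"
  using stableD(6) by blast

section \<open>The radical and the decomposition of the top\<close>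

lemma rad_props:
  assumes U: "stable U"
  shows "subspace (rad U)" "rad U \<subseteq> U" "D ` U \<subseteq> rad U"
    "\<And>r. r \<in> rad U \<Longrightarrow> \<exists>u\<in>U. \<exists>v\<in>U. r = x u + D v"
    "\<And>u. u \<in> U \<Longrightarrow> x u \<in> rad U" "\<And>u. u \<in> U \<Longrightarrow> y u \<in> rad U"
proof -
  note sU = stableD[OF U]
  note [simp] = subsetD[OF sU(2)]
  show x_rad: "x u \<in> rad U" if "u \<in> U" for u

  proof -
    have "x u = x u + y 0" by simp
    then show ?thesis unfolding rad_def using that subspace_0[OF sU(1)] by blast
  qed
  show y_rad: "y u \<in> rad U" if "u \<in> U" for u

  proof -
    have "y u = x 0 + y u" by simp
    then show ?thesis unfolding rad_def using that subspace_0[OF sU(1)] by blast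
  qed
  show s: "subspace (rad U)"
  proof (rule subspaceI)
    show "0 \<in> rad U" using x_rad[of 0] subspace_0[OF sU(1)] by simp
    fix a b assume "a \<in> rad U" "b \<in> rad U"
    then obtain u u' v v' where "a = x u + y u'" "b = x v + y v'" "u \<in> U" "u' \<in> U" "v \<in> U" "v' \<in> U"
      unfolding rad_def by blast
    then have "a + b = x (u + v) + y (u' + v')" "u + v \<in> U" "u' + v' \<in> U"
      by (auto simp: subspace_add[OF sU(1)])
    then show "a + b \<in> rad U" unfolding rad_def by blast
  next
    fix c a assume "a \<in> rad U"
    then obtain u u' where "a = x u + y u'" "u \<in> U" "u' \<in> U" unfolding rad_def by blast
    then have "scale c a = x (scale c u) + y (scale c u')" "scale c u \<in> U" "scale c u' \<in> U"
      by (auto simp: subspace_scale[OF sU(1)] scale_right_distrib)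
    then show "scale c a \<in> rad U" unfolding rad_def by blast
  qed
  show "rad U \<subseteq> U" unfolding rad_def using sU(3,4) subspace_add[OF sU(1)] by blast
  show "D ` U \<subseteq> rad U"
  proof safe
    fix u assume "u \<in> U"
    then show "D u \<in> rad U" unfolding D_def using x_rad y_rad subspace_diff[OF s] by simp
  qed
  show "\<exists>u\<in>U. \<exists>v\<in>U. r = x u + D v" if r: "r \<in> rad U" for r
  proof -
    obtain u u' where "r = x u + y u'" "u \<in> U" "u' \<in> U" using r unfolding rad_def by blast
    then have "r = x (u + u') + D (- u')" "u + u' \<in> U" "- u' \<in> U"
      by (auto simp: subspace_add[OF sU(1)] subspace_neg[OF sU(1)] D_def)
    then show ?thesis by blast
  qed
qed

lemma D_rad: "stable U \<Longrightarrow> rad (D ` U) = D ` rad U"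
proof -
  assume U: "stable U"
  note sU = stableD[OF U]
  note [simp] = subsetD[OF sU(2)]
  show ?thesis
  proof
    show "rad (D ` U) \<subseteq> D ` rad U"
    proof
      fix r assume "r \<in> rad (D ` U)"
      then obtain u u' where "r = x (D u) + y (D u')" "u \<in> U" "u' \<in> U" unfolding rad_def by blast
      then have "r = D (x (- u') + y (- u))" "- u \<in> U" "- u' \<in> U"
        by (auto simp: x_D y_D subspace_neg[OF sU(1)])
      then show "r \<in> D ` rad U" unfolding rad_def by blast
    qed
    show "D ` rad U \<subseteq> rad (D ` U)"
    proof
      fix r assume "r \<in> D ` rad U"
      then obtain u u' where "r = D (x u + y u')" "u \<in> U" "u' \<in> U" unfolding rad_def by blast
      then have "r = x (D (- u')) + y (D (- u))" "- u \<in> U" "- u' \<in> U"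
        by (auto simp: x_D y_D subspace_neg[OF sU(1)])
      then show "r \<in> rad (D ` U)" unfolding rad_def by blast
    qed
  qed
qed

text \<open>Altogether U = T + x T + D U is a direct sum, so an extension of a map from
  \<open>D U\<close> that commutes with \<open>x\<close> is prescribed by its values on
  \<open>T\<close>. Independence uses exactness twice: if \<open>x t\<close> lies in
  \<open>D U\<close>, it is \<open>x u\<close> with \<open>u\<close> in \<open>D U\<close> by
  exactness of \<open>D U\<close>; then \<open>t - u\<close> is in the image of \<open>x\<close> by
  exactness of \<open>U\<close>, so that \<open>t\<close> lies in the radical and is 0.\<close>

lemma ex_top_decomposition:
  assumes U: "stable U" and ex: "exact U" "exact (D ` U)"
  shows "\<exists>T. direct_sum U T (rad U) \<and> inj_on x T \<and> direct_sum (rad U) (x ` T) (D ` U)"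
proof -
  note sU = stableD[OF U]
  note [simp] = subsetD[OF sU(2)]
  note rU = rad_props[OF U]
  note sDU = stableD[OF stable_D[OF U]]
  obtain T where "direct_sum U (rad U) T" using ex_complement[OF sU(1,5) rU(1,2)] by blast
  then have T: "direct_sum U T (rad U)" by (rule direct_sum_commute)
  have sT: "subspace T" "T \<subseteq> U" "T \<inter> rad U = {0}" using T by (auto simp: direct_sum_def)
  have key: "t = 0" if t: "t \<in> T" "x t \<in> D ` U" for t
  proof -
    have tU: "t \<in> U" using t sT by blast
    then have "x (x t) = 0" by simp
    then obtain u where u: "u \<in> D ` U" "x t = x u" using exactD(1)[OF ex(2) t(2)] by blast
    have uU: "u \<in> U" using u(1) D_subset[OF U] by blast
    have "x (t - u) = 0" using u(2) tU uU by simp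
    moreover have "t - u \<in> U" using tU uU subspace_diff[OF sU(1)] by blast
    ultimately obtain u' where "u' \<in> U" "t - u = x u'" using exactD(1)[OF ex(1)] by blast
    then have "t - u \<in> rad U" using rU(5) by simp
    moreover have "u \<in> rad U" using u(1) rU(3) by blast
    ultimately have "t - u + u \<in> rad U" using subspace_add[OF rU(1)] by blast
    then show "t = 0" using sT(3) t(1) by auto
  qed
  have linT: "lin T x" using lin_mono[OF lin_x, of T] sT(2) sU(2) by blast
  have inj: "inj_on x T"
  proof (rule lin_inj[OF linT sT(1)])
    show "u = 0" if "u \<in> T" "x u = 0" for u
      by (rule key) (use that subspace_0[OF sDU(1)] in auto)
  qed
  have "direct_sum (rad U) (x ` T) (D ` U)"
    unfolding direct_sum_def
  proof (intro conjI)
    show "subspace (x ` T)" by (rule subspace_linear_image[OF linT sT(1)])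
    show "x ` T \<subseteq> rad U" using rU(5) sT by blast
    show "x ` T \<inter> D ` U = {0}"
    proof
      show "x ` T \<inter> D ` U \<subseteq> {0}" using key by fastforce
      have "0 \<in> x ` T" using subspace_0[OF sT(1)] by force
      then show "{0} \<subseteq> x ` T \<inter> D ` U" using subspace_0[OF sDU(1)] by simp
    qed
    show "\<forall>u\<in>rad U. \<exists>a\<in>x ` T. \<exists>b\<in>D ` U. u = a + b"
    proof
      fix r assume "r \<in> rad U"
      then obtain u v where uv: "u \<in> U" "v \<in> U" "r = x u + D v" using rU(4) by blast
      obtain t r' where tr: "t \<in> T" "r' \<in> rad U" "u = t + r'"
        using T uv(1) unfolding direct_sum_def by blast
      obtain u' v' where r': "u' \<in> U" "v' \<in> U" "r' = x u' + D v'" using rU(4) tr(2) by blast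
      have tU: "t \<in> U" using tr(1) sT by blast
      \<comment> \<open>\<open>x\<close> kills the part \<open>x u'\<close> of \<open>r'\<close> and
        moves the part \<open>D v'\<close> to \<open>D (- y v')\<close>; so only \<open>x t\<close>
        and elements of \<open>D U\<close> remain.\<close>
      have "x u = x t + x (D v')" unfolding tr(3) r'(3) using tU r' by simp
      also have "x (D v') = D (- y v')" using r' by (simp add: x_D)
      finally have "r = x t + D (v - y v')" unfolding uv(3) using uv r' by simp
      moreover have "v - y v' \<in> U" using uv r' sU(4) subspace_diff[OF sU(1)] by blast
      ultimately show "\<exists>a\<in>x ` T. \<exists>b\<in>D ` U. r = a + b" using tr(1) by blast
    qed
  qed (use rU sDU in auto)
  then show ?thesis using T inj by blast
qed

end

section \<open>Extension of automorphisms from D U to U\<close>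

context nilpair
begin

lemma ex_lin_top_decomposition:
  assumes T: "direct_sum U T (rad U)" and W: "direct_sum (rad U) (x ` T) W"
    and f: "lin T f" and g: "lin (x ` T) g" and k: "lin W k"
  shows "\<exists>s. lin U s \<and> (\<forall>t\<in>T. s t = f t) \<and> (\<forall>z\<in>x ` T. s z = g z) \<and> (\<forall>w\<in>W. s w = k w)"
proof -
  obtain s' where s': "lin (rad U) s'" "\<forall>z\<in>x ` T. s' z = g z" "\<forall>w\<in>W. s' w = k w"
    using ex_lin_direct_sum[OF W g k] by blast
  obtain s where s: "lin U s" "\<forall>t\<in>T. s t = f t" "\<forall>z\<in>rad U. s z = s' z"
    using ex_lin_direct_sum[OF T f s'(1)] by blast
  have "x ` T \<subseteq> rad U" "W \<subseteq> rad U" using W by (auto simp: direct_sum_def)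
  then have "s z = g z" if "z \<in> x ` T" for z using s(3) s'(2) that by auto
  moreover have "s w = k w" if "w \<in> W" for w using s(3) s'(3) \<open>W \<subseteq> rad U\<close> that by auto
  ultimately show ?thesis using s(1,2) by blast
qed

lemma commutingD:
  assumes "commuting U s"
  shows "lin U s" "\<And>u. u \<in> U \<Longrightarrow> s u \<in> U" "\<And>u. u \<in> U \<Longrightarrow> s (x u) = x (s u)"
    "\<And>u. u \<in> U \<Longrightarrow> s (y u) = y (s u)"
  using assms by (auto simp: commuting_def)

lemma commuting_D:
  assumes "commuting U s" "stable U" "u \<in> U" shows "s (D u) = D (s u)"
  using lin_diff[OF commutingD(1)[OF assms(1)] stableD(1,3,4)[OF assms(2)]] commutingD(3,4)[OF assms(1)] assms(3)
  by (simp add: D_def)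

lemma top_decomposition_cases:
  assumes T: "direct_sum U T (rad U)" and W: "direct_sum (rad U) (x ` T) W" and u: "u \<in> U"
  obtains t t' w where "t \<in> T" "t' \<in> T" "w \<in> W" "u = t + (x t' + w)"
proof -
  obtain t r where "t \<in> T" "r \<in> rad U" "u = t + r" using T u unfolding direct_sum_def by blast
  moreover then obtain z w where "z \<in> x ` T" "w \<in> W" "r = z + w" using W unfolding direct_sum_def by blast
  ultimately show ?thesis using that by blast
qed

text \<open>On \<open>T\<close> put s t = t + w t with \<open>w t\<close> in the radical and D (w t)
  = s1 (D t) - D t. This is solvable because the right side lies in rad (D U) = D (rad U). The
  values on \<open>x T\<close> are forced, and D (s t) = s1 (D t) on \<open>T\<close> is all that is
  needed for \<open>s\<close> to commute with \<open>D\<close>. Commuting with \<open>x\<close> and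
  \<open>D\<close> means commuting with \<open>y\<close>.\<close>

lemma extend_automorphism:
  assumes U: "stable U" and ex: "exact U" "exact (D ` U)"
    and s1: "commuting (D ` U) s1" "\<And>u. u \<in> D ` U \<Longrightarrow> s1 u - u \<in> rad (D ` U)" "inj_on s1 (D ` U)"
  shows "\<exists>s. commuting U s \<and> (\<forall>u\<in>D ` U. s u = s1 u) \<and> (\<forall>u\<in>U. s u - u \<in> rad U) \<and> inj_on s U"
proof -
  note sU = stableD[OF U]
  note UV [simp] = subsetD[OF sU(2)]
  note rU = rad_props[OF U]
  note sDU = stableD[OF stable_D[OF U]]
  note rV = subset_trans[OF rU(2) sU(2)]
  note c1 = commutingD[OF s1(1)]
  obtain T where T: "direct_sum U T (rad U)" "inj_on x T" "direct_sum (rad U) (x ` T) (D ` U)"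
    using ex_top_decomposition[OF U ex] by blast
  have sT: "subspace T" "T \<subseteq> U" using T(1) by (auto simp: direct_sum_def)
  note TU [simp] = subsetD[OF sT(2)]
  have fin: "finite T" "finite (rad U)" using sU(5) sT(2) rU(2) finite_subset by blast+
  have rinV [simp]: "r \<in> V" if "r \<in> rad U" for r using that rV by blast
  have linT: "lin T x" by (rule lin_mono[OF lin_x]) auto
  have linTD: "lin T D" by (rule lin_mono[OF lin_D]) auto
  have linRD: "lin (rad U) D" by (rule lin_mono[OF lin_D rV])
  obtain g where g: "lin (D ` rad U) g" "\<And>z. z \<in> D ` rad U \<Longrightarrow> g z \<in> rad U" "\<And>z. z \<in> D ` rad U \<Longrightarrow> D (g z) = z"
    using ex_linear_section[OF linRD rU(1) fin(2)] by blast
  obtain g' where g': "lin (x ` T) g'" "\<And>z. z \<in> x ` T \<Longrightarrow> g' z \<in> T" "\<And>z. z \<in> x ` T \<Longrightarrow> x (g' z) = z"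
    using ex_linear_section[OF linT sT(1) fin(1)] by blast
  have g'x: "g' (x t) = t" if "t \<in> T" for t
    using inj_onD[OF T(2) g'(3)[of "x t"] g'(2)[of "x t"] that] that by simp
  define w where "w t = g (s1 (D t) - D t)" for t
  have inw: "s1 (D t) - D t \<in> D ` rad U" if "t \<in> T" for t
    using s1(2)[of "D t"] D_rad[OF U] that by simp
  have w: "w t \<in> rad U" "D (w t) = s1 (D t) - D t" if "t \<in> T" for t
    using g(2,3)[OF inw[OF that]] by (auto simp: w_def)
  have "lin T (\<lambda>t. s1 (D t) - D t)"
    by (rule lin_minus_fun[OF lin_compose[OF linTD _ c1(1)] linTD]) auto
  then have lw: "lin T w" unfolding w_def
    by (rule lin_compose[OF _ _ g(1)]) (use inw in auto)
  have ls: "lin T (\<lambda>t. t + w t)" by (rule lin_plus[OF lin_id lw])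
  have lsx: "lin T (\<lambda>t. x (t + w t))"
    by (rule lin_compose[OF ls _ lin_x]) (use w(1) in auto)
  have lx: "lin (x ` T) (\<lambda>z. x (g' z + w (g' z)))"
    by (rule lin_compose[OF g'(1) _ lsx]) (use g'(2) in auto)
  obtain s where s: "lin U s" "\<forall>t\<in>T. s t = t + w t" "\<forall>z\<in>x ` T. s z = x (g' z + w (g' z))"
      "\<forall>z\<in>D ` U. s z = s1 z"
    using ex_lin_top_decomposition[OF T(1,3) ls lx c1(1)] by blast
  note s4 = bspec[OF s(4)]
  have DUV [simp]: "z \<in> V" if "z \<in> D ` U" for z using that sDU(2) by blast
  have rU_U: "r \<in> U" if "r \<in> rad U" for r using that rU(2) by blast
  have DU_U: "z \<in> U" if "z \<in> D ` U" for z using that D_subset[OF U] by blast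
  have sx: "s (x t) = x (s t)" if "t \<in> T" for t using s(2,3) g'x that by simp
  have sT_U: "s t \<in> U" if "t \<in> T" for t
    using s(2) subspace_add[OF sU(1) TU[OF that] rU_U[OF w(1)[OF that]]] that by simp
  have add: "s (t + (x t' + z)) = s t + (x (s t') + s1 z)" if "t \<in> T" "t' \<in> T" "z \<in> D ` U" for t t' z
  proof -
    have "x t' \<in> U" "z \<in> U" using that sU(3) DU_U by auto
    then have "s (t + (x t' + z)) = s t + (s (x t') + s z)"
      using lin_add[OF s(1)] that subspace_add[OF sU(1)] by simp
    then show ?thesis using sx s4 that by simp
  qed
  have sD_T: "D (s t) = s1 (D t)" if "t \<in> T" for t
    using s(2) that w[OF that] by simp
  have comm: "s u \<in> U \<and> s (x u) = x (s u) \<and> s (D u) = D (s u) \<and> s u - u \<in> rad U" if u: "u \<in> U" for u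
  proof -
    obtain t t' z where t: "t \<in> T" "t' \<in> T" "z \<in> D ` U" "u = t + (x t' + z)"
      using top_decomposition_cases[OF T(1,3) u] .
    note tV [simp] = UV[OF TU[OF t(1)]] UV[OF TU[OF t(2)]] UV[OF sT_U[OF t(1)]] UV[OF sT_U[OF t(2)]]
      DUV[OF t(3)] DUV[OF c1(2)[OF t(3)]]
    have s1z: "s1 z \<in> D ` U" "s1 z \<in> U" using c1(2) t(3) DU_U by auto
    have su: "s u = s t + (x (s t') + s1 z)" unfolding t(4) by (rule add[OF t(1-3)])
    have U1: "s u \<in> U" unfolding su
      using sT_U t s1z sU(3) subspace_add[OF sU(1)] by simp
    have "s (x u) = s (x t + x z)" unfolding t(4) by simp
    also have "\<dots> = s (x t) + s (x z)"
      by (rule lin_add[OF s(1)]) (use t sU(3) DU_U in auto)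
    also have "\<dots> = x (s t) + x (s1 z)" using sx[OF t(1)] s4[OF sDU(3)[OF t(3)]] c1(3)[OF t(3)] by simp
    finally have X: "s (x u) = x (s u)" unfolding su by simp
    have Dsum: "D u = D t + (D (x t') + D z)" unfolding t(4) by simp
    have mem: "D t \<in> D ` U" "D (x t') \<in> D ` U" "D z \<in> D ` U" "D t' \<in> D ` U" using t sU(3) DU_U by auto
    have "s (D u) = s1 (D t + (D (x t') + D z))" unfolding Dsum
      using s4 mem subspace_add[OF sDU(1)] by simp
    also have "\<dots> = s1 (D t) + (s1 (D (x t')) + s1 (D z))"
      using lin_add[OF c1(1)] mem subspace_add[OF sDU(1)] by simp
    also have "s1 (D z) = D (s1 z)"
      by (rule commuting_D[OF s1(1) stable_D[OF U] t(3)])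
    also have "s1 (D (x t')) = s1 (- y (D t'))" by (simp add: y_D)
    also have "\<dots> = - y (s1 (D t'))"
      using lin_minus[OF c1(1) sDU(1) sDU(4)[OF mem(4)]] c1(4)[OF mem(4)] by simp
    also have "\<dots> = D (x (s t'))" unfolding sD_T[OF t(2), symmetric] by (simp add: y_D)
    also have "s1 (D t) = D (s t)" using sD_T[OF t(1)] by simp
    finally have Dc: "s (D u) = D (s u)" unfolding su by simp
    have diff: "s u - u = w t + (x (w t') + (s1 z - z))" unfolding su unfolding t(4) using s(2) t w(1) by simp
    have "s1 z - z \<in> rad U"
    proof -
      have "s1 z - z \<in> rad (D ` U)" by (rule s1(2)[OF t(3)])
      then show ?thesis using rad_props(2)[OF stable_D[OF U]] rU(3) by blast
    qed
    then have "s u - u \<in> rad U" unfolding diff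
      using w(1) t rU(5)[OF rU_U[OF w(1)[OF t(2)]]] subspace_add[OF rU(1)] by simp
    then show ?thesis using U1 X Dc by blast
  qed
  have "s (y u) = y (s u)" if u: "u \<in> U" for u
  proof -
    have "s (y u) = s (x u - D u)" by (simp add: D_def)
    also have "\<dots> = s (x u) - s (D u)" by (rule lin_diff[OF s(1) sU(1) sU(3)[OF u] sU(6)[OF u]])
    finally show ?thesis using comm[OF u] by (simp add: D_def)
  qed
  then have "commuting U s" unfolding commuting_def using s(1) comm by blast
  \<comment> \<open>The kernel lies in the radical because \<open>s u - u\<close> does. There
    \<open>s\<close> changes \<open>x t\<close> only by an element of \<open>D U\<close>, so the
    component in \<open>x T\<close> vanishes and injectivity of \<open>s1\<close> finishes.\<close>
  moreover have "inj_on s U"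
  proof (rule lin_inj[OF s(1) sU(1)])
    fix u assume u: "u \<in> U" "s u = 0"
    have "s u - u \<in> rad U" using comm u(1) by blast
    then have "u \<in> rad U" using u(2) subspace_neg[OF rU(1), of "s u - u"] by simp
    then obtain a z where az: "a \<in> x ` T" "z \<in> D ` U" "u = a + z" using T(3) unfolding direct_sum_def by blast
    then obtain t where t: "t \<in> T" "a = x t" by blast
    have tw: "w t \<in> V" using w(1)[OF t(1)] rV by blast
    obtain u' v' where wt: "u' \<in> U" "v' \<in> U" "w t = x u' + D v'" using rU(4)[OF w(1)[OF t(1)]] by blast
    have aU: "x t \<in> U" using sU(3) t by simp
    have "0 = s (x t) + s1 z" using u(2) lin_add[OF s(1) aU DU_U[OF az(2)]] s4 az t by simp
    also have "s (x t) = x t + x (w t)" using sx[OF t(1)] s(2) t tw by simp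
    also have "x (w t) = x (D v')" using wt by simp
    finally have "x t = - (x (D v') + s1 z)" by (metis add.assoc eq_neg_iff_add_eq_0)
    moreover have "x (D v') + s1 z \<in> D ` U"
      using subspace_add[OF sDU(1) sDU(3)[OF imageI[OF wt(2)]] c1(2)[OF az(2)]] by simp
    ultimately have "x t \<in> D ` U" using subspace_neg[OF sDU(1)] by metis
    then have "x t = 0" using T(3) t(1) unfolding direct_sum_def by blast
    then have "u \<in> D ` U" "s1 u = 0" using az t s4 u(2) by auto
    then show "u = 0" using s1(3) lin_0[OF c1(1) sDU(1)] subspace_0[OF sDU(1)] by (metis inj_onD)
  qed
  ultimately show ?thesis using s(4) comm by blast
qed

section \<open>Contracting homotopies and their extension\<close>

lemma homotopyD:
  assumes "homotopy z U h"
  shows "lin U h" "\<And>u. u \<in> U \<Longrightarrow> h u \<in> U" "\<And>u. u \<in> U \<Longrightarrow> h (h u) = 0"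
    "\<And>u. u \<in> U \<Longrightarrow> z (h u) + h (z u) = u"
  using assms by (auto simp: homotopy_def)

text \<open>\<open>z\<close> maps \<open>G\<close> bijectively onto its kernel; \<open>h\<close> is
  the inverse on the kernel and 0 on \<open>G\<close>. The freedom in \<open>G\<close> is used where
  image and kernel of the homotopy have to be prescribed.\<close>

lemma ex_homotopy_complement:
  assumes z: "lin U z" "\<And>u. u \<in> U \<Longrightarrow> z u \<in> U" "\<And>u. u \<in> U \<Longrightarrow> z (z u) = 0"
    and ker: "\<And>u. u \<in> U \<Longrightarrow> z u = 0 \<Longrightarrow> u \<in> z ` U"
    and U: "subspace U" "finite U" and G: "direct_sum U {u \<in> U. z u = 0} G"
  shows "\<exists>h. homotopy z U h \<and> (\<forall>g\<in>G. h g = 0) \<and> h ` U \<subseteq> G"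
proof -
  let ?A = "{u \<in> U. z u = 0}"
  have sG: "subspace G" "G \<subseteq> U" and dec: "\<And>u. u \<in> U \<Longrightarrow> \<exists>a\<in>?A. \<exists>g\<in>G. u = a + g" and AG: "?A \<inter> G = {0}"
    using G by (auto simp: direct_sum_def)
  have linG: "lin G z" using lin_mono[OF z(1) sG(2)] .
  have finG: "finite G" using U(2) sG(2) finite_subset by blast
  obtain i where i: "lin (z ` G) i" "\<And>a. a \<in> z ` G \<Longrightarrow> i a \<in> G" "\<And>a. a \<in> z ` G \<Longrightarrow> z (i a) = a"
    using ex_linear_section[OF linG sG(1) finG] by blast
  have zG: "z ` G = ?A"
  proof
    show "z ` G \<subseteq> ?A" using z(2,3) sG by auto
    show "?A \<subseteq> z ` G"
    proof
      fix a assume "a \<in> ?A"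
      then obtain u where u: "u \<in> U" "a = z u" using ker by blast
      then obtain b g where bg: "b \<in> ?A" "g \<in> G" "u = b + g" using dec by blast
      then have "z u = z g" using lin_add[OF z(1), of b g] sG by auto
      then show "a \<in> z ` G" using u bg by blast
    qed
  qed
  have inj: "inj_on z G"
    by (rule lin_inj[OF linG sG(1)]) (use AG sG in blast)
  have iz: "i (z g) = g" if "g \<in> G" for g
    using inj_onD[OF inj i(3)[of "z g"] i(2)[of "z g"] that] that by simp
  have "lin G (\<lambda>_. 0)" by (simp add: lin_def)
  then obtain h where h: "lin U h" "\<forall>a\<in>?A. h a = i a" "\<forall>g\<in>G. h g = 0"
    using ex_lin_direct_sum[OF G i(1)[unfolded zG]] by blast
  have eq: "h (a + g) = i a" if "a \<in> ?A" "g \<in> G" for a g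
    using lin_add[OF h(1), of a g] h(2,3) that sG by auto
  have hG: "h u \<in> G" if u: "u \<in> U" for u
  proof -
    obtain a g where ag: "a \<in> ?A" "g \<in> G" "u = a + g" using dec[OF u] by blast
    then show ?thesis using eq[OF ag(1,2)] i(2) zG by simp
  qed
  have "z (h u) + h (z u) = u" if u: "u \<in> U" for u
  proof -
    obtain a g where ag: "a \<in> ?A" "g \<in> G" "u = a + g" using dec[OF u] by blast
    have "z u = z g" using lin_add[OF z(1), of a g] ag sG by auto
    moreover have "z g \<in> ?A" using ag zG by blast
    ultimately have "h (z u) = g" using h(2) iz ag by simp
    moreover have "z (h u) = a" using eq[OF ag(1,2)] i(3) zG ag by simp
    ultimately show ?thesis using ag by simp
  qed
  then have "homotopy z U h" unfolding homotopy_def using h hG sG(2) by blast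
  then show ?thesis using h(3) hG by blast
qed

lemma ex_homotopy:
  assumes z: "lin U z" "\<And>u. u \<in> U \<Longrightarrow> z u \<in> U" "\<And>u. u \<in> U \<Longrightarrow> z (z u) = 0"
    and ker: "\<And>u. u \<in> U \<Longrightarrow> z u = 0 \<Longrightarrow> u \<in> z ` U"
    and U: "subspace U" "finite U"
  shows "\<exists>h. homotopy z U h"
proof -
  obtain G where "direct_sum U {u \<in> U. z u = 0} G"
    using ex_complement[OF U subspace_linear_kernel[OF z(1) U(1)]] by blast
  then show ?thesis using ex_homotopy_complement[OF z ker U] by blast
qed

text \<open>Along U = T + x T + D U both maps vanish on \<open>T\<close>, and h (x t) = t. The value
  k (x t) = t + k1 (D t) is forced by k (y t) = t and y t = x t - D t. Hence \<open>h\<close> and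
  \<open>k\<close> differ by elements of \<open>D U\<close> only.\<close>

lemma extend_homotopies:
  assumes U: "stable U" and ex: "exact U" "exact (D ` U)"
    and h1: "homotopy x (D ` U) h1" and k1: "homotopy y (D ` U) k1"
  shows "\<exists>h k. homotopy x U h \<and> homotopy y U k \<and> (\<forall>u\<in>D ` U. h u = h1 u \<and> k u = k1 u)
    \<and> (\<forall>u\<in>U. h u - k u \<in> D ` U)"
proof -
  note sU = stableD[OF U]
  note UV [simp] = subsetD[OF sU(2)]
  note rU = rad_props[OF U]
  note sDU = stableD[OF stable_D[OF U]]
  note h1 = homotopyD[OF h1] and k1 = homotopyD[OF k1]
  obtain T where T: "direct_sum U T (rad U)" "inj_on x T" "direct_sum (rad U) (x ` T) (D ` U)"
    using ex_top_decomposition[OF U ex] by blast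
  have sT: "subspace T" "T \<subseteq> U" using T(1) by (auto simp: direct_sum_def)
  note TU [simp] = subsetD[OF sT(2)]
  have finT: "finite T" using sU(5) sT(2) finite_subset by blast
  have linT: "lin T x" by (rule lin_mono[OF lin_x]) auto
  have linTD: "lin T D" by (rule lin_mono[OF lin_D]) auto
  have DUV [simp]: "z \<in> V" if "z \<in> D ` U" for z using that sDU(2) by blast
  have DU_U: "z \<in> U" if "z \<in> D ` U" for z using that D_subset[OF U] by blast
  obtain g where g: "lin (x ` T) g" "\<And>z. z \<in> x ` T \<Longrightarrow> g z \<in> T" "\<And>z. z \<in> x ` T \<Longrightarrow> x (g z) = z"
    using ex_linear_section[OF linT sT(1) finT] by blast
  have gx: "g (x t) = t" if "t \<in> T" for t
    using inj_onD[OF T(2) g(3)[of "x t"] g(2)[of "x t"] that] that by simp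
  have l0: "lin T (\<lambda>_. 0)" by (simp add: lin_def)
  obtain h where h: "lin U h" "\<forall>t\<in>T. h t = 0" "\<forall>z\<in>x ` T. h z = g z" "\<forall>z\<in>D ` U. h z = h1 z"
    using ex_lin_top_decomposition[OF T(1,3) l0 g(1) h1(1)] by blast
  note h4 = bspec[OF h(4)]
  have "lin T (\<lambda>t. k1 (D t))" by (rule lin_compose[OF linTD _ k1(1)]) auto
  then have "lin T (\<lambda>t. t + k1 (D t))" by (rule lin_plus[OF lin_id])
  from lin_compose[OF g(1) _ this] have lk: "lin (x ` T) (\<lambda>z. g z + k1 (D (g z)))"
    using g(2) by auto
  obtain k where k: "lin U k" "\<forall>t\<in>T. k t = 0" "\<forall>z\<in>x ` T. k z = g z + k1 (D (g z))" "\<forall>z\<in>D ` U. k z = k1 z"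
    using ex_lin_top_decomposition[OF T(1,3) l0 lk k1(1)] by blast
  note k4 = bspec[OF k(4)]
  have hx: "h (x t) = t" "k (x t) = t + k1 (D t)" if "t \<in> T" for t using h(3) k(3) gx that by auto
  have add: "f (t + (x t' + z)) = f t + (f (x t') + f z)"
    if "lin U f" "t \<in> T" "t' \<in> T" "z \<in> D ` U" for f t t' z
  proof -
    have "x t' \<in> U" "z \<in> U" using that sU(3) DU_U by auto
    then show ?thesis using lin_add[OF that(1)] that subspace_add[OF sU(1)] by simp
  qed
  have main: "h u \<in> U \<and> h (h u) = 0 \<and> x (h u) + h (x u) = u \<and> k u \<in> U \<and> k (k u) = 0 \<and> y (k u) + k (y u) = u
      \<and> h u - k u \<in> D ` U" if u: "u \<in> U" for u
  proof -
    obtain t t' z where t: "t \<in> T" "t' \<in> T" "z \<in> D ` U" "u = t + (x t' + z)"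
      using top_decomposition_cases[OF T(1,3) u] .
    have mem: "D t \<in> D ` U" "D t' \<in> D ` U" using t by auto
    note [simp] = UV[OF TU[OF t(1)]] UV[OF TU[OF t(2)]] DUV[OF t(3)] DUV[OF h1(2)[OF t(3)]]
      DUV[OF k1(2)[OF t(3)]] DUV[OF k1(2)[OF mem(1)]] DUV[OF k1(2)[OF mem(2)]]
    have hu: "h u = t' + h1 z" unfolding t(4) add[OF h(1) t(1-3)] using h(2) h4 hx t by simp
    have ku: "k u = t' + (k1 (D t') + k1 z)" unfolding t(4) add[OF k(1) t(1-3)] using k(2) k4 hx t by simp
    have kz: "k1 (D t') + k1 z \<in> D ` U" using k1(2) mem t(3) subspace_add[OF sDU(1)] by simp
    have hhu: "h (h u) = 0" unfolding hu
      using lin_add[OF h(1) TU[OF t(2)] DU_U[OF h1(2)[OF t(3)]]] h(2) h4 t h1(2,3) by simp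
    have kku: "k (k u) = 0"
    proof -
      have "k (k u) = k1 (k1 (D t') + k1 z)"
        unfolding ku using lin_add[OF k(1) TU[OF t(2)] DU_U[OF kz]] k(2) k4 t kz by simp
      also have "\<dots> = 0" using lin_add[OF k1(1) k1(2)[OF mem(2)] k1(2)[OF t(3)]] k1(3) mem t(3) by simp
      finally show ?thesis .
    qed
    have xu: "x u = x t + x z" unfolding t(4) by simp
    have "h (x u) = t + h1 (x z)" unfolding xu
      using lin_add[OF h(1), of "x t" "x z"] sU(3) t DU_U hx h4 sDU(3) by simp
    moreover have "x (h u) = x t' + x (h1 z)" unfolding hu by simp
    ultimately have X: "x (h u) + h (x u) = u" using h1(4)[OF t(3)] unfolding t(4)
      by (metis add.assoc add.left_commute)
    have yt': "y (x t') = y (D t')" by (simp add: D_def)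
    have ty: "y t = x t - D t" by (simp add: D_def)
    have yu: "y u = y t + (y (D t') + y z)" unfolding t(4) using yt' by simp
    have kyt: "k (y t) = t"
      unfolding ty using lin_diff[OF k(1) sU(1), of "x t" "D t"] sU(3) t(1) DU_U mem(1) hx k4 by simp
    have mm: "y (D t') \<in> D ` U" "y z \<in> D ` U" using sDU(4) mem t(3) by auto
    then have mm2: "y (D t') + y z \<in> D ` U" using subspace_add[OF sDU(1)] by simp
    have "k (y u) = k (y t) + k1 (y (D t') + y z)" unfolding yu
      using lin_add[OF k(1) sU(4)[OF TU[OF t(1)]] DU_U[OF mm2]] k4 mm2 by simp
    also have "\<dots> = t + (k1 (y (D t')) + k1 (y z))" using kyt lin_add[OF k1(1) mm] by simp
    finally have ky: "k (y u) = t + (k1 (y (D t')) + k1 (y z))" .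
    have "y (k u) + k (y u) = (y t' + t) + ((y (k1 (D t')) + k1 (y (D t'))) + (y (k1 z) + k1 (y z)))"
      unfolding ku ky by (simp add: algebra_simps)
    also have "\<dots> = (y t' + t) + (D t' + z)" using k1(4)[OF mem(2)] k1(4)[OF t(3)] by simp
    also have "\<dots> = u" unfolding t(4) by (simp add: D_def algebra_simps)
    finally have Y: "y (k u) + k (y u) = u" .
    have "h u - k u = h1 z - (k1 (D t') + k1 z)" unfolding hu ku by simp
    then have "h u - k u \<in> D ` U" using h1(2)[OF t(3)] kz subspace_diff[OF sDU(1)] by simp
    moreover have "h u \<in> U" unfolding hu using t(2) DU_U[OF h1(2)[OF t(3)]] subspace_add[OF sU(1)] by simp
    moreover have "k u \<in> U" unfolding ku using t(2) DU_U[OF kz] subspace_add[OF sU(1)] by simp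
    ultimately show ?thesis using hhu kku X Y by blast
  qed
  have "homotopy x U h" "homotopy y U k" unfolding homotopy_def using h(1) k(1) main by auto
  then show ?thesis using h(4) k(4) main by blast
qed

section \<open>The filtration by the images of the powers of D\<close>

definition level :: "nat \<Rightarrow> 'v set" where "level i = (D ^^ i) ` V"

lemma level_0 [simp]: "level 0 = V" by (simp add: level_def)

lemma level_Suc: "level (Suc i) = D ` level i" by (simp add: level_def image_comp)

lemma stable_level: "stable (level i)"
  by (induction i) (simp_all add: stable_V level_Suc stable_D)

lemma level_Suc_subset: "level (Suc i) \<subseteq> level i"
  unfolding level_Suc by (rule D_subset[OF stable_level])

lemma extend_automorphism_level:
  assumes "\<And>j. j \<le> i \<Longrightarrow> exact (level j)"
    and "commuting (level i) s1" "\<And>u. u \<in> level i \<Longrightarrow> s1 u - u \<in> rad (level i)" "inj_on s1 (level i)"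
  shows "\<exists>s. commuting V s \<and> (\<forall>u\<in>level i. s u = s1 u) \<and> inj_on s V"
  using assms
proof (induction i arbitrary: s1)
  case 0
  then show ?case by auto
next
  case (Suc i)
  obtain s2 where s2: "commuting (level i) s2" "\<forall>u\<in>level (Suc i). s2 u = s1 u"
      "\<forall>u\<in>level i. s2 u - u \<in> rad (level i)" "inj_on s2 (level i)"
    using extend_automorphism[OF stable_level Suc.prems(1)[of i] Suc.prems(1)[of "Suc i", unfolded level_Suc], of s1]
      Suc.prems(2-4) unfolding level_Suc by auto
  obtain s where s: "commuting V s" "\<forall>u\<in>level i. s u = s2 u" "inj_on s V"
    using Suc.IH[of s2] Suc.prems(1) s2 by force
  then show ?case using s2(2) level_Suc_subset[of i] by (metis subsetD)
qed

text \<open>The agreement modulo the next level is what later reduces the trace on \<open>V\<close>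
  to a trace on \<open>level i\<close>.\<close>

lemma extend_homotopies_level:
  assumes "\<And>j. j \<le> i \<Longrightarrow> exact (level j)"
    and "homotopy x (level i) h1" "homotopy y (level i) k1"
  shows "\<exists>h k. homotopy x V h \<and> homotopy y V k \<and> (\<forall>u\<in>level i. h u = h1 u \<and> k u = k1 u)
    \<and> (\<forall>j\<le>i. h ` level j \<subseteq> level j \<and> k ` level j \<subseteq> level j)
    \<and> (\<forall>j<i. \<forall>u\<in>level j. h u - k u \<in> level (Suc j))"
  using assms
proof (induction i arbitrary: h1 k1)
  case 0
  then show ?case using homotopyD(2) by fastforce
next
  case (Suc i)
  obtain h2 k2 where hk2: "homotopy x (level i) h2" "homotopy y (level i) k2"
      "\<forall>u\<in>level (Suc i). h2 u = h1 u \<and> k2 u = k1 u" "\<forall>u\<in>level i. h2 u - k2 u \<in> level (Suc i)"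
    using extend_homotopies[OF stable_level Suc.prems(1)[of i] Suc.prems(1)[of "Suc i", unfolded level_Suc], of h1 k1]
      Suc.prems(2,3) unfolding level_Suc by auto
  obtain h k where hk: "homotopy x V h" "homotopy y V k" "\<forall>u\<in>level i. h u = h2 u \<and> k u = k2 u"
      "\<forall>j\<le>i. h ` level j \<subseteq> level j \<and> k ` level j \<subseteq> level j"
      "\<forall>j<i. \<forall>u\<in>level j. h u - k u \<in> level (Suc j)"
    using Suc.IH[of h2 k2] Suc.prems(1) hk2 by auto
  have ag: "h u = h1 u \<and> k u = k1 u" if "u \<in> level (Suc i)" for u
    using hk(3) hk2(3) that level_Suc_subset[of i] by auto
  have "h ` level (Suc i) \<subseteq> level (Suc i)" "k ` level (Suc i) \<subseteq> level (Suc i)"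
    using ag homotopyD(2)[OF Suc.prems(2)] homotopyD(2)[OF Suc.prems(3)] by auto
  then have "\<forall>j\<le>Suc i. h ` level j \<subseteq> level j \<and> k ` level j \<subseteq> level j"
    using hk(4) le_Suc_eq by auto
  moreover have "\<forall>j<Suc i. \<forall>u\<in>level j. h u - k u \<in> level (Suc j)"
    using hk(3,5) hk2(4) less_Suc_eq by auto
  ultimately show ?case using hk(1,2) ag by blast
qed

end

context nilpair
begin

lemma powD_V [simp]: "v \<in> V \<Longrightarrow> (D ^^ i) v \<in> V"
  by (induction i) auto

lemma lin_powD: "lin V (D ^^ i)"
proof (induction i)
  case (Suc i)
  have "lin V (\<lambda>u. D ((D ^^ i) u))" by (rule lin_compose[OF Suc _ lin_D]) auto
  then show ?case by (simp add: o_def)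
qed (simp add: lin_def)

lemma level_subset_V: "level i \<subseteq> V" using stableD(2)[OF stable_level] .

lemma levelI: "v \<in> V \<Longrightarrow> (D ^^ i) v \<in> level i" by (simp add: level_def)

lemma rad_level: "rad (level i) = (D ^^ i) ` rad V"
proof (induction i)
  case (Suc i)
  then show ?case unfolding level_Suc D_rad[OF stable_level] by (simp add: image_comp)
qed simp

lemma commuting_powD:
  assumes s: "commuting V s" and v: "v \<in> V" shows "s ((D ^^ i) v) = (D ^^ i) (s v)"
  by (induction i) (simp_all add: commuting_D[OF s stable_V] v)

lemma commuting_level:
  assumes s: "commuting V s" and u: "u \<in> level i" shows "s u \<in> level i"
proof -
  obtain v where v: "v \<in> V" "u = (D ^^ i) v" using u unfolding level_def by blast
  then show ?thesis using commuting_powD[OF s] levelI commutingD(2)[OF s] by simp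
qed

text \<open>Applied contrapositively: if the next level is not exact, some socle vector
  \<open>w\<close> has \<open>h w - k w\<close> outside the radical. The reason: w = x (h w) = y (k
  w), and \<open>h w - k w = x a + y b\<close> turns u = h w - x a = k w + y b into a common
  preimage of \<open>w\<close> under \<open>x\<close> and \<open>y\<close>, which \<open>D\<close>
  kills.\<close>

lemma exact_next_level:
  assumes ex: "exact (level i)" and h: "homotopy x (level i) h" and k: "homotopy y (level i) k"
    and sig: "\<And>w. w \<in> level i \<Longrightarrow> x w = 0 \<Longrightarrow> y w = 0 \<Longrightarrow> h w - k w \<in> rad (level i)"
  shows "exact (level (Suc i))"
proof -
  note sL = stableD[OF stable_level[of i]]
  note hD = homotopyD[OF h] and kD = homotopyD[OF k]
  note [simp] = subsetD[OF sL(2)]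
  have lift: "\<exists>u\<in>level i. x u = w \<and> y u = w" if w: "w \<in> level i" "x w = 0" "y w = 0" for w
  proof -
    have "h w - k w \<in> rad (level i)" by (rule sig[OF w])
    then obtain a b where ab: "a \<in> level i" "b \<in> level i" "h w - k w = x a + y b" unfolding rad_def by blast
    have hw: "x (h w) = w" and kw: "y (k w) = w"
      using hD(4)[OF w(1)] kD(4)[OF w(1)] w(2,3) lin_0[OF hD(1) sL(1)] lin_0[OF kD(1) sL(1)] by auto
    let ?u = "h w - x a"
    have [simp]: "h w \<in> V" "k w \<in> V" using hD(2)[OF w(1)] kD(2)[OF w(1)] by auto
    have u: "?u \<in> level i" using subspace_diff[OF sL(1) hD(2)[OF w(1)] sL(3)[OF ab(1)]] .
    have "?u = k w + y b" using ab(3) by (simp add: algebra_simps)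
    then have "y ?u = w" using kw ab by simp
    moreover have "x ?u = w" using hw ab by simp
    ultimately show ?thesis using u by blast
  qed
  have d0: "D u = 0" if "x u = w" "y u = w" for u w using that by (simp add: D_def)
  show ?thesis unfolding exact_def
  proof (intro conjI ballI impI)
    fix v assume v: "v \<in> level (Suc i)" "x v = 0"
    then obtain z where z: "z \<in> level i" "v = D z" unfolding level_Suc by blast
    \<comment> \<open>So \<open>y z\<close> is a socle vector. Its common preimage \<open>u\<close>
      is killed by \<open>D\<close>, hence \<open>z\<close> may be replaced by \<open>z - u\<close>,
      which lies in the kernel and so in the image of \<open>y\<close>; then
      \<open>D y = - x D\<close> applies.\<close>
    have "x (y z) = 0" using v(2) z by (simp add: x_D D_def)
    then obtain u where u: "u \<in> level i" "x u = y z" "y u = y z"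
      using lift[of "y z"] sL(4)[OF z(1)] z(1) by auto
    have "y (z - u) = 0" using u z by simp
    then obtain z' where z': "z' \<in> level i" "z - u = y z'"
      using exactD(2)[OF ex] subspace_diff[OF sL(1) z(1) u(1)] by blast
    have "v = D (z - u)" using z u d0[OF u(2,3)] by simp
    also have "\<dots> = x (D (- z'))" using z' by (simp add: x_D)
    finally show "v \<in> x ` level (Suc i)"
      using subspace_neg[OF sL(1) z'(1)] unfolding level_Suc by blast
  next
    fix v assume v: "v \<in> level (Suc i)" "y v = 0"
    then obtain z where z: "z \<in> level i" "v = D z" unfolding level_Suc by blast
    have "y (x z) = 0" using v(2) z by (simp add: y_D D_def)
    then obtain u where u: "u \<in> level i" "x u = x z" "y u = x z"
      using lift[of "x z"] sL(3)[OF z(1)] z(1) by auto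
    have "x (z - u) = 0" using u z by simp
    then obtain z' where z': "z' \<in> level i" "z - u = x z'"
      using exactD(1)[OF ex] subspace_diff[OF sL(1) z(1) u(1)] by blast
    have "v = D (z - u)" using z u d0[OF u(2,3)] by simp
    also have "\<dots> = y (D (- z'))" using z' by (simp add: y_D)
    finally show "v \<in> y ` level (Suc i)"
      using subspace_neg[OF sL(1) z'(1)] unfolding level_Suc by blast
  qed
qed

definition inverse_pair :: "('v \<Rightarrow> 'v) \<Rightarrow> ('v \<Rightarrow> 'v) \<Rightarrow> bool" where
  "inverse_pair s s' \<longleftrightarrow> commuting V s \<and> commuting V s' \<and> (\<forall>v\<in>V. s (s' v) = v \<and> s' (s v) = v)"

lemma ex_inverse:
  assumes s: "commuting V s" "inj_on s V" shows "\<exists>s'. inverse_pair s s'"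
proof -
  let ?i = "inv_into V s"
  have im: "s ` V = V" using endo_inj_surj[OF V(2) _ s(2)] commutingD(2)[OF s(1)] by blast
  have i: "?i v \<in> V" "s (?i v) = v" if "v \<in> V" for v
    using that im by (auto intro: inv_into_into f_inv_into_f)
  have i2: "?i (s v) = v" if "v \<in> V" for v using inv_into_f_f[OF s(2) that] .
  note c = commutingD[OF s(1)]
  have eq: "?i w = v" if "v \<in> V" "w = s v" for v w using i2 that by simp
  have "lin V ?i"
  proof (rule linI)
    fix u v assume uv: "u \<in> V" "v \<in> V"
    show "?i (u + v) = ?i u + ?i v"
      by (rule eq) (use uv i lin_add[OF c(1)] in auto)
  next
    fix a u assume u: "u \<in> V"
    show "?i (scale a u) = scale a (?i u)"
      by (rule eq) (use u i lin_scale[OF c(1)] in auto)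
  qed
  moreover have "?i (x u) = x (?i u)" if u: "u \<in> V" for u
    by (rule eq) (use u i c(3) in auto)
  moreover have "?i (y u) = y (?i u)" if u: "u \<in> V" for u
    by (rule eq) (use u i c(4) in auto)
  ultimately have "commuting V ?i" unfolding commuting_def using i by blast
  then show ?thesis unfolding inverse_pair_def using s(1) i(2) i2 by blast
qed

text \<open>The operators \<open>Z\<close> that occur as \<open>n D\<^sup>i\<close> for some \<open>n\<close> mapping the top of \<open>level i\<close> into its socle.\<close>

definition socle_maps :: "nat \<Rightarrow> ('v \<Rightarrow> 'v) set" where
  "socle_maps i = {Z. lin V Z \<and> (\<forall>v\<in>V. Z v \<in> level i \<and> x (Z v) = 0 \<and> y (Z v) = 0
      \<and> Z (x v) = 0 \<and> Z (y v) = 0 \<and> ((D ^^ i) v = 0 \<longrightarrow> Z v = 0))}"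

end

section \<open>Traces and the difference of two logarithms\<close>

locale traced_nilpair = nilpair scale V x y for scale :: "'k::field \<Rightarrow> 'v::ab_group_add \<Rightarrow> 'v" and V x y +
  fixes tr :: "('v \<Rightarrow> 'v) \<Rightarrow> 'k"
  assumes tr_cong: "(\<And>v. v \<in> V \<Longrightarrow> f v = g v) \<Longrightarrow> tr f = tr g"
    and tr_plus: "tr (\<lambda>v. f v + g v) = tr f + tr g"
    and tr_minus: "tr (\<lambda>v. f v - g v) = tr f - tr g"
    and tr_scale: "tr (\<lambda>v. scale c (f v)) = c * tr f"
    and tr_comm: "lin V f \<Longrightarrow> lin V g \<Longrightarrow> f ` V \<subseteq> V \<Longrightarrow> g ` V \<subseteq> V \<Longrightarrow> tr (\<lambda>v. f (g v)) = tr (\<lambda>v. g (f v))"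
    and tr_rank1: "funl V \<phi> \<Longrightarrow> w \<in> V \<Longrightarrow> tr (\<lambda>v. scale (\<phi> v) w) = \<phi> w"
begin

lemma tr_0: "(\<And>v. v \<in> V \<Longrightarrow> f v = 0) \<Longrightarrow> tr f = 0"
  using tr_scale[of 0 f] tr_cong[of f "\<lambda>v. scale 0 (f v)"] by simp

text \<open>\<open>M\<close> acts nilpotently on \<open>V\<close> modulo \<open>level i\<close>. In
  the induction step \<open>p\<close> projects onto \<open>level i\<close> and \<open>P\<close> onto
  the next level: M p = P M p, and cyclicity of the trace brings \<open>P\<close> to the right,
  where p P = P.\<close>

lemma tr_level:
  assumes M: "lin V M" "M ` V \<subseteq> V" "\<And>j u. j < i \<Longrightarrow> u \<in> level j \<Longrightarrow> M u \<in> level (Suc j)"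
    and P: "lin V P" "\<And>v. v \<in> V \<Longrightarrow> P v \<in> level i" "\<And>u. u \<in> level i \<Longrightarrow> P u = u"
  shows "tr M = tr (\<lambda>v. M (P v))"
  using M(3) P
proof (induction i arbitrary: P)
  case 0
  then show ?case by (intro tr_cong) simp
next
  case (Suc i)
  note sL = stableD[OF stable_level[of i]]
  obtain C where C: "direct_sum V (level i) C" using ex_complement[OF V sL(1,2)] by blast
  obtain p where p: "lin V p" "\<forall>v\<in>V. p v \<in> level i \<and> v - p v \<in> C" "\<forall>u\<in>level i. p u = u"
    using ex_projection[OF C] by blast
  have pV: "p ` V \<subseteq> V" using p(2) sL(2) by blast
  have PV: "P ` V \<subseteq> V" using Suc.prems(3) level_subset_V by blast
  have Mp: "lin V (\<lambda>v. M (p v))" by (rule lin_compose[OF p(1) pV M(1)])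
  have MpV: "(\<lambda>v. M (p v)) ` V \<subseteq> V" using pV M(2) by blast
  have inl: "M (p v) \<in> level (Suc i)" if "v \<in> V" for v using Suc.prems(1)[of i] p(2) that by blast
  have "tr M = tr (\<lambda>v. M (p v))"
    by (rule Suc.IH) (use Suc.prems(1) p in auto)
  also have "\<dots> = tr (\<lambda>v. P (M (p v)))"
    by (rule tr_cong) (use inl Suc.prems(4) in simp)
  also have "\<dots> = tr (\<lambda>v. M (p (P v)))"
    by (rule tr_comm[OF Suc.prems(2) Mp PV MpV])
  also have "\<dots> = tr (\<lambda>v. M (P v))"
    by (rule tr_cong) (simp only: bspec[OF p(3) subsetD[OF level_Suc_subset Suc.prems(3)]])
  finally show ?case .
qed

text \<open>For a homotopy \<open>h\<close> of \<open>z\<close> and an automorphism \<open>s\<close> commuting with \<open>z\<close>, with inverse \<open>s'\<close>, this is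
  the logarithmic derivative of the determinant of \<open>s\<close> over the dual numbers \<open>k[z]\<close>.\<close>

definition dlog :: "('v \<Rightarrow> 'v) \<Rightarrow> ('v \<Rightarrow> 'v) \<Rightarrow> ('v \<Rightarrow> 'v) \<Rightarrow> ('v \<Rightarrow> 'v) \<Rightarrow> 'k" where
  "dlog z h s s' = tr (\<lambda>v. s' (z (h (s (h v)))))"

text \<open>The identity x h s h - y k s k = D h s h + y (h - k) s h + y k s (h - k) shows that the
  operator under the trace maps \<open>level j\<close> into \<open>level (Suc j)\<close> for j < i;
  then \<open>tr_level\<close> applies.\<close>

lemma dlog_diff_level:
  assumes h: "homotopy x V h" and k: "homotopy y V k"
    and hk: "\<And>j. j \<le> i \<Longrightarrow> h ` level j \<subseteq> level j" "\<And>j. j \<le> i \<Longrightarrow> k ` level j \<subseteq> level j"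
      "\<And>j u. j < i \<Longrightarrow> u \<in> level j \<Longrightarrow> h u - k u \<in> level (Suc j)"
    and s: "inverse_pair s s'"
    and P: "lin V P" "\<And>v. v \<in> V \<Longrightarrow> P v \<in> level i" "\<And>u. u \<in> level i \<Longrightarrow> P u = u"
  shows "dlog x h s s' - dlog y k s s'
    = tr (\<lambda>v. s' (x (h (s (h (P v))))) - s' (y (k (s (k (P v))))))"
proof -
  let ?M = "\<lambda>v. s' (x (h (s (h v)))) - s' (y (k (s (k v))))"
  have c: "commuting V s" "commuting V s'" using s by (auto simp: inverse_pair_def)
  note c1 = commutingD[OF c(1)] and c2 = commutingD[OF c(2)]
  note hD = homotopyD[OF h] and kD = homotopyD[OF k]
  have "lin V (\<lambda>v. s (h v))" by (rule lin_compose[OF hD(1) _ c1(1)]) (use hD in auto)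
  then have "lin V (\<lambda>v. h (s (h v)))" by (rule lin_compose[OF _ _ hD(1)]) (use hD c1 in auto)
  then have "lin V (\<lambda>v. x (h (s (h v))))" by (rule lin_compose[OF _ _ lin_x]) (use hD c1 in auto)
  then have l1: "lin V (\<lambda>v. s' (x (h (s (h v)))))" by (rule lin_compose[OF _ _ c2(1)]) (use hD c1 in auto)
  have "lin V (\<lambda>v. s (k v))" by (rule lin_compose[OF kD(1) _ c1(1)]) (use kD in auto)
  then have "lin V (\<lambda>v. k (s (k v)))" by (rule lin_compose[OF _ _ kD(1)]) (use kD c1 in auto)
  then have "lin V (\<lambda>v. y (k (s (k v))))" by (rule lin_compose[OF _ _ lin_y]) (use kD c1 in auto)
  then have l2: "lin V (\<lambda>v. s' (y (k (s (k v)))))" by (rule lin_compose[OF _ _ c2(1)]) (use kD c1 in auto)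
  have lM: "lin V ?M" by (rule lin_minus_fun[OF l1 l2])
  have MV: "?M ` V \<subseteq> V" using hD kD c1 c2 by auto
  have "?M u \<in> level (Suc j)" if j: "j < i" and u: "u \<in> level j" for j u
  proof -
    note sL = stableD[OF stable_level[of j]] and sL' = stableD[OF stable_level[of "Suc j"]]
    note [simp] = subsetD[OF sL(2)]
    have hL: "h w \<in> level j" "k w \<in> level j" "s w \<in> level j" if "w \<in> level j" for w
      using hk(1,2)[of j] j that commuting_level[OF c(1)] by auto
    have uh: "h u \<in> level j" "k u \<in> level j" "s (h u) \<in> level j" "s (k u) \<in> level j" "h (s (h u)) \<in> level j"
        "k (s (h u)) \<in> level j" "k (s (k u)) \<in> level j"
      using hL u by auto
    have 1: "D (h (s (h u))) \<in> level (Suc j)" using uh(5) unfolding level_Suc by blast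
    have 2: "y (h (s (h u)) - k (s (h u))) \<in> level (Suc j)"
      by (rule sL'(4)[OF hk(3)[OF j uh(3)]])
    have "h u - k u \<in> level (Suc j)" by (rule hk(3)[OF j u])
    then have "s (h u - k u) \<in> level (Suc j)" by (rule commuting_level[OF c(1)])
    then have "k (s (h u - k u)) \<in> level (Suc j)" using hk(2)[of "Suc j"] j by auto
    then have 3: "y (k (s (h u - k u))) \<in> level (Suc j)" by (rule sL'(4))
    have s_diff: "s (h u - k u) = s (h u) - s (k u)" by (rule lin_diff[OF c1(1) V(1)]) (use uh in auto)
    have k_diff: "k (s (h u) - s (k u)) = k (s (h u)) - k (s (k u))"
      by (rule lin_diff[OF kD(1) V(1)]) (use uh in auto)
    have [simp]: "h (s (h u)) \<in> V" "k (s (h u)) \<in> V" "k (s (k u)) \<in> V" using uh by auto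
    have "x (h (s (h u))) - y (k (s (k u)))
      = D (h (s (h u))) + y (h (s (h u)) - k (s (h u))) + y (k (s (h u - k u)))"
      unfolding s_diff k_diff by (simp add: D_def)
    then have "x (h (s (h u))) - y (k (s (k u))) \<in> level (Suc j)"
      using subspace_add[OF sL'(1) subspace_add[OF sL'(1) 1 2] 3] by simp
    then have "s' (x (h (s (h u))) - y (k (s (k u)))) \<in> level (Suc j)" by (rule commuting_level[OF c(2)])
    moreover have "s' (x (h (s (h u))) - y (k (s (k u)))) = ?M u"
      by (rule lin_diff[OF c2(1) V(1)]) auto
    ultimately show ?thesis by simp
  qed
  then have "tr ?M = tr (\<lambda>v. ?M (P v))" by (rule tr_level[OF lM MV _ P])
  then show ?thesis unfolding dlog_def tr_minus by simp
qed

text \<open>On \<open>level i\<close> the operator h s h is a multiple of h h = 0, and likewise for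
  \<open>k\<close>.\<close>

lemma dlog_diff_scalar:
  assumes h: "homotopy x V h" and k: "homotopy y V k"
    and hk: "\<And>j. j \<le> i \<Longrightarrow> h ` level j \<subseteq> level j" "\<And>j. j \<le> i \<Longrightarrow> k ` level j \<subseteq> level j"
      "\<And>j u. j < i \<Longrightarrow> u \<in> level j \<Longrightarrow> h u - k u \<in> level (Suc j)"
    and s: "inverse_pair s s'" and sc: "\<And>v. v \<in> V \<Longrightarrow> s ((D ^^ i) v) = scale c ((D ^^ i) v)"
  shows "dlog x h s s' - dlog y k s s' = 0"
proof -
  have sc': "s u = scale c u" if "u \<in> level i" for u using sc that unfolding level_def by blast
  note hD = homotopyD[OF h] and kD = homotopyD[OF k]
  have c: "commuting V s'" using s by (simp add: inverse_pair_def)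
  note sL = stableD[OF stable_level[of i]]
  obtain C where C: "direct_sum V (level i) C" using ex_complement[OF V sL(1,2)] by blast
  obtain p where p: "lin V p" "\<forall>v\<in>V. p v \<in> level i \<and> v - p v \<in> C" "\<forall>u\<in>level i. p u = u"
    using ex_projection[OF C] by blast
  have "s' (x (h (s (h (p v))))) - s' (y (k (s (k (p v))))) = 0" if v: "v \<in> V" for v
  proof -
    have pv: "p v \<in> level i" using p(2) v by blast
    then have hk': "h (p v) \<in> level i" "k (p v) \<in> level i" using hk(1,2)[of i] by auto
    have V': "p v \<in> V" "h (p v) \<in> V" "k (p v) \<in> V" using pv hk' sL(2) by auto
    have "h (s (h (p v))) = 0" "k (s (k (p v))) = 0"
      using sc' hk' lin_scale[OF hD(1) V'(2)] lin_scale[OF kD(1) V'(3)] hD(3)[OF V'(1)] kD(3)[OF V'(1)] by auto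
    then show ?thesis using lin_0[OF commutingD(1)[OF c] V(1)] by simp
  qed
  then have "tr (\<lambda>v. s' (x (h (s (h (p v))))) - s' (y (k (s (k (p v)))))) = 0" by (rule tr_0)
  then show ?thesis using dlog_diff_level[OF h k hk s p(1)] p(2,3) by simp
qed

text \<open>The filtration becomes stationary at a level where \<open>D\<close> is bijective, and
  this level is the direct sum of the kernels of \<open>x\<close> and \<open>y\<close>. There
  \<open>h\<close> is chosen with values in ker y and zero on ker y, and \<open>k\<close> in the
  same way with ker x. As \<open>s\<close> preserves both kernels, h s h and k s k vanish on that
  level.\<close>

lemma dlog_diff_eventually_zero:
  assumes ex: "\<And>j. exact (level j)"
  shows "\<exists>h k. homotopy x V h \<and> homotopy y V k \<and> (\<forall>s s'. inverse_pair s s' \<longrightarrow> dlog x h s s' - dlog y k s s' = 0)"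
proof -
  have "\<exists>i. level (Suc i) = level i"
  proof (rule ccontr)
    assume "\<not> ?thesis"
    then have psub: "level (Suc i) \<subset> level i" for i using level_Suc_subset[of i] by blast
    have "card (level i) + i \<le> card V" for i
    proof (induction i)
      case (Suc i)
      have "card (level (Suc i)) < card (level i)"
        by (rule psubset_card_mono[OF stableD(5)[OF stable_level] psub])
      then show ?case using Suc by linarith
    qed simp
    from this[of "Suc (card V)"] show False by simp
  qed
  then obtain i where i: "level (Suc i) = level i" by blast
  let ?U = "level i"
  note sU = stableD[OF stable_level[of i]]
  note UV [simp] = subsetD[OF sU(2)]
  have DU: "D ` ?U = ?U" using i level_Suc by simp
  then have Dinj: "inj_on D ?U" using eq_card_imp_inj_on[OF sU(5), of D] by simp
  let ?A = "{u \<in> ?U. x u = 0}" and ?B = "{u \<in> ?U. y u = 0}"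
  have linU: "lin ?U x" "lin ?U y" using lin_mono[OF lin_x sU(2)] lin_mono[OF lin_y sU(2)] .
  have AB: "?A \<inter> ?B = {0}"
  proof
    show "?A \<inter> ?B \<subseteq> {0}"
    proof
      fix u assume "u \<in> ?A \<inter> ?B"
      then have "u \<in> ?U" "D u = D 0" by (auto simp: D_def)
      then show "u \<in> {0}" using inj_onD[OF Dinj, of u 0] subspace_0[OF sU(1)] by simp
    qed
    show "{0} \<subseteq> ?A \<inter> ?B" using subspace_0[OF sU(1)] by simp
  qed
  have dec: "\<exists>a\<in>?A. \<exists>b\<in>?B. u = a + b" if "u \<in> ?U" for u
  proof -
    have "u \<in> D ` ?U" using that DU by simp
    then obtain z where z: "z \<in> ?U" "u = D z" by blast
    then have "u = x z + (- y z)" by (simp add: D_def)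
    moreover have "x z \<in> ?A" "- y z \<in> ?B" using z(1) sU(3,4) subspace_neg[OF sU(1)] by auto
    ultimately show ?thesis by blast
  qed
  have dA: "direct_sum ?U ?A ?B"
    unfolding direct_sum_def
    using sU(1) subspace_linear_kernel[OF linU(1) sU(1)] subspace_linear_kernel[OF linU(2) sU(1)] AB dec by blast
  have dB: "direct_sum ?U ?B ?A" using direct_sum_commute[OF dA] .
  obtain h1 where h1: "homotopy x ?U h1" "\<forall>b\<in>?B. h1 b = 0" "h1 ` ?U \<subseteq> ?B"
    using ex_homotopy_complement[OF linU(1) sU(3) _ _ sU(1,5) dA] exactD(1)[OF ex[of i]] by auto
  obtain k1 where k1: "homotopy y ?U k1" "\<forall>b\<in>?A. k1 b = 0" "k1 ` ?U \<subseteq> ?A"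
    using ex_homotopy_complement[OF linU(2) sU(4) _ _ sU(1,5) dB] exactD(2)[OF ex[of i]] by auto
  obtain h k where hk: "homotopy x V h" "homotopy y V k" "\<forall>u\<in>?U. h u = h1 u \<and> k u = k1 u"
      "\<forall>j\<le>i. h ` level j \<subseteq> level j \<and> k ` level j \<subseteq> level j"
      "\<forall>j<i. \<forall>u\<in>level j. h u - k u \<in> level (Suc j)"
    using extend_homotopies_level[OF ex h1(1) k1(1)] by auto
  have hk1: "\<And>j. j \<le> i \<Longrightarrow> h ` level j \<subseteq> level j" "\<And>j. j \<le> i \<Longrightarrow> k ` level j \<subseteq> level j"
      "\<And>j u. j < i \<Longrightarrow> u \<in> level j \<Longrightarrow> h u - k u \<in> level (Suc j)"
    using hk(4,5) by blast+
  obtain C where C: "direct_sum V ?U C" using ex_complement[OF V sU(1,2)] by blast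
  obtain p where p: "lin V p" "\<forall>v\<in>V. p v \<in> ?U \<and> v - p v \<in> C" "\<forall>u\<in>?U. p u = u"
    using ex_projection[OF C] by blast
  have "dlog x h s s' - dlog y k s s' = 0" if s: "inverse_pair s s'" for s s'
  proof -
    have c: "commuting V s" "commuting V s'" using s by (auto simp: inverse_pair_def)
    note c1 = commutingD[OF c(1)]
    have s0: "s 0 = 0" using lin_0[OF c1(1) V(1)] .
    have "s' (x (h (s (h (p v))))) - s' (y (k (s (k (p v))))) = 0" if v: "v \<in> V" for v
    proof -
      have pv: "p v \<in> ?U" using p(2) v by blast
      have "h (p v) \<in> ?B" "k (p v) \<in> ?A" using hk(3) h1(3) k1(3) pv by auto
      then have "s (h (p v)) \<in> ?B" "s (k (p v)) \<in> ?A"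
        using commuting_level[OF c(1)] c1(3)[of "k (p v)"] c1(4)[of "h (p v)"] s0 by auto
      then have "h (s (h (p v))) = 0" "k (s (k (p v))) = 0" using hk(3) h1(2) k1(2) by auto
      then show ?thesis using lin_0[OF commutingD(1)[OF c(2)] V(1)] by simp
    qed
    then have "tr (\<lambda>v. s' (x (h (s (h (p v))))) - s' (y (k (s (k (p v)))))) = 0" by (rule tr_0)
    then show ?thesis using dlog_diff_level[OF hk(1,2) hk1 s p(1)] p(2,3) by simp
  qed
  then show ?thesis using hk(1,2) by blast
qed

text \<open>For Z = n D^i the automorphism 1 + n of \<open>level i\<close> extends to
  \<open>V\<close>. Since h h = 0 and \<open>n\<close> has values in the socle, x h (1 + n) h = n h,
  and similarly for \<open>y\<close> and \<open>k\<close>. So the difference of the logarithms is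
  the trace of n (h - k) on \<open>level i\<close>, which is linear in \<open>Z\<close>. The
  homotopies and \<open>T\<close> do not depend on \<open>Z\<close>.\<close>

lemma inexact_level:
  assumes ex': "\<forall>j\<le>i. exact (level j)" and nex: "\<not> exact (level (Suc i))"
  shows "\<exists>h k. homotopy x V h \<and> homotopy y V k \<and> (\<exists>T.
      (\<exists>Z\<in>socle_maps i. T Z \<noteq> 0) \<and>
      (\<forall>Z Z' c. T (\<lambda>v. Z v + scale c (Z' v)) = T Z + c * T Z') \<and>
      (\<forall>Z\<in>socle_maps i. \<exists>s s'. inverse_pair s s' \<and> (\<forall>v\<in>V. s ((D ^^ i) v) = (D ^^ i) v + Z v)
        \<and> dlog x h s s' - dlog y k s s' = T Z) \<and>
      (\<forall>c s s'. inverse_pair s s' \<and> (\<forall>v\<in>V. s ((D ^^ i) v) = scale c ((D ^^ i) v))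
        \<longrightarrow> dlog x h s s' - dlog y k s s' = 0))"
proof -
  note ex = ex'[rule_format]
  let ?U = "level i"
  note sU = stableD[OF stable_level[of i]]
  note UV [simp] = subsetD[OF sU(2)]
  have linU: "lin ?U x" "lin ?U y" using lin_mono[OF lin_x sU(2)] lin_mono[OF lin_y sU(2)] .
  obtain h1 where h1: "homotopy x ?U h1"
    using ex_homotopy[OF linU(1) sU(3) _ _ sU(1,5)] exactD(1)[OF ex[of i]] by auto
  obtain k1 where k1: "homotopy y ?U k1"
    using ex_homotopy[OF linU(2) sU(4) _ _ sU(1,5)] exactD(2)[OF ex[of i]] by auto
  obtain h k where hk: "homotopy x V h" "homotopy y V k" "\<forall>u\<in>?U. h u = h1 u \<and> k u = k1 u"
      "\<forall>j\<le>i. h ` level j \<subseteq> level j \<and> k ` level j \<subseteq> level j"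
      "\<forall>j<i. \<forall>u\<in>level j. h u - k u \<in> level (Suc j)"
    using extend_homotopies_level[OF ex h1 k1] by auto
  have hk1: "\<And>j. j \<le> i \<Longrightarrow> h ` level j \<subseteq> level j" "\<And>j. j \<le> i \<Longrightarrow> k ` level j \<subseteq> level j"
      "\<And>j u. j < i \<Longrightarrow> u \<in> level j \<Longrightarrow> h u - k u \<in> level (Suc j)"
    using hk(4,5) by blast+
  note hD = homotopyD[OF hk(1)] and kD = homotopyD[OF hk(2)]
  note h1D = homotopyD[OF h1] and k1D = homotopyD[OF k1]
  obtain C where C: "direct_sum V ?U C" using ex_complement[OF V sU(1,2)] by blast
  obtain p where p: "lin V p" "\<forall>v\<in>V. p v \<in> ?U \<and> v - p v \<in> C" "\<forall>u\<in>?U. p u = u"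
    using ex_projection[OF C] by blast
  note pU = bspec[OF p(2), THEN conjunct1] and pid = bspec[OF p(3)]
  obtain g where g: "lin ?U g" "\<forall>u\<in>?U. g u \<in> V \<and> (D ^^ i) (g u) = u"
    using ex_linear_section[OF lin_powD V, of i] unfolding level_def by blast
  note gV = bspec[OF g(2), THEN conjunct1] and gD = bspec[OF g(2), THEN conjunct2]
  \<comment> \<open>\<open>Z\<close> after the section \<open>g\<close> of D^i is \<open>n\<close>,
    and \<open>p\<close> projects onto \<open>level i\<close>: this is the trace of n (h - k) on
    \<open>level i\<close>.\<close>
  define T where "T Z = tr (\<lambda>v. Z (g (h (p v) - k (p v))))" for Z
  have hkU: "h u \<in> ?U" "k u \<in> ?U" "h u - k u \<in> ?U" if "u \<in> ?U" for u
    using hk1(1,2)[of i] that subspace_diff[OF sU(1)] by auto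
  have "\<exists>Z\<in>socle_maps i. T Z \<noteq> 0"
  proof -
    \<comment> \<open>Witness of rank one: n u = \<phi>(u) w with \<phi> zero on the radical. The
      trace of n (h - k) is then \<phi>(h w - k w), normalised to 1.\<close>
    obtain w where w: "w \<in> ?U" "x w = 0" "y w = 0" "h1 w - k1 w \<notin> rad ?U"
      using exact_next_level[OF ex[of i] h1 k1] nex by blast
    have dU: "h1 w - k1 w \<in> ?U" using subspace_diff[OF sU(1) h1D(2)[OF w(1)] k1D(2)[OF w(1)]] .
    obtain \<phi> where \<phi>: "funl ?U \<phi>" "\<forall>a\<in>rad ?U. \<phi> a = 0" "\<phi> (h1 w - k1 w) = 1"
      using ex_functional[OF sU(1,5) rad_props(1,2)[OF stable_level] dU w(4)] by blast
    define Z where "Z v = scale (\<phi> ((D ^^ i) v)) w" for v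
    have \<phi>0: "\<phi> 0 = 0" using \<phi>(2) subspace_0[OF rad_props(1)[OF stable_level]] by blast
    have "(D ^^ i) (x v) \<in> rad ?U" "(D ^^ i) (y v) \<in> rad ?U" if "v \<in> V" for v
      unfolding rad_level using rad_props(5,6)[OF stable_V that] by auto
    then have "Z (x v) = 0" "Z (y v) = 0" if "v \<in> V" for v using \<phi>(2) that by (auto simp: Z_def)
    moreover have "lin V Z"
    proof (rule linI)
      show "Z (u + v) = Z u + Z v" if "u \<in> V" "v \<in> V" for u v
        unfolding Z_def using \<phi>(1) levelI that lin_add[OF lin_powD that, of i]
        by (simp add: funl_def scale_left_distrib)
      show "Z (scale c u) = scale c (Z u)" if "u \<in> V" for c u
        unfolding Z_def using \<phi>(1) levelI that lin_scale[OF lin_powD that, of i]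
        by (simp add: funl_def)
    qed
    ultimately have "Z \<in> socle_maps i"
      unfolding socle_maps_def Z_def using w(1-3) \<phi>0 subspace_scale[OF sU(1)] by simp
    moreover have "T Z = 1"
    proof -
      define \<chi> where "\<chi> v = \<phi> (h (p v) - k (p v))" for v
      have add: "h (p (u + v)) - k (p (u + v)) = (h (p u) - k (p u)) + (h (p v) - k (p v))"
        if "u \<in> V" "v \<in> V" for u v
        using lin_add[OF p(1) that] lin_add[OF hD(1), of "p u" "p v"] lin_add[OF kD(1), of "p u" "p v"]
          pU that by simp
      have scl: "h (p (scale c u)) - k (p (scale c u)) = scale c (h (p u) - k (p u))" if "u \<in> V" for c u
        using lin_scale[OF p(1) that] lin_scale[OF hD(1), of "p u"] lin_scale[OF kD(1), of "p u"] pU that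
        by (simp add: scale_right_diff_distrib)
      have "funl V \<chi>"
        unfolding funl_def \<chi>_def using \<phi>(1) add scl hkU pU by (simp add: funl_def)
      moreover have "T Z = tr (\<lambda>v. scale (\<chi> v) w)"
        unfolding T_def by (rule tr_cong) (use gD hkU pU in \<open>simp add: Z_def \<chi>_def\<close>)
      moreover have "\<chi> w = 1" unfolding \<chi>_def using pid[OF w(1)] hk(3) w(1) \<phi>(3) by simp
      ultimately show ?thesis using tr_rank1[of \<chi> w] w(1) by simp
    qed
    ultimately show ?thesis by (metis zero_neq_one)
  qed
  moreover have "T (\<lambda>v. Z v + scale c (Z' v)) = T Z + c * T Z'" for Z Z' c
    unfolding T_def tr_plus tr_scale ..
  moreover have "\<exists>s s'. inverse_pair s s' \<and> (\<forall>v\<in>V. s ((D ^^ i) v) = (D ^^ i) v + Z v)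
      \<and> dlog x h s s' - dlog y k s s' = T Z" if Z: "Z \<in> socle_maps i" for Z
  proof -
    have lZ: "lin V Z" and Z1: "\<And>v. v \<in> V \<Longrightarrow> Z v \<in> ?U" "\<And>v. v \<in> V \<Longrightarrow> x (Z v) = 0"
        "\<And>v. v \<in> V \<Longrightarrow> y (Z v) = 0" "\<And>v. v \<in> V \<Longrightarrow> Z (x v) = 0" "\<And>v. v \<in> V \<Longrightarrow> Z (y v) = 0"
        "\<And>v. v \<in> V \<Longrightarrow> (D ^^ i) v = 0 \<Longrightarrow> Z v = 0"
      using Z by (auto simp: socle_maps_def)
    define n where "n u = Z (g u)" for u
    have Zeq: "Z v = Z v'" if "v \<in> V" "v' \<in> V" "(D ^^ i) v = (D ^^ i) v'" for v v'
    proof -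
      have "Z (v - v') = 0" by (rule Z1(6)) (use that lin_diff[OF lin_powD V(1)] in auto)
      then show ?thesis using lin_diff[OF lZ V(1) that(1,2)] by simp
    qed
    have nD: "n ((D ^^ i) v) = Z v" if "v \<in> V" for v
      unfolding n_def by (rule Zeq) (use that gV gD levelI in auto)
    have ln: "lin ?U n" unfolding n_def by (rule lin_compose[OF g(1) _ lZ]) (use gV in auto)
    have nU: "n u \<in> ?U" "x (n u) = 0" "y (n u) = 0" if "u \<in> ?U" for u
      using Z1(1-3) gV that by (auto simp: n_def)
    have n_rad: "n r = 0" if r: "r \<in> rad ?U" for r
    proof -
      obtain r' where r': "r' \<in> rad V" "r = (D ^^ i) r'" using r unfolding rad_level by blast
      obtain u v where uv: "u \<in> V" "v \<in> V" "r' = x u + y v" using r'(1) unfolding rad_def by blast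
      then have "Z r' = 0" using lin_add[OF lZ, of "x u" "y v"] Z1(4,5) by simp
      then show ?thesis using nD[of r'] uv r'(2) by simp
    qed
    have xy_rad: "x u \<in> rad ?U" "y u \<in> rad ?U" if "u \<in> ?U" for u
      using rad_props(5,6)[OF stable_level that] .
    \<comment> \<open>Values of \<open>n\<close> are killed by \<open>x\<close>, so exactness puts
      them into the image of \<open>x\<close>, hence into the radical, where \<open>n\<close>
      vanishes. Therefore n n = 0 and 1 + n is injective.\<close>
    have n_img: "n u \<in> rad ?U" if u: "u \<in> ?U" for u
    proof -
      obtain u' where "u' \<in> ?U" "n u = x u'" using exactD(1)[OF ex[of i] nU(1)[OF u]] nU(2)[OF u] by blast
      then show ?thesis using xy_rad by simp
    qed
    have nn: "n (n u) = 0" if "u \<in> ?U" for u using n_rad[OF n_img[OF that]] .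
    let ?s1 = "\<lambda>u. u + n u"
    have ls1: "lin ?U ?s1" by (rule lin_plus[OF lin_id ln])
    have "commuting ?U ?s1"
      unfolding commuting_def using ls1 nU n_rad xy_rad subspace_add[OF sU(1)] by auto
    moreover have "?s1 u - u \<in> rad ?U" if "u \<in> ?U" for u using n_img[OF that] by simp
    moreover have "inj_on ?s1 ?U"
    proof (rule lin_inj[OF ls1 sU(1)])
      fix u assume u: "u \<in> ?U" "u + n u = 0"
      then have "u = - n u" by (simp add: eq_neg_iff_add_eq_0)
      then have "n u = - n (n u)" using lin_minus[OF ln sU(1) nU(1)[OF u(1)]] by simp
      then show "u = 0" using nn[OF u(1)] u(2) by simp
    qed
    ultimately obtain s where s: "commuting V s" "\<forall>u\<in>?U. s u = u + n u" "inj_on s V"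
      using extend_automorphism_level[OF ex, of i ?s1] by auto
    note su = bspec[OF s(2)]
    obtain s' where s': "inverse_pair s s'" using ex_inverse[OF s(1,3)] by blast
    have c': "commuting V s'" "\<And>v. v \<in> V \<Longrightarrow> s' (s v) = v" using s' by (auto simp: inverse_pair_def)
    have main: "s' (x (h (s (h u)))) - s' (y (k (s (k u)))) = n (h u - k u)" if u: "u \<in> ?U" for u
    proof -
      note hu = hkU[OF u]
      note [simp] = UV[OF u] UV[OF hu(1)] UV[OF hu(2)] UV[OF nU(1)[OF hu(1)]] UV[OF nU(1)[OF hu(2)]]
      have fx: "s' (n w) = n w" if w: "w \<in> ?U" for w
      proof -
        have "s (n w) = n w" using su[OF nU(1)[OF w]] nn[OF w] by simp
        then show ?thesis using c'(2)[of "n w"] nU(1)[OF w] by simp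
      qed
      have "h (s (h u)) = h (n (h u))"
        unfolding su[OF hu(1)] using lin_add[OF hD(1), of "h u" "n (h u)"] hD(3)[of u] by simp
      moreover have "x (h (n (h u))) = n (h u)"
        using hD(4)[of "n (h u)"] nU(2)[OF hu(1)] lin_0[OF hD(1) V(1)] by simp
      moreover have "k (s (k u)) = k (n (k u))"
        unfolding su[OF hu(2)] using lin_add[OF kD(1), of "k u" "n (k u)"] kD(3)[of u] by simp
      moreover have "y (k (n (k u))) = n (k u)"
        using kD(4)[of "n (k u)"] nU(3)[OF hu(2)] lin_0[OF kD(1) V(1)] by simp
      ultimately show ?thesis using fx hu lin_diff[OF ln sU(1) hu(1,2)] by simp
    qed
    have "dlog x h s s' - dlog y k s s' = tr (\<lambda>v. s' (x (h (s (h (p v))))) - s' (y (k (s (k (p v))))))"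
      by (rule dlog_diff_level[OF hk(1,2) hk1 s' p(1)]) (use pU pid in auto)
    also have "\<dots> = T Z" unfolding T_def by (rule tr_cong) (use main pU in \<open>simp add: n_def\<close>)
    finally have "dlog x h s s' - dlog y k s s' = T Z" .
    moreover have "s ((D ^^ i) v) = (D ^^ i) v + Z v" if "v \<in> V" for v
      using su[OF levelI[OF that]] nD[OF that] by simp
    ultimately show ?thesis using s' by blast
  qed
  moreover have "dlog x h s s' - dlog y k s s' = 0"
    if "inverse_pair s s'" "\<forall>v\<in>V. s ((D ^^ i) v) = scale c ((D ^^ i) v)" for c s s'
    by (rule dlog_diff_scalar[OF hk(1,2) hk1 that(1)]) (use that(2) in auto)
  ultimately show ?thesis
    by (rule_tac exI[of _ h], rule_tac exI[of _ k], intro conjI hk(1,2), rule_tac exI[of _ T]) blast+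
qed

text \<open>The operator m = h x + x h0 commutes with \<open>x\<close>, has inverse h0 x + x h and
  conjugates \<open>h0\<close> into \<open>h\<close>. A change of the homotopy thus amounts to
  conjugating the automorphism inside the centraliser of \<open>x\<close>, which a homomorphism to
  an abelian group does not notice.\<close>

lemma dlog_homotopy_independent:
  assumes h: "homotopy x V h" and h0: "homotopy x V h0"
  shows "\<exists>m m'. lin V m \<and> lin V m' \<and> (\<forall>v\<in>V. m v \<in> V \<and> m' v \<in> V \<and> m (m' v) = v \<and> m' (m v) = v
      \<and> m (x v) = x (m v) \<and> m' (x v) = x (m' v))
    \<and> (\<forall>s s'. lin V s \<and> lin V s' \<and> s ` V \<subseteq> V \<and> s' ` V \<subseteq> V \<longrightarrow>
      dlog x h s s' = dlog x h0 (\<lambda>v. m' (s (m v))) (\<lambda>v. m' (s' (m v))))"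
proof -
  note hD = homotopyD[OF h] and h0D = homotopyD[OF h0]
  note [simp] = hD(2) h0D(2) hD(3) h0D(3)
  note [simp] = lin_add[OF hD(1)] lin_add[OF h0D(1)] lin_diff[OF hD(1) V(1)] lin_diff[OF h0D(1) V(1)]
    lin_0[OF hD(1) V(1)] lin_0[OF h0D(1) V(1)]
  have xh: "x (h v) = v - h (x v)" "x (h0 v) = v - h0 (x v)" if "v \<in> V" for v
    using hD(4)[OF that] h0D(4)[OF that] by (simp_all add: eq_diff_eq)
  \<comment> \<open>The first term is h x, because x h0 x = x; \<open>m_eq\<close> records the short
    form.\<close>
  define m where "m v = h (x (h0 (x v))) + x (h0 v)" for v
  define m' where "m' v = h0 (x (h (x v))) + x (h v)" for v
  have xhx: "x (h (x v)) = x v" "x (h0 (x v)) = x v" if "v \<in> V" for v using xh[of "x v"] that by auto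
  have hxh: "h (x (h v)) = h v" "h0 (x (h0 v)) = h0 v" if "v \<in> V" for v using xh[of v] that by auto
  have m_eq: "m v = h (x v) + x (h0 v)" and m'_eq: "m' v = h0 (x v) + x (h v)" if "v \<in> V" for v
    unfolding m_def m'_def using xhx that by auto
  have lm: "lin V m"
  proof -
    have 1: "lin V (\<lambda>v. h (x v))" by (rule lin_compose[OF lin_x _ hD(1)]) auto
    have 2: "lin V (\<lambda>v. x (h0 v))" by (rule lin_compose[OF h0D(1) _ lin_x]) auto
    from lin_plus[OF 1 2] show ?thesis using m_eq V(1) by (simp add: lin_def)
  qed
  have lm': "lin V m'"
  proof -
    have 1: "lin V (\<lambda>v. h0 (x v))" by (rule lin_compose[OF lin_x _ h0D(1)]) auto
    have 2: "lin V (\<lambda>v. x (h v))" by (rule lin_compose[OF hD(1) _ lin_x]) auto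
    from lin_plus[OF 1 2] show ?thesis using m'_eq V(1) by (simp add: lin_def)
  qed
  have mV: "m v \<in> V" "m' v \<in> V" if "v \<in> V" for v using m_eq m'_eq that by auto
  have mm': "m (m' v) = v" "m' (m v) = v" if v: "v \<in> V" for v
    using v hxh xhx hD(4)[OF v] h0D(4)[OF v] by (simp_all add: m_eq m'_eq add.commute)
  have mx: "m (x v) = x (m v)" "m' (x v) = x (m' v)" if v: "v \<in> V" for v
    using v xhx by (simp_all add: m_eq m'_eq)
  have mh: "h v = m (h0 (m' v))" if v: "v \<in> V" for v
    using v hxh xhx by (simp add: m_eq m'_eq)
  have key: "dlog x h s s' = dlog x h0 (\<lambda>v. m' (s (m v))) (\<lambda>v. m' (s' (m v)))"
    if s: "lin V s \<and> lin V s' \<and> s ` V \<subseteq> V \<and> s' ` V \<subseteq> V" for s s'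
  proof -
    have sV [simp]: "s v \<in> V" "s' v \<in> V" if "v \<in> V" for v using s that by auto
    have ls: "lin V s" "lin V s'" using s by auto
    note [simp] = mV
    let ?f = "\<lambda>v. s' (x (m (h0 (m' (s (m (h0 v)))))))"
    have lf: "lin V ?f"
    proof -
      have 1: "lin V (\<lambda>v. m (h0 v))" by (rule lin_compose[OF h0D(1) _ lm]) auto
      have 2: "lin V (\<lambda>v. s (m (h0 v)))" by (rule lin_compose[OF 1 _ ls(1)]) auto
      have 3: "lin V (\<lambda>v. m' (s (m (h0 v))))" by (rule lin_compose[OF 2 _ lm']) auto
      have 4: "lin V (\<lambda>v. h0 (m' (s (m (h0 v)))))" by (rule lin_compose[OF 3 _ h0D(1)]) auto
      have 5: "lin V (\<lambda>v. m (h0 (m' (s (m (h0 v))))))" by (rule lin_compose[OF 4 _ lm]) auto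
      have 6: "lin V (\<lambda>v. x (m (h0 (m' (s (m (h0 v)))))))" by (rule lin_compose[OF 5 _ lin_x]) auto
      show ?thesis by (rule lin_compose[OF 6 _ ls(2)]) auto
    qed
    have "dlog x h s s' = tr (\<lambda>v. ?f (m' v))"
      unfolding dlog_def by (rule tr_cong) (simp add: mh)
    also have "\<dots> = tr (\<lambda>v. m' (?f v))"
      by (rule tr_comm[OF lf lm']) auto
    also have "\<dots> = dlog x h0 (\<lambda>v. m' (s (m v))) (\<lambda>v. m' (s' (m v)))"
      unfolding dlog_def by (rule tr_cong) (simp add: mx)
    finally show ?thesis .
  qed
  show ?thesis
  proof (rule exI[of _ m], rule exI[of _ m'], intro conjI lm lm')
    show "\<forall>v\<in>V. m v \<in> V \<and> m' v \<in> V \<and> m (m' v) = v \<and> m' (m v) = v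
        \<and> m (x v) = x (m v) \<and> m' (x v) = x (m' v)" using mV mm' mx by simp
    show "\<forall>s s'. lin V s \<and> lin V s' \<and> s ` V \<subseteq> V \<and> s' ` V \<subseteq> V \<longrightarrow>
      dlog x h s s' = dlog x h0 (\<lambda>v. m' (s (m v))) (\<lambda>v. m' (s' (m v)))" using key by blast
  qed
qed

end

section \<open>Adjoint forms\<close>

context vs
begin

lemma lin_sum:
  assumes f: "lin U f" and U: "subspace U" and g: "\<And>a. a \<in> A \<Longrightarrow> g a \<in> U"
  shows "f (\<Sum>a\<in>A. g a) = (\<Sum>a\<in>A. f (g a))"
  using g
proof (induction A rule: infinite_finite_induct)
  case (insert a A)
  have "(\<Sum>a\<in>A. g a) \<in> U" using insert.prems by (intro subspace_sum[OF U]) auto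
  then show ?case using insert lin_add[OF f] by simp
qed (use lin_0[OF f U] in auto)

lemma funl_add: "funl U \<phi> \<Longrightarrow> u \<in> U \<Longrightarrow> v \<in> U \<Longrightarrow> \<phi> (u + v) = \<phi> u + \<phi> v"
  and funl_scale: "funl U \<phi> \<Longrightarrow> u \<in> U \<Longrightarrow> \<phi> (scale c u) = c * \<phi> u"
  by (auto simp: funl_def)

lemma funl_0: "funl U \<phi> \<Longrightarrow> subspace U \<Longrightarrow> \<phi> 0 = 0"
  using funl_scale[of U \<phi> 0 0] subspace_0 by simp

lemma funl_diff:
  assumes "funl U \<phi>" "subspace U" "u \<in> U" "v \<in> U" shows "\<phi> (u - v) = \<phi> u - \<phi> v"
proof -
  have "\<phi> (u + scale (-1) v) = \<phi> u + (-1) * \<phi> v"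
    using funl_add[OF assms(1,3) subspace_scale[OF assms(2,4), of "-1"]] funl_scale[OF assms(1,4), of "-1"] by simp
  then show ?thesis by simp
qed

lemma funl_sum:
  assumes f: "funl U f" and U: "subspace U" and g: "\<And>a. a \<in> A \<Longrightarrow> g a \<in> U"
  shows "f (\<Sum>a\<in>A. g a) = (\<Sum>a\<in>A. f (g a))"
  using g
proof (induction A rule: infinite_finite_induct)
  case (insert a A)
  have "(\<Sum>a\<in>A. g a) \<in> U" using insert.prems by (intro subspace_sum[OF U]) auto
  then show ?case using insert funl_add[OF f] by simp
qed (use funl_0[OF f U] in auto)

text \<open>Linearity is required in one argument only; symmetry gives the other
  (\<open>adjoint_form_right\<close>).\<close>

definition adjoint_form :: "'v set \<Rightarrow> ('v \<Rightarrow> 'v \<Rightarrow> 'k) \<Rightarrow> ('v \<Rightarrow> 'v) \<Rightarrow> ('v \<Rightarrow> 'v) \<Rightarrow> bool" where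
  "adjoint_form U \<beta> f g \<longleftrightarrow> (\<forall>v\<in>U. funl U (\<lambda>u. \<beta> u v)) \<and> (\<forall>u\<in>U. \<forall>v\<in>U. \<beta> u v = \<beta> v u)
    \<and> (\<forall>u\<in>U. (\<forall>v\<in>U. \<beta> u v = 0) \<longrightarrow> u = 0) \<and> (\<forall>u\<in>U. \<forall>v\<in>U. \<beta> (f u) v = \<beta> u (g v))"

lemma adjoint_formD:
  assumes "adjoint_form U \<beta> f g"
  shows "\<And>v. v \<in> U \<Longrightarrow> funl U (\<lambda>u. \<beta> u v)" "\<And>u v. u \<in> U \<Longrightarrow> v \<in> U \<Longrightarrow> \<beta> u v = \<beta> v u"
    "\<And>u. u \<in> U \<Longrightarrow> (\<And>v. v \<in> U \<Longrightarrow> \<beta> u v = 0) \<Longrightarrow> u = 0"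
    "\<And>u v. u \<in> U \<Longrightarrow> v \<in> U \<Longrightarrow> \<beta> (f u) v = \<beta> u (g v)"
  using assms by (auto simp: adjoint_form_def)

lemma adjoint_form_right:
  assumes "adjoint_form U \<beta> f g" "subspace U" "u \<in> U" shows "funl U (\<beta> u)"
  unfolding funl_def
proof (intro conjI ballI allI)
  note b = adjoint_formD[OF assms(1)]
  fix v w assume "v \<in> U" "w \<in> U"
  then show "\<beta> u (v + w) = \<beta> u v + \<beta> u w"
    using b(2)[OF assms(3)] funl_add[OF b(1)[OF assms(3)]] subspace_add[OF assms(2)] by simp
next
  note b = adjoint_formD[OF assms(1)]
  fix c v assume "v \<in> U"
  then show "\<beta> u (scale c v) = c * \<beta> u v"
    using b(2)[OF assms(3)] funl_scale[OF b(1)[OF assms(3)]] subspace_scale[OF assms(2)] by simp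
qed

text \<open>The orthogonal sum of the two forms. That \<open>f\<close> and \<open>g\<close> preserve
  both summands makes them commute with the projections.\<close>

lemma adjoint_form_direct_sum:
  assumes d: "direct_sum U A B" and f: "lin U f" "f ` A \<subseteq> A" "f ` B \<subseteq> B" and g: "lin U g" "g ` A \<subseteq> A" "g ` B \<subseteq> B"
    and a: "adjoint_form A \<alpha> f g" and b: "adjoint_form B \<beta> f g"
  shows "\<exists>\<gamma>. adjoint_form U \<gamma> f g"
proof -
  have sub: "subspace U" "subspace A" "subspace B" "A \<subseteq> U" "B \<subseteq> U" using d by (auto simp: direct_sum_def)
  obtain p where p: "lin U p" "\<forall>u\<in>U. p u \<in> A \<and> u - p u \<in> B" "\<forall>a\<in>A. p a = a" "\<forall>b\<in>B. p b = 0"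
    using ex_projection[OF d] by blast
  note pA = bspec[OF p(2), THEN conjunct1] and pB = bspec[OF p(2), THEN conjunct2]
  note aD = adjoint_formD[OF a] and bD = adjoint_formD[OF b]
  let ?q = "\<lambda>u. u - p u"
  have lq: "lin U ?q" by (rule lin_minus_fun[OF lin_id p(1)])
  have pc: "p (h u) = h (p u)" "?q (h u) = h (?q u)"
    if h: "lin U h" "h ` A \<subseteq> A" "h ` B \<subseteq> B" and u: "u \<in> U" for h u
  proof -
    have "h u = h (p u) + h (?q u)"
      using lin_add[OF h(1) subsetD[OF sub(4) pA[OF u]] subsetD[OF sub(5) pB[OF u]]] by simp
    moreover have hA: "h (p u) \<in> A" "h (?q u) \<in> B" using h pA[OF u] pB[OF u] by auto
    ultimately have "p (h u) = p (h (p u)) + p (h (?q u))"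
      using lin_add[OF p(1) subsetD[OF sub(4) hA(1)] subsetD[OF sub(5) hA(2)]] by simp
    then show 1: "p (h u) = h (p u)" using p(3,4) hA by simp
    show "?q (h u) = h (?q u)" using \<open>h u = h (p u) + h (?q u)\<close> 1 by (simp add: algebra_simps)
  qed
  define \<gamma> where "\<gamma> u v = \<alpha> (p u) (p v) + \<beta> (?q u) (?q v)" for u v
  have "adjoint_form U \<gamma> f g"
    unfolding adjoint_form_def
  proof (intro conjI ballI impI)
    fix v assume v: "v \<in> U"
    show "funl U (\<lambda>u. \<gamma> u v)"
      unfolding funl_def
    proof (intro conjI ballI allI)
      fix u w assume u: "u \<in> U" "w \<in> U"
      show "\<gamma> (u + w) v = \<gamma> u v + \<gamma> w v"
        unfolding \<gamma>_def
        by (simp only: lin_add[OF lq u]) (simp only: lin_add[OF p(1) u] add_ac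
          funl_add[OF aD(1)[OF pA[OF v]] pA[OF u(1)] pA[OF u(2)]]
          funl_add[OF bD(1)[OF pB[OF v]] pB[OF u(1)] pB[OF u(2)]])
    next
      fix c u assume u: "u \<in> U"
      show "\<gamma> (scale c u) v = c * \<gamma> u v"
        unfolding \<gamma>_def
        using funl_scale[OF aD(1)[OF pA[OF v]] pA[OF u]] lin_scale[OF p(1) u]
          funl_scale[OF bD(1)[OF pB[OF v]] pB[OF u], of c] lin_scale[OF lq u, of c]
        by (simp add: algebra_simps)
    qed
  next
    fix u v assume "u \<in> U" "v \<in> U"
    then show "\<gamma> u v = \<gamma> v u" unfolding \<gamma>_def using aD(2) bD(2) pA pB by simp
  next
    fix u assume u: "u \<in> U" "\<forall>v\<in>U. \<gamma> u v = 0"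
    have a0: "\<alpha> (p u) 0 = 0" using funl_0[OF adjoint_form_right[OF a sub(2) pA[OF u(1)]] sub(2)] .
    have b0: "\<beta> (?q u) 0 = 0" using funl_0[OF adjoint_form_right[OF b sub(3) pB[OF u(1)]] sub(3)] .
    have "p u = 0"
    proof (rule aD(3)[OF pA[OF u(1)]])
      fix v assume v: "v \<in> A"
      then have "\<gamma> u v = 0" using u(2) sub(4) by blast
      then show "\<alpha> (p u) v = 0" unfolding \<gamma>_def using p(3) v b0 by simp
    qed
    moreover have "?q u = 0"
    proof (rule bD(3)[OF pB[OF u(1)]])
      fix v assume v: "v \<in> B"
      then have "\<gamma> u v = 0" using u(2) sub(5) by blast
      then show "\<beta> (?q u) v = 0" unfolding \<gamma>_def using p(4) v a0 by simp
    qed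
    ultimately show "u = 0" by simp
  next
    fix u v assume uv: "u \<in> U" "v \<in> U"
    show "\<gamma> (f u) v = \<gamma> u (g v)"
      unfolding \<gamma>_def pc(2)[OF f uv(1)] pc(2)[OF g uv(2)]
      by (simp only: pc(1)[OF f uv(1)] pc(1)[OF g uv(2)] aD(4)[OF pA[OF uv(1)] pA[OF uv(2)]]
          bD(4)[OF pB[OF uv(1)] pB[OF uv(2)]])
  qed
  then show ?thesis by blast
qed

text \<open>One step of biorthogonalisation: \<open>s'\<close> is \<open>s\<close> corrected so as
  to pair to 0 with every \<open>d t\<close>, and nonzero by independence; \<open>c'\<close> is
  \<open>c\<close> corrected so as to be orthogonal to \<open>S\<close>. Both corrections give the
  same number, b s c' = b s' c, which is therefore nonzero and can be normalised.\<close>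

lemma ex_dual_family:
  assumes C: "subspace C" and b: "\<And>v. v \<in> C \<Longrightarrow> funl C (\<lambda>u. b u v)" "\<And>u. u \<in> C \<Longrightarrow> funl C (b u)"
    and nd: "\<And>u. u \<in> C \<Longrightarrow> (\<And>v. v \<in> C \<Longrightarrow> b u v = 0) \<Longrightarrow> u = 0"
    and S: "finite S" "independent S" "S \<subseteq> C"
  shows "\<exists>d. \<forall>s\<in>S. d s \<in> C \<and> (\<forall>t\<in>S. b t (d s) = (if t = s then 1 else 0))"
  using S
proof (induction S rule: finite_induct)
  case empty
  then show ?case by simp
next
  case (insert s S)
  have ind: "independent S" using insert.prems(1) by (rule independent_mono) auto
  have sC: "s \<in> C" and SC: "S \<subseteq> C" using insert.prems by auto
  obtain d where d: "\<forall>t\<in>S. d t \<in> C \<and> (\<forall>r\<in>S. b r (d t) = (if r = t then 1 else 0))"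
    using insert.IH[OF ind SC] by blast
  note dC = bspec[OF d, THEN conjunct1]
  define s' where "s' = s - (\<Sum>t\<in>S. scale (b s (d t)) t)"
  have sumC: "(\<Sum>t\<in>S. scale (b s (d t)) t) \<in> C"
    using SC by (intro subspace_sum[OF C] subspace_scale[OF C]) auto
  have s'C: "s' \<in> C" unfolding s'_def by (rule subspace_diff[OF C sC sumC])
  have "s' \<noteq> 0"
  proof
    assume "s' = 0"
    then have "s = (\<Sum>t\<in>S. scale (b s (d t)) t)" unfolding s'_def by simp
    moreover have "(\<Sum>t\<in>S. scale (b s (d t)) t) \<in> span S" by (intro span_sum span_scale span_base)
    ultimately have "s \<in> span S" by simp
    then show False using insert.prems(1) insert.hyps(2) by (simp add: independent_insert)
  qed
  then obtain c where c: "c \<in> C" "b s' c \<noteq> 0" using nd[OF s'C] by blast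
  define c' where "c' = c - (\<Sum>t\<in>S. scale (b t c) (d t))"
  have mC: "scale (b t c) (d t) \<in> C" if "t \<in> S" for t using dC[OF that] subspace_scale[OF C] by simp
  have sumC2: "(\<Sum>t\<in>S. scale (b t c) (d t)) \<in> C" by (intro subspace_sum[OF C] mC)
  have c'C: "c' \<in> C" unfolding c'_def by (rule subspace_diff[OF C c(1) sumC2])
  have bc': "b r c' = b r c - (\<Sum>t\<in>S. b t c * b r (d t))" if r: "r \<in> C" for r
  proof -
    have "b r (\<Sum>t\<in>S. scale (b t c) (d t)) = (\<Sum>t\<in>S. b r (scale (b t c) (d t)))"
      by (rule funl_sum[OF b(2)[OF r] C mC])
    then show ?thesis unfolding c'_def funl_diff[OF b(2)[OF r] C c(1) sumC2]
      using funl_scale[OF b(2)[OF r] dC] by simp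
  qed
  have z: "b r c' = 0" if r: "r \<in> S" for r
  proof -
    have "(\<Sum>t\<in>S. b t c * b r (d t)) = (\<Sum>t\<in>S. if t = r then b r c else 0)"
      by (rule sum.cong) (use d r in auto)
    also have "\<dots> = b r c" using insert.hyps(1) r by simp
    finally show ?thesis using bc'[of r] r SC by auto
  qed
  have nz: "b s c' \<noteq> 0"
  proof -
    have sS: "scale (b s (d t)) t \<in> C" if "t \<in> S" for t using SC that subspace_scale[OF C] by blast
    have "b (\<Sum>t\<in>S. scale (b s (d t)) t) c = (\<Sum>t\<in>S. b (scale (b s (d t)) t) c)"
      by (rule funl_sum[OF b(1)[OF c(1)] C sS])
    then have "b s' c = b s c - (\<Sum>t\<in>S. b s (d t) * b t c)"
      unfolding s'_def funl_diff[OF b(1)[OF c(1)] C sC sumC]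
      using funl_scale[OF b(1)[OF c(1)] subsetD[OF SC]] by simp
    then have "b s' c = b s c'" unfolding bc'[OF sC] by (simp add: mult.commute)
    then show ?thesis using c(2) by simp
  qed
  define e where "e = scale (inverse (b s c')) c'"
  have eC: "e \<in> C" unfolding e_def by (rule subspace_scale[OF C c'C])
  have be: "b r e = inverse (b s c') * b r c'" if "r \<in> C" for r
    unfolding e_def by (rule funl_scale[OF b(2)[OF that] c'C])
  have es: "b s e = 1" "\<And>r. r \<in> S \<Longrightarrow> b r e = 0" using be[OF sC] nz be z SC by auto
  define d' where "d' t = (if t = s then e else d t - scale (b s (d t)) e)" for t
  have "d' r \<in> C \<and> (\<forall>t\<in>insert s S. b t (d' r) = (if t = r then 1 else 0))" if r: "r \<in> insert s S" for r
  proof (cases "r = s")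
    case True
    then show ?thesis using eC es insert.hyps(2) by (auto simp: d'_def)
  next
    case False
    then have rS: "r \<in> S" using r by simp
    have m: "scale (b s (d r)) e \<in> C" by (rule subspace_scale[OF C eC])
    have "b t (d' r) = b t (d r) - b s (d r) * b t e" if "t \<in> C" for t
      unfolding d'_def using False funl_diff[OF b(2)[OF that] C dC[OF rS] m] funl_scale[OF b(2)[OF that] eC] by simp
    then show ?thesis
      using False rS es sC SC d insert.hyps(2) subspace_diff[OF C dC[OF rS] m] by (auto simp: d'_def)
  qed
  then show ?case by blast
qed

text \<open>The element \<open>c\<close> is the component of \<open>v\<close> in \<open>C\<close>
  for the orthogonal decomposition: \<open>v - c\<close> pairs to 0 with \<open>C\<close>. It is
  assembled from a dual basis.\<close>

lemma ex_orthogonal_approximation: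
  assumes C: "subspace C" "finite C" "C \<subseteq> U" and b: "\<And>v. v \<in> U \<Longrightarrow> funl C (\<lambda>u. b u v)" "\<And>u. u \<in> C \<Longrightarrow> funl C (b u)"
    and nd: "\<And>u. u \<in> C \<Longrightarrow> (\<And>v. v \<in> C \<Longrightarrow> b u v = 0) \<Longrightarrow> u = 0" and v: "v \<in> U"
  shows "\<exists>c\<in>C. \<forall>u\<in>C. b u v = b u c"
proof -
  obtain S where S: "S \<subseteq> C" "independent S" "C \<subseteq> span S" using maximal_independent_subset[of C] by blast
  have fS: "finite S" using S(1) C(2) finite_subset by blast
  have bC: "funl C (\<lambda>u. b u w)" if "w \<in> C" for w using b(1) C(3) that by blast
  obtain d where d: "\<forall>s\<in>S. d s \<in> C \<and> (\<forall>t\<in>S. b t (d s) = (if t = s then 1 else 0))"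
    using ex_dual_family[OF C(1) bC b(2) nd fS S(2,1)] by blast
  let ?c = "\<Sum>s\<in>S. scale (b s v) (d s)"
  have m: "scale (b s v) (d s) \<in> C" if "s \<in> S" for s using d that subspace_scale[OF C(1)] by blast
  have cC: "?c \<in> C" by (intro subspace_sum[OF C(1)] m)
  have eq: "b t v = b t ?c" if t: "t \<in> S" for t
  proof -
    have tC: "t \<in> C" using t S(1) by blast
    have "b t ?c = (\<Sum>s\<in>S. b t (scale (b s v) (d s)))" by (rule funl_sum[OF b(2)[OF tC] C(1) m])
    also have "\<dots> = (\<Sum>s\<in>S. b s v * b t (d s))"
      using funl_scale[OF b(2)[OF tC]] d by (intro sum.cong) auto
    also have "\<dots> = (\<Sum>s\<in>S. if s = t then b t v else 0)" by (rule sum.cong) (use d t in auto)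
    also have "\<dots> = b t v" using fS t by simp
    finally show ?thesis by simp
  qed
  have sp: "span S \<subseteq> C" by (rule span_minimal[OF S(1) C(1)])
  have "u \<in> C \<and> b u v = b u ?c" if "u \<in> span S" for u
    using that
  proof (induction rule: span_induct_alt)
    case base
    then show ?case using funl_0[OF b(1)[OF v] C(1)] funl_0[OF bC[OF cC] C(1)] subspace_0[OF C(1)] by simp
  next
    case (step a t u)
    have tC: "t \<in> C" "u \<in> C" "scale a t \<in> C" "b u v = b u ?c" using step S(1) subspace_scale[OF C(1)] by auto
    have "b (scale a t + u) w = a * b t w + b u w" if "funl C (\<lambda>u. b u w)" for w
      using funl_add[OF that tC(3,2)] funl_scale[OF that tC(1), of a] by simp
    from this[OF b(1)[OF v]] this[OF bC[OF cC]] show ?case using eq[OF step(1)] tC(4) subspace_add[OF C(1) tC(3,2)] by simp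
  qed
  then show ?thesis using cC S(3) by blast
qed

text \<open>Fitting's lemma; the chain of images becomes stationary because \<open>U\<close> is
  finite. Positivity of \<open>k\<close> guarantees that the kernel of \<open>S\<close> itself lies
  in the first summand, which is why the chain is inspected from index 1 on.\<close>

lemma ex_fitting:
  assumes U: "subspace U" "finite U" and S: "lin U S" "S ` U \<subseteq> U"
  shows "\<exists>k>0. direct_sum U {u \<in> U. (S ^^ k) u = 0} ((S ^^ k) ` U) \<and> S ` (S ^^ k) ` U = (S ^^ k) ` U"
proof -
  let ?L = "\<lambda>k. (S ^^ k) ` U"
  have SU: "(S ^^ k) u \<in> U" if "u \<in> U" for k u using that S(2) by (induction k) auto
  have lS: "lin U (S ^^ k)" for k
  proof (induction k)
    case (Suc k)
    have "lin U (\<lambda>u. S ((S ^^ k) u))" by (rule lin_compose[OF Suc _ S(1)]) (use SU in auto)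
    then show ?case by (simp add: o_def)
  qed (simp add: lin_def)
  have dec: "?L (Suc k) \<subseteq> ?L k" for k
  proof
    fix z assume "z \<in> ?L (Suc k)"
    then obtain u where "u \<in> U" "z = (S ^^ k) (S u)" by (auto simp: funpow_Suc_right simp del: funpow.simps)
    then show "z \<in> ?L k" using S(2) by auto
  qed
  have "\<exists>k>0. ?L (Suc k) = ?L k"
  proof (rule ccontr)
    assume neg: "\<not> ?thesis"
    have psub: "?L (Suc (Suc k)) \<subset> ?L (Suc k)" for k using neg dec[of "Suc k"] by blast
    have "card (?L (Suc k)) + k \<le> card U" for k
    proof (induction k)
      case 0
      show ?case using card_mono[OF U(2), of "?L (Suc 0)"] S(2) by simp
    next
      case (Suc k)
      have "finite (?L (Suc k))" using U(2) by simp
      then have "card (?L (Suc (Suc k))) < card (?L (Suc k))" by (rule psubset_card_mono[OF _ psub])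
      then show ?case using Suc by linarith
    qed
    from this[of "Suc (card U)"] show False by simp
  qed
  then obtain k where k: "k > 0" "?L (Suc k) = ?L k" by blast
  have SL: "S ` ?L k = ?L k" using k(2) by (simp add: image_comp)
  have SkL: "(S ^^ j) ` ?L k = ?L k" for j
  proof (induction j)
    case (Suc j)
    have "(S ^^ Suc j) ` ?L k = S ` (S ^^ j) ` ?L k" by (simp add: image_comp)
    then show ?case using Suc SL by simp
  qed simp
  have LU: "?L k \<subseteq> U" using SU by blast
  have sL: "subspace (?L k)" by (rule subspace_linear_image[OF lS U(1)])
  have inj: "inj_on (S ^^ k) (?L k)"
    by (rule eq_card_imp_inj_on) (use U(2) SkL in auto)
  have k0: "(S ^^ k) 0 = 0" by (rule lin_0[OF lS U(1)])
  have "direct_sum U {u \<in> U. (S ^^ k) u = 0} (?L k)"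
    unfolding direct_sum_def
  proof (intro conjI ballI)
    show "{u \<in> U. (S ^^ k) u = 0} \<inter> ?L k = {0}"
    proof
      show "{u \<in> U. (S ^^ k) u = 0} \<inter> ?L k \<subseteq> {0}"
        using inj_onD[OF inj, of _ 0] k0 subspace_0[OF sL] by auto
      show "{0} \<subseteq> {u \<in> U. (S ^^ k) u = 0} \<inter> ?L k" using k0 subspace_0[OF sL] subspace_0[OF U(1)] by auto
    qed
    fix u assume u: "u \<in> U"
    then have "(S ^^ k) u \<in> (S ^^ k) ` ?L k" using SkL[of k] by blast
    then obtain w where w: "w \<in> ?L k" "(S ^^ k) u = (S ^^ k) w" by blast
    have wU: "w \<in> U" using w(1) LU by blast
    have "u - w \<in> {u \<in> U. (S ^^ k) u = 0}"
      using lin_diff[OF lS U(1) u wU] w(2) subspace_diff[OF U(1) u wU] by simp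
    moreover have "u = (u - w) + w" by simp
    ultimately show "\<exists>a\<in>{u \<in> U. (S ^^ k) u = 0}. \<exists>b\<in>?L k. u = a + b" using w(1) by blast
  qed (use U sL LU subspace_linear_kernel[OF lS U(1)] in auto)
  then show ?thesis using k(1) SL by blast
qed

end

section \<open>Polynomials in one operator and forms that make it self-adjoint\<close>

context vs
begin

text \<open>The operator p(R) in Horner form, so that inductions over polynomials apply to it
  directly.\<close>

definition pact :: "('v \<Rightarrow> 'v) \<Rightarrow> 'k poly \<Rightarrow> 'v \<Rightarrow> 'v" where
  "pact R p = fold_coeffs (\<lambda>a f u. scale a u + R (f u)) p (\<lambda>_. 0)"

lemma pact_0 [simp]: "pact R 0 u = 0"
  by (simp add: pact_def)

lemma pact_pCons:
  assumes "R 0 = 0" shows "pact R (pCons a p) u = scale a u + R (pact R p u)"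
proof (cases "a = 0 \<and> p = 0")
  case False
  then show ?thesis unfolding pact_def
    by (cases "a = 0") (auto simp: fold_coeffs_pCons_not_0_0_eq fold_coeffs_pCons_coeff_not_0_eq)
qed (use assms in simp)

context
  fixes U R assumes U: "subspace U" and R: "lin U R" "R ` U \<subseteq> U"
begin

lemma pact_R_0: "R 0 = 0" using lin_0[OF R(1) U] .

lemma R_U: "u \<in> U \<Longrightarrow> R u \<in> U" using R(2) by blast

lemma pact_U: "u \<in> U \<Longrightarrow> pact R p u \<in> U"
  by (induction p) (simp_all add: pact_pCons[of R, OF pact_R_0] subspace_add[OF U] subspace_scale[OF U] subspace_0[OF U] R_U)

lemma lin_pact: "lin U (pact R p)"
proof (induction p)
  case 0
  then show ?case by (simp add: lin_def)
next
  case (pCons a p)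
  have 1: "lin U (\<lambda>u. scale a u)" by (simp add: lin_def scale_right_distrib scale_left_commute)
  have 2: "lin U (\<lambda>u. R (pact R p u))" by (rule lin_compose[OF pCons(2) _ R(1)]) (use pact_U in auto)
  from lin_plus[OF 1 2] show ?case by (simp add: pact_pCons[of R, OF pact_R_0] lin_def)
qed

lemma pact_add: "u \<in> U \<Longrightarrow> pact R (p + q) u = pact R p u + pact R q u"
proof (induction p q rule: poly_induct2)
  case (pCons a p b q)
  then show ?case
    by (simp add: pact_pCons[of R, OF pact_R_0] lin_add[OF R(1) pact_U pact_U] scale_left_distrib algebra_simps)
qed simp

lemma pact_smult: "u \<in> U \<Longrightarrow> pact R (smult c p) u = scale c (pact R p u)"
  by (induction p) (simp_all add: pact_pCons[of R, OF pact_R_0] lin_scale[OF R(1) pact_U] scale_right_distrib)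

lemma pact_diff: "u \<in> U \<Longrightarrow> pact R (p - q) u = pact R p u - pact R q u"
  using pact_add[of u p "smult (-1) q"] pact_smult[of u "-1" q] by simp

lemma pact_mult: "u \<in> U \<Longrightarrow> pact R (p * q) u = pact R p (pact R q u)"
proof (induction p)
  case (pCons a p)
  have "pact R (pCons a p * q) u = pact R (smult a q + pCons 0 (p * q)) u" by simp
  also have "\<dots> = scale a (pact R q u) + R (pact R (p * q) u)"
    using pCons(3) by (simp add: pact_add pact_smult pact_pCons[of R, OF pact_R_0])
  finally show ?case using pCons by (simp add: pact_pCons[of R, OF pact_R_0])
qed simp

lemma pact_commute: "u \<in> U \<Longrightarrow> pact R p (pact R q u) = pact R q (pact R p u)"
  using pact_mult[of u p q] pact_mult[of u q p] by (simp add: mult.commute)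

lemma pact_R: "u \<in> U \<Longrightarrow> pact R p (R u) = R (pact R p u)"
  using pact_commute[of u p "[:0, 1:]"] by (simp add: pact_pCons[of R, OF pact_R_0] pact_R_0)

lemma pact_1: "pact R 1 u = u"
  by (simp add: one_pCons pact_pCons[of R, OF pact_R_0] pact_R_0)

lemma pact_monom: "u \<in> U \<Longrightarrow> pact R (monom 1 i) u = (R ^^ i) u"
  by (induction i) (simp_all add: monom_0 monom_Suc pact_pCons[of R, OF pact_R_0] pact_R_0)

lemma pact_power: "u \<in> U \<Longrightarrow> pact R (p ^ i) u = (pact R p ^^ i) u"
  by (induction i) (simp_all add: pact_1 pact_mult)

text \<open>In a finite space two powers of \<open>R\<close> agree on \<open>u\<close>, and the
  difference of the two monomials kills it.\<close>

lemma ex_annihilating_poly: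
  assumes fin: "finite U" and u: "u \<in> U" shows "\<exists>p. p \<noteq> 0 \<and> pact R p u = 0"
proof -
  have RiU: "(R ^^ i) u \<in> U" for i using u R_U by (induction i) auto
  have "\<not> inj (\<lambda>i. (R ^^ i) u)"
  proof
    assume "inj (\<lambda>i. (R ^^ i) u)"
    moreover have "finite (range (\<lambda>i. (R ^^ i) u))" by (rule finite_subset[OF _ fin]) (use RiU in blast)
    ultimately show False using finite_imageD[of "\<lambda>i. (R ^^ i) u" UNIV] by simp
  qed
  then obtain i j where ij: "(R ^^ i) u = (R ^^ j) u" "i \<noteq> j" unfolding inj_def by blast
  have "pact R (monom 1 i - monom 1 j) u = 0" using ij(1) u by (simp add: pact_diff pact_monom)
  moreover have "monom (1::'k) i - monom 1 j \<noteq> 0" using ij(2) by (simp add: monom_eq_iff')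
  ultimately show ?thesis by blast
qed

text \<open>When \<open>U\<close> is primary for \<open>p\<close>, the cyclic subspace of a vector \<open>u\<close> of maximal order carries the
  form \<open>(q u, q' u) \<mapsto> \<phi> (q q' u)\<close>, which is nondegenerate for \<open>\<phi>\<close> nonzero on the socle.\<close>

lemma ex_cyclic_form:
  assumes fin: "finite U" and p: "0 < degree p"
    and min: "\<And>q v. q \<noteq> 0 \<Longrightarrow> degree q < degree p \<Longrightarrow> v \<in> U \<Longrightarrow> pact R q v = 0 \<Longrightarrow> v = 0"
    and nil: "\<And>v. v \<in> U \<Longrightarrow> pact R (p ^ k) v = 0"
    and u: "u \<in> U" "pact R (p ^ (k - 1)) u \<noteq> 0"
  shows "\<exists>C C' \<beta>. direct_sum U C C' \<and> C \<noteq> {0} \<and> R ` C \<subseteq> C \<and> R ` C' \<subseteq> C' \<and> adjoint_form C \<beta> R R"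
proof -
  let ?a = "pact R"
  have p0: "p \<noteq> 0" using p by auto
  have k0: "k > 0" using u nil[OF u(1)] by (cases k) auto
  have a0: "?a q 0 = 0" for q using lin_0[OF lin_pact U] .
  \<comment> \<open>Stands in for irreducibility of \<open>p\<close>. The last nonzero vector of the
    form p^i w is killed by \<open>p\<close> and by \<open>r\<close>, hence by the nonzero remainder
    \<open>r mod p\<close>, against the minimality of \<open>p\<close>.\<close>
  have unit: "w = 0" if r: "\<not> p dvd r" and w: "w \<in> U" "?a r w = 0" for r w
  proof (rule ccontr)
    assume w0: "w \<noteq> 0"
    define j where "j = (LEAST j. ?a (p ^ j) w = 0)"
    have j: "?a (p ^ j) w = 0" unfolding j_def by (rule LeastI[of _ k]) (rule nil[OF w(1)])
    have jm: "?a (p ^ i) w \<noteq> 0" if "i < j" for i using not_less_Least[of i "\<lambda>j. ?a (p ^ j) w = 0"] that j_def by auto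
    have "j \<noteq> 0"
    proof
      assume "j = 0"
      then show False using j w0 pact_1 by simp
    qed
    then obtain i where i: "j = Suc i" using not0_implies_Suc by blast
    let ?v = "?a (p ^ i) w"
    have v: "?v \<in> U" "?v \<noteq> 0" using pact_U[OF w(1)] jm[of i] i by auto
    have pv: "?a p ?v = 0" using j w(1) unfolding i by (simp add: pact_mult)
    have "?a r ?v = ?a (p ^ i) (?a r w)" by (rule pact_commute[OF w(1)])
    then have rv: "?a r ?v = 0" using w(2) a0 by simp
    have "?a r ?v = ?a (r div p * p + r mod p) ?v" by simp
    also have "\<dots> = ?a (r div p) (?a p ?v) + ?a (r mod p) ?v" using v(1) by (simp only: pact_add pact_mult)
    finally have "?a (r mod p) ?v = 0" using rv pv a0 by simp
    moreover have "r mod p \<noteq> 0" using r by (simp add: dvd_eq_mod_eq_0)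
    moreover have "degree (r mod p) < degree p" using degree_mod_less[OF p0, of r] calculation(2) by auto
    ultimately show False using min v by blast
  qed
  have factor: "\<exists>m r. q = p ^ m * r \<and> \<not> p dvd r" if q: "q \<noteq> 0" for q
  proof -
    have bound: "m \<le> degree q" if "p ^ m dvd q" for m
    proof -
      have "degree (p ^ m) \<le> degree q" using dvd_imp_degree_le[OF that q] .
      then have "m * degree p \<le> degree q" using p0 by (simp add: degree_power_eq mult.commute)
      then show ?thesis using p by (metis One_nat_def Suc_leI le_trans mult.right_neutral mult_le_mono2)
    qed
    define m where "m = Max {m. p ^ m dvd q}"
    have fm: "finite {m. p ^ m dvd q}" using bound by (auto intro: finite_subset[of _ "{..degree q}"])
    have "p ^ 0 dvd q" by simp
    then have m: "p ^ m dvd q" using Max_in[OF fm] unfolding m_def by blast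
    then obtain r where r: "q = p ^ m * r" by (elim dvdE)
    have "\<not> p dvd r"
    proof
      assume "p dvd r"
      then have "p ^ Suc m dvd q" unfolding r by (simp add: mult_dvd_mono)
      then have "Suc m \<le> m" using Max_ge[OF fm, of "Suc m"] unfolding m_def by simp
      then show False by simp
    qed
    then show ?thesis using r by blast
  qed
  have low: "?a (p ^ m) u \<noteq> 0" if "m < k" for m
  proof
    assume "?a (p ^ m) u = 0"
    moreover have "p ^ (k - 1) = p ^ (k - 1 - m) * p ^ m" using that k0 by (simp add: power_add[symmetric])
    ultimately have "?a (p ^ (k - 1)) u = 0" using u(1) a0 by (simp add: pact_mult)
    then show False using u(2) by simp
  qed
  \<comment> \<open>\<open>u\<close> has maximal order: a polynomial that kills \<open>u\<close> is
    divisible by p^k and so kills \<open>U\<close>. This makes the pairing \<open>b\<close> below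
    well defined.\<close>
  have ann: "?a q v = 0" if q: "?a q u = 0" and v: "v \<in> U" for q v
  proof (cases "q = 0")
    case False
    then obtain m r where mr: "q = p ^ m * r" "\<not> p dvd r" using factor by blast
    have "?a r (?a (p ^ m) u) = 0" using q u(1) unfolding mr(1) by (metis mult.commute pact_mult)
    then have "?a (p ^ m) u = 0" using unit[OF mr(2) pact_U[OF u(1)]] by blast
    then have "\<not> m < k" using low by blast
    then have "q = r * p ^ (m - k) * p ^ k" unfolding mr(1) by (simp add: power_add[symmetric] mult.assoc)
    then show ?thesis using pact_mult[OF v, of "r * p ^ (m - k)" "p ^ k"] nil[OF v] a0 by simp
  qed simp
  let ?z = "?a (p ^ (k - 1)) u"
  have zU: "?z \<in> U" by (rule pact_U[OF u(1)])
  have sub0: "subspace {0}" by simp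
  obtain \<phi> where \<phi>: "funl U \<phi>" "\<phi> ?z = 1"
    using ex_functional[OF U fin sub0 _ zU] subspace_0[OF U] u(2) by auto
  define C where "C = range (\<lambda>q. ?a q u)"
  have CU: "C \<subseteq> U" unfolding C_def using pact_U[OF u(1)] by auto
  have sC: "subspace C"
  proof (rule subspaceI)
    show "0 \<in> C" unfolding C_def by (rule range_eqI[of _ _ 0]) simp
    show "a + b \<in> C" if "a \<in> C" "b \<in> C" for a b
      using that pact_add[OF u(1), symmetric] unfolding C_def by auto
    show "scale c a \<in> C" if "a \<in> C" for c a
      using that pact_smult[OF u(1), symmetric] unfolding C_def by auto
  qed
  have fC: "finite C" using CU fin finite_subset by blast
  have RC: "R ` C \<subseteq> C"
  proof -
    have "R (?a q u) = ?a (pCons 0 q) u" for q by (simp add: pact_pCons[of R, OF pact_R_0])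
    then show ?thesis unfolding C_def by auto
  qed
  \<comment> \<open>A power of \<open>p\<close> carries \<open>q u\<close> to \<open>r z\<close>
    with z = p^(k-1) u. As \<open>r\<close> acts injectively on the finite cyclic space of
    \<open>z\<close>, it is bijective there, and some multiple reaches \<open>z\<close>, where
    \<phi> is 1.\<close>
  have nondeg: "\<exists>q'. \<phi> (?a q' (?a q u)) \<noteq> 0" if q: "?a q u \<noteq> 0" for q
  proof -
    have "q \<noteq> 0" using q by auto
    then obtain m r where mr: "q = p ^ m * r" "\<not> p dvd r" using factor by blast
    have mk: "m < k"
    proof (rule ccontr)
      assume "\<not> m < k"
      then have "q = r * p ^ (m - k) * p ^ k" unfolding mr(1) by (simp add: power_add[symmetric] mult.assoc)
      then show False using q pact_mult[OF u(1), of "r * p ^ (m - k)" "p ^ k"] nil[OF u(1)] a0 by simp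
    qed
    have "p ^ (k - 1 - m) * q = r * p ^ (k - 1)"
      unfolding mr(1) using mk by (simp add: mult.assoc[symmetric] power_add[symmetric] mult.commute)
    then have eq: "?a (p ^ (k - 1 - m)) (?a q u) = ?a r ?z" using pact_mult[OF u(1)] by metis
    let ?Z = "range (\<lambda>s. ?a s ?z)"
    have ZU: "?Z \<subseteq> U" using pact_U[OF zU] by auto
    have fZ: "finite ?Z" using ZU fin finite_subset by blast
    have sZ: "subspace ?Z"
    proof (rule subspaceI)
      show "0 \<in> ?Z" by (rule range_eqI[of _ _ 0]) simp
      show "a + b \<in> ?Z" if "a \<in> ?Z" "b \<in> ?Z" for a b
        using that pact_add[OF zU, symmetric] by auto
      show "scale c a \<in> ?Z" if "a \<in> ?Z" for c a
        using that pact_smult[OF zU, symmetric] by auto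
    qed
    have "inj_on (?a r) ?Z"
      by (rule lin_inj[OF lin_mono[OF lin_pact ZU] sZ]) (use unit[OF mr(2)] ZU in blast)
    moreover have "?a r ` ?Z \<subseteq> ?Z" using pact_mult[OF zU, symmetric] by auto
    ultimately have "?a r ` ?Z = ?Z" by (rule endo_inj_surj[OF fZ, rotated])
    moreover have "?z \<in> ?Z" by (rule range_eqI[of _ _ 1]) (simp add: pact_1)
    ultimately obtain s where s: "?z = ?a r (?a s ?z)" by (metis (no_types, lifting) imageE)
    have "?a (s * p ^ (k - 1 - m)) (?a q u) = ?a s (?a r ?z)"
      using eq pact_mult[OF pact_U[OF u(1)]] by simp
    also have "\<dots> = ?z" using s pact_commute[OF zU] by simp
    finally show ?thesis using \<phi>(2) by (metis zero_neq_one)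
  qed
  \<comment> \<open>An arbitrary polynomial \<open>q\<close> with c = q u; by \<open>ann\<close> its
    action on \<open>U\<close> does not depend on the choice.\<close>
  define qq where "qq c = (SOME q. c = ?a q u)" for c
  have qq: "?a (qq c) u = c" if c: "c \<in> C" for c
  proof -
    have "\<exists>q. c = ?a q u" using c unfolding C_def by blast
    from someI_ex[OF this] show ?thesis unfolding qq_def by simp
  qed
  have qq_eq: "?a (qq (?a q u)) v = ?a q v" if "v \<in> U" for q v
  proof -
    have "?a (qq (?a q u) - q) u = 0" using qq[of "?a q u"] u(1) by (simp add: pact_diff C_def)
    then have "?a (qq (?a q u) - q) v = 0" by (rule ann) (rule that)
    then show ?thesis using that by (simp add: pact_diff)
  qed
  define b where "b c v = \<phi> (?a (qq c) v)" for c v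
  have b_eq: "b (?a q u) v = \<phi> (?a q v)" if "v \<in> U" for q v
    unfolding b_def qq_eq[OF that] ..
  have b1: "funl C (\<lambda>c. b c v)" if v: "v \<in> U" for v
    unfolding funl_def
  proof (intro conjI ballI allI)
    fix c d assume "c \<in> C" "d \<in> C"
    then obtain q r where qr: "c = ?a q u" "d = ?a r u" unfolding C_def by blast
    have "b (c + d) v = \<phi> (?a (q + r) v)" unfolding qr pact_add[OF u(1), symmetric] by (rule b_eq[OF v])
    then show "b (c + d) v = b c v + b d v"
      unfolding qr b_eq[OF v] using funl_add[OF \<phi>(1) pact_U[OF v] pact_U[OF v]] pact_add[OF v] by simp
  next
    fix t c assume "c \<in> C"
    then obtain q where qr: "c = ?a q u" unfolding C_def by blast
    have "b (scale t c) v = \<phi> (?a (smult t q) v)" unfolding qr pact_smult[OF u(1), symmetric] by (rule b_eq[OF v])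
    then show "b (scale t c) v = t * b c v"
      unfolding qr b_eq[OF v] using funl_scale[OF \<phi>(1) pact_U[OF v]] pact_smult[OF v] by simp
  qed
  have b2: "funl U (b c)" if "c \<in> C" for c
    unfolding funl_def b_def
    using lin_add[OF lin_pact] lin_scale[OF lin_pact] funl_add[OF \<phi>(1)] funl_scale[OF \<phi>(1)] pact_U by simp
  have b2C: "funl C (b c)" if "c \<in> C" for c
    using b2[OF that] CU unfolding funl_def by blast
  have sym: "b c d = b d c" if cd: "c \<in> C" "d \<in> C" for c d
  proof -
    obtain q r where qr: "c = ?a q u" "d = ?a r u" using cd unfolding C_def by blast
    then show ?thesis using b_eq pact_U[OF u(1)] pact_commute[OF u(1)] by simp
  qed
  have nd: "c = 0" if c: "c \<in> C" and z: "\<And>d. d \<in> C \<Longrightarrow> b c d = 0" for c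
  proof (rule ccontr)
    assume c0: "c \<noteq> 0"
    obtain q where q: "c = ?a q u" using c unfolding C_def by blast
    then obtain q' where "\<phi> (?a q' c) \<noteq> 0" using nondeg c0 by blast
    then have "b (?a q' u) c \<noteq> 0" using b_eq c CU by auto
    moreover have "?a q' u \<in> C" unfolding C_def by blast
    ultimately show False using sym[OF c] z by simp
  qed
  have adj: "b (R c) d = b c (R d)" if cd: "c \<in> C" "d \<in> C" for c d
  proof -
    obtain q where q: "c = ?a q u" using cd(1) unfolding C_def by blast
    have dU: "d \<in> U" using cd CU by blast
    have "R c = ?a (pCons 0 q) u" unfolding q by (simp add: pact_pCons[of R, OF pact_R_0])
    then have "b (R c) d = \<phi> (?a (pCons 0 q) d)" using b_eq[OF dU] by simp
    also have "\<dots> = \<phi> (?a q (R d))" by (simp add: pact_pCons[of R, OF pact_R_0] pact_R[OF dU])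
    also have "\<dots> = b c (R d)" unfolding q using b_eq[OF R_U[OF dU]] by simp
    finally show ?thesis .
  qed
  have form: "adjoint_form C b R R"
    unfolding adjoint_form_def using b1 CU sym nd adj by blast
  \<comment> \<open>The pairing \<open>b\<close> is defined on C times all of U and \<open>R\<close>
    is self-adjoint for it, so the orthogonal complement of \<open>C\<close> in \<open>U\<close> is
    stable under \<open>R\<close>.\<close>
  define C' where "C' = {v \<in> U. \<forall>c\<in>C. b c v = 0}"
  have bC'0: "b c 0 = 0" if "c \<in> C" for c using funl_0[OF b2[OF that] U] .
  have sC': "subspace C'"
    unfolding C'_def
    by (rule subspaceI) (auto simp: bC'0 funl_add[OF b2] funl_scale[OF b2] subspace_0[OF U] subspace_add[OF U] subspace_scale[OF U])
  have RC': "R ` C' \<subseteq> C'"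
  proof safe
    fix v assume v: "v \<in> C'"
    then have vU: "v \<in> U" unfolding C'_def by blast
    have "b c (R v) = 0" if c: "c \<in> C" for c
    proof -
      obtain q where q: "c = ?a q u" using c unfolding C_def by blast
      have "b c (R v) = b (?a (pCons 0 q) u) v"
        unfolding q b_eq[OF R_U[OF vU]] b_eq[OF vU] by (simp add: pact_pCons[of R, OF pact_R_0] pact_R[OF vU])
      moreover have "?a (pCons 0 q) u \<in> C" unfolding C_def by blast
      ultimately show ?thesis using v unfolding C'_def by simp
    qed
    then show "R v \<in> C'" unfolding C'_def using R_U[OF vU] by blast
  qed
  have "direct_sum U C C'"
    unfolding direct_sum_def
  proof (intro conjI ballI)
    show "C \<inter> C' = {0}"
    proof
      show "C \<inter> C' \<subseteq> {0}"
      proof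
        fix c assume c: "c \<in> C \<inter> C'"
        then have "b c d = 0" if "d \<in> C" for d using sym[of c d] that unfolding C'_def by auto
        then show "c \<in> {0}" using nd[of c] c by simp
      qed
      show "{0} \<subseteq> C \<inter> C'" using subspace_0[OF sC] subspace_0[OF sC'] by simp
    qed
    fix v assume v: "v \<in> U"
    obtain c where c: "c \<in> C" "\<forall>d\<in>C. b d v = b d c"
      using ex_orthogonal_approximation[OF sC fC CU b1 b2C nd v] by blast
    have cU: "c \<in> U" using c(1) CU by blast
    have "b d (v - c) = 0" if d: "d \<in> C" for d
      using funl_diff[OF b2[OF d] U v cU] bspec[OF c(2) d] by simp
    then have "v - c \<in> C'" unfolding C'_def using subspace_diff[OF U v cU] by blast
    moreover have "v = c + (v - c)" by simp
    ultimately show "\<exists>a\<in>C. \<exists>b\<in>C'. v = a + b" using c(1) by blast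
  qed (use U sC sC' CU C'_def in auto)
  moreover have "C \<noteq> {0}"
  proof -
    have "?z \<in> C" unfolding C_def by blast
    then show ?thesis using u(2) by auto
  qed
  ultimately show ?thesis using RC RC' form by blast
qed

end

text \<open>Basis-free form of the fact that over any field a square matrix is conjugate to its
  transpose by a symmetric matrix. Let \<open>p\<close> have least degree among the nonzero
  polynomials that kill some nonzero vector. Either the Fitting decomposition for p(R) is proper, or
  \<open>U\<close> is primary for \<open>p\<close> and a cyclic summand with its own form splits
  off.\<close>

theorem ex_selfadjoint_form:
  assumes "subspace U" "finite U" "lin U R" "R ` U \<subseteq> U"
  shows "\<exists>\<beta>. adjoint_form U \<beta> R R"
  using assms
proof (induction "card U" arbitrary: U rule: less_induct)
  case less
  note U = less.prems(1) and fin = less.prems(2) and R = less.prems(3,4)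
  have step: "\<exists>\<beta>. adjoint_form U \<beta> R R"
    if d: "direct_sum U A B" and AB: "R ` A \<subseteq> A" "R ` B \<subseteq> B" and B: "A \<noteq> {0}"
      and A: "\<exists>\<alpha>. adjoint_form A \<alpha> R R" for A B
  proof -
    have sub: "subspace A" "subspace B" "A \<subseteq> U" "B \<subseteq> U" "A \<inter> B = {0}" using d by (auto simp: direct_sum_def)
    have "B \<noteq> U"
      using sub B subspace_0[OF sub(1)] by auto
    then have "card B < card U" using psubset_card_mono[OF fin, of B] sub(4) by blast
    then obtain \<beta> where "adjoint_form B \<beta> R R"
      using less.hyps[of B] sub lin_mono[OF R(1)] AB finite_subset[OF sub(4) fin] by blast
    then show ?thesis using A adjoint_form_direct_sum[OF d R(1) AB R(1) AB] by blast
  qed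
  show ?case
  proof (cases "U = {0}")
    case True
    have "adjoint_form U (\<lambda>_ _. 0) R R" unfolding adjoint_form_def funl_def True by simp
    then show ?thesis by blast
  next
    case False
    then obtain v0 where v0: "v0 \<in> U" "v0 \<noteq> 0" using subspace_0[OF U] by blast
    obtain p where p: "p \<noteq> 0" "\<exists>v\<in>U. v \<noteq> 0 \<and> pact R p v = 0"
        and min: "\<And>q. q \<noteq> 0 \<and> (\<exists>v\<in>U. v \<noteq> 0 \<and> pact R q v = 0) \<Longrightarrow> degree p \<le> degree q"
      using ex_has_least_nat[of "\<lambda>p. p \<noteq> 0 \<and> (\<exists>v\<in>U. v \<noteq> 0 \<and> pact R p v = 0)" _ degree]
        ex_annihilating_poly[OF U R fin v0(1)] v0 by metis
    obtain v1 where v1: "v1 \<in> U" "v1 \<noteq> 0" "pact R p v1 = 0" using p(2) by blast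
    have degp: "0 < degree p"
    proof (rule ccontr)
      assume "\<not> ?thesis"
      then obtain c where c: "p = [:c:]" by (auto elim: degree_eq_zeroE)
      then have "scale c v1 = 0"
        using v1(3) pact_pCons[of R c 0 v1, OF pact_R_0[OF U R]] pact_R_0[OF U R] by simp
      then show False using v1(2) p(1) c by simp
    qed
    have lp: "lin U (pact R p)" "pact R p ` U \<subseteq> U" using lin_pact[OF U R] pact_U[OF U R] by auto
    obtain k where k: "k > 0" "direct_sum U {u \<in> U. (pact R p ^^ k) u = 0} ((pact R p ^^ k) ` U)"
      using ex_fitting[OF U fin lp] by blast
    let ?N = "{u \<in> U. (pact R p ^^ k) u = 0}" and ?I = "(pact R p ^^ k) ` U"
    have pw: "(pact R p ^^ k) u = pact R (p ^ k) u" if "u \<in> U" for u using pact_power[OF U R that] by simp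
    have sub: "subspace ?N" "subspace ?I" "?I \<subseteq> U" "?N \<inter> ?I = {0}" using k(2) by (auto simp: direct_sum_def)
    have RN: "R ` ?N \<subseteq> ?N"
    proof safe
      fix u assume u: "u \<in> U" "(pact R p ^^ k) u = 0"
      show Ru: "R u \<in> U" using u R by blast
      show "(pact R p ^^ k) (R u) = 0"
        unfolding pw[OF Ru] pact_R[OF U R u(1)] using u pw pact_R_0[OF U R] by simp
    qed
    have RI: "R ` ?I \<subseteq> ?I"
    proof safe
      fix u assume u: "u \<in> U"
      then have Ru: "R u \<in> U" using R by blast
      have "R ((pact R p ^^ k) u) = (pact R p ^^ k) (R u)"
        unfolding pw[OF Ru] pw[OF u] pact_R[OF U R u] ..
      then show "R ((pact R p ^^ k) u) \<in> ?I" using Ru by blast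
    qed
    have p0: "pact R q 0 = 0" for q using lin_0[OF lin_pact[OF U R] U] .
    have v1N: "v1 \<in> ?N"
    proof -
      obtain j where "k = Suc j" using k(1) by (cases k) auto
      then have "(pact R p ^^ k) v1 = (pact R p ^^ j) 0" using v1(3) by (simp add: funpow_Suc_right del: funpow.simps)
      also have "\<dots> = 0" using p0 by (induction j) auto
      finally show ?thesis using v1(1) by simp
    qed
    have N0: "?N \<noteq> {0}" using v1N v1(2) by blast
    show ?thesis
    proof (cases "?I = {0}")
      case False
      have "?N \<noteq> U" using sub(3,4) subspace_0[OF sub(2)] False by auto
      then have "card ?N < card U" using psubset_card_mono[OF fin, of ?N] by blast
      then have "\<exists>\<beta>. adjoint_form ?N \<beta> R R"
        by (rule less.hyps) (use sub RN fin lin_mono[OF R(1), of ?N] in auto)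
      then show ?thesis by (rule step[OF k(2) RN RI N0])
    next
      case True
      define m where "m = (LEAST m. \<forall>u\<in>U. pact R (p ^ m) u = 0)"
      have "\<forall>u\<in>U. pact R (p ^ k) u = 0" using True pw by auto
      then have m: "\<forall>u\<in>U. pact R (p ^ m) u = 0" unfolding m_def by (rule LeastI)
      have "m \<noteq> 0"
      proof
        assume "m = 0"
        then show False using bspec[OF m v0(1)] v0(2) pact_1[OF U R] by simp
      qed
      then have "\<not> (\<forall>u\<in>U. pact R (p ^ (m - 1)) u = 0)"
        using not_less_Least[of "m - 1" "\<lambda>m. \<forall>u\<in>U. pact R (p ^ m) u = 0"] unfolding m_def[symmetric] by simp
      then obtain u where u: "u \<in> U" "pact R (p ^ (m - 1)) u \<noteq> 0" by blast
      have inj: "v = 0" if "q \<noteq> 0" "degree q < degree p" "v \<in> U" "pact R q v = 0" for q v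
        using min[of q] that by force
      have "\<exists>C C' \<beta>. direct_sum U C C' \<and> C \<noteq> {0} \<and> R ` C \<subseteq> C \<and> R ` C' \<subseteq> C' \<and> adjoint_form C \<beta> R R"
        by (rule ex_cyclic_form[OF U R fin degp _ _ u]) (use inj m in blast)+
      then obtain C C' \<beta> where C: "direct_sum U C C'" "C \<noteq> {0}" "R ` C \<subseteq> C" "R ` C' \<subseteq> C'" "adjoint_form C \<beta> R R"
        by blast
      show ?thesis by (rule step[OF C(1,3,4,2)]) (use C(5) in blast)
    qed
  qed
qed

end

section \<open>Forms for a pair all of whose levels are exact\<close>

context nilpair
begin

text \<open>Climbs from \<open>level m\<close>, which is 0, up to \<open>V\<close>. Given
  \<open>W1\<close> on the next smaller level, \<open>W\<close> is taken inside E, the preimage of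
  \<open>W1\<close> under \<open>D\<close>, as a complement of the kernel of \<open>x\<close> there
  that contains \<open>W1\<close>. Then \<open>D\<close> maps \<open>W\<close> into
  \<open>W1\<close> and so into \<open>W\<close>.\<close>

lemma ex_D_stable_complement:
  assumes ex: "\<And>j. exact (level j)" and nil: "level m = {0}"
  shows "\<exists>W. direct_sum V {v \<in> V. x v = 0} W \<and> D ` W \<subseteq> W"
proof -
  have "\<exists>W. direct_sum (level (m - i)) {v \<in> level (m - i). x v = 0} W \<and> D ` W \<subseteq> W" if "i \<le> m" for i
    using that
  proof (induction i)
    case 0
    have "{v \<in> level m. x v = 0} = {0}" unfolding nil by auto
    then have "direct_sum (level m) {v \<in> level m. x v = 0} {0}" by (simp add: direct_sum_def nil)
    then show ?case by auto
  next
    case (Suc i)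
    define j where "j = m - Suc i"
    have j: "m - i = Suc j" using Suc.prems unfolding j_def by simp
    let ?U = "level j" and ?U1 = "level (Suc j)"
    let ?A = "{v \<in> ?U. x v = 0}" and ?A1 = "{v \<in> ?U1. x v = 0}"
    note sU = stableD[OF stable_level[of j]] and sU1 = stableD[OF stable_level[of "Suc j"]]
    note [simp] = subsetD[OF sU(2)] subsetD[OF sU1(2)]
    obtain W1 where W1: "direct_sum ?U1 ?A1 W1" "D ` W1 \<subseteq> W1" using Suc.IH Suc.prems unfolding j by auto
    have sW1: "subspace W1" "W1 \<subseteq> ?U1" "?A1 \<inter> W1 = {0}"
      and decW1: "\<And>v. v \<in> ?U1 \<Longrightarrow> \<exists>a\<in>?A1. \<exists>w\<in>W1. v = a + w"
      using W1(1) by (auto simp: direct_sum_def)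
    \<comment> \<open>Exactness gives \<open>x W1 + W1\<close>; the summand \<open>x W1\<close> can
      be traded for \<open>y W1\<close> because x = D + y and \<open>W1\<close> is stable under
      \<open>D\<close>.\<close>
    have dec2: "\<exists>w\<in>W1. \<exists>w'\<in>W1. v = w + y w'" if v: "v \<in> ?U1" for v
    proof -
      obtain a w where aw: "a \<in> ?A1" "w \<in> W1" "v = a + w" using decW1[OF v] by blast
      obtain u where u: "u \<in> ?U1" "a = x u" using exactD(1)[OF ex[of "Suc j"]] aw(1) by blast
      obtain a' w' where aw': "a' \<in> ?A1" "w' \<in> W1" "u = a' + w'" using decW1[OF u(1)] by blast
      have [simp]: "w' \<in> V" "a' \<in> V" using aw' sW1(2) by auto
      have "a = x w'" unfolding u(2) aw'(3) using aw'(1) by simp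
      then have "v = (D w' + w) + y w'" unfolding aw(3) by (simp add: D_def)
      moreover have "D w' + w \<in> W1" using W1(2) aw(2) aw'(2) subspace_add[OF sW1(1)] by blast
      ultimately show ?thesis using aw'(2) by blast
    qed
    define E where "E = {v \<in> ?U. D v \<in> W1}"
    have linU: "lin ?U D" "lin ?U x" using lin_mono[OF lin_D sU(2)] lin_mono[OF lin_x sU(2)] .
    have sE: "subspace E" "E \<subseteq> ?U" unfolding E_def using subspace_linear_preimage[OF linU(1) sU(1) sW1(1)] by auto
    have fE: "finite E" using sE(2) sU(5) finite_subset by blast
    have W1E: "W1 \<subseteq> E" unfolding E_def using sW1(2) level_Suc_subset[of j] W1(2) by blast
    let ?AE = "{v \<in> E. x v = 0}"
    have sAE: "subspace ?AE" "?AE \<subseteq> E"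
      using subspace_linear_kernel[OF lin_mono[OF linU(2) sE(2)] sE(1)] by auto
    have "?AE \<inter> W1 = {0}"
    proof
      show "?AE \<inter> W1 \<subseteq> {0}" using sW1(2,3) by blast
      show "{0} \<subseteq> ?AE \<inter> W1" using subspace_0[OF sAE(1)] subspace_0[OF sW1(1)] by blast
    qed
    then obtain W where W: "W1 \<subseteq> W" "direct_sum E ?AE W"
      using ex_complement_containing[OF sE(1) fE sAE sW1(1) W1E] by blast
    have sW: "subspace W" "W \<subseteq> E" "?AE \<inter> W = {0}" and decW: "\<And>v. v \<in> E \<Longrightarrow> \<exists>a\<in>?AE. \<exists>w\<in>W. v = a + w"
      using W(2) by (auto simp: direct_sum_def)
    have DW: "D ` W \<subseteq> W" using sW(2) W(1) unfolding E_def by blast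
    have "direct_sum ?U ?A W"
      unfolding direct_sum_def
    proof (intro conjI ballI)
      show "?A \<inter> W = {0}"
      proof
        show "?A \<inter> W \<subseteq> {0}" using sW(2,3) by blast
        show "{0} \<subseteq> ?A \<inter> W" using subspace_0[OF sU(1)] subspace_0[OF sW(1)] by simp
      qed
      fix v assume v: "v \<in> ?U"
      then have "D v \<in> ?U1" unfolding level_Suc by blast
      then obtain w w' where ww: "w \<in> W1" "w' \<in> W1" "D v = w + y w'" using dec2 by blast
      have "w' \<in> D ` ?U" using ww(2) sW1(2) unfolding level_Suc by blast
      then obtain z where z: "z \<in> ?U" "w' = D z" by blast
      \<comment> \<open>As D x = - y D, adding \<open>x z\<close> to \<open>v\<close> cancels y w' =
        y (D z).\<close>
      have "D (v + x z) = w" using ww(3) v z by (simp add: y_D)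
      then have "v + x z \<in> E" unfolding E_def using ww(1) subspace_add[OF sU(1) v sU(3)[OF z(1)]] by simp
      then obtain a w2 where aw: "a \<in> ?AE" "w2 \<in> W" "v + x z = a + w2" using decW by blast
      have aU: "a \<in> ?U" "x a = 0" using aw(1) sE(2) by auto
      have "a - x z \<in> ?A" using aU z subspace_diff[OF sU(1) aU(1) sU(3)[OF z(1)]] by simp
      moreover have "v = (a - x z) + w2" using aw(3) by (simp add: algebra_simps)
      ultimately show "\<exists>a\<in>?A. \<exists>b\<in>W. v = a + b" using aw(2) by blast
    qed (use sU sW sE subspace_linear_kernel[OF linU(2) sU(1)] in auto)
    then show ?case using DW unfolding j_def by blast
  qed
  from this[of m] show ?thesis by simp
qed

lemma exact_homotopy:
  assumes "exact V" "direct_sum V {v \<in> V. x v = 0} G"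
  shows "\<exists>h. homotopy x V h \<and> (\<forall>g\<in>G. h g = 0) \<and> h ` V \<subseteq> G"
  by (rule ex_homotopy_complement[OF lin_x _ _ _ V assms(2)]) (use exactD(1)[OF assms(1)] in auto)

text \<open>Write v = x v0 + v1 with v0 = h v and v1 = h (x v) in \<open>W\<close>. The first two
  terms of \<gamma> pair v0 with v1 crosswise by a form for which \<open>D\<close> is self-adjoint;
  they make \<open>x\<close> self-adjoint and ensure nondegeneracy. The third term b (D u0) v0
  changes the adjoint of \<open>x\<close> from \<open>x\<close> to x - D = y.\<close>

lemma adjoint_form_nilpotent:
  assumes ex: "\<And>j. exact (level j)" and nil: "level m = {0}"
  shows "\<exists>\<beta>. adjoint_form V \<beta> x y"
proof -
  obtain W where W: "direct_sum V {v \<in> V. x v = 0} W" "D ` W \<subseteq> W"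
    using ex_D_stable_complement[OF ex nil] by blast
  have sW: "subspace W" "W \<subseteq> V" using W(1) by (auto simp: direct_sum_def)
  have fW: "finite W" using sW(2) V(2) finite_subset by blast
  note [simp] = subsetD[OF sW(2)]
  obtain b where "adjoint_form W b D D"
    using ex_selfadjoint_form[OF sW(1) fW lin_mono[OF lin_D sW(2)] W(2)] by blast
  note b = adjoint_formD[OF this] and br = adjoint_form_right[OF this sW(1)]
  have DW: "D w \<in> W" if "w \<in> W" for w using W(2) that by blast
  obtain h where h: "homotopy x V h" "\<forall>g\<in>W. h g = 0" "h ` V \<subseteq> W"
    using exact_homotopy[OF _ W(1)] ex[of 0] by auto
  note hD = homotopyD[OF h(1)]
  have hW [simp]: "h v \<in> W" if "v \<in> V" for v using h(3) that by blast
  have h0 [simp]: "h w = 0" if "w \<in> W" for w using h(2) that by blast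
  have hx [simp]: "h (x w) = w" if "w \<in> W" for w using hD(4)[of w] that by simp
  note ladd = lin_add[OF hD(1)]
  note b_l = funl_add[OF b(1)] funl_scale[OF b(1)] funl_diff[OF b(1) sW(1)] funl_0[OF b(1) sW(1)]
  note b_r = funl_add[OF br] funl_scale[OF br] funl_diff[OF br sW(1)] funl_0[OF br sW(1)]
  have W0 [simp]: "0 \<in> W" using subspace_0[OF sW(1)] .
  define \<gamma> where "\<gamma> u v = b (h (x u)) (h v) + b (h u) (h (x v)) + b (D (h u)) (h v)" for u v
  have "adjoint_form V \<gamma> x y"
    unfolding adjoint_form_def
  proof (intro conjI ballI impI)
    fix v assume v: "v \<in> V"
    show "funl V (\<lambda>u. \<gamma> u v)"
      unfolding funl_def \<gamma>_def
      using v by (auto simp: ladd lin_scale[OF hD(1)] b_l DW algebra_simps)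
  next
    fix u v assume "u \<in> V" "v \<in> V"
    then show "\<gamma> u v = \<gamma> v u" unfolding \<gamma>_def
      using b(2)[of "h (x u)" "h v"] b(2)[of "h u" "h (x v)"] b(4)[of "h u" "h v"] b(2)[of "h u" "D (h v)"] DW
      by simp
  next
    fix u assume u: "u \<in> V" "\<forall>v\<in>V. \<gamma> u v = 0"
    have 1: "h u = 0"
    proof (rule b(3))
      fix w assume w: "w \<in> W"
      then have "\<gamma> u w = 0" using u(2) by simp
      then show "b (h u) w = 0" unfolding \<gamma>_def using w u(1) by (simp add: b_r DW)
    qed (use u(1) in simp)
    have "h (x u) = 0"
    proof (rule b(3))
      fix w assume w: "w \<in> W"
      then have "\<gamma> u (x w) = 0" using u(2) by simp
      then show "b (h (x u)) w = 0" unfolding \<gamma>_def using w u(1) 1 by (simp add: b_l)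
    qed (use u(1) in simp)
    then show "u = 0" using hD(4)[OF u(1)] 1 by simp
  next
    fix u v assume uv: "u \<in> V" "v \<in> V"
    define w w' where "w = h (x v)" and "w' = h v"
    have ww [simp]: "w \<in> W" "w' \<in> W" "D w' \<in> W" "D w \<in> W" "D (D w') \<in> W" using uv DW by (auto simp: w_def w'_def)
    have v: "v = x w' + w" using hD(4)[OF uv(2)] by (simp add: w_def w'_def)
    have "y v = x (w + D w') - (D w + D (D w'))" unfolding v by (simp add: D_def)
    then have "y v = x (w + D w') - (D w + D (D w'))" .
    have e1: "h (y v) = w + D w'"
      unfolding \<open>y v = _\<close> using lin_diff[OF hD(1) V(1)] subspace_add[OF sW(1)] by (simp add: ladd)
    have e2: "h (x (y v)) = - (D w + D (D w'))"
    proof -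
      have xyv: "x (y v) = x (- (D w + D (D w')))" unfolding \<open>y v = _\<close> by simp
      show ?thesis unfolding xyv
        by (rule hx, intro subspace_neg[OF sW(1)] subspace_add[OF sW(1)]) simp_all
    qed
    let ?u = "h (x u)" and ?u' = "h u"
    have uW [simp]: "?u \<in> W" "?u' \<in> W" "D ?u \<in> W" "D ?u' \<in> W" using uv DW by auto
    have m: "b p (- q) = - b p q" if "p \<in> W" "q \<in> W" for p q
      using b_r(2)[OF that, of "-1"] by simp
    have L: "\<gamma> (x u) v = b ?u w + b ?u (D w')"
      unfolding \<gamma>_def using uv b(4)[of ?u w'] by (simp add: w_def[symmetric] w'_def[symmetric] b_l)
    have "\<gamma> u (y v) = b ?u (w + D w') + b ?u' (- (D w + D (D w'))) + b (D ?u') (w + D w')"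
      unfolding \<gamma>_def e1 e2 ..
    also have "\<dots> = b ?u w + b ?u (D w') - b ?u' (D w) - b ?u' (D (D w')) + b (D ?u') w + b (D ?u') (D w')"
      using subspace_add[OF sW(1)] by (simp only: b_r m ww uW) (simp add: b_r)
    also have "\<dots> = b ?u w + b ?u (D w')" using b(4)[of ?u' w] b(4)[of ?u' "D w'"] by simp
    finally show "\<gamma> (x u) v = \<gamma> u (y v)" using L by simp
  qed
  then show ?thesis by blast
qed

text \<open>Here \<open>V\<close> is the direct sum of ker x and ker y, and \<open>x\<close> and
  \<open>y\<close> map each kernel isomorphically onto the other one. A form on ker y for which y x
  is self-adjoint is carried to ker x along \<open>x\<close> and twisted there by y x.\<close>

lemma adjoint_form_invertible:
  assumes ex: "exact V" and DV: "D ` V = V"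
  shows "\<exists>\<beta>. adjoint_form V \<beta> x y"
proof -
  let ?A = "{u \<in> V. x u = 0}" and ?B = "{u \<in> V. y u = 0}"
  have Dinj: "inj_on D V" using eq_card_imp_inj_on[OF V(2), of D] DV by simp
  have xy0: "u = 0" if "u \<in> V" "x u = 0" "y u = 0" for u
    using inj_onD[OF Dinj, of u 0] that by (simp add: D_def)
  have "direct_sum V ?A ?B"
    unfolding direct_sum_def
  proof (intro conjI ballI)
    show "?A \<inter> ?B = {0}" using xy0 by auto
    fix u assume "u \<in> V"
    then have "u \<in> D ` V" using DV by simp
    then obtain z where z: "z \<in> V" "u = D z" by blast
    then have "u = x z + (- y z)" by (simp add: D_def)
    moreover have "x z \<in> ?A" "- y z \<in> ?B" using z(1) by auto
    ultimately show "\<exists>a\<in>?A. \<exists>b\<in>?B. u = a + b" by blast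
  qed (use V subspace_linear_kernel[OF lin_x V(1)] subspace_linear_kernel[OF lin_y V(1)] in auto)
  note d = this
  have sB: "subspace ?B" "?B \<subseteq> V" using d by (auto simp: direct_sum_def)
  have fB: "finite ?B" using V(2) by simp
  have "lin ?B (\<lambda>u. y (x u))"
    by (rule lin_compose[OF lin_mono[OF lin_x sB(2)] _ lin_y]) auto
  moreover have RB: "(\<lambda>u. y (x u)) ` ?B \<subseteq> ?B" by auto
  ultimately obtain b where "adjoint_form ?B b (\<lambda>u. y (x u)) (\<lambda>u. y (x u))"
    using ex_selfadjoint_form[OF sB(1) fB] by blast
  note b = adjoint_formD[OF this] and br = adjoint_form_right[OF this sB(1)]
  obtain h where h: "homotopy x V h" "\<forall>g\<in>?B. h g = 0" "h ` V \<subseteq> ?B"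
    using exact_homotopy[OF ex d] by blast
  note hD = homotopyD[OF h(1)]
  have hB: "h v \<in> ?B" if "v \<in> V" for v using h(3) that by blast
  have hV [simp]: "h v \<in> V" "y (h v) = 0" if "v \<in> V" for v using hB[OF that] by auto
  have h0: "h w = 0" if "w \<in> V" "y w = 0" for w using h(2) that by blast
  have hx: "h (x w) = w" if "w \<in> V" "y w = 0" for w using hD(4)[of w] h0 that by simp
  note ladd = lin_add[OF hD(1)]
  note b_l = funl_add[OF b(1)] funl_scale[OF b(1)] funl_diff[OF b(1) sB(1)] funl_0[OF b(1) sB(1)]
  note b_r = funl_add[OF br] funl_scale[OF br] funl_diff[OF br sB(1)] funl_0[OF br sB(1)]
  define \<gamma> where "\<gamma> u v = b (h (x u)) (h (x v)) + b (h u) (y (x (h v)))" for u v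
  have h00: "h 0 = 0" using lin_0[OF hD(1) V(1)] .
  have "adjoint_form V \<gamma> x y"
    unfolding adjoint_form_def
  proof (intro conjI ballI impI)
    fix v assume v: "v \<in> V"
    show "funl V (\<lambda>u. \<gamma> u v)"
      unfolding funl_def \<gamma>_def
      using v by (auto simp: ladd lin_scale[OF hD(1)] b_l algebra_simps)
  next
    fix u v assume "u \<in> V" "v \<in> V"
    then show "\<gamma> u v = \<gamma> v u" unfolding \<gamma>_def
      using b(2)[of "h (x u)" "h (x v)"] b(4)[of "h u" "h v"] b(2)[of "y (x (h u))" "h v"]
      by simp
  next
    fix u assume u: "u \<in> V" "\<forall>v\<in>V. \<gamma> u v = 0"
    have 1: "h (x u) = 0"
    proof (rule b(3))
      fix w assume w: "w \<in> ?B"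
      then have "\<gamma> u w = 0" using u(2) by simp
      then show "b (h (x u)) w = 0" unfolding \<gamma>_def using w u(1) h0[of w] hx[of w] by (simp add: b_r)
    qed (use u(1) in simp)
    have "y (x (h u)) = 0"
    proof (rule b(3))
      fix w assume w: "w \<in> ?B"
      then have "\<gamma> u (x w) = 0" using u(2) by simp
      then show "b (y (x (h u))) w = 0" unfolding \<gamma>_def
        using w u(1) hx[of w] b(4)[of "h u" w] 1 by (simp add: b_l h00)
    qed (use u(1) in simp)
    then have "x (h u) = 0" using xy0[of "x (h u)"] u(1) by simp
    then show "u = 0" using hD(4)[OF u(1)] 1 by simp
  next
    fix u v assume uv: "u \<in> V" "v \<in> V"
    have "y v = y (x (h v) + h (x v))" using hD(4)[OF uv(2)] by simp
    then have yv: "y v = y (x (h v))" using uv by simp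
    have "h (y v) = 0" using h0[of "y v"] uv by simp
    moreover have "h (x (y v)) = y (x (h v))" unfolding yv using uv by (intro hx) auto
    ultimately show "\<gamma> (x u) v = \<gamma> u (y v)" unfolding \<gamma>_def
      using uv by (simp add: b_l b_r h00)
  qed
  then show ?thesis by blast
qed

text \<open>Each \<open>D\<close> exchanges \<open>x\<close> and \<open>y\<close> up to sign. The
  disjunction is enough to see that the kernel of a power of \<open>D\<close> is stable.\<close>

lemma powD_xy:
  "v \<in> V \<Longrightarrow> ((D ^^ i) (x v) = x ((D ^^ i) v) \<or> (D ^^ i) (x v) = - y ((D ^^ i) v))
    \<and> ((D ^^ i) (y v) = y ((D ^^ i) v) \<or> (D ^^ i) (y v) = - x ((D ^^ i) v))"
proof (induction i arbitrary: v)
  case (Suc i)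
  have "D (x v) = - y (D v)" "D (y v) = - x (D v)" using x_D y_D Suc.prems by simp_all
  moreover have "(D ^^ i) (- w) = - (D ^^ i) w" if "w \<in> V" for w using lin_minus[OF lin_powD V(1) that] .
  ultimately show ?case
    using Suc.IH[of "D v"] Suc.prems by (auto simp: funpow_Suc_right simp del: funpow.simps)
qed simp

lemma exact_direct_summand:
  assumes ex: "exact (level j)" and d: "direct_sum V N I" and N: "stable N" and I: "stable I"
  shows "exact ((D ^^ j) ` N)"
proof -
  note sN = stableD[OF N] and sI = stableD[OF I]
  have NI: "N \<inter> I = {0}" and dec: "\<And>v. v \<in> V \<Longrightarrow> \<exists>a\<in>N. \<exists>b\<in>I. v = a + b"
    using d by (auto simp: direct_sum_def)
  have pN: "(D ^^ j) a \<in> N" if "a \<in> N" for a using that sN(6) by (induction j) auto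
  have pI: "(D ^^ j) a \<in> I" if "a \<in> I" for a using that sI(6) by (induction j) auto
  have main: "u \<in> z ` (D ^^ j) ` N"
    if u: "u \<in> (D ^^ j) ` N" and w: "w \<in> level j" "u = z w" and lz: "lin V z"
      and zN: "\<And>v. v \<in> N \<Longrightarrow> z v \<in> N" and zI: "\<And>v. v \<in> I \<Longrightarrow> z v \<in> I" for u w z
  proof -
    obtain v where v: "v \<in> V" "w = (D ^^ j) v" using w(1) unfolding level_def by blast
    obtain a b where ab: "a \<in> N" "b \<in> I" "v = a + b" using dec[OF v(1)] by blast
    have abV: "a \<in> V" "b \<in> V" using ab sN(2) sI(2) by auto
    have "w = (D ^^ j) a + (D ^^ j) b" unfolding v(2) ab(3) by (rule lin_add[OF lin_powD abV])
    then have e: "u = z ((D ^^ j) a) + z ((D ^^ j) b)" using w(2) lin_add[OF lz] abV by simp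
    have uN: "u \<in> N" using u pN by blast
    have "z ((D ^^ j) b) = u - z ((D ^^ j) a)" using e by simp
    then have "z ((D ^^ j) b) \<in> N" using subspace_diff[OF sN(1) uN zN[OF pN[OF ab(1)]]] by simp
    then have "z ((D ^^ j) b) = 0" using zI[OF pI[OF ab(2)]] NI by blast
    then show ?thesis using e ab(1) by auto
  qed
  have lev: "u \<in> level j" if "u \<in> (D ^^ j) ` N" for u using that sN(2) unfolding level_def by blast
  show ?thesis
    unfolding exact_def
  proof (intro conjI ballI impI)
    fix u assume u: "u \<in> (D ^^ j) ` N" "x u = 0"
    then obtain w where "w \<in> level j" "u = x w" using exactD(1)[OF ex lev] by blast
    then show "u \<in> x ` (D ^^ j) ` N" by (rule main[OF u(1) _ _ lin_x sN(3) sI(3)])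
  next
    fix u assume u: "u \<in> (D ^^ j) ` N" "y u = 0"
    then obtain w where "w \<in> level j" "u = y w" using exactD(2)[OF ex lev] by blast
    then show "u \<in> y ` (D ^^ j) ` N" by (rule main[OF u(1) _ _ lin_y sN(4) sI(4)])
  qed
qed

lemma nilpair_restrict: assumes "stable U" shows "nilpair scale U x y"
  by unfold_locales
    (use stableD[OF assms] lin_mono[OF lin_x] lin_mono[OF lin_y] xx yy in auto)

text \<open>The Fitting decomposition of \<open>D\<close> separates the two constructions:
  \<open>D\<close> is nilpotent on the kernel of D^m and bijective on \<open>level m\<close>. Both
  summands inherit exactness of all levels.\<close>

theorem ex_adjoint_form:
  assumes ex: "\<And>j. exact (level j)"
  shows "\<exists>\<beta>. adjoint_form V \<beta> x y"
proof -
  obtain m where m: "direct_sum V {v \<in> V. (D ^^ m) v = 0} (level m)" "D ` level m = level m"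
    using ex_fitting[OF V lin_D] D_V unfolding level_def by blast
  let ?N = "{v \<in> V. (D ^^ m) v = 0}" and ?I = "level m"
  have sub: "subspace ?N" "subspace ?I" "?I \<subseteq> V" "?N \<inter> ?I = {0}" using m(1) by (auto simp: direct_sum_def)
  have "x v \<in> ?N" "y v \<in> ?N" if "v \<in> ?N" for v
    using powD_xy[of v m] that by auto
  then have N: "stable ?N" unfolding stable_def using sub(1) by blast
  note sN = stableD[OF N] and sI = stableD[OF stable_level[of m]]
  interpret N: nilpair scale ?N x y by (rule nilpair_restrict[OF N])
  interpret I: nilpair scale ?I x y by (rule nilpair_restrict[OF stable_level])
  have "N.exact (N.level j)" for j
    unfolding N.level_def using exact_direct_summand[OF ex m(1) N stable_level] .
  moreover have "N.level m = {0}"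
  proof
    show "N.level m \<subseteq> {0}" unfolding N.level_def by auto
    show "{0} \<subseteq> N.level m" unfolding N.level_def using subspace_0[OF sub(1)] lin_0[OF lin_powD V(1), of m] by force
  qed
  ultimately obtain \<alpha> where a: "adjoint_form ?N \<alpha> x y" using N.adjoint_form_nilpotent by blast
  obtain \<beta> where b: "adjoint_form ?I \<beta> x y" using I.adjoint_form_invertible[OF ex m(2)] by blast
  show ?thesis
    by (rule adjoint_form_direct_sum[OF m(1) lin_x _ _ lin_y _ _ a b]) (use sN(3,4) sI(3,4) in blast)+
qed

end

section \<open>Norms in a group algebra\<close>

text \<open>Axioms modelled on the conjugation of the field with q^2 elements over the field with q
  elements.\<close>

locale quadratic_conjugation =
  fixes \<sigma> :: "'k::field \<Rightarrow> 'k"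
  assumes \<sigma>_add: "\<sigma> (a + b) = \<sigma> a + \<sigma> b" and \<sigma>_mult: "\<sigma> (a * b) = \<sigma> a * \<sigma> b"
    and \<sigma>_1: "\<sigma> 1 = 1" and \<sigma>_\<sigma>: "\<sigma> (\<sigma> a) = a"
    and ex_norm: "\<sigma> a = a \<Longrightarrow> a \<noteq> 0 \<Longrightarrow> \<exists>b. b * \<sigma> b = a"
    and ex_sqrt: "\<sigma> a = a \<Longrightarrow> \<exists>b. b * b = a \<and> (\<sigma> b = b \<or> \<sigma> b = - b)"
    and ex_nonfixed: "\<exists>a. \<sigma> a \<noteq> a"
begin

lemma \<sigma>_0 [simp]: "\<sigma> 0 = 0" using \<sigma>_add[of 0 0] by (simp only: add_0_left) (metis add_cancel_right_right)

lemma \<sigma>_minus: "\<sigma> (- a) = - \<sigma> a"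
  using \<sigma>_add[of a "-a"] by (simp add: add_eq_0_iff)

lemma \<sigma>_diff: "\<sigma> (a - b) = \<sigma> a - \<sigma> b"
  using \<sigma>_add[of a "-b"] by (simp add: \<sigma>_minus)

lemma \<sigma>_inverse: "\<sigma> (inverse a) = inverse (\<sigma> a)"
proof (cases "a = 0")
  case False
  have "\<sigma> a * \<sigma> (inverse a) = 1" using False by (simp add: \<sigma>_mult[symmetric] \<sigma>_1)
  then show ?thesis by (simp add: inverse_unique)
qed simp

lemma \<sigma>_sum: "\<sigma> (\<Sum>i\<in>A. f i) = (\<Sum>i\<in>A. \<sigma> (f i))"
  by (induction A rule: infinite_finite_induct) (simp_all add: \<sigma>_add)

definition bar :: "'k poly \<Rightarrow> 'k poly" where "bar = map_poly \<sigma>"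

lemma coeff_bar: "coeff (bar p) i = \<sigma> (coeff p i)"
  by (simp add: bar_def coeff_map_poly)

lemma bar_add: "bar (p + q) = bar p + bar q"
  by (rule poly_eqI) (simp add: coeff_bar \<sigma>_add)

lemma bar_diff: "bar (p - q) = bar p - bar q"
  by (rule poly_eqI) (simp add: coeff_bar \<sigma>_diff)

lemma bar_mult: "bar (p * q) = bar p * bar q"
  by (rule poly_eqI) (simp add: coeff_bar coeff_mult \<sigma>_sum \<sigma>_mult)

lemma bar_const [simp]: "bar [:a:] = [:\<sigma> a:]"
  by (rule poly_eqI) (simp add: coeff_bar coeff_pCons split: nat.split)

lemma bar_pCons: "bar (pCons a p) = pCons (\<sigma> a) (bar p)"
  by (rule poly_eqI) (simp add: coeff_bar coeff_pCons split: nat.split)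

lemma bar_1 [simp]: "bar 1 = 1" by (simp add: one_pCons \<sigma>_1)

lemma bar_0 [simp]: "bar 0 = 0" by (simp add: bar_def)

lemma bar_power: "bar (p ^ i) = bar p ^ i"
  by (induction i) (simp_all add: bar_mult)

lemma bar_bar [simp]: "bar (bar p) = p"
  by (rule poly_eqI) (simp add: coeff_bar \<sigma>_\<sigma>)

section \<open>Norms modulo a polynomial that is fixed by conjugation\<close>

context
  fixes m :: "'k poly" assumes bar_m: "bar m = m"
begin

definition eqv :: "'k poly \<Rightarrow> 'k poly \<Rightarrow> bool" (infix "~~" 50) where "a ~~ b \<longleftrightarrow> m dvd (a - b)"

lemma eqv_refl: "a ~~ a" by (simp add: eqv_def)
lemma eqv_sym: "a ~~ b \<Longrightarrow> b ~~ a" unfolding eqv_def by (metis dvd_minus_iff minus_diff_eq)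
lemma eqv_trans [trans]: "a ~~ b \<Longrightarrow> b ~~ c \<Longrightarrow> a ~~ c"
  using dvd_add[of m "a - b" "b - c"] by (simp add: eqv_def)
lemma eqv_add: "a ~~ b \<Longrightarrow> c ~~ d \<Longrightarrow> a + c ~~ b + d"
  using dvd_add[of m "a - b" "c - d"] by (simp add: eqv_def algebra_simps)
lemma eqv_mult: assumes "a ~~ b" "c ~~ d" shows "a * c ~~ b * d"
proof -
  have "m dvd (a - b) * c + b * (c - d)" using assms by (simp add: eqv_def)
  then show ?thesis by (simp add: eqv_def algebra_simps)
qed
lemma eqv_power: "a ~~ b \<Longrightarrow> a ^ n ~~ b ^ n"
  by (induction n) (simp_all add: eqv_mult eqv_refl)

text \<open>On \<open>e\<close> one has (w - B) (w + B) = 0, and \<open>i\<close> inverts 2 B;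
  \<open>p\<close> and \<open>q\<close> are the projections to w = B and w = - B. Each congruence
  comes from an explicit combination of the hypotheses.\<close>

lemma split_idempotent:
  assumes e: "e * e ~~ e" and w: "w * w * e ~~ B * B * e" and i: "2 * B * i = 1"
  defines "p \<equiv> e * (B + w) * i" and "q \<equiv> e * (B - w) * i"
  shows "p * p ~~ p" "q * q ~~ q" "p * q ~~ 0" "p + q = e" "w * p ~~ B * p" "w * q ~~ (- B) * q"
proof -
  obtain u where u: "e * e - e = m * u" using e unfolding eqv_def by (elim dvdE)
  obtain v where v: "w * w * e - B * B * e = m * v" using w unfolding eqv_def by (elim dvdE)
  have "p * p - p = (e * e - e) * ((B + w) * (B + w) * i * i) + (w * w * e - B * B * e) * (i * i)
      + e * (B + w) * i * (2 * B * i - 1)"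
    unfolding p_def by (simp add: algebra_simps)
  then show "p * p ~~ p" unfolding i u v by (simp add: eqv_def)
  have "q * q - q = (e * e - e) * ((B - w) * (B - w) * i * i) + (w * w * e - B * B * e) * (i * i)
      + e * (B - w) * i * (2 * B * i - 1)"
    unfolding q_def by (simp add: algebra_simps)
  then show "q * q ~~ q" unfolding i u v by (simp add: eqv_def)
  have "p * q = (e * e - e) * ((B * B - w * w) * i * i) - (w * w * e - B * B * e) * (i * i)"
    unfolding p_def q_def by (simp add: algebra_simps)
  then show "p * q ~~ 0" unfolding u v by (simp add: eqv_def)
  have "p + q = e * (2 * B * i)" unfolding p_def q_def by (simp add: algebra_simps)
  then show "p + q = e" unfolding i by simp
  have "w * p - B * p = (w * w * e - B * B * e) * i" unfolding p_def by (simp add: algebra_simps)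
  then show "w * p ~~ B * p" unfolding v by (simp add: eqv_def)
  have "w * q - (- B) * q = - (w * w * e - B * B * e) * i" unfolding q_def by (simp add: algebra_simps)
  then show "w * q ~~ (- B) * q" unfolding v by (simp add: eqv_def)
qed

text \<open>Write \<open>w = c ^ 2 ^ (r - 1)\<close>, so that \<open>w\<^sup>2 = \<alpha>\<close> on \<open>e\<close>. If \<open>\<alpha> = \<beta>\<^sup>2\<close> with \<open>\<sigma> \<beta> = \<beta>\<close>, then \<open>e\<close> splits
  into the idempotents on which \<open>w = \<plusminus>\<beta>\<close>. If \<open>\<alpha> = \<kappa>\<^sup>2\<close> with \<open>\<sigma> \<kappa> = - \<kappa>\<close>, then the idempotent \<open>f\<close> on
  which \<open>w = \<kappa>\<close> satisfies \<open>e = f + bar f\<close>, and \<open>f c + bar f\<close> has norm \<open>c\<close> on \<open>e\<close>.\<close>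

lemma norm_on_idempotent:
  assumes two: "(2::'k) \<noteq> 0" and c: "bar c = c"
    and "\<sigma> \<alpha> = \<alpha>" "\<alpha> \<noteq> 0" and "e * e ~~ e" "bar e ~~ e" and "c ^ (2 ^ r) * e ~~ [:\<alpha>:] * e"
  shows "\<exists>b. b * bar b * e ~~ c * e"
  using assms(3-)
proof (induction r arbitrary: \<alpha> e)
  case 0
  obtain \<nu> where \<nu>: "\<nu> * \<sigma> \<nu> = \<alpha>" using ex_norm 0(1,2) by blast
  have "[:\<nu>:] * bar [:\<nu>:] * e = [:\<alpha>:] * e" using \<nu> by (simp add: mult.commute)
  then show ?case using eqv_sym[OF 0(5)] by (intro exI[of _ "[:\<nu>:]"]) simp
next
  case (Suc r)
  define w where "w = c ^ (2 ^ r)"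
  have bw: "bar w = w" unfolding w_def bar_power c ..
  obtain \<beta> where \<beta>: "\<beta> * \<beta> = \<alpha>" "\<sigma> \<beta> = \<beta> \<or> \<sigma> \<beta> = - \<beta>" using ex_sqrt[OF Suc.prems(1)] by blast
  define B i where "B = [:\<beta>:]" and "i = [:inverse (2 * \<beta>):]"
  have \<beta>0: "\<beta> \<noteq> 0" using \<beta>(1) Suc.prems(2) by auto
  have two_poly: "(2::'k poly) = [:2:]" by (simp add: numeral_poly)
  have i: "2 * B * i = 1" unfolding B_def i_def two_poly using two \<beta>0 by (simp add: one_pCons)
  have w: "w * w * e ~~ B * B * e"
    using Suc.prems(5) \<beta>(1) unfolding w_def B_def by (simp add: power_add[symmetric] mult_2)
  define p q where "p = e * (B + w) * i" and "q = e * (B - w) * i"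
  note pq = split_idempotent[OF Suc.prems(3) w i, folded p_def q_def]
  have s2: "\<sigma> 2 = 2" using \<sigma>_add[of 1 1] \<sigma>_1 by simp
  have si: "\<sigma> (inverse (2 * \<beta>)) = inverse (2 * \<sigma> \<beta>)" by (simp only: \<sigma>_inverse \<sigma>_mult s2)
  show ?case
  proof (cases "\<sigma> \<beta> = \<beta>")
    case True
    then have Bi: "bar B = B" "bar i = i" unfolding B_def i_def bar_const si by simp_all
    have bp: "bar p ~~ p" unfolding p_def bar_mult bar_add Bi bw
      by (intro eqv_mult eqv_refl Suc.prems(4))
    have bq: "bar q ~~ q" unfolding q_def bar_mult bar_diff Bi bw
      by (intro eqv_mult eqv_refl Suc.prems(4))
    obtain b1 where b1: "b1 * bar b1 * p ~~ c * p"
      using Suc.IH[OF True \<beta>0 pq(1) bp] pq(5) unfolding w_def B_def by blast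
    have "[:- \<beta>:] = - B" by (simp add: B_def)
    then obtain b2 where b2: "b2 * bar b2 * q ~~ c * q"
      using Suc.IH[of "- \<beta>", OF _ _ pq(2) bq] pq(6) True \<beta>0 \<sigma>_minus unfolding w_def by auto
    define b where "b = b1 * p + b2 * q"
    have qp: "q * p ~~ 0" using pq(3) by (simp add: mult.commute)
    have bb: "bar b ~~ bar b1 * p + bar b2 * q"
      unfolding b_def bar_add bar_mult by (intro eqv_add eqv_mult eqv_refl bp bq)
    have "b * bar b * e ~~ (b1 * p + b2 * q) * (bar b1 * p + bar b2 * q) * (p + q)"
      unfolding b_def[symmetric] pq(4) by (intro eqv_mult eqv_refl bb)
    also have "\<dots> = (b1 * bar b1) * (p * p) * p + (b2 * bar b2) * (q * q) * q
        + (p * q) * (b1 * bar b1 * p + b1 * bar b2 * (p + q) + b2 * bar b1 * (p + q) + b2 * bar b2 * q)"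
      by (simp add: algebra_simps)
    also have "\<dots> ~~ (b1 * bar b1) * p * p + (b2 * bar b2) * q * q
        + 0 * (b1 * bar b1 * p + b1 * bar b2 * (p + q) + b2 * bar b1 * (p + q) + b2 * bar b2 * q)"
      by (intro eqv_mult eqv_add eqv_refl pq(1,2,3))
    also have "\<dots> = (b1 * bar b1) * (p * p) + (b2 * bar b2) * (q * q)" by (simp add: algebra_simps)
    also have "\<dots> ~~ (b1 * bar b1) * p + (b2 * bar b2) * q"
      by (intro eqv_mult eqv_add eqv_refl pq(1,2))
    also have "\<dots> ~~ c * p + c * q" by (intro eqv_add b1 b2)
    also have "\<dots> = c * e" unfolding pq(4)[symmetric] by (simp add: algebra_simps)
    finally show ?thesis by blast
  next
    case False
    then have "\<sigma> \<beta> = - \<beta>" using \<beta>(2) by blast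
    then have Bi: "bar B = - B" "bar i = - i" unfolding B_def i_def bar_const si by simp_all
    have bp: "bar p ~~ q"
    proof -
      have "bar p ~~ e * (- B + w) * (- i)" unfolding p_def bar_mult bar_add Bi bw
        by (intro eqv_mult eqv_refl Suc.prems(4))
      also have "\<dots> = q" unfolding q_def by (simp add: algebra_simps)
      finally show ?thesis .
    qed
    have bq: "bar q ~~ p"
    proof -
      have "bar q ~~ e * (- B - w) * (- i)" unfolding q_def bar_mult bar_diff Bi bw
        by (intro eqv_mult eqv_refl Suc.prems(4))
      also have "\<dots> = p" unfolding p_def by (simp add: algebra_simps)
      finally show ?thesis .
    qed
    define b where "b = p * c + q"
    have bb: "bar b ~~ q * c + p"
      unfolding b_def bar_add bar_mult c by (intro eqv_add eqv_mult eqv_refl bp bq)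
    have "b * bar b * e ~~ (p * c + q) * (q * c + p) * e"
      unfolding b_def[symmetric] by (intro eqv_mult eqv_refl bb)
    also have "\<dots> = (p * q) * (c * c + 1) * e + (p * p) * c * e + (q * q) * c * e" by (simp add: algebra_simps)
    also have "\<dots> ~~ 0 * (c * c + 1) * e + p * c * e + q * c * e"
      by (intro eqv_mult eqv_add eqv_refl pq(1,2,3))
    also have "\<dots> = c * (e * e)" unfolding pq(4)[symmetric] by (simp add: algebra_simps)
    also have "\<dots> ~~ c * e" by (intro eqv_mult eqv_refl Suc.prems(3))
    finally show ?thesis by blast
  qed
qed

text \<open>Write N(b) for b times its conjugate. With T + bar T = 1 the element b0 = bar T + T c
  has norm c + T (bar T) (1 + c)^2. So c' = N(b0) / c differs from 1 by a multiple of (1 + c)^2, and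
  the Frobenius map shows that its order divides 2^r, half of the bound for \<open>c\<close>. A
  solution for c' corrects \<open>b0\<close>.\<close>

lemma norm_char_2:
  assumes two: "(2::'k) = 0" and c: "bar c = c" "c ^ (2 ^ r) ~~ 1"
  shows "\<exists>b. b * bar b ~~ c"
  using c
proof (induction r arbitrary: c)
  case 0
  then show ?case using eqv_sym[of c 1] by (intro exI[of _ 1]) simp
next
  case (Suc r)
  have two_poly: "(2::'k poly) = 0" using two by (simp add: numeral_poly)
  obtain \<omega> where \<omega>: "\<sigma> \<omega> \<noteq> \<omega>" using ex_nonfixed by blast
  \<comment> \<open>The trace of \<omega>; as - 1 = 1, it is nonzero exactly because \<omega> is not
    fixed. Dividing by it yields conjugate elements with sum 1.\<close>
  define t where "t = \<omega> + \<sigma> \<omega>"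
  have mm: "- a = a" for a :: 'k
  proof -
    have "a + a = 2 * a" by simp
    then have "a + a = 0" using two by simp
    then show ?thesis by (simp add: add_eq_0_iff)
  qed
  have t0: "t \<noteq> 0" using \<omega> mm[of \<omega>] unfolding t_def by (metis add_eq_0_iff)
  have st: "\<sigma> t = t" unfolding t_def by (simp add: \<sigma>_add \<sigma>_\<sigma> add.commute)
  define T T' where "T = [:\<omega> * inverse t:]" and "T' = [:\<sigma> \<omega> * inverse t:]"
  have bT: "bar T = T'" "bar T' = T" unfolding T_def T'_def by (simp_all add: \<sigma>_mult \<sigma>_inverse st \<sigma>_\<sigma>)
  have TT: "T + T' = 1" unfolding T_def T'_def using t0
    by (simp add: distrib_right[symmetric] t_def[symmetric] one_pCons)
  define b0 where "b0 = T' + T * c"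
  have bb0: "bar b0 = T + T' * c" unfolding b0_def bar_add bar_mult bT Suc.prems(1) ..
  have n0: "b0 * bar b0 = c + (T * T') * (1 + c) ^ 2"
  proof -
    have T': "T' = 1 - T" using TT by (simp add: eq_diff_eq add.commute)
    have "b0 * bar b0 = c + (T * T') * (1 + c) ^ 2 - 2 * (2 * T * T' * c)"
      unfolding bb0 unfolding b0_def T' by (simp add: algebra_simps power2_eq_square)
    then show ?thesis using two_poly by simp
  qed
  \<comment> \<open>The inverse of \<open>c\<close> modulo \<open>m\<close>.\<close>
  define d where "d = c ^ (2 ^ Suc r - 1)"
  have "c * d = c ^ Suc (2 ^ Suc r - 1)" unfolding d_def by (simp only: power_Suc)
  also have "Suc (2 ^ Suc r - 1) = (2::nat) ^ Suc r" by simp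
  finally have cd: "c * d ~~ 1" using Suc.prems(2) by simp
  define c' where "c' = b0 * bar b0 * d"
  have bd: "bar d = d" unfolding d_def bar_power Suc.prems(1) ..
  have bc': "bar c' = c'" unfolding c'_def by (simp add: bar_mult bd mult.commute)
  define z where "z = (T * T') * (1 + c) ^ 2 * d"
  have "c' = c * d + z" unfolding c'_def n0 z_def by (simp add: algebra_simps)
  then have c'z: "c' ~~ 1 + z" using eqv_add[OF cd eqv_refl[of z]] by simp
  have fresh: "(a + b) ^ (2 ^ n) = a ^ (2 ^ n) + b ^ (2 ^ n)" for a b :: "'k poly" and n
  proof (induction n)
    case (Suc n)
    have "(a + b) ^ (2 ^ Suc n) = ((a + b) ^ (2 ^ n)) ^ 2" by (simp add: power_mult[symmetric] mult.commute)
    also have "\<dots> = (a ^ (2 ^ n)) ^ 2 + (b ^ (2 ^ n)) ^ 2 + 2 * (a ^ (2 ^ n) * b ^ (2 ^ n))"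
      unfolding Suc by (simp add: algebra_simps power2_eq_square)
    also have "\<dots> = a ^ (2 ^ Suc n) + b ^ (2 ^ Suc n)"
      using two_poly by (simp add: power_mult[symmetric] mult.commute)
    finally show ?case .
  qed simp
  have "z ^ (2 ^ r) = (T * T') ^ (2 ^ r) * (1 + c) ^ (2 ^ Suc r) * d ^ (2 ^ r)"
    unfolding z_def by (simp add: power_mult_distrib power_mult[symmetric])
  also have "\<dots> = (T * T') ^ (2 ^ r) * (1 + c ^ (2 ^ Suc r)) * d ^ (2 ^ r)" unfolding fresh by simp
  also have "\<dots> ~~ (T * T') ^ (2 ^ r) * (1 + 1) * d ^ (2 ^ r)"
    by (intro eqv_mult eqv_add eqv_refl Suc.prems(2))
  also have "\<dots> = 0" using two_poly by simp
  finally have z0: "z ^ (2 ^ r) ~~ 0" .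
  have c'1: "c' ^ (2 ^ r) ~~ 1"
  proof -
    have "c' ^ (2 ^ r) ~~ (1 + z) ^ (2 ^ r)" by (rule eqv_power[OF c'z])
    also have "\<dots> = 1 + z ^ (2 ^ r)" unfolding fresh by simp
    also have "\<dots> ~~ 1 + 0" by (intro eqv_add eqv_refl z0)
    finally show ?thesis by simp
  qed
  obtain b' where b': "b' * bar b' ~~ c'" using Suc.IH[OF bc' c'1] by blast
  \<comment> \<open>The exponent 2^r - 1 inverts c', so the norm of \<open>b\<close> is N(b0) / c',
    which is \<open>c\<close>.\<close>
  define b where "b = b0 * b' ^ (2 ^ r - 1)"
  have "b * bar b = (b0 * bar b0) * (b' * bar b') ^ (2 ^ r - 1)"
    unfolding b_def bar_mult bar_power power_mult_distrib by (simp add: algebra_simps)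
  also have "\<dots> ~~ (b0 * bar b0) * c' ^ (2 ^ r - 1)"
    by (intro eqv_mult eqv_refl eqv_power b')
  finally have 1: "b * bar b ~~ (b0 * bar b0) * c' ^ (2 ^ r - 1)" .
  have "c' * c = (b0 * bar b0) * (c * d)" unfolding c'_def by (simp add: algebra_simps)
  then have "c' * c ~~ b0 * bar b0" using eqv_mult[OF eqv_refl[of "b0 * bar b0"] cd] by (simp only: mult_1_right)
  then have "(b0 * bar b0) * c' ^ (2 ^ r - 1) ~~ (c' * c) * c' ^ (2 ^ r - 1)"
    by (rule eqv_mult[OF eqv_sym eqv_refl])
  also have "\<dots> = c' ^ Suc (2 ^ r - 1) * c" by (simp only: power_Suc mult_ac)
  also have "Suc (2 ^ r - 1) = (2::nat) ^ r" by simp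
  also have "c' ^ (2 ^ r) * c ~~ 1 * c" by (intro eqv_mult eqv_refl c'1)
  finally have "(b0 * bar b0) * c' ^ (2 ^ r - 1) ~~ c" by simp
  with 1 have "b * bar b ~~ c" by (rule eqv_trans)
  then show ?case by blast
qed

lemma norm_2_power_order:
  assumes "bar c = c" "c ^ (2 ^ r) ~~ 1" shows "\<exists>b. b * bar b ~~ c"
proof (cases "(2::'k) = 0")
  case True
  then show ?thesis using norm_char_2 assms by blast
next
  case False
  then show ?thesis using norm_on_idempotent[OF False assms(1), of 1 1 r] assms(2) \<sigma>_1 by (simp add: one_pCons[symmetric] eqv_refl)
qed

end

text \<open>X generates the group algebra of a cyclic group of order \<open>M\<close>. Its power
  X^m' with m' the odd part of \<open>M\<close> has 2-power order and is a norm by the previous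
  lemma; modulo X^M = 1, X itself differs from it by a square X^(2 k), which is the norm of X^k
  because X is its own conjugate.\<close>

theorem ex_poly_norm:
  assumes M: "M > 0" shows "\<exists>P. (monom 1 M - 1) dvd (P * bar P - [:0, 1:])"
proof -
  let ?X = "[:0, 1::'k:]"
  define m where "m = ?X ^ M - 1"
  have m: "m = monom 1 M - 1" unfolding m_def by (simp add: monom_altdef)
  have bX: "bar ?X = ?X" by (simp add: bar_pCons \<sigma>_1)
  have bm: "bar m = m" unfolding m_def by (simp add: bar_diff bar_power bX)
  obtain r m' where rm: "M = 2 ^ r * m'" "odd m'"
  proof -
    obtain m' where "M = 2 ^ multiplicity 2 M * m'" "\<not> 2 dvd m'"
      using multiplicity_decompose'[of M 2] M by auto
    then show ?thesis using that by blast
  qed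
  define c where "c = ?X ^ m'"
  have bc: "bar c = c" unfolding c_def bar_power bX ..
  have "c ^ (2 ^ r) = ?X ^ M" unfolding c_def rm(1) by (simp add: power_mult[symmetric] mult.commute)
  then have "m dvd (c ^ (2 ^ r) - 1)" unfolding m_def by simp
  then obtain b0 where b0: "m dvd (b0 * bar b0 - c)" using norm_2_power_order[OF bm bc, unfolded eqv_def[OF bm]] by blast
  \<comment> \<open>Chosen so that m' + 2 k = 1 + 2 M m', which is 1 modulo \<open>M\<close>; the
    division is exact because m' is odd.\<close>
  define k where "k = (2 * M * m' + 1 - m') div 2"
  have "m' \<le> 2 * M * m'" using M by simp
  have "even (2 * M * m' + 1 - m')" using rm(2) by simp
  then have "2 * k = 2 * M * m' + 1 - m'" unfolding k_def by simp
  moreover have "m' + (2 * M * m' + 1 - m') = 2 * M * m' + 1" using \<open>m' \<le> 2 * M * m'\<close> by linarith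
  ultimately have k: "m' + 2 * k = 1 + M * (2 * m')" by simp
  define P where "P = b0 * ?X ^ k"
  have "P * bar P = (b0 * bar b0) * ?X ^ (2 * k)"
    unfolding P_def by (simp add: bar_mult bar_power bX mult_2 power_add)
  then have 1: "m dvd (P * bar P - c * ?X ^ (2 * k))"
    using dvd_mult2[OF b0, of "?X ^ (2 * k)"] by (simp only: left_diff_distrib)
  have "c * ?X ^ (2 * k) = ?X * (?X ^ M) ^ (2 * m')"
    unfolding c_def power_add[symmetric] k by (simp add: power_add power_mult)
  then have "c * ?X ^ (2 * k) - ?X = ?X * ((?X ^ M) ^ (2 * m') - 1)" by (simp only: right_diff_distrib mult_1_right)
  moreover have "m dvd ((?X ^ M) ^ (2 * m') - 1)"
    using eqv_power[OF bm, of "?X ^ M" 1 "2 * m'"] by (simp add: eqv_def[OF bm] m_def[symmetric])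
  ultimately have "m dvd (c * ?X ^ (2 * k) - ?X)" by (simp only: dvd_mult)
  with 1 have "m dvd (P * bar P - ?X)" by (rule eqv_trans[OF bm, unfolded eqv_def[OF bm]])
  then show ?thesis unfolding m by blast
qed

end

section \<open>Matrices and the Shalika subgroup\<close>

lemma GL_simps [simp]: "x \<otimes>\<^bsub>GL m\<^esub> y = x * y" "\<one>\<^bsub>GL m\<^esub> = 1\<^sub>m m"
  by (auto simp: GL_def units_of_def ring_mat_def)

lemma GL_carrier:
  "A \<in> carrier (GL m) \<longleftrightarrow> A \<in> carrier_mat m m \<and> (\<exists>B\<in>carrier_mat m m. A * B = 1\<^sub>m m \<and> B * A = 1\<^sub>m m)"
  by (auto simp: GL_def units_of_def ring_mat_def Units_def)

lemma group_GL: "group (GL m)"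
proof -
  interpret ring "ring_mat TYPE('a::field) m ()" by (rule ring_mat)
  show ?thesis unfolding GL_def by (rule units_group)
qed

lemma GL_in_carrier_mat: "A \<in> carrier (GL m) \<Longrightarrow> A \<in> carrier_mat m m"
  by (simp add: GL_carrier)

lemma GL_inv:
  assumes "A \<in> carrier (GL m)"
  shows "inv\<^bsub>GL m\<^esub> A \<in> carrier (GL m)" "inv\<^bsub>GL m\<^esub> A * A = 1\<^sub>m m" "A * inv\<^bsub>GL m\<^esub> A = 1\<^sub>m m"
    "inv\<^bsub>GL m\<^esub> A \<in> carrier_mat m m"
proof -
  interpret group "GL m" by (rule group_GL)
  show 1: "inv\<^bsub>GL m\<^esub> A \<in> carrier (GL m)" "inv\<^bsub>GL m\<^esub> A * A = 1\<^sub>m m" "A * inv\<^bsub>GL m\<^esub> A = 1\<^sub>m m"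
    using assms l_inv[of A] r_inv[of A] by auto
  show "inv\<^bsub>GL m\<^esub> A \<in> carrier_mat m m" by (rule GL_in_carrier_mat[OF 1(1)])
qed

lemma GL_mult: "A \<in> carrier (GL m) \<Longrightarrow> B \<in> carrier (GL m) \<Longrightarrow> A * B \<in> carrier (GL m)"
  using group.is_monoid[OF group_GL[of m], THEN monoid.m_closed, of A B] by simp

lemma GL_inv_mult:
  "A \<in> carrier (GL m) \<Longrightarrow> B \<in> carrier (GL m) \<Longrightarrow> inv\<^bsub>GL m\<^esub> (A * B) = inv\<^bsub>GL m\<^esub> B * inv\<^bsub>GL m\<^esub> A"
  using group.inv_mult_group[OF group_GL[of m], of A B] by simp

lemma GL_inv_inv: "A \<in> carrier (GL m) \<Longrightarrow> inv\<^bsub>GL m\<^esub> (inv\<^bsub>GL m\<^esub> A) = A"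
  using group.inv_inv[OF group_GL[of m], of A] by simp

lemma GL_inv_unique:
  assumes "A \<in> carrier_mat m m" "B \<in> carrier_mat m m" "A * B = 1\<^sub>m m" "B * A = 1\<^sub>m m"
  shows "A \<in> carrier (GL m)" "inv\<^bsub>GL m\<^esub> A = B"
proof -
  show A: "A \<in> carrier (GL m)" using assms by (auto simp: GL_carrier)
  have "B \<in> carrier (GL m)" using assms by (auto simp: GL_carrier)
  then show "inv\<^bsub>GL m\<^esub> A = B"
    using group.inv_equality[OF group_GL[of m], of B A] A assms(4) by simp
qed

lemma sq_assoc:
  "A \<in> carrier_mat m m \<Longrightarrow> B \<in> carrier_mat m m \<Longrightarrow> C \<in> carrier_mat m m \<Longrightarrow> (A * B) * C = A * (B * C)"
  by (rule assoc_mult_mat)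

lemma sq_mult [simp]: "A \<in> carrier_mat m m \<Longrightarrow> B \<in> carrier_mat m m \<Longrightarrow> A * B \<in> carrier_mat m m"
  by (rule mult_carrier_mat)

lemma sq_cancel:
  fixes A :: "'a::semiring_1 mat"
  assumes "A \<in> carrier_mat m m" "B \<in> carrier_mat m m" "C \<in> carrier_mat m m" "A * B = 1\<^sub>m m"
  shows "A * (B * C) = C" "C * A * B = C"
  using assms left_mult_one_mat[of C m m] right_mult_one_mat[of C m m]
  by (simp_all only: sq_assoc[of A m B C, symmetric] sq_assoc[of C m A B])

lemma GL_inv_commute:
  assumes s: "s \<in> carrier (GL m)" and x: "x \<in> carrier_mat m m" and c: "s * x = x * s"
  shows "inv\<^bsub>GL m\<^esub> s * x = x * inv\<^bsub>GL m\<^esub> s"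
proof -
  let ?t = "inv\<^bsub>GL m\<^esub> s"
  note si = GL_inv[OF s] and sc = GL_in_carrier_mat[OF s]
  have "?t * x = ?t * (x * s) * ?t" using si sc x by (simp add: sq_assoc[of _ m])
  also have "\<dots> = x * ?t" unfolding c[symmetric] using si sc x by (simp add: sq_assoc[of _ m] sq_cancel[of ?t m s])
  finally show ?thesis .
qed

lemma mat_trace_mult:
  assumes A: "A \<in> carrier_mat p q" and B: "B \<in> carrier_mat q p"
  shows "mat_trace (A * B) = (\<Sum>i<p. \<Sum>j<q. A $$ (i, j) * B $$ (j, i))"
proof -
  have "dim_row (A * B) = p" using A by simp
  then have "mat_trace (A * B) = (\<Sum>i<p. (A * B) $$ (i, i))" by (simp add: mat_trace_def)
  also have "\<dots> = (\<Sum>i<p. \<Sum>j<q. A $$ (i, j) * B $$ (j, i))"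
    using A B by (intro sum.cong) (auto simp: scalar_prod_def atLeast0LessThan)
  finally show ?thesis .
qed

lemma mat_trace_comm:
  fixes A B :: "'a::comm_semiring_0 mat"
  assumes A: "A \<in> carrier_mat p q" and B: "B \<in> carrier_mat q p"
  shows "mat_trace (A * B) = mat_trace (B * A)"
  unfolding mat_trace_mult[OF A B] mat_trace_mult[OF B A]
  by (subst sum.swap) (simp add: mult.commute)

lemma mat_trace_add:
  "A \<in> carrier_mat m m \<Longrightarrow> B \<in> carrier_mat m m \<Longrightarrow> mat_trace (A + B) = mat_trace A + mat_trace B"
  by (auto simp: mat_trace_def sum.distrib)

lemma mat_trace_four_block:
  assumes "A \<in> carrier_mat p p" "D \<in> carrier_mat q q"
  shows "mat_trace (four_block_mat A B C D) = mat_trace A + mat_trace (D :: 'a::comm_monoid_add mat)"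
proof -
  let ?F = "four_block_mat A B C D"
  have d: "dim_row ?F = p + q" "dim_col ?F = p + q" using assms by auto
  have "mat_trace ?F = (\<Sum>i<p + q. if i < p then A $$ (i, i) else D $$ (i - p, i - p))"
    unfolding mat_trace_def d using assms by (intro sum.cong) auto
  also have "\<dots> = (\<Sum>i<p. A $$ (i, i)) + (\<Sum>i<q. D $$ (i, i))"
  proof (induction q)
    case (Suc q)
    then show ?case by (simp add: add.assoc)
  qed simp
  finally show ?thesis using assms by (simp add: mat_trace_def)
qed

section \<open>The standard square-zero matrix and its centraliser\<close>

definition X0 :: "nat \<Rightarrow> 'a::field mat" where "X0 n = four_block_mat (0\<^sub>m n n) (1\<^sub>m n) (0\<^sub>m n n) (0\<^sub>m n n)"
text \<open>The standard contracting homotopy of \<open>X0\<close>.\<close>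

definition H0 :: "nat \<Rightarrow> 'a::field mat" where "H0 n = four_block_mat (0\<^sub>m n n) (0\<^sub>m n n) (1\<^sub>m n) (0\<^sub>m n n)"
definition W0 :: "nat \<Rightarrow> 'a::field mat" where "W0 n = four_block_mat (0\<^sub>m n n) (1\<^sub>m n) (1\<^sub>m n) (0\<^sub>m n n)"

lemma block_mult:
  assumes "A \<in> carrier_mat n n" "B \<in> carrier_mat n n" "C \<in> carrier_mat n n" "D \<in> carrier_mat n n"
    "A' \<in> carrier_mat n n" "B' \<in> carrier_mat n n" "C' \<in> carrier_mat n n" "D' \<in> carrier_mat n n"
  shows "four_block_mat A B C D * four_block_mat A' B' C' D'
    = four_block_mat (A * A' + B * C') (A * B' + B * D') (C * A' + D * C') (C * B' + D * D')"
  by (rule mult_four_block_mat) (use assms in auto)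

lemma block_carrier:
  "A \<in> carrier_mat n n \<Longrightarrow> D \<in> carrier_mat n n \<Longrightarrow> four_block_mat A B C D \<in> carrier_mat (2 * n) (2 * n)"
  by (simp add: mult_2)

lemma block_eq:
  assumes "four_block_mat A B C D = four_block_mat A' B' C' D'"
    "A \<in> carrier_mat n n" "B \<in> carrier_mat n n" "C \<in> carrier_mat n n" "D \<in> carrier_mat n n"
    "A' \<in> carrier_mat n n" "B' \<in> carrier_mat n n" "C' \<in> carrier_mat n n" "D' \<in> carrier_mat n n"
  shows "A = A' \<and> B = B' \<and> C = C' \<and> D = D'"
proof -
  have e: "four_block_mat A B C D $$ (i, j) = four_block_mat A' B' C' D' $$ (i, j)" for i j
    using assms(1) by simp
  have "A = A'"
  proof (rule eq_matI)
    fix i j assume "i < dim_row A'" "j < dim_col A'"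
    then show "A $$ (i, j) = A' $$ (i, j)" using e[of i j] assms(2-9) by auto
  qed (use assms in auto)
  moreover have "B = B'"
  proof (rule eq_matI)
    fix i j assume "i < dim_row B'" "j < dim_col B'"
    then show "B $$ (i, j) = B' $$ (i, j)" using e[of i "j + n"] assms(2-9) by auto
  qed (use assms in auto)
  moreover have "C = C'"
  proof (rule eq_matI)
    fix i j assume "i < dim_row C'" "j < dim_col C'"
    then show "C $$ (i, j) = C' $$ (i, j)" using e[of "i + n" j] assms(2-9) by auto
  qed (use assms in auto)
  moreover have "D = D'"
  proof (rule eq_matI)
    fix i j assume "i < dim_row D'" "j < dim_col D'"
    then show "D $$ (i, j) = D' $$ (i, j)" using e[of "i + n" "j + n"] assms(2-9) by auto
  qed (use assms in auto)
  ultimately show ?thesis by blast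
qed

lemma ex_block:
  assumes "M \<in> carrier_mat (2 * n) (2 * n)"
  obtains A B C D where "A \<in> carrier_mat n n" "B \<in> carrier_mat n n" "C \<in> carrier_mat n n" "D \<in> carrier_mat n n"
    "M = four_block_mat A B C D"
proof -
  obtain A B C D where s: "split_block M n n = (A, B, C, D)" by (metis surj_pair)
  have "dim_row M = n + n" "dim_col M = n + n" using assms by auto
  from split_block[OF s this] show ?thesis using that by blast
qed

lemma split_block_four_block:
  assumes "A \<in> carrier_mat n n" "B \<in> carrier_mat n n" "C \<in> carrier_mat n n" "D \<in> carrier_mat n n"
  shows "split_block (four_block_mat A B C D) n n = (A, B, C, D)"
proof -
  obtain A' B' C' D' where s: "split_block (four_block_mat A B C D) n n = (A', B', C', D')" by (metis surj_pair)
  have "dim_row (four_block_mat A B C D) = n + n" "dim_col (four_block_mat A B C D) = n + n" using assms by auto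
  from split_block[OF s this] show ?thesis using block_eq[of A B C D A' B' C' D' n] assms s by simp
qed

lemma X0_carrier [simp]: "X0 n \<in> carrier_mat (2 * n) (2 * n)"
  and H0_carrier [simp]: "H0 n \<in> carrier_mat (2 * n) (2 * n)"
  and W0_carrier [simp]: "W0 n \<in> carrier_mat (2 * n) (2 * n)"
  unfolding X0_def H0_def W0_def by (auto intro!: block_carrier)

lemma one_block: "1\<^sub>m (2 * n) = four_block_mat (1\<^sub>m n) (0\<^sub>m n n) (0\<^sub>m n n) (1\<^sub>m n)"
  by (simp add: mult_2)

lemma zero_block: "0\<^sub>m (2 * n) (2 * n) = four_block_mat (0\<^sub>m n n) (0\<^sub>m n n) (0\<^sub>m n n) (0\<^sub>m n n)"
  by (simp add: mult_2)

lemma X0_X0: "X0 n * X0 n = 0\<^sub>m (2 * n) (2 * n)"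
  unfolding X0_def zero_block by (subst block_mult[of _ n]) auto

lemma H0_H0: "H0 n * H0 n = 0\<^sub>m (2 * n) (2 * n)"
  unfolding H0_def zero_block by (subst block_mult[of _ n]) auto

lemma X0_H0: "X0 n * H0 n + H0 n * X0 n = 1\<^sub>m (2 * n)"
  unfolding X0_def H0_def one_block
  by (subst block_mult[of _ n], simp_all)+ (subst add_four_block_mat[of _ n n _ n _ n], auto)

lemma W0_W0: "W0 n * W0 n = 1\<^sub>m (2 * n)"
  unfolding W0_def one_block by (subst block_mult[of _ n]) auto

lemma W0_GL: "W0 n \<in> carrier (GL (2 * n))" "inv\<^bsub>GL (2 * n)\<^esub> (W0 n) = W0 n"
  using GL_inv_unique[OF W0_carrier W0_carrier W0_W0 W0_W0] .

lemma W0_transpose: "transpose_mat (W0 n) = W0 n"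
  unfolding W0_def by (subst transpose_four_block_mat[of _ n n _ n _ n]) (auto simp: transpose_one)

lemma W0_X0: "W0 n * X0 n * W0 n = transpose_mat (X0 n)"
  unfolding W0_def X0_def
  by (subst transpose_four_block_mat[of _ n n _ n _ n], simp_all add: transpose_one)
    (subst block_mult[of _ n], simp_all, subst block_mult[of _ n], simp_all)

lemma Shalika_simps [simp]: "x \<otimes>\<^bsub>Shalika n\<^esub> y = x * y" "\<one>\<^bsub>Shalika n\<^esub> = 1\<^sub>m (2 * n)"
  by (simp_all add: Shalika_def)

lemma block_Shalika_inverse:
  fixes g :: "'a::field mat"
  assumes g: "g \<in> carrier (GL n)" and x: "x \<in> carrier_mat n n"
  defines "g' \<equiv> inv\<^bsub>GL n\<^esub> g"
  shows "four_block_mat g x (0\<^sub>m n n) g \<in> carrier (GL (2 * n))"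
    "inv\<^bsub>GL (2 * n)\<^esub> (four_block_mat g x (0\<^sub>m n n) g) = four_block_mat g' (- (g' * x * g')) (0\<^sub>m n n) g'"
proof -
  note gi = GL_inv[OF g, folded g'_def]
  note gc = GL_in_carrier_mat[OF g]
  have 1: "g * (- (g' * x * g')) + x * g' = 0\<^sub>m n n"
  proof -
    have "g * (g' * x * g') = x * g'" using gc gi x by (simp add: sq_assoc[of _ n] sq_cancel[of _ n])
    then have "g * (- (g' * x * g')) = - (x * g')"
      using gc gi x by (simp add: uminus_mult_right_mat)
    then show ?thesis using gi x by simp
  qed
  have 2: "g' * x + - (g' * x * g') * g = 0\<^sub>m n n"
  proof -
    have "g' * x * g' * g = g' * x" using gc gi x by (simp add: sq_assoc[of _ n])
    then have "- (g' * x * g') * g = - (g' * x)" using gc gi x by simp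
    then show ?thesis using gi x by (subst comm_add_mat[of _ n n]) auto
  qed
  let ?s = "four_block_mat g x (0\<^sub>m n n) g" and ?t = "four_block_mat g' (- (g' * x * g')) (0\<^sub>m n n) g'"
  have z: "- 0\<^sub>m n n = (0\<^sub>m n n :: 'a mat)" by (rule eq_matI) auto
  have 3: "?s * ?t = 1\<^sub>m (2 * n)"
    unfolding one_block using gc gi x 1 z by (subst block_mult[of _ n]) (auto simp del: four_block_one_mat)
  have 4: "?t * ?s = 1\<^sub>m (2 * n)"
    unfolding one_block using gc gi x 2 z by (subst block_mult[of _ n]) (auto simp del: four_block_one_mat)
  show "?s \<in> carrier (GL (2 * n))" "inv\<^bsub>GL (2 * n)\<^esub> ?s = ?t"
    using GL_inv_unique[of ?s "2 * n" ?t] 3 4 gc gi by (auto intro!: block_carrier)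
qed

lemma Shalika_block:
  "s \<in> carrier (Shalika n) \<longleftrightarrow> (\<exists>g x. g \<in> carrier (GL n) \<and> x \<in> carrier_mat n n \<and> s = four_block_mat g x (0\<^sub>m n n) g)"
  by (auto simp: Shalika_def)

text \<open>Comparing blocks in the commutation relation gives the Shalika shape. The inverse
  commutes as well and has the same shape, and its diagonal block inverts the one of
  \<open>s\<close>.\<close>

lemma Shalika_commute_X0:
  fixes s :: "'a::field mat"
  shows "s \<in> carrier (Shalika n) \<longleftrightarrow> s \<in> carrier (GL (2 * n)) \<and> s * X0 n = X0 n * s"
proof (safe)
  assume "s \<in> carrier (Shalika n)"
  then obtain g x where gx: "g \<in> carrier (GL n)" "x \<in> carrier_mat n n" "s = four_block_mat g x (0\<^sub>m n n) g"
    by (auto simp: Shalika_block)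
  show "s \<in> carrier (GL (2 * n))" unfolding gx(3) by (rule block_Shalika_inverse[OF gx(1,2)])
  note gc = GL_in_carrier_mat[OF gx(1)]
  show "s * X0 n = X0 n * s" unfolding gx(3) X0_def using gc gx(2)
    by (simp add: block_mult[of _ n])
next
  assume s: "s \<in> carrier (GL (2 * n))" and c: "s * X0 n = X0 n * s"
  have blocks: "\<exists>g x. g \<in> carrier_mat n n \<and> x \<in> carrier_mat n n \<and> t = four_block_mat g x (0\<^sub>m n n) g"
    if t: "t \<in> carrier_mat (2 * n) (2 * n)" and ct: "t * X0 n = X0 n * t" for t :: "'a mat"
  proof -
    obtain A B C D where b: "A \<in> carrier_mat n n" "B \<in> carrier_mat n n" "C \<in> carrier_mat n n"
        "D \<in> carrier_mat n n" "t = four_block_mat A B C D" using ex_block[OF t] by blast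
    have "t * X0 n = four_block_mat (0\<^sub>m n n) A (0\<^sub>m n n) C" "X0 n * t = four_block_mat C D (0\<^sub>m n n) (0\<^sub>m n n)"
      unfolding X0_def b(5) using b(1-4) by (simp_all add: block_mult[of _ n])
    with ct have "four_block_mat (0\<^sub>m n n) A (0\<^sub>m n n) C = four_block_mat C D (0\<^sub>m n n) (0\<^sub>m n n)" by simp
    from block_eq[OF this zero_carrier_mat b(1) zero_carrier_mat b(3) b(3,4) zero_carrier_mat zero_carrier_mat]
    have "C = 0\<^sub>m n n" "D = A" by (elim conjE; metis)+
    then show ?thesis using b by blast
  qed
  let ?t = "inv\<^bsub>GL (2 * n)\<^esub> s"
  note si = GL_inv[OF s] and sc = GL_in_carrier_mat[OF s]
  note ct = GL_inv_commute[OF s X0_carrier c]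
  obtain g x where gx: "g \<in> carrier_mat n n" "x \<in> carrier_mat n n" "s = four_block_mat g x (0\<^sub>m n n) g"
    using blocks[OF sc c] by blast
  obtain g' x' where gx': "g' \<in> carrier_mat n n" "x' \<in> carrier_mat n n" "?t = four_block_mat g' x' (0\<^sub>m n n) g'"
    using blocks[OF si(4) ct] by blast
  have diag: "a * b = 1\<^sub>m n"
    if c: "a \<in> carrier_mat n n" "u \<in> carrier_mat n n" "b \<in> carrier_mat n n" "v \<in> carrier_mat n n"
      and e: "four_block_mat a u (0\<^sub>m n n) a * four_block_mat b v (0\<^sub>m n n) b = 1\<^sub>m (2 * n)" for a b u v :: "'a mat"
  proof -
    have z: "0\<^sub>m n n \<in> carrier_mat n n" by simp
    have "four_block_mat a u (0\<^sub>m n n) a * four_block_mat b v (0\<^sub>m n n) b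
      = four_block_mat (a * b + u * 0\<^sub>m n n) (a * v + u * b) (0\<^sub>m n n * b + a * 0\<^sub>m n n) (0\<^sub>m n n * v + a * b)"
      by (rule block_mult[OF c(1,2) z c(1) c(3,4) z c(3)])
    then have "four_block_mat (a * b + u * 0\<^sub>m n n) (a * v + u * b) (0\<^sub>m n n * b + a * 0\<^sub>m n n) (0\<^sub>m n n * v + a * b)
      = four_block_mat (1\<^sub>m n) (0\<^sub>m n n) (0\<^sub>m n n) (1\<^sub>m n)" using e one_block[of n] by metis
    then have "a * b + u * 0\<^sub>m n n = 1\<^sub>m n"
      by (rule block_eq[where n = n, THEN conjunct1]) (use c in auto)
    then show ?thesis using c by simp
  qed
  have 1: "g * g' = 1\<^sub>m n" by (rule diag[OF gx(1,2) gx'(1,2)]) (use si(3) in \<open>unfold gx(3)[symmetric] gx'(3)[symmetric]\<close>)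
  have 2: "g' * g = 1\<^sub>m n" by (rule diag[OF gx'(1,2) gx(1,2)]) (use si(2) in \<open>unfold gx(3)[symmetric] gx'(3)[symmetric]\<close>)
  have "g \<in> carrier (GL n)" using 1 2 gx gx' by (auto simp: GL_carrier)
  then show "s \<in> carrier (Shalika n)" using gx by (auto simp: Shalika_block)
qed

lemma Shalika_GL: "s \<in> carrier (Shalika n) \<Longrightarrow> s \<in> carrier (GL (2 * n))"
  by (simp add: Shalika_commute_X0)

lemma Shalika_mult: "s \<in> carrier (Shalika n) \<Longrightarrow> t \<in> carrier (Shalika n) \<Longrightarrow> s * t \<in> carrier (Shalika n)"
  using sq_assoc[of s "2 * n" t "X0 n"] sq_assoc[of s "2 * n" "X0 n" t] sq_assoc[of "X0 n" "2 * n" s t]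
  by (simp add: Shalika_commute_X0 GL_mult GL_in_carrier_mat)

lemma Shalika_inv:
  assumes "s \<in> carrier (Shalika n)" shows "inv\<^bsub>GL (2 * n)\<^esub> s \<in> carrier (Shalika n)"
proof -
  have s: "s \<in> carrier (GL (2 * n))" "s * X0 n = X0 n * s" using assms by (simp_all add: Shalika_commute_X0)
  show ?thesis using GL_inv(1)[OF s(1)] GL_inv_commute[OF s(1) X0_carrier s(2)] by (simp add: Shalika_commute_X0)
qed

lemma GL_one: "1\<^sub>m m \<in> carrier (GL m)"
  using group.is_monoid[OF group_GL[of m], THEN monoid.one_closed] by simp

lemma Shalika_one: "1\<^sub>m (2 * n) \<in> carrier (Shalika n)"
  using X0_carrier left_mult_one_mat right_mult_one_mat by (metis Shalika_commute_X0 GL_one)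

text \<open>The additive logarithm of \<open>psi_S\<close>, stated over any field so that it can be
  computed over a finite field and then transported to the algebraic closure.\<close>

definition chiS :: "nat \<Rightarrow> 'a::field mat \<Rightarrow> 'a" where
  "chiS n s = (case split_block s n n of (g, x, _, _) \<Rightarrow> mat_trace (inv\<^bsub>GL n\<^esub> g * x))"

lemma chiS_block:
  assumes "g \<in> carrier (GL n)" "x \<in> carrier_mat n n"
  shows "chiS n (four_block_mat g x (0\<^sub>m n n) g) = mat_trace (inv\<^bsub>GL n\<^esub> g * x)"
  using split_block_four_block[of g n x "0\<^sub>m n n" g] assms GL_in_carrier_mat[OF assms(1)] by (simp add: chiS_def)

lemma chiS_mult:
  fixes s t :: "'a::field mat"
  assumes s: "s \<in> carrier (Shalika n)" and t: "t \<in> carrier (Shalika n)"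
  shows "chiS n (s * t) = chiS n s + chiS n t"
proof -
  obtain g x where gx: "g \<in> carrier (GL n)" "x \<in> carrier_mat n n" "s = four_block_mat g x (0\<^sub>m n n) g"
    using s by (auto simp: Shalika_block)
  obtain h y where hy: "h \<in> carrier (GL n)" "y \<in> carrier_mat n n" "t = four_block_mat h y (0\<^sub>m n n) h"
    using t by (auto simp: Shalika_block)
  note gc = GL_in_carrier_mat[OF gx(1)] GL_in_carrier_mat[OF hy(1)] and gi = GL_inv[OF gx(1)] GL_inv[OF hy(1)]
  have st: "s * t = four_block_mat (g * h) (g * y + x * h) (0\<^sub>m n n) (g * h)"
    unfolding gx(3) hy(3) using gc gx(2) hy(2) by (simp add: block_mult[of _ n])
  let ?g = "inv\<^bsub>GL n\<^esub> g" and ?h = "inv\<^bsub>GL n\<^esub> h"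
  have "?h * ?g * (g * y + x * h) = ?h * y + ?h * (?g * x * h)"
    using gc gi gx(2) hy(2) by (simp add: mult_add_distrib_mat[of _ n n _ n] sq_assoc[of _ n] sq_cancel[of _ n])
  then have "chiS n (s * t) = mat_trace (?h * y) + mat_trace (?h * (?g * x * h))"
    unfolding st using gc gi gx(2) hy(2) GL_mult[OF gx(1) hy(1)] GL_inv_mult[OF gx(1) hy(1)]
    by (simp add: chiS_block mat_trace_add[of _ n])
  also have "mat_trace (?h * (?g * x * h)) = mat_trace (?g * x * h * ?h)"
    by (rule mat_trace_comm[of _ n n]) (use gc gi gx(2) in auto)
  also have "?g * x * h * ?h = ?g * x"
    using gc gi gx(2) by (simp add: sq_assoc[of _ n])
  finally show ?thesis using gx hy by (simp add: chiS_block)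
qed

lemma chiS_one: "chiS n (1\<^sub>m (2 * n)) = 0"
  using chiS_mult[OF Shalika_one[of n] Shalika_one[of n]] left_mult_one_mat[OF one_carrier_mat[of "2 * n"]]
  by (metis add_cancel_left_left)

lemma chiS_inv:
  assumes "s \<in> carrier (Shalika n)" shows "chiS n (inv\<^bsub>GL (2 * n)\<^esub> s) = - chiS n s"
  using chiS_mult[OF Shalika_inv[OF assms] assms] GL_inv(2)[OF Shalika_GL[OF assms]] chiS_one[of n]
  by (metis eq_neg_iff_add_eq_0)

text \<open>The right side is \<open>dlog\<close> for the homotopy \<open>H0\<close>: the bridge
  from the concrete character to the abstract logarithm.\<close>

lemma chiS_trace:
  assumes s: "s \<in> carrier (Shalika n)"
  shows "chiS n s = mat_trace (inv\<^bsub>GL (2 * n)\<^esub> s * (X0 n * (H0 n * (s * H0 n))))"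
proof -
  obtain g x where gx: "g \<in> carrier (GL n)" "x \<in> carrier_mat n n" "s = four_block_mat g x (0\<^sub>m n n) g"
    using s by (auto simp: Shalika_block)
  note gc = GL_in_carrier_mat[OF gx(1)] and gi = GL_inv[OF gx(1)]
  let ?g = "inv\<^bsub>GL n\<^esub> g"
  have "X0 n * (H0 n * (s * H0 n)) = four_block_mat x (0\<^sub>m n n) (0\<^sub>m n n) (0\<^sub>m n n)"
    unfolding gx(3) X0_def H0_def using gc gx(2) by (simp add: block_mult[of _ n])
  then have "inv\<^bsub>GL (2 * n)\<^esub> s * (X0 n * (H0 n * (s * H0 n))) = four_block_mat (?g * x) (0\<^sub>m n n) (0\<^sub>m n n) (0\<^sub>m n n)"
    using gc gi gx(2) by (simp add: gx(3) block_Shalika_inverse[OF gx(1,2)] block_mult[of _ n])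
  then show ?thesis using gc gi gx
    by (simp add: chiS_block mat_trace_four_block[of _ n _ n]) (simp add: mat_trace_def)
qed

text \<open>Swapping the halves of the basis undoes the exchange of the off-diagonal blocks by
  transposition, so each block is merely transposed; the trace of a product ignores transposition
  and cyclic order.\<close>

lemma chiS_transpose:
  assumes s: "s \<in> carrier (Shalika n)"
  shows "chiS n (W0 n * transpose_mat s * W0 n) = chiS n s"
proof -
  obtain g x where gx: "g \<in> carrier (GL n)" "x \<in> carrier_mat n n" "s = four_block_mat g x (0\<^sub>m n n) g"
    using s by (auto simp: Shalika_block)
  note gc = GL_in_carrier_mat[OF gx(1)] and gi = GL_inv[OF gx(1)]
  let ?g = "inv\<^bsub>GL n\<^esub> g"
  have gt: "transpose_mat g \<in> carrier (GL n)" "inv\<^bsub>GL n\<^esub> (transpose_mat g) = transpose_mat ?g"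
    using GL_inv_unique[of "transpose_mat g" n "transpose_mat ?g"] gc gi
    by (simp_all flip: transpose_mult[of _ n n _ n] add: transpose_one)
  have "W0 n * transpose_mat s * W0 n = four_block_mat (transpose_mat g) (transpose_mat x) (0\<^sub>m n n) (transpose_mat g)"
    unfolding gx(3) W0_def using gc gx(2)
    by (simp add: transpose_four_block_mat[of _ n n _ n _ n] block_mult[of _ n])
  then have "chiS n (W0 n * transpose_mat s * W0 n) = mat_trace (transpose_mat ?g * transpose_mat x)"
    using gt gx by (simp add: chiS_block)
  also have "\<dots> = mat_trace (transpose_mat (x * ?g))" using gx gi by (simp add: transpose_mult[of _ n n _ n])
  also have "\<dots> = mat_trace (x * ?g)" using gx gi by (simp add: mat_trace_def)
  also have "\<dots> = mat_trace (?g * x)" using gx gi by (intro mat_trace_comm[of _ n n]) auto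
  finally show ?thesis using gx by (simp add: chiS_block)
qed

section \<open>Column vectors as functions on the natural numbers\<close>

definition fscale :: "'k::field \<Rightarrow> (nat \<Rightarrow> 'k) \<Rightarrow> nat \<Rightarrow> 'k" where "fscale c v = (\<lambda>i. c * v i)"

lemma vs_fscale: "vs fscale"
  by unfold_locales (auto simp: fscale_def fun_eq_iff algebra_simps)

interpretation fv: vs fscale by (rule vs_fscale)

lemma sum_fun_apply: "(\<Sum>a\<in>A. f a) i = (\<Sum>a\<in>A. f a i)" for f :: "'a \<Rightarrow> 'b \<Rightarrow> 'c::comm_monoid_add"
  by (induction A rule: infinite_finite_induct) simp_all

text \<open>Vectors of length \<open>N\<close> are functions that vanish from \<open>N\<close> on,
  so that all lengths live in one additive group, as \<open>vs\<close> demands.\<close>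

definition fV :: "nat \<Rightarrow> (nat \<Rightarrow> 'k::field) set" where "fV N = {v. \<forall>i\<ge>N. v i = 0}"

lemma subspace_fV: "fv.subspace (fV N)"
  by (rule fv.subspaceI) (auto simp: fV_def fscale_def)

lemma finite_fV: "finite (fV N :: (nat \<Rightarrow> 'k::{field,finite}) set)"
proof -
  have "fV N \<subseteq> {f. \<forall>i. (i \<in> {..<N} \<longrightarrow> f i \<in> UNIV) \<and> (i \<notin> {..<N} \<longrightarrow> f i = (0::'k))}"
    by (auto simp: fV_def)
  then show ?thesis by (rule finite_subset) (rule finite_set_of_finite_funs, auto)
qed

definition mv :: "nat \<Rightarrow> 'k::field mat \<Rightarrow> (nat \<Rightarrow> 'k) \<Rightarrow> nat \<Rightarrow> 'k" where
  "mv N M v = (\<lambda>i. if i < N then \<Sum>j<N. M $$ (i, j) * v j else 0)"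

definition unitf :: "nat \<Rightarrow> nat \<Rightarrow> 'k::field" where "unitf j = (\<lambda>i. if i = j then 1 else 0)"

text \<open>The matrix of \<open>f\<close> in the standard basis; it represents \<open>f\<close>
  only if \<open>f\<close> is linear on \<open>fV N\<close> and preserves it
  (\<open>mv_mt\<close>).\<close>

definition mt :: "nat \<Rightarrow> ((nat \<Rightarrow> 'k::field) \<Rightarrow> nat \<Rightarrow> 'k) \<Rightarrow> 'k mat" where
  "mt N f = mat N N (\<lambda>(i, j). f (unitf j) i)"

definition ftr :: "nat \<Rightarrow> ((nat \<Rightarrow> 'k::field) \<Rightarrow> nat \<Rightarrow> 'k) \<Rightarrow> 'k" where
  "ftr N f = (\<Sum>i<N. f (unitf i) i)"

lemma unitf_fV: "j < N \<Longrightarrow> unitf j \<in> fV N" by (auto simp: unitf_def fV_def)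

lemma mv_fV [simp]: "mv N M v \<in> fV N" by (simp add: mv_def fV_def)

lemma mv_add: "mv N M (u + v) = mv N M u + mv N M v"
  by (auto simp: mv_def fun_eq_iff algebra_simps sum.distrib)

lemma mv_scale: "mv N M (fscale c v) = fscale c (mv N M v)"
  by (auto simp: mv_def fun_eq_iff fscale_def sum_distrib_left algebra_simps)

lemma mv_lin: "fv.lin U (mv N M)" by (auto intro!: fv.linI simp: mv_add mv_scale)

lemma mv_0 [simp]: "mv N M 0 = 0" by (auto simp: mv_def fun_eq_iff)

lemma mv_mult:
  assumes "A \<in> carrier_mat N N" "B \<in> carrier_mat N N"
  shows "mv N (A * B) v = mv N A (mv N B v)"
proof
  fix i show "mv N (A * B) v i = mv N A (mv N B v) i"
  proof (cases "i < N")
    case True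
    have "(\<Sum>j<N. (A * B) $$ (i, j) * v j) = (\<Sum>j<N. \<Sum>k<N. A $$ (i, k) * B $$ (k, j) * v j)"
      using assms True by (intro sum.cong) (auto simp: scalar_prod_def atLeast0LessThan sum_distrib_right)
    also have "\<dots> = (\<Sum>k<N. A $$ (i, k) * (\<Sum>j<N. B $$ (k, j) * v j))"
      by (subst sum.swap) (simp add: sum_distrib_left mult.assoc)
    finally show ?thesis using True by (simp add: mv_def)
  qed (simp add: mv_def)
qed

lemma mv_plus: "A \<in> carrier_mat N N \<Longrightarrow> B \<in> carrier_mat N N \<Longrightarrow> mv N (A + B) v = mv N A v + mv N B v"
  by (auto simp: mv_def fun_eq_iff algebra_simps sum.distrib)

lemma mv_minus: "A \<in> carrier_mat N N \<Longrightarrow> B \<in> carrier_mat N N \<Longrightarrow> mv N (A - B) v = mv N A v - mv N B v"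
  by (auto simp: mv_def fun_eq_iff algebra_simps sum_subtractf)

lemma mv_smult: "A \<in> carrier_mat N N \<Longrightarrow> mv N (c \<cdot>\<^sub>m A) v = fscale c (mv N A v)"
  by (auto simp: mv_def fun_eq_iff fscale_def sum_distrib_left algebra_simps)

lemma mv_zero: "mv N (0\<^sub>m N N) v = 0"
  by (auto simp: mv_def fun_eq_iff)

lemma mv_one: "v \<in> fV N \<Longrightarrow> mv N (1\<^sub>m N) v = v"
proof
  fix i assume v: "v \<in> fV N"
  show "mv N (1\<^sub>m N) v i = v i"
  proof (cases "i < N")
    case True
    have "(\<Sum>j<N. 1\<^sub>m N $$ (i, j) * v j) = (\<Sum>j<N. if j = i then v j else 0)"
      using True by (intro sum.cong) auto
    then show ?thesis using True by (simp add: mv_def)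
  qed (use v in \<open>simp add: mv_def fV_def\<close>)
qed

lemma mv_unitf: "j < N \<Longrightarrow> mv N A (unitf j) = (\<lambda>i. if i < N then A $$ (i, j) else 0)"
proof
  fix i assume j: "j < N"
  have "(\<Sum>l<N. A $$ (i, l) * unitf j l) = (\<Sum>l<N. if l = j then A $$ (i, l) else 0)"
    by (intro sum.cong) (auto simp: unitf_def)
  then show "mv N A (unitf j) i = (if i < N then A $$ (i, j) else 0)" using j by (simp add: mv_def)
qed

lemma mv_inj:
  assumes "A \<in> carrier_mat N N" "B \<in> carrier_mat N N" and eq: "\<And>v. v \<in> fV N \<Longrightarrow> mv N A v = mv N B v"
  shows "A = B"
proof (rule eq_matI)
  fix i j assume "i < dim_row B" "j < dim_col B"
  then have ij: "i < N" "j < N" using assms(2) by auto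
  show "A $$ (i, j) = B $$ (i, j)"
    using fun_cong[OF eq[OF unitf_fV[OF ij(2)]], of i] ij by (simp add: mv_unitf)
qed (use assms in auto)

lemma mt_carrier [simp]: "mt N f \<in> carrier_mat N N" by (simp add: mt_def)

lemma unitf_expansion: "v \<in> fV N \<Longrightarrow> v = (\<Sum>j<N. fscale (v j) (unitf j))"
proof
  fix i assume v: "v \<in> fV N"
  have "(\<Sum>j<N. fscale (v j) (unitf j)) i = (\<Sum>j<N. if j = i then v j else 0)"
    by (simp add: sum_fun_apply fscale_def unitf_def if_distrib cong: if_cong)
  then show "v i = (\<Sum>j<N. fscale (v j) (unitf j)) i" using v by (auto simp: fV_def)
qed

lemma mv_mt:
  assumes f: "fv.lin (fV N) f" "\<And>v. v \<in> fV N \<Longrightarrow> f v \<in> fV N" and v: "v \<in> fV N"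
  shows "mv N (mt N f) v = f v"
proof -
  have e: "f v = (\<Sum>j<N. fscale (v j) (f (unitf j)))"
    using arg_cong[OF unitf_expansion[OF v], of f] fv.lin_scale[OF f(1) unitf_fV]
    by (subst (asm) fv.lin_sum[OF f(1) subspace_fV])
      (auto intro: fv.subspace_scale[OF subspace_fV unitf_fV])
  show ?thesis
  proof
    fix i show "mv N (mt N f) v i = f v i"
    proof (cases "i < N")
      case True
      then have "mv N (mt N f) v i = (\<Sum>j<N. f (unitf j) i * v j)"
        by (simp add: mv_def mt_def)
      also have "\<dots> = f v i" unfolding e by (simp add: sum_fun_apply fscale_def mult.commute)
      finally show ?thesis .
    qed (use f(2)[OF v] in \<open>simp add: fV_def mv_def\<close>)
  qed
qed

lemma ftr_mv: "A \<in> carrier_mat N N \<Longrightarrow> ftr N (mv N A) = mat_trace A"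
  by (auto simp: ftr_def mat_trace_def mv_unitf)

lemma ftr_cong: "(\<And>v. v \<in> fV N \<Longrightarrow> f v = g v) \<Longrightarrow> ftr N f = ftr N g"
  by (simp add: ftr_def unitf_fV)

lemma traced_nilpair_matrices:
  fixes A B :: "'k::{field,finite} mat"
  assumes A: "A \<in> carrier_mat N N" "A * A = 0\<^sub>m N N" and B: "B \<in> carrier_mat N N" "B * B = 0\<^sub>m N N"
  shows "traced_nilpair fscale (fV N) (mv N A) (mv N B) (ftr N)"
proof unfold_locales
  show "fv.subspace (fV N :: (nat \<Rightarrow> 'k) set)" "finite (fV N :: (nat \<Rightarrow> 'k) set)" by (rule subspace_fV finite_fV)+
  show "fv.lin (fV N) (mv N A)" "fv.lin (fV N) (mv N B)" by (rule mv_lin)+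
  show "mv N A (mv N A v) = 0" "mv N B (mv N B v) = 0" for v
    by (simp_all add: A B mv_zero flip: mv_mult)
  show "(\<And>v. v \<in> fV N \<Longrightarrow> f v = g v) \<Longrightarrow> ftr N f = ftr N g" for f g by (rule ftr_cong)
  show "ftr N (\<lambda>v. f v + g v) = ftr N f + ftr N g" "ftr N (\<lambda>v. f v - g v) = ftr N f - ftr N g"
    "ftr N (\<lambda>v. fscale c (f v)) = c * ftr N f" for f g :: "(nat \<Rightarrow> 'k) \<Rightarrow> nat \<Rightarrow> 'k" and c
    by (simp_all add: ftr_def sum.distrib sum_subtractf fscale_def sum_distrib_left)
  fix f g :: "(nat \<Rightarrow> 'k) \<Rightarrow> nat \<Rightarrow> 'k"
  {
    assume fg: "fv.lin (fV N) f" "fv.lin (fV N) g" "f ` fV N \<subseteq> fV N" "g ` fV N \<subseteq> fV N"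
    have f: "mv N (mt N f) v = f v" and g: "mv N (mt N g) v = g v" if "v \<in> fV N" for v
      using mv_mt[OF fg(1) _ that] mv_mt[OF fg(2) _ that] fg(3,4) by blast+
    have "ftr N (\<lambda>v. f (g v)) = ftr N (mv N (mt N f * mt N g))"
      by (rule ftr_cong) (use fg(4) in \<open>auto simp: mv_mult f g\<close>)
    moreover have "ftr N (\<lambda>v. g (f v)) = ftr N (mv N (mt N g * mt N f))"
      by (rule ftr_cong) (use fg(3) in \<open>auto simp: mv_mult f g\<close>)
    moreover have "mat_trace (mt N f * mt N g) = mat_trace (mt N g * mt N f)"
      by (rule mat_trace_comm[of _ N N]) auto
    ultimately show "ftr N (\<lambda>v. f (g v)) = ftr N (\<lambda>v. g (f v))"
      by (simp add: ftr_mv mult_carrier_mat[of _ N N])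
  }
  fix \<phi> :: "(nat \<Rightarrow> 'k) \<Rightarrow> 'k" and w :: "nat \<Rightarrow> 'k" assume p: "fv.funl (fV N) \<phi>" and w: "w \<in> fV N"
  have "\<phi> w = (\<Sum>j<N. w j * \<phi> (unitf j))"
    using arg_cong[OF unitf_expansion[OF w], of \<phi>] fv.funl_scale[OF p unitf_fV]
    by (subst (asm) fv.funl_sum[OF p subspace_fV])
      (auto intro: fv.subspace_scale[OF subspace_fV unitf_fV])
  then show "ftr N (\<lambda>v. fscale (\<phi> v) w) = \<phi> w" by (simp add: ftr_def fscale_def mult.commute)
qed simp_all

abbreviation ginv :: "nat \<Rightarrow> 'a::field mat \<Rightarrow> 'a mat" where "ginv m A \<equiv> inv\<^bsub>GL m\<^esub> A"

lemma GL_injective: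
  fixes A :: "'k::{field,finite} mat"
  assumes A: "A \<in> carrier_mat N N" and inj: "\<And>v. v \<in> fV N \<Longrightarrow> mv N A v = 0 \<Longrightarrow> v = 0"
  shows "A \<in> carrier (GL N)"
proof -
  \<comment> \<open>For the pair of zero matrices every endomorphism is \<open>commuting\<close>, so
    \<open>ex_inverse\<close> supplies a linear inverse of any injective matrix.\<close>
  interpret z: traced_nilpair fscale "fV N" "mv N (0\<^sub>m N N :: 'k mat)" "mv N (0\<^sub>m N N)" "ftr N"
    by (rule traced_nilpair_matrices) auto
  have "inj_on (mv N A) (fV N)"
  proof (rule inj_onI)
    fix u v assume uv: "u \<in> fV N" "v \<in> fV N" "mv N A u = mv N A v"
    then have "mv N A (u - v) = 0" using fv.lin_diff[OF mv_lin[of "fV N" N A] subspace_fV uv(1,2)] by simp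
    then show "u = v" using inj[OF fv.subspace_diff[OF subspace_fV uv(1,2)]] by simp
  qed
  moreover have "z.commuting (fV N) (mv N A)"
    unfolding z.commuting_def by (auto simp: mv_lin mv_zero)
  ultimately obtain s' where s': "z.inverse_pair (mv N A) s'" using z.ex_inverse by blast
  then have l: "fv.lin (fV N) s'" "\<And>v. v \<in> fV N \<Longrightarrow> s' v \<in> fV N" "\<And>v. v \<in> fV N \<Longrightarrow> mv N A (s' v) = v"
      "\<And>v. v \<in> fV N \<Longrightarrow> s' (mv N A v) = v"
    by (auto simp: z.inverse_pair_def z.commuting_def)
  have mm: "mv N (mt N s') v = s' v" if "v \<in> fV N" for v using mv_mt[OF l(1) _ that] l(2) by blast
  have "A * mt N s' = 1\<^sub>m N"
    by (rule mv_inj[of _ N]) (use A in \<open>auto simp: mv_mult mm l(3) mv_one\<close>)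
  moreover have "mt N s' * A = 1\<^sub>m N"
    by (rule mv_inj[of _ N]) (use A in \<open>auto simp: mv_mult mm l(4) mv_one\<close>)
  ultimately have "A * mt N s' = 1\<^sub>m N" "mt N s' * A = 1\<^sub>m N" .
  then show ?thesis using A mt_carrier[of N s'] by (auto simp: GL_carrier)
qed

section \<open>Conjugates of the Shalika subgroup\<close>

lemma conj_commute_iff:
  fixes p :: "'k::field mat"
  assumes p: "p \<in> carrier (GL m)" and t: "t \<in> carrier_mat m m" and x: "x \<in> carrier_mat m m"
  shows "inv\<^bsub>GL m\<^esub> p * t * p * x = x * (inv\<^bsub>GL m\<^esub> p * t * p) \<longleftrightarrow> t * (p * x * inv\<^bsub>GL m\<^esub> p) = p * x * inv\<^bsub>GL m\<^esub> p * t"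
proof -
  note pi = GL_inv[OF p] and pc = GL_in_carrier_mat[OF p]
  note [simp] = sq_assoc[of _ m] sq_cancel[OF pi(4) pc _ pi(2)] sq_cancel[OF pc pi(4) _ pi(3)]
  show ?thesis
  proof
    assume "inv\<^bsub>GL m\<^esub> p * t * p * x = x * (inv\<^bsub>GL m\<^esub> p * t * p)"
    then have "p * (inv\<^bsub>GL m\<^esub> p * t * p * x) * inv\<^bsub>GL m\<^esub> p = p * (x * (inv\<^bsub>GL m\<^esub> p * t * p)) * inv\<^bsub>GL m\<^esub> p" by simp
    then show "t * (p * x * inv\<^bsub>GL m\<^esub> p) = p * x * inv\<^bsub>GL m\<^esub> p * t" using pi pc t x by simp
  next
    assume "t * (p * x * inv\<^bsub>GL m\<^esub> p) = p * x * inv\<^bsub>GL m\<^esub> p * t"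
    then have "inv\<^bsub>GL m\<^esub> p * (t * (p * x * inv\<^bsub>GL m\<^esub> p)) * p = inv\<^bsub>GL m\<^esub> p * (p * x * inv\<^bsub>GL m\<^esub> p * t) * p" by simp
    then show "inv\<^bsub>GL m\<^esub> p * t * p * x = x * (inv\<^bsub>GL m\<^esub> p * t * p)" using pi pc t x by simp
  qed
qed

lemma conj_GL: "p \<in> carrier (GL m) \<Longrightarrow> t \<in> carrier (GL m) \<Longrightarrow> inv\<^bsub>GL m\<^esub> p * t * p \<in> carrier (GL m)"
  by (intro GL_mult GL_inv(1))

lemma Shalika_conj_iff:
  fixes p :: "'k::field mat"
  assumes "p \<in> carrier (GL (2 * n))" and "t \<in> carrier (GL (2 * n))"
  shows "inv\<^bsub>GL (2 * n)\<^esub> p * t * p \<in> carrier (Shalika n)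
    \<longleftrightarrow> t * (p * X0 n * inv\<^bsub>GL (2 * n)\<^esub> p) = p * X0 n * inv\<^bsub>GL (2 * n)\<^esub> p * t"
  using conj_commute_iff[OF assms(1) GL_in_carrier_mat[OF assms(2)] X0_carrier] conj_GL[OF assms]
  by (simp add: Shalika_commute_X0)

lemma conj_mult:
  assumes p: "p \<in> carrier (GL m)" and s: "s \<in> carrier_mat m m" and t: "t \<in> carrier_mat m m"
  shows "inv\<^bsub>GL m\<^esub> p * (s * t) * p = (inv\<^bsub>GL m\<^esub> p * s * p) * (inv\<^bsub>GL m\<^esub> p * t * p)"
proof -
  note pi = GL_inv[OF p] and pc = GL_in_carrier_mat[OF p]
  show ?thesis using pi pc s t by (simp add: sq_assoc[of _ m] sq_cancel[OF pc pi(4) _ pi(3)])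
qed

lemma conj_inv:
  assumes p: "p \<in> carrier (GL m)" and t: "t \<in> carrier (GL m)"
  shows "inv\<^bsub>GL m\<^esub> (inv\<^bsub>GL m\<^esub> p * t * p) = inv\<^bsub>GL m\<^esub> p * inv\<^bsub>GL m\<^esub> t * p"
proof -
  note pi = GL_inv[OF p] and pc = GL_in_carrier_mat[OF p] and ti = GL_inv[OF t] and tc = GL_in_carrier_mat[OF t]
  show ?thesis
    using pi(1,4) p t ti pc tc by (simp add: GL_inv_mult GL_mult GL_inv_inv sq_assoc[of _ m])
qed

text \<open>For the homotopy \<open>H0\<close> conjugated by \<open>p\<close> this is
  \<open>chiS_trace\<close>. Any other homotopy replaces \<open>t\<close> by its conjugate under a
  matrix that commutes with \<open>M\<close>; transported by \<open>p\<close> this is a conjugation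
  inside the Shalika subgroup, and \<open>chiS\<close> is a homomorphism to an abelian
  group.\<close>

lemma dlog_chiS:
  fixes p :: "'k::{field,finite} mat"
  assumes p: "p \<in> carrier (GL (2 * n))" and t: "t \<in> carrier (GL (2 * n))"
    and M: "M = p * X0 n * ginv (2 * n) p" and tM: "t * M = M * t"
    and h: "fv.lin (fV (2 * n)) h" "h ` fV (2 * n) \<subseteq> fV (2 * n)"
      "\<forall>u\<in>fV (2 * n). h (h u) = 0 \<and> mv (2 * n) M (h u) + h (mv (2 * n) M u) = u"
  shows "ftr (2 * n) (\<lambda>v. mv (2 * n) (ginv (2 * n) t) (mv (2 * n) M (h (mv (2 * n) t (h v))))) = chiS n (ginv (2 * n) p * t * p)"
proof -
  let ?N = "2 * n"
  note pi = GL_inv[OF p] and pc = GL_in_carrier_mat[OF p]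
  note ti = GL_inv[OF t] and tc = GL_in_carrier_mat[OF t]
  note [simp] = sq_assoc[of _ ?N] sq_cancel[OF pi(4) pc _ pi(2)] sq_cancel[OF pc pi(4) _ pi(3)] pi pc ti tc right_mult_zero_mat[OF pc]
  have Xc: "M \<in> carrier_mat ?N ?N" by (auto simp: M)
  have "X0 n * (X0 n * ginv ?N p) = 0\<^sub>m ?N ?N" by (subst sq_assoc[of "X0 n" ?N "X0 n", symmetric]) (auto simp only: X0_carrier pi X0_X0 left_mult_zero_mat)
  then have XX: "M * M = 0\<^sub>m ?N ?N" by (simp add: M)
  interpret z: traced_nilpair fscale "fV ?N" "mv ?N M" "mv ?N M" "ftr ?N"
    by (rule traced_nilpair_matrices) (fact Xc XX)+
  define H where "H = p * H0 n * ginv ?N p"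
  have Hc: "H \<in> carrier_mat ?N ?N" by (auto simp: H_def)
  have "H0 n * (H0 n * ginv ?N p) = 0\<^sub>m ?N ?N" by (subst sq_assoc[of "H0 n" ?N "H0 n", symmetric]) (auto simp only: H0_carrier pi H0_H0 left_mult_zero_mat)
  then have HH: "H * H = 0\<^sub>m ?N ?N" by (simp add: H_def)
  have "M * H + H * M = p * (X0 n * H0 n) * ginv ?N p + p * (H0 n * X0 n) * ginv ?N p" by (simp add: M H_def)
  also have "\<dots> = p * (X0 n * H0 n + H0 n * X0 n) * ginv ?N p"
    by (simp add: mult_add_distrib_mat[of _ ?N ?N _ ?N] add_mult_distrib_mat[of _ ?N ?N _ _ ?N] del: sq_assoc)
  also have "\<dots> = 1\<^sub>m ?N" by (simp add: X0_H0 left_mult_one_mat[OF pi(4)])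
  finally have XH: "M * H + H * M = 1\<^sub>m ?N" .
  have h0: "z.homotopy (mv ?N M) (fV ?N) (mv ?N H)"
    unfolding z.homotopy_def
  proof (intro conjI ballI)
    show "fv.lin (fV ?N) (mv ?N H)" by (rule mv_lin)
    show "mv ?N H ` fV ?N \<subseteq> fV ?N" by auto
    fix u :: "nat \<Rightarrow> 'k" assume u: "u \<in> fV ?N"
    show "mv ?N H (mv ?N H u) = 0" using Hc by (simp add: HH mv_zero flip: mv_mult)
    have "mv ?N M (mv ?N H u) + mv ?N H (mv ?N M u) = mv ?N (M * H + H * M) u"
      using Hc Xc by (subst mv_plus) (auto simp: mv_mult)
    then show "mv ?N M (mv ?N H u) + mv ?N H (mv ?N M u) = u" by (simp only: XH mv_one[OF u])
  qed
  have hh: "z.homotopy (mv ?N M) (fV ?N) h" using h by (simp add: z.homotopy_def)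
  obtain m m' where m: "fv.lin (fV ?N) m" "fv.lin (fV ?N) m'"
      "\<forall>v\<in>fV ?N. m v \<in> fV ?N \<and> m' v \<in> fV ?N \<and> m (m' v) = v \<and> m' (m v) = v
      \<and> m (mv ?N M v) = mv ?N M (m v) \<and> m' (mv ?N M v) = mv ?N M (m' v)"
    and md: "\<forall>s s'. fv.lin (fV ?N) s \<and> fv.lin (fV ?N) s' \<and> s ` fV ?N \<subseteq> fV ?N \<and> s' ` fV ?N \<subseteq> fV ?N \<longrightarrow>
      z.dlog (mv ?N M) h s s' = z.dlog (mv ?N M) (mv ?N H) (\<lambda>v. m' (s (m v))) (\<lambda>v. m' (s' (m v)))"
    using z.dlog_homotopy_independent[OF hh h0] by blast
  define A where "A = mt ?N m"
  have Ac: "A \<in> carrier_mat ?N ?N" "mt ?N m' \<in> carrier_mat ?N ?N" by (simp_all add: A_def)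
  have mA: "mv ?N A v = m v" "mv ?N (mt ?N m') v = m' v" if "v \<in> fV ?N" for v
    unfolding A_def using mv_mt[OF m(1) _ that] mv_mt[OF m(2) _ that] m(3) by blast+
  have mm: "A * mt ?N m' = 1\<^sub>m ?N"
    by (rule mv_inj[of _ ?N]) (use Ac m(3) in \<open>auto simp: mv_mult mA mv_one\<close>)
  have "mt ?N m' * A = 1\<^sub>m ?N"
    by (rule mv_inj[of _ ?N]) (use Ac m(3) in \<open>auto simp: mv_mult mA mv_one\<close>)
  from GL_inv_unique[OF Ac mm this] have A: "A \<in> carrier (GL ?N)" "ginv ?N A = mt ?N m'" by simp_all
  have AX: "A * M = M * A" by (rule mv_inj[of _ ?N]; use Ac Xc m(3) in \<open>auto simp: mv_mult mA\<close>)
  note Ai = GL_inv[OF A(1)]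
  define B where "B = ginv ?N p * A * p"
  define r where "r = ginv ?N p * t * p"
  have BS: "B \<in> carrier (Shalika n)"
    unfolding B_def using Shalika_conj_iff[OF p A(1)] AX by (simp add: M)
  have rS: "r \<in> carrier (Shalika n)"
    unfolding r_def using Shalika_conj_iff[OF p t] tM by (simp add: M)
  define q where "q = ginv ?N B * r * B"
  have qS: "q \<in> carrier (Shalika n)" unfolding q_def by (intro Shalika_mult Shalika_inv BS rS)
  have gB: "ginv ?N B = ginv ?N p * ginv ?N A * p" unfolding B_def by (rule conj_inv[OF p A(1)])
  have q: "q = ginv ?N p * (ginv ?N A * t * A) * p"
    unfolding q_def gB unfolding B_def r_def using Ac Ai by simp
  have gq: "ginv ?N q = ginv ?N p * (ginv ?N A * ginv ?N t * A) * p"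
    unfolding q
    using conj_inv[OF p conj_GL[OF A(1) t]] conj_inv[OF A(1) t] by simp
  have "z.dlog (mv ?N M) h (mv ?N t) (mv ?N (ginv ?N t))
    = z.dlog (mv ?N M) (mv ?N H) (\<lambda>v. m' (mv ?N t (m v))) (\<lambda>v. m' (mv ?N (ginv ?N t) (m v)))"
    by (rule md[rule_format]) (auto simp: mv_lin)
  also have "\<dots> = ftr ?N (mv ?N (ginv ?N A * ginv ?N t * A * (M * (H * (ginv ?N A * t * A * H)))))"
    unfolding z.dlog_def
    by (rule ftr_cong) (use Ac Ai Xc Hc m(3) in \<open>auto simp: mv_mult mA A(2)\<close>)
  also have "\<dots> = mat_trace (ginv ?N A * ginv ?N t * A * (M * (H * (ginv ?N A * t * A * H))))"
    using Ac Ai Xc Hc by (subst ftr_mv) auto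
  also have "ginv ?N A * ginv ?N t * A * (M * (H * (ginv ?N A * t * A * H))) = p * (ginv ?N q * (X0 n * (H0 n * (q * (H0 n * ginv ?N p)))))"
    unfolding gq unfolding q using Ac Ai by (simp add: M H_def)
  also have "mat_trace \<dots> = mat_trace (ginv ?N q * (X0 n * (H0 n * (q * (H0 n * ginv ?N p)))) * p)"
    using Shalika_inv[OF qS] qS by (intro mat_trace_comm[of _ ?N ?N]) (auto simp: Shalika_GL GL_in_carrier_mat )
  also have "ginv ?N q * (X0 n * (H0 n * (q * (H0 n * ginv ?N p)))) * p = ginv ?N q * (X0 n * (H0 n * (q * H0 n)))"
    using GL_in_carrier_mat[OF Shalika_GL[OF qS]] GL_inv(4)[OF Shalika_GL[OF qS]]
    by (simp add: right_mult_one_mat[OF H0_carrier])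
  also have "mat_trace \<dots> = chiS n q" by (rule chiS_trace[OF qS, symmetric])
  also have "\<dots> = chiS n r"
    unfolding q_def using BS rS Shalika_inv[OF BS] by (simp add: chiS_mult Shalika_mult chiS_inv)
  finally show ?thesis unfolding z.dlog_def r_def .
qed

lemma mv_pow:
  assumes "A \<in> carrier_mat N N" "v \<in> fV N"
  shows "mv N (A ^\<^sub>m i) v = (mv N A ^^ i) v"
  using assms(2)
proof (induction i arbitrary: v)
  case (Suc i)
  have "mv N (A ^\<^sub>m Suc i) v = mv N (A ^\<^sub>m i) (mv N A v)"
    using assms(1) by (simp add: mv_mult)
  then show ?case using Suc.IH[of "mv N A v"] by (simp add: funpow_swap1)
qed (use assms(1) in \<open>simp add: mv_one\<close>)

section \<open>The pair attached to a group element\<close>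

locale shalika_pair =
  fixes n :: nat and g :: "'k::{field,finite} mat"
  assumes g: "g \<in> carrier (GL (2 * n))"
begin

definition Y :: "'k mat" where "Y = g * X0 n * ginv (2 * n) g"
definition Delta :: "'k mat" where "Delta = X0 n - Y"
definition C :: "'k mat set" where
  "C = {s \<in> carrier (Shalika n). ginv (2 * n) g * s * g \<in> carrier (Shalika n)}"
definition chi :: "'k mat \<Rightarrow> 'k" where
  "chi s = chiS n s - chiS n (ginv (2 * n) g * s * g)"

lemmas gi = GL_inv[OF g] and gc = GL_in_carrier_mat[OF g]

lemma Y_carrier [simp]: "Y \<in> carrier_mat (2 * n) (2 * n)" using gi gc by (simp add: Y_def)
lemma Delta_carrier [simp]: "Delta \<in> carrier_mat (2 * n) (2 * n)" by (simp add: Delta_def minus_carrier_mat)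
lemma Delta_pow_carrier [simp]: "Delta ^\<^sub>m i \<in> carrier_mat (2 * n) (2 * n)" by (rule pow_carrier_mat) simp

lemma Y_Y: "Y * Y = 0\<^sub>m (2 * n) (2 * n)"
proof -
  have "X0 n * (X0 n * ginv (2 * n) g) = 0\<^sub>m (2 * n) (2 * n)"
    using gi by (subst sq_assoc[of "X0 n" "2 * n" "X0 n", symmetric]) (auto simp only: X0_carrier X0_X0 left_mult_zero_mat)
  then show ?thesis
    using gi gc by (simp add: Y_def sq_assoc[of _ "2 * n"] sq_cancel[OF gi(4) gc _ gi(2)] right_mult_zero_mat[OF gc])
qed

sublocale np: traced_nilpair fscale "fV (2 * n)" "mv (2 * n) (X0 n)" "mv (2 * n) Y" "ftr (2 * n)"
  by (rule traced_nilpair_matrices) (simp_all add: X0_X0 Y_Y)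

lemma D_mv: "np.D v = mv (2 * n) Delta v"
  by (simp add: np.D_def Delta_def mv_minus)

lemma D_pow: "v \<in> fV (2 * n) \<Longrightarrow> (np.D ^^ i) v = mv (2 * n) (Delta ^\<^sub>m i) v"
proof -
  have "np.D = mv (2 * n) Delta" by (rule ext) (rule D_mv)
  then show "v \<in> fV (2 * n) \<Longrightarrow> ?thesis" by (simp add: mv_pow)
qed

lemma C_iff: "s \<in> C \<longleftrightarrow> s \<in> carrier (GL (2 * n)) \<and> s * X0 n = X0 n * s \<and> s * Y = Y * s"
  using Shalika_conj_iff[OF g, of s] unfolding C_def Y_def by (auto simp: Shalika_commute_X0)

lemma C_GL: "s \<in> C \<Longrightarrow> s \<in> carrier (GL (2 * n))" by (simp add: C_iff)
lemma C_carrier: "s \<in> C \<Longrightarrow> s \<in> carrier_mat (2 * n) (2 * n)" by (rule GL_in_carrier_mat[OF C_GL])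

lemma C_mult: "s \<in> C \<Longrightarrow> t \<in> C \<Longrightarrow> s * t \<in> C"
  using conj_mult[OF g, of s t] C_carrier[of s] C_carrier[of t] by (simp add: C_def Shalika_mult)

lemma C_inv: "s \<in> C \<Longrightarrow> ginv (2 * n) s \<in> C"
  using conj_inv[OF g C_GL[of s]] Shalika_inv[of "ginv (2 * n) g * s * g" n] by (simp add: C_def Shalika_inv)

lemma chi_mult: "s \<in> C \<Longrightarrow> t \<in> C \<Longrightarrow> chi (s * t) = chi s + chi t"
  using conj_mult[OF g, of s t] C_carrier[of s] C_carrier[of t] by (simp add: C_def chi_def chiS_mult)

lemma chi_inv: "s \<in> C \<Longrightarrow> chi (ginv (2 * n) s) = - chi s"
  using conj_inv[OF g C_GL[of s]] chiS_inv[of "ginv (2 * n) g * s * g" n] by (simp add: C_def chi_def chiS_inv)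

lemma C_commute_Delta: "s \<in> C \<Longrightarrow> s * Delta = Delta * s"
  using C_carrier[of s] by (simp add: C_iff Delta_def mult_minus_distrib_mat[of _ "2 * n" "2 * n" _ "2 * n"] minus_mult_distrib_mat[of _ "2 * n" "2 * n" _ _ "2 * n"])

lemma inverse_pair_C:
  assumes p: "np.inverse_pair s s'"
  shows "mt (2 * n) s \<in> C" "ginv (2 * n) (mt (2 * n) s) = mt (2 * n) s'"
proof -
  have c: "fv.lin (fV (2 * n)) s" "fv.lin (fV (2 * n)) s'" "\<And>v. v \<in> fV (2 * n) \<Longrightarrow> s v \<in> fV (2 * n)"
    "\<And>v. v \<in> fV (2 * n) \<Longrightarrow> s' v \<in> fV (2 * n)" "\<And>v. v \<in> fV (2 * n) \<Longrightarrow> s (mv (2 * n) (X0 n) v) = mv (2 * n) (X0 n) (s v)"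
    "\<And>v. v \<in> fV (2 * n) \<Longrightarrow> s (mv (2 * n) Y v) = mv (2 * n) Y (s v)"
    "\<And>v. v \<in> fV (2 * n) \<Longrightarrow> s (s' v) = v" "\<And>v. v \<in> fV (2 * n) \<Longrightarrow> s' (s v) = v"
    using p by (auto simp: np.inverse_pair_def np.commuting_def)
  have m: "mv (2 * n) (mt (2 * n) s) v = s v" "mv (2 * n) (mt (2 * n) s') v = s' v" if "v \<in> fV (2 * n)" for v
    using mv_mt[OF c(1) _ that] mv_mt[OF c(2) _ that] c(3,4) by blast+
  have i1: "mt (2 * n) s * mt (2 * n) s' = 1\<^sub>m (2 * n)"
    by (rule mv_inj[of _ "2 * n"]) (simp_all add: mv_mult m c mv_one)
  have i2: "mt (2 * n) s' * mt (2 * n) s = 1\<^sub>m (2 * n)"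
    by (rule mv_inj[of _ "2 * n"]) (simp_all add: mv_mult m c mv_one)
  note u = GL_inv_unique[OF mt_carrier mt_carrier i1 i2]
  show "ginv (2 * n) (mt (2 * n) s) = mt (2 * n) s'" by (rule u(2))
  have "mt (2 * n) s * X0 n = X0 n * mt (2 * n) s"
    by (rule mv_inj[of _ "2 * n"]) (simp_all add: mv_mult m c)
  moreover have "mt (2 * n) s * Y = Y * mt (2 * n) s"
    by (rule mv_inj[of _ "2 * n"]) (simp_all add: mv_mult m c)
  ultimately show "mt (2 * n) s \<in> C" using u(1) by (simp add: C_iff)
qed

lemma C_inverse_pair:
  assumes s: "s \<in> C"
  shows "np.inverse_pair (mv (2 * n) s) (mv (2 * n) (ginv (2 * n) s))"
proof -
  have 1: "ginv (2 * n) s \<in> C" by (rule C_inv[OF s])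
  note i = GL_inv[OF C_GL[OF s]] and c = C_carrier[OF s] C_carrier[OF 1]
  have "mv (2 * n) t (mv (2 * n) (X0 n) v) = mv (2 * n) (X0 n) (mv (2 * n) t v)"
    "mv (2 * n) t (mv (2 * n) Y v) = mv (2 * n) Y (mv (2 * n) t v)" if "t \<in> C" for t v
    using that C_carrier[OF that] by (simp_all add: C_iff flip: mv_mult)
  moreover have "mv (2 * n) s (mv (2 * n) (ginv (2 * n) s) v) = v" "mv (2 * n) (ginv (2 * n) s) (mv (2 * n) s v) = v"
    if "v \<in> fV (2 * n)" for v
    using c i that by (simp_all add: mv_one flip: mv_mult)
  ultimately show ?thesis
    unfolding np.inverse_pair_def np.commuting_def using s 1 by (auto simp: mv_lin)
qed

lemma dlog_chi:
  assumes h: "np.homotopy (mv (2 * n) (X0 n)) (fV (2 * n)) h" and k: "np.homotopy (mv (2 * n) Y) (fV (2 * n)) k"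
    and s: "s \<in> C"
  shows "np.dlog (mv (2 * n) (X0 n)) h (mv (2 * n) s) (mv (2 * n) (ginv (2 * n) s))
    - np.dlog (mv (2 * n) Y) k (mv (2 * n) s) (mv (2 * n) (ginv (2 * n) s)) = chi s"
proof -
  have one: "1\<^sub>m (2 * n) * A = A" "A * 1\<^sub>m (2 * n) = A" if "A \<in> carrier_mat (2 * n) (2 * n)" for A :: "'k mat"
    using that by simp_all
  have i1: "ginv (2 * n) (1\<^sub>m (2 * n)) = (1\<^sub>m (2 * n) :: 'k mat)"
    by (rule GL_inv_unique(2)) auto
  have "np.dlog (mv (2 * n) (X0 n)) h (mv (2 * n) s) (mv (2 * n) (ginv (2 * n) s)) = chiS n (ginv (2 * n) (1\<^sub>m (2 * n)) * s * 1\<^sub>m (2 * n))"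
    unfolding np.dlog_def
    by (rule dlog_chiS[OF GL_one]) (use h s in \<open>auto simp: np.homotopy_def i1 one C_iff\<close>)
  moreover have "np.dlog (mv (2 * n) Y) k (mv (2 * n) s) (mv (2 * n) (ginv (2 * n) s)) = chiS n (ginv (2 * n) g * s * g)"
    unfolding np.dlog_def
    by (rule dlog_chiS[OF g]) (use k s in \<open>auto simp: np.homotopy_def C_iff Y_def\<close>)
  ultimately show ?thesis using C_carrier[OF s] by (simp add: chi_def i1 one)
qed

lemma dlog_inverse_pair:
  assumes h: "np.homotopy (mv (2 * n) (X0 n)) (fV (2 * n)) h" and k: "np.homotopy (mv (2 * n) Y) (fV (2 * n)) k"
    and p: "np.inverse_pair s s'"
  shows "np.dlog (mv (2 * n) (X0 n)) h s s' - np.dlog (mv (2 * n) Y) k s s' = chi (mt (2 * n) s)"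
proof -
  have c: "fv.lin (fV (2 * n)) s" "fv.lin (fV (2 * n)) s'" "\<And>v. v \<in> fV (2 * n) \<Longrightarrow> s v \<in> fV (2 * n)"
    "\<And>v. v \<in> fV (2 * n) \<Longrightarrow> s' v \<in> fV (2 * n)"
    using p by (auto simp: np.inverse_pair_def np.commuting_def)
  have m: "mv (2 * n) (mt (2 * n) s) v = s v" "mv (2 * n) (mt (2 * n) s') v = s' v" if "v \<in> fV (2 * n)" for v
    using mv_mt[OF c(1) _ that] mv_mt[OF c(2) _ that] c(3,4) by blast+
  have "np.dlog z h s s' = np.dlog z h (mv (2 * n) (mt (2 * n) s)) (mv (2 * n) (mt (2 * n) s'))"
    if "np.homotopy z' (fV (2 * n)) h" "\<And>v. z v \<in> fV (2 * n)" for z z' h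
    unfolding np.dlog_def by (rule ftr_cong) (use np.homotopyD(2)[OF that(1)] that(2) c in \<open>simp add: m\<close>)
  from this[OF h] this[OF k] show ?thesis
    using dlog_chi[OF h k inverse_pair_C(1)[OF p]] inverse_pair_C(2)[OF p] by simp
qed

text \<open>Matrix form of \<open>socle_maps i\<close>: the left factor Delta^i puts the image into
  \<open>level i\<close>, the right factor makes the kernel contain that of Delta^i.\<close>

definition Q :: "nat \<Rightarrow> 'k mat set" where
  "Q i = {Z \<in> carrier_mat (2 * n) (2 * n). X0 n * Z = 0\<^sub>m (2 * n) (2 * n) \<and> Y * Z = 0\<^sub>m (2 * n) (2 * n)
    \<and> Z * X0 n = 0\<^sub>m (2 * n) (2 * n) \<and> Z * Y = 0\<^sub>m (2 * n) (2 * n)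
    \<and> (\<exists>A\<in>carrier_mat (2 * n) (2 * n). Z = Delta ^\<^sub>m i * A)
    \<and> (\<exists>B\<in>carrier_mat (2 * n) (2 * n). Z = B * Delta ^\<^sub>m i)}"

lemma mv_eq_0_iff: "A \<in> carrier_mat N N \<Longrightarrow> A = 0\<^sub>m N N \<longleftrightarrow> (\<forall>v\<in>fV N. mv N A v = 0)"
  using mv_inj[of A N "0\<^sub>m N N"] by (auto simp: mv_zero)

lemma Q_socle: "Z \<in> Q i \<Longrightarrow> mv (2 * n) Z \<in> np.socle_maps i"
  unfolding np.socle_maps_def
proof (intro CollectI conjI ballI impI)
  assume Z: "Z \<in> Q i"
  then have c: "Z \<in> carrier_mat (2 * n) (2 * n)" "X0 n * Z = 0\<^sub>m (2 * n) (2 * n)" "Y * Z = 0\<^sub>m (2 * n) (2 * n)"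
    "Z * X0 n = 0\<^sub>m (2 * n) (2 * n)" "Z * Y = 0\<^sub>m (2 * n) (2 * n)" by (auto simp: Q_def)
  obtain A B where AB: "A \<in> carrier_mat (2 * n) (2 * n)" "Z = Delta ^\<^sub>m i * A"
    "B \<in> carrier_mat (2 * n) (2 * n)" "Z = B * Delta ^\<^sub>m i" using Z by (auto simp: Q_def)
  show "fv.lin (fV (2 * n)) (mv (2 * n) Z)" by (rule mv_lin)
  fix v :: "nat \<Rightarrow> 'k" assume v: "v \<in> fV (2 * n)"
  show "mv (2 * n) (X0 n) (mv (2 * n) Z v) = 0" "mv (2 * n) Y (mv (2 * n) Z v) = 0"
    "mv (2 * n) Z (mv (2 * n) (X0 n) v) = 0" "mv (2 * n) Z (mv (2 * n) Y v) = 0"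
    using c by (simp_all add: mv_zero flip: mv_mult)
  have "mv (2 * n) Z v = (np.D ^^ i) (mv (2 * n) A v)" using AB(1) by (simp add: D_pow AB(2) mv_mult)
  then show "mv (2 * n) Z v \<in> np.level i" by (auto simp: np.level_def)
  assume "(np.D ^^ i) v = 0"
  then show "mv (2 * n) Z v = 0" using AB(3) by (simp add: AB(4) mv_mult flip: D_pow[OF v])
qed

lemma socle_Q:
  assumes f: "f \<in> np.socle_maps i" shows "mt (2 * n) f \<in> Q i" "\<And>v. v \<in> fV (2 * n) \<Longrightarrow> mv (2 * n) (mt (2 * n) f) v = f v"
proof -
  have c: "fv.lin (fV (2 * n)) f" "\<And>v. v \<in> fV (2 * n) \<Longrightarrow> f v \<in> np.level i"
    "\<And>v. v \<in> fV (2 * n) \<Longrightarrow> mv (2 * n) (X0 n) (f v) = 0" "\<And>v. v \<in> fV (2 * n) \<Longrightarrow> mv (2 * n) Y (f v) = 0"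
    "\<And>v. v \<in> fV (2 * n) \<Longrightarrow> f (mv (2 * n) (X0 n) v) = 0" "\<And>v. v \<in> fV (2 * n) \<Longrightarrow> f (mv (2 * n) Y v) = 0"
    "\<And>v. v \<in> fV (2 * n) \<Longrightarrow> (np.D ^^ i) v = 0 \<Longrightarrow> f v = 0"
    using f by (auto simp: np.socle_maps_def)
  have c2: "f v \<in> fV (2 * n)" if "v \<in> fV (2 * n)" for v
    using c(2)[OF that] np.stableD(2)[OF np.stable_level] by blast
  show m: "mv (2 * n) (mt (2 * n) f) v = f v" if "v \<in> fV (2 * n)" for v
    using mv_mt[OF c(1) _ that] c2 by blast
  have linD: "fv.lin (fV (2 * n)) (np.D ^^ i)"
    using mv_lin[of "fV (2 * n)" "2 * n" "Delta ^\<^sub>m i"] unfolding fv.lin_def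
    using np.V(1) by (simp add: D_pow fv.subspace_add fv.subspace_scale)
  obtain sec where sec: "fv.lin (np.level i) sec" "\<forall>z\<in>np.level i. sec z \<in> fV (2 * n) \<and> (np.D ^^ i) (sec z) = z"
    using fv.ex_linear_section[OF linD np.V] unfolding np.level_def by blast
  note sL = np.stableD[OF np.stable_level[of i]]
  obtain E where "fv.direct_sum (fV (2 * n)) (np.level i) E" using fv.ex_complement[OF np.V sL(1,2)] by blast
  then obtain p where p: "fv.lin (fV (2 * n)) p" "\<forall>u\<in>fV (2 * n). p u \<in> np.level i" "\<forall>a\<in>np.level i. p a = a"
    using fv.ex_projection by blast
  have lA: "fv.lin (fV (2 * n)) (\<lambda>v. sec (f v))"
    by (rule fv.linI) (use c fv.lin_add[OF sec(1)] fv.lin_add[OF c(1)] fv.lin_scale[OF sec(1)] fv.lin_scale[OF c(1)] in simp_all)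
  have lB: "fv.lin (fV (2 * n)) (\<lambda>v. f (sec (p v)))"
    by (rule fv.linI) (use sec(2) p(2) fv.lin_add[OF sec(1)] fv.lin_add[OF c(1)] fv.lin_scale[OF sec(1)] fv.lin_scale[OF c(1)]
        fv.lin_add[OF p(1)] fv.lin_scale[OF p(1)] in simp_all)
  have mA: "mv (2 * n) (mt (2 * n) (\<lambda>v. sec (f v))) v = sec (f v)"
    and mB: "mv (2 * n) (mt (2 * n) (\<lambda>v. f (sec (p v)))) v = f (sec (p v))" if "v \<in> fV (2 * n)" for v
    using mv_mt[OF lA _ that] mv_mt[OF lB _ that] c(2) c2 sec(2) p(2) by auto
  have D: "(np.D ^^ i) v \<in> np.level i" if "v \<in> fV (2 * n)" for v using that by (auto simp: np.level_def)
  have fD: "f (sec (p ((np.D ^^ i) v))) = f v" if v: "v \<in> fV (2 * n)" for v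
  proof -
    let ?w = "sec (p ((np.D ^^ i) v))"
    have w: "?w \<in> fV (2 * n)" "(np.D ^^ i) ?w = (np.D ^^ i) v" using D[OF v] p(3) sec(2) by simp_all
    have "(np.D ^^ i) (?w - v) = 0" using fv.lin_diff[OF linD np.V(1) w(1) v] w(2) by simp
    then have "f (?w - v) = 0" using c(7) fv.subspace_diff[OF np.V(1) w(1) v] by blast
    then show ?thesis using fv.lin_diff[OF c(1) np.V(1) w(1) v] by simp
  qed
  have e1: "mt (2 * n) f = Delta ^\<^sub>m i * mt (2 * n) (\<lambda>v. sec (f v))"
    by (rule mv_inj[of _ "2 * n"]) (use c(2) sec(2) in \<open>simp_all add: mv_mult m mA flip: D_pow\<close>)
  have e2: "mt (2 * n) f = mt (2 * n) (\<lambda>v. f (sec (p v))) * Delta ^\<^sub>m i"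
    by (rule mv_inj[of _ "2 * n"]) (use fD in \<open>simp_all add: mv_mult m mB D_pow\<close>)
  have "\<exists>A\<in>carrier_mat (2 * n) (2 * n). mt (2 * n) f = Delta ^\<^sub>m i * A" using e1 mt_carrier by blast
  moreover have "\<exists>B\<in>carrier_mat (2 * n) (2 * n). mt (2 * n) f = B * Delta ^\<^sub>m i" using e2 mt_carrier by blast
  ultimately show "mt (2 * n) f \<in> Q i"
    unfolding Q_def using c(3-6) c2 by (simp add: mv_eq_0_iff mv_mult m)
qed

lemma Q_combine:
  assumes "Z \<in> Q i" "Z' \<in> Q i" shows "Z + c \<cdot>\<^sub>m Z' \<in> Q i"
proof -
  let ?N = "2 * n"
  obtain A B A' B' where AB: "A \<in> carrier_mat ?N ?N" "Z = Delta ^\<^sub>m i * A" "B \<in> carrier_mat ?N ?N" "Z = B * Delta ^\<^sub>m i"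
    "A' \<in> carrier_mat ?N ?N" "Z' = Delta ^\<^sub>m i * A'" "B' \<in> carrier_mat ?N ?N" "Z' = B' * Delta ^\<^sub>m i"
    using assms by (auto simp: Q_def)
  have "Z + c \<cdot>\<^sub>m Z' = Delta ^\<^sub>m i * (A + c \<cdot>\<^sub>m A')"
    using AB(1,5) by (simp add: AB(2,6) mult_add_distrib_mat[of _ ?N ?N _ ?N] mult_smult_distrib[of _ ?N ?N _ ?N])
  moreover have "Z + c \<cdot>\<^sub>m Z' = (B + c \<cdot>\<^sub>m B') * Delta ^\<^sub>m i"
    using AB(3,7) by (simp add: AB(4,8) add_mult_distrib_mat[of _ ?N ?N _ _ ?N] mult_smult_assoc_mat[of _ ?N ?N _ ?N])
  ultimately have ex: "\<exists>A\<in>carrier_mat ?N ?N. Z + c \<cdot>\<^sub>m Z' = Delta ^\<^sub>m i * A"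
      "\<exists>B\<in>carrier_mat ?N ?N. Z + c \<cdot>\<^sub>m Z' = B * Delta ^\<^sub>m i"
    using AB(1,3,5,7) by (meson add_carrier_mat smult_carrier_mat)+
  have q: "Z \<in> carrier_mat ?N ?N" "Z' \<in> carrier_mat ?N ?N" "X0 n * Z = 0\<^sub>m ?N ?N" "X0 n * Z' = 0\<^sub>m ?N ?N"
    "Y * Z = 0\<^sub>m ?N ?N" "Y * Z' = 0\<^sub>m ?N ?N" "Z * X0 n = 0\<^sub>m ?N ?N" "Z' * X0 n = 0\<^sub>m ?N ?N"
    "Z * Y = 0\<^sub>m ?N ?N" "Z' * Y = 0\<^sub>m ?N ?N" using assms by (auto simp: Q_def)
  then show ?thesis
    unfolding Q_def using ex
    by (simp add: mult_add_distrib_mat[of _ ?N ?N _ ?N] mult_smult_distrib[of _ ?N ?N _ ?N]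
      add_mult_distrib_mat[of _ ?N ?N _ _ ?N] mult_smult_assoc_mat[of _ ?N ?N _ ?N])
qed

text \<open>Values of \<open>Z'\<close> lie in \<open>level i\<close> and are killed by
  \<open>x\<close>, so by exactness they have the form x D^i u. Up to sign this is D^i applied to
  \<open>x u\<close> or \<open>y u\<close>; hence \<open>B\<close> sends it to a value of B Delta^i
  on an image of \<open>x\<close> or \<open>y\<close>, which is 0. In the unitary case this removes
  the second-order term.\<close>

lemma Q_annihilate:
  assumes ex: "np.exact (np.level i)" and Z: "B * Delta ^\<^sub>m i \<in> Q i" and B: "B \<in> carrier_mat (2 * n) (2 * n)" and Z': "Z' \<in> Q i"
  shows "B * Z' = 0\<^sub>m (2 * n) (2 * n)"
proof -
  let ?N = "2 * n"
  note s1 = Q_socle[OF Z] and s2 = Q_socle[OF Z']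
  have zero: "0\<^sub>m ?N ?N - A = - A" "A - 0\<^sub>m ?N ?N = A" "1 \<cdot>\<^sub>m A = A" "- (- A) = A" if "A \<in> carrier_mat ?N ?N" for A :: "'k mat"
    by (rule eq_matI; use that in auto)+
  have X_Delta: "X0 n * Delta = - (Delta * Y)" and Y_Delta: "Y * Delta = - (Delta * X0 n)"
    by (simp_all add: Delta_def mult_minus_distrib_mat[of _ ?N ?N _ ?N] minus_mult_distrib_mat[of _ ?N ?N _ _ ?N] X0_X0 Y_Y zero)
  \<comment> \<open>Each factor \<open>Delta\<close> exchanges \<open>X0\<close> and
    \<open>Y\<close> up to a sign, which is collected in \<open>c\<close>.\<close>
  have comm: "\<exists>c. \<exists>M\<in>{X0 n, Y}. X0 n * Delta ^\<^sub>m j = c \<cdot>\<^sub>m (Delta ^\<^sub>m j * M)" for j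
  proof (induction j)
    case 0
    have "X0 n * Delta ^\<^sub>m 0 = 1 \<cdot>\<^sub>m (Delta ^\<^sub>m 0 * X0 n)"
      using carrier_matD[OF Delta_carrier] left_mult_one_mat[of "X0 n :: 'k mat" ?N ?N] right_mult_one_mat[of "X0 n :: 'k mat" ?N ?N]
      by (simp add: zero)
    then show ?case by blast
  next
    case (Suc j)
    then obtain c M where M: "M \<in> {X0 n, Y}" "X0 n * Delta ^\<^sub>m j = c \<cdot>\<^sub>m (Delta ^\<^sub>m j * M)" by blast
    obtain M' where M': "M' \<in> {X0 n, Y}" "M * Delta = - (Delta * M')" using M(1) X_Delta Y_Delta by blast
    have Mc: "M \<in> carrier_mat ?N ?N" "M' \<in> carrier_mat ?N ?N" using M(1) M'(1) by auto
    have "X0 n * Delta ^\<^sub>m Suc j = X0 n * Delta ^\<^sub>m j * Delta" by (simp add: sq_assoc[of _ ?N])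
    also have "\<dots> = c \<cdot>\<^sub>m (Delta ^\<^sub>m j * (M * Delta))"
      using Mc by (simp add: M(2) mult_smult_assoc_mat[of _ ?N ?N _ ?N] sq_assoc[of _ ?N])
    also have "\<dots> = (- c) \<cdot>\<^sub>m (Delta ^\<^sub>m Suc j * M')"
      using Mc by (simp add: M'(2) sq_assoc[of _ ?N] uminus_mult_right_mat[of _ "Delta * M'"] carrier_matD[OF Delta_carrier]
        del: uminus_mult_right_mat) (rule eq_matI; auto)
    finally show ?case using M'(1) by blast
  qed
  have "mv ?N (B * Z') v = 0" if v: "v \<in> fV ?N" for v
  proof -
    have "mv ?N Z' v \<in> np.level i" "mv ?N (X0 n) (mv ?N Z' v) = 0" using s2 v by (auto simp: np.socle_maps_def)
    then obtain w where w: "w \<in> np.level i" "mv ?N Z' v = mv ?N (X0 n) w" using np.exactD(1)[OF ex] by blast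
    obtain u where u: "u \<in> fV ?N" "w = (np.D ^^ i) u" using w(1) by (auto simp: np.level_def)
    obtain c M where M: "M \<in> {X0 n, Y}" "X0 n * Delta ^\<^sub>m i = c \<cdot>\<^sub>m (Delta ^\<^sub>m i * M)"
      using comm by blast
    have Mc: "M \<in> carrier_mat ?N ?N" using M(1) by auto
    have "mv ?N Z' v = mv ?N (X0 n * Delta ^\<^sub>m i) u" using w(2) u by (simp add: mv_mult D_pow)
    then have "mv ?N (B * Z') v = fscale c (mv ?N (B * Delta ^\<^sub>m i) (mv ?N M u))"
      using B Z' Mc by (simp add: Q_def M(2) mv_mult mv_smult[of _ ?N] mv_scale)
    also have "mv ?N (B * Delta ^\<^sub>m i) (mv ?N M u) = 0" using s1 M(1) u(1) by (auto simp: np.socle_maps_def)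
    finally show ?thesis by (simp only: fv.scale_zero_right)
  qed
  then show ?thesis using B Z' by (subst mv_eq_0_iff) (auto simp: Q_def)
qed

theorem inexact_matrix:
  assumes ex: "\<forall>j\<le>i. np.exact (np.level j)" and nex: "\<not> np.exact (np.level (Suc i))"
  obtains T where "\<exists>Z\<in>Q i. T Z \<noteq> 0"
    "\<And>Z Z' c. Z \<in> Q i \<Longrightarrow> Z' \<in> Q i \<Longrightarrow> T (Z + c \<cdot>\<^sub>m Z') = T Z + c * T Z'"
    "\<And>Z. Z \<in> Q i \<Longrightarrow> \<exists>s\<in>C. s * Delta ^\<^sub>m i = Delta ^\<^sub>m i + Z \<and> chi s = T Z"
    "\<And>s c. s \<in> C \<Longrightarrow> s * Delta ^\<^sub>m i = c \<cdot>\<^sub>m Delta ^\<^sub>m i \<Longrightarrow> chi s = 0"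
proof -
  let ?N = "2 * n" and ?x = "mv (2 * n) (X0 n)" and ?y = "mv (2 * n) Y" and ?V = "fV (2 * n)"
  obtain h k T where h: "np.homotopy ?x ?V h" and k: "np.homotopy ?y ?V k"
    and T0: "\<exists>Z\<in>np.socle_maps i. T Z \<noteq> 0"
    and Tlin: "\<forall>Z Z' c. T (\<lambda>v. Z v + fscale c (Z' v)) = T Z + c * T Z'"
    and Tex: "\<forall>Z\<in>np.socle_maps i. \<exists>s s'. np.inverse_pair s s' \<and> (\<forall>v\<in>?V. s ((np.D ^^ i) v) = (np.D ^^ i) v + Z v)
        \<and> np.dlog ?x h s s' - np.dlog ?y k s s' = T Z"
    and Tsc: "\<forall>c s s'. np.inverse_pair s s' \<and> (\<forall>v\<in>?V. s ((np.D ^^ i) v) = fscale c ((np.D ^^ i) v))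
        \<longrightarrow> np.dlog ?x h s s' - np.dlog ?y k s s' = 0"
    using np.inexact_level[OF ex nex] by (elim exE conjE) (rule that)
  have T1: "\<exists>s\<in>C. (\<forall>v\<in>?V. mv ?N s ((np.D ^^ i) v) = (np.D ^^ i) v + Z v) \<and> chi s = T Z"
    if Z: "Z \<in> np.socle_maps i" for Z
  proof -
    obtain s s' where s: "np.inverse_pair s s'" "\<forall>v\<in>?V. s ((np.D ^^ i) v) = (np.D ^^ i) v + Z v"
      "np.dlog ?x h s s' - np.dlog ?y k s s' = T Z" using Tex Z by blast
    have c: "fv.lin ?V s" "\<And>v. v \<in> ?V \<Longrightarrow> s v \<in> ?V" using s(1) by (auto simp: np.inverse_pair_def np.commuting_def)
    have "mv ?N (mt ?N s) ((np.D ^^ i) v) = s ((np.D ^^ i) v)" if "v \<in> ?V" for v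
      by (rule mv_mt[OF c]) (use that in \<open>auto simp: D_pow\<close>)
    then have "\<forall>v\<in>?V. mv ?N (mt ?N s) ((np.D ^^ i) v) = (np.D ^^ i) v + Z v" using s(2) by simp
    moreover have "chi (mt ?N s) = T Z" using s(3) dlog_inverse_pair[OF h k s(1)] by simp
    ultimately show ?thesis using inverse_pair_C(1)[OF s(1)] by blast
  qed
  have T2: "chi s = 0" if "s \<in> C" "\<forall>v\<in>?V. mv ?N s ((np.D ^^ i) v) = fscale c ((np.D ^^ i) v)" for s c
    using Tsc[rule_format, OF conjI, OF C_inverse_pair[OF that(1)] that(2)] dlog_chi[OF h k that(1)] by simp
  \<comment> \<open>\<open>T\<close> takes total functions, and two of them with the same
    restriction to the space must be shown to have the same value. Their difference is a socle map
    that vanishes there, its automorphism fixes \<open>level i\<close>, and the scalar case gives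
    logarithm 0.\<close>
  have Tcong: "T Z = T Z'" if Z: "Z \<in> np.socle_maps i" "Z' \<in> np.socle_maps i" "\<And>v. v \<in> ?V \<Longrightarrow> Z v = Z' v" for Z Z'
  proof -
    let ?W = "\<lambda>v. Z v + fscale (-1) (Z' v)"
    have W0: "?W v = 0" if "v \<in> ?V" for v using Z(3)[OF that] by (simp add: fscale_def fun_eq_iff)
    have W: "?W \<in> np.socle_maps i"
      unfolding np.socle_maps_def
      using W0 fv.subspace_0[OF np.stableD(1)[OF np.stable_level[of i]]]
      by (auto intro!: fv.linI simp: fv.subspace_add[OF np.V(1)] fv.subspace_scale[OF np.V(1)])
    obtain s where s: "s \<in> C" "\<forall>v\<in>?V. mv ?N s ((np.D ^^ i) v) = (np.D ^^ i) v + ?W v" "chi s = T ?W"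
      using T1[OF W] by blast
    have "chi s = 0" by (rule T2[OF s(1), of 1]) (use s(2) W0 in \<open>simp add: fscale_def\<close>)
    moreover have "T ?W = T Z + (-1) * T Z'" using Tlin by blast
    ultimately show ?thesis using s(3) by simp
  qed
  show ?thesis
  proof (rule that[of "\<lambda>Z. T (mv ?N Z)"])
    obtain f where f: "f \<in> np.socle_maps i" "T f \<noteq> 0" using T0 by blast
    have "T (mv ?N (mt ?N f)) = T f"
      by (rule Tcong[OF Q_socle[OF socle_Q(1)[OF f(1)]] f(1)]) (rule socle_Q(2)[OF f(1)])
    then show "\<exists>Z\<in>Q i. T (mv ?N Z) \<noteq> 0" using socle_Q(1)[OF f(1)] f(2) by force
  next
    fix Z Z' c assume Z: "Z \<in> Q i" "Z' \<in> Q i"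
    have "mv ?N (Z + c \<cdot>\<^sub>m Z') = (\<lambda>v. mv ?N Z v + fscale c (mv ?N Z' v))"
      using Z by (auto simp: Q_def mv_plus[of _ ?N] mv_smult[of _ ?N] fun_eq_iff)
    then show "T (mv ?N (Z + c \<cdot>\<^sub>m Z')) = T (mv ?N Z) + c * T (mv ?N Z')" using Tlin by simp
  next
    fix Z assume Z: "Z \<in> Q i"
    obtain s where s: "s \<in> C" "\<forall>v\<in>?V. mv ?N s ((np.D ^^ i) v) = (np.D ^^ i) v + mv ?N Z v" "chi s = T (mv ?N Z)"
      using T1[OF Q_socle[OF Z]] by blast
    have "s * Delta ^\<^sub>m i = Delta ^\<^sub>m i + Z"
      by (rule mv_inj[of _ ?N]) (use s C_carrier[OF s(1)] Z in \<open>auto simp: Q_def mv_mult mv_plus D_pow\<close>)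
    then show "\<exists>s\<in>C. s * Delta ^\<^sub>m i = Delta ^\<^sub>m i + Z \<and> chi s = T (mv ?N Z)" using s by blast
  next
    fix s c assume s: "s \<in> C" "s * Delta ^\<^sub>m i = c \<cdot>\<^sub>m Delta ^\<^sub>m i"
    show "chi s = 0"
    proof (rule T2[OF s(1), of c])
      have "mv ?N (s * Delta ^\<^sub>m i) v = mv ?N (c \<cdot>\<^sub>m Delta ^\<^sub>m i) v" for v using s(2) by simp
      then show "\<forall>v\<in>?V. mv ?N s ((np.D ^^ i) v) = fscale c ((np.D ^^ i) v)"
        using C_carrier[OF s(1)] by (simp add: D_pow mv_mult mv_smult[of _ ?N])
    qed
  qed
qed

theorem exact_matrix:
  assumes ex: "\<And>j. np.exact (np.level j)"
  obtains \<Phi> where "\<Phi> \<in> carrier (GL (2 * n))" "transpose_mat \<Phi> = \<Phi>" "\<Phi> * X0 n = transpose_mat Y * \<Phi>"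
    "\<And>s. s \<in> C \<Longrightarrow> chi s = 0"
proof -
  let ?N = "2 * n" and ?x = "mv (2 * n) (X0 n)" and ?y = "mv (2 * n) Y" and ?V = "fV (2 * n)"
  obtain \<beta> where b: "fv.adjoint_form ?V \<beta> ?x ?y" using np.ex_adjoint_form[OF ex] by blast
  note bD = fv.adjoint_formD[OF b]
  define \<Phi> where "\<Phi> = mat ?N ?N (\<lambda>(i, j). \<beta> (unitf i) (unitf j))"
  have Pc: "\<Phi> \<in> carrier_mat ?N ?N" by (simp add: \<Phi>_def)
  have sym: "transpose_mat \<Phi> = \<Phi>"
    by (rule eq_matI) (auto simp: \<Phi>_def intro!: bD(2) unitf_fV)
  have expand: "\<beta> u v = (\<Sum>j<?N. u j * \<beta> (unitf j) v)" if "u \<in> ?V" "v \<in> ?V" for u v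
    using arg_cong[OF unitf_expansion[OF that(1)], of "\<lambda>u. \<beta> u v"] fv.funl_scale[OF bD(1)[OF that(2)] unitf_fV]
    by (subst (asm) fv.funl_sum[OF bD(1)[OF that(2)] subspace_fV])
      (auto intro: fv.subspace_scale[OF subspace_fV unitf_fV])
  have ent: "\<beta> u (unitf j) = mv ?N \<Phi> u j" if "u \<in> ?V" "j < ?N" for u j
  proof -
    have "\<beta> u (unitf j) = (\<Sum>l<?N. u l * \<beta> (unitf l) (unitf j))" by (rule expand[OF that(1) unitf_fV[OF that(2)]])
    also have "\<dots> = (\<Sum>l<?N. \<Phi> $$ (j, l) * u l)"
      using that(2) by (intro sum.cong) (auto simp: \<Phi>_def mult.commute bD(2)[OF unitf_fV unitf_fV, of j])
    finally show ?thesis using that(2) by (simp add: mv_def)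
  qed
  have GL: "\<Phi> \<in> carrier (GL ?N)"
  proof (rule GL_injective[OF Pc])
    fix v :: "nat \<Rightarrow> 'k" assume v: "v \<in> ?V" "mv ?N \<Phi> v = 0"
    show "v = 0"
    proof (rule bD(3)[OF v(1)])
      fix w :: "nat \<Rightarrow> 'k" assume w: "w \<in> ?V"
      have "\<beta> v w = \<beta> w v" by (rule bD(2)[OF v(1) w])
      also have "\<dots> = (\<Sum>j<?N. w j * \<beta> (unitf j) v)" by (rule expand[OF w v(1)])
      also have "\<dots> = 0"
      proof (intro sum.neutral ballI)
        fix j assume "j \<in> {..<?N}"
        then have j: "j < ?N" by simp
        have "\<beta> (unitf j) v = mv ?N \<Phi> v j" using bD(2)[OF unitf_fV[OF j] v(1)] ent[OF v(1) j] by simp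
        then show "w j * \<beta> (unitf j) v = 0" by (simp add: v(2))
      qed
      finally show "\<beta> v w = 0" .
    qed
  qed
  have "\<Phi> * X0 n = transpose_mat Y * \<Phi>"
  proof (rule eq_matI)
    fix j i assume "j < dim_row (transpose_mat Y * \<Phi>)" "i < dim_col (transpose_mat Y * \<Phi>)"
    then have ij: "j < ?N" "i < ?N" using Pc carrier_matD[OF Y_carrier] by auto
    have "(\<Phi> * X0 n) $$ (j, i) = mv ?N (\<Phi> * X0 n) (unitf i) j" using ij by (simp add: mv_unitf)
    also have "\<dots> = mv ?N \<Phi> (?x (unitf i)) j" using Pc by (simp add: mv_mult)
    also have "\<dots> = \<beta> (?x (unitf i)) (unitf j)" using ent[OF mv_fV ij(1)] by simp
    also have "\<dots> = \<beta> (unitf i) (?y (unitf j))" by (rule bD(4)) (use ij unitf_fV in auto)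
    also have "\<dots> = \<beta> (?y (unitf j)) (unitf i)" by (rule bD(2)) (use ij unitf_fV in auto)
    also have "\<dots> = (\<Sum>l<?N. Y $$ (l, j) * \<beta> (unitf l) (unitf i))"
      unfolding expand[OF mv_fV unitf_fV[OF ij(2)]] using ij by (simp add: mv_unitf)
    also have "\<dots> = (transpose_mat Y * \<Phi>) $$ (j, i)"
      using ij Pc carrier_matD[OF Y_carrier] by (simp add: scalar_prod_def atLeast0LessThan \<Phi>_def)
    finally show "(\<Phi> * X0 n) $$ (j, i) = (transpose_mat Y * \<Phi>) $$ (j, i)" .
  qed (use Pc carrier_matD[OF Y_carrier] carrier_matD[OF X0_carrier] in auto)
  moreover have "chi s = 0" if "s \<in> C" for s
  proof -
    obtain h k where hk: "np.homotopy ?x ?V h" "np.homotopy ?y ?V k"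
      "\<forall>s s'. np.inverse_pair s s' \<longrightarrow> np.dlog ?x h s s' - np.dlog ?y k s s' = 0"
      using np.dlog_diff_eventually_zero[OF ex] by blast
    then show ?thesis using dlog_chi[OF hk(1,2) that] C_inverse_pair[OF that] by simp
  qed
  ultimately show thesis using that[OF GL sym] by blast
qed

end

section \<open>Unitary matrices\<close>

lemma (in field_hom) GL_hom:
  assumes A: "A \<in> carrier (GL m)"
  shows "map_mat hom A \<in> carrier (GL m)" "ginv m (map_mat hom A) = map_mat hom (ginv m A)"
  using GL_inv_unique[of "map_mat hom A" m "map_mat hom (ginv m A)"] GL_inv[OF A] GL_in_carrier_mat[OF A]
  by (simp_all add: mat_hom_one flip: mat_hom_mult[of _ m m _ m])

lemma transpose_GL:
  assumes A: "A \<in> carrier (GL m)"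
  shows "transpose_mat A \<in> carrier (GL m)" "ginv m (transpose_mat A) = transpose_mat (ginv m A)"
  using GL_inv_unique[of "transpose_mat A" m "transpose_mat (ginv m A)"] GL_inv[OF A] GL_in_carrier_mat[OF A]
  by (simp_all flip: transpose_mult[of _ m m _ m] add: transpose_one)

lemma sq_uminus:
  fixes A :: "'a::ring mat"
  assumes "A \<in> carrier_mat m m" "B \<in> carrier_mat m m"
  shows "- A * B = - (A * B)" "A * - B = - (A * B)"
  using assms by auto

lemma uminus_mat_zero [simp]: "- 0\<^sub>m m k = (0\<^sub>m m k :: 'a::group_add mat)"
  by (rule eq_matI) auto

lemma uminus_uminus_sq [simp]: "- (- A) = (A :: 'a::group_add mat)"
  by (rule eq_matI) auto

lemma E_mat_GL:
  "(E_mat n :: 'a::field mat) \<in> carrier (GL (2 * n))"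
  "ginv (2 * n) (E_mat n) = four_block_mat (0\<^sub>m n n) (- 1\<^sub>m n) (1\<^sub>m n) (0\<^sub>m n n :: 'a::field mat)"
proof -
  let ?E = "E_mat n :: 'a mat" and ?I = "four_block_mat (0\<^sub>m n n) (- 1\<^sub>m n) (1\<^sub>m n) (0\<^sub>m n n) :: 'a mat"
  have c: "?E \<in> carrier_mat (2 * n) (2 * n)" "?I \<in> carrier_mat (2 * n) (2 * n)"
    unfolding E_mat_def by (intro block_carrier; simp)+
  have 1: "?E * ?I = 1\<^sub>m (2 * n)" unfolding E_mat_def one_block by (subst block_mult[of _ n]) (auto simp del: four_block_one_mat)
  have 2: "?I * ?E = 1\<^sub>m (2 * n)" unfolding E_mat_def one_block by (subst block_mult[of _ n]) (auto simp del: four_block_one_mat)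
  show "?E \<in> carrier (GL (2 * n))" "ginv (2 * n) ?E = ?I" by (rule GL_inv_unique[OF c 1 2])+
qed

lemma E_mat_neg: "ginv (2 * n) (E_mat n) = - (E_mat n :: 'a::field mat)"
  unfolding E_mat_GL(2) unfolding E_mat_def
  by (rule eq_matI) auto

lemma E_mat_transpose: "transpose_mat (E_mat n) = - (E_mat n :: 'a::field mat)"
  unfolding E_mat_def by (rule eq_matI) auto

lemma E_mat_E_mat: "E_mat n * E_mat n = - (1\<^sub>m (2 * n) :: 'a::field mat)"
  unfolding E_mat_def
  by (subst block_mult[of _ n], simp_all) (rule eq_matI; auto)

lemma E_carrier [simp]: "E_mat n \<in> carrier_mat (2 * n) (2 * n)" by (rule GL_in_carrier_mat[OF E_mat_GL(1)])

lemma E_inv: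
  fixes n :: nat
  defines "E \<equiv> E_mat n :: 'a::field mat"
  shows "ginv (2 * n) E \<in> carrier (GL (2 * n))" "ginv (2 * n) E * E = 1\<^sub>m (2 * n)" "E * ginv (2 * n) E = 1\<^sub>m (2 * n)"
    "ginv (2 * n) E \<in> carrier_mat (2 * n) (2 * n)"
  unfolding E_def by (rule GL_inv[OF E_mat_GL(1)])+

lemma conj_E_block:
  assumes "A \<in> carrier_mat n n" "B \<in> carrier_mat n n" "C \<in> carrier_mat n n" "D \<in> carrier_mat n n"
  shows "E_mat n * four_block_mat A B C D * ginv (2 * n) (E_mat n) = four_block_mat D (- C) (- B) (A :: 'a::field mat)"
  unfolding E_mat_GL(2) unfolding E_mat_def using assms by (simp add: block_mult[of _ n])

text \<open>The adjoint for the sesquilinear form with matrix \<open>E_mat n\<close>. For \<sigma>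
  the q-th power map, \<open>F_U\<close> sends \<open>A\<close> to the inverse of this matrix, so
  its fixed points are the unitary matrices.\<close>

definition dag :: "('a \<Rightarrow> 'a) \<Rightarrow> nat \<Rightarrow> 'a::field mat \<Rightarrow> 'a mat" where
  "dag \<sigma> n A = E_mat n * transpose_mat (map_mat \<sigma> A) * ginv (2 * n) (E_mat n)"

definition unitary :: "('a \<Rightarrow> 'a) \<Rightarrow> nat \<Rightarrow> 'a::field mat set" where
  "unitary \<sigma> n = {A \<in> carrier (GL (2 * n)). dag \<sigma> n A * A = 1\<^sub>m (2 * n)}"

lemma GL_left_inverse:
  assumes "A \<in> carrier (GL m)" "B \<in> carrier_mat m m" "B * A = 1\<^sub>m m" shows "ginv m A = B"
proof -
  have "B * A * ginv m A = ginv m A" using assms(3) GL_inv[OF assms(1)] by simp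
  then show ?thesis using GL_inv[OF assms(1)] GL_in_carrier_mat[OF assms(1)] assms(2) by (simp add: sq_assoc[of _ m])
qed

text \<open>No involution is assumed, because the facts are also applied to the q-th power map on
  the algebraic closure.\<close>

locale field_endomorphism = \<sigma>h: field_hom \<sigma> for \<sigma> :: "'k::field \<Rightarrow> 'k"
begin

lemma dag_carrier [simp]: "A \<in> carrier_mat (2 * n) (2 * n) \<Longrightarrow> dag \<sigma> n A \<in> carrier_mat (2 * n) (2 * n)"
  using E_inv(4)[of n, where 'a='k] by (simp add: dag_def)

lemma dag_mult:
  assumes "A \<in> carrier_mat (2 * n) (2 * n)" "B \<in> carrier_mat (2 * n) (2 * n)"
  shows "dag \<sigma> n (A * B) = dag \<sigma> n B * dag \<sigma> n A"
proof -
  note i = E_inv[of n, where 'a='k]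
  show ?thesis unfolding dag_def using assms i
    by (simp add: \<sigma>h.mat_hom_mult[of _ "2 * n" "2 * n" _ "2 * n"] transpose_mult[of _ "2 * n" "2 * n" _ "2 * n"]
      sq_assoc[of _ "2 * n"] sq_cancel[OF i(4) E_carrier _ i(2)])
qed

lemma dag_one: "dag \<sigma> n (1\<^sub>m (2 * n)) = 1\<^sub>m (2 * n)"
  using E_inv[of n, where 'a='k]
  by (simp add: right_mult_one_mat[OF E_carrier] dag_def \<sigma>h.mat_hom_one transpose_one)

text \<open>Inverse and transpose of \<open>E_mat n\<close> are both its negative, so that all signs
  cancel and only \<sigma> applied twice remains.\<close>

lemma dag_dag_map:
  assumes "A \<in> carrier_mat (2 * n) (2 * n)" shows "dag \<sigma> n (dag \<sigma> n A) = map_mat \<sigma> (map_mat \<sigma> A)"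
proof -
  let ?E = "E_mat n :: 'k mat"
  have m: "map_mat \<sigma> ?E = ?E" "map_mat \<sigma> (- ?E) = - ?E"
    unfolding E_mat_def by (rule eq_matI; auto simp: \<sigma>h.hom_uminus)+
  let ?A = "map_mat \<sigma> (map_mat \<sigma> A)"
  have t: "transpose_mat (- ?E) = ?E" using E_mat_transpose[of n, where 'a='k] by (metis uminus_uminus_sq transpose_transpose)
  have EE: "- ?E * - ?E = ?E * ?E" by (simp add: carrier_matD[OF E_carrier])
  have "dag \<sigma> n (dag \<sigma> n A) = ?E * transpose_mat (?E * transpose_mat ?A * - ?E) * - ?E"
    unfolding dag_def E_mat_neg using assms
    by (simp add: \<sigma>h.mat_hom_mult[of _ "2 * n" "2 * n" _ "2 * n"] m map_mat_transpose[symmetric] del: uminus_mult_right_mat uminus_mult_left_mat)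
  also have "transpose_mat (?E * transpose_mat ?A * - ?E) = ?E * ?A * - ?E"
    using assms by (simp add: transpose_mult[of _ "2 * n" "2 * n" _ "2 * n"] t E_mat_transpose sq_assoc[of _ "2 * n"]
      del: uminus_mult_right_mat uminus_mult_left_mat)
  also have "?E * (?E * ?A * - ?E) * - ?E = (?E * ?E) * ?A * (?E * ?E)"
    using assms EE by (simp add: sq_assoc[of _ "2 * n"])
  also have "\<dots> = ?A" using assms by (simp add: E_mat_E_mat)
  finally show ?thesis .
qed

lemma dag_GL:
  assumes A: "A \<in> carrier (GL (2 * n))"
  shows "dag \<sigma> n A \<in> carrier (GL (2 * n))" "ginv (2 * n) (dag \<sigma> n A) = dag \<sigma> n (ginv (2 * n) A)"
proof -
  note i = GL_inv[OF A] GL_in_carrier_mat[OF A]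
  have 1: "dag \<sigma> n A * dag \<sigma> n (ginv (2 * n) A) = 1\<^sub>m (2 * n)" "dag \<sigma> n (ginv (2 * n) A) * dag \<sigma> n A = 1\<^sub>m (2 * n)"
    using i by (simp_all add: dag_one flip: dag_mult)
  show "dag \<sigma> n A \<in> carrier (GL (2 * n))" "ginv (2 * n) (dag \<sigma> n A) = dag \<sigma> n (ginv (2 * n) A)"
    using GL_inv_unique[OF _ _ 1] i by auto
qed

end

context quadratic_conjugation
begin

sublocale field_endomorphism \<sigma>
  by unfold_locales (auto simp: \<sigma>_add \<sigma>_mult \<sigma>_1)

lemma dag_dag:
  assumes "A \<in> carrier_mat (2 * n) (2 * n)" shows "dag \<sigma> n (dag \<sigma> n A) = A"
  unfolding dag_dag_map[OF assms] by (rule eq_matI) (auto simp: \<sigma>_\<sigma>)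

lemma dag_zero: "dag \<sigma> n (0\<^sub>m (2 * n) (2 * n)) = 0\<^sub>m (2 * n) (2 * n)"
proof -
  have "map_mat \<sigma> (0\<^sub>m (2 * n) (2 * n)) = 0\<^sub>m (2 * n) (2 * n)" by (rule eq_matI) auto
  then show ?thesis using E_inv[of n, where 'a='k]
    by (simp add: right_mult_zero_mat[OF E_carrier] dag_def)
qed

lemma dag_combine:
  assumes "A \<in> carrier_mat (2 * n) (2 * n)" "B \<in> carrier_mat (2 * n) (2 * n)"
  shows "dag \<sigma> n (A + c \<cdot>\<^sub>m B) = dag \<sigma> n A + \<sigma> c \<cdot>\<^sub>m dag \<sigma> n B"
proof -
  note i = E_inv[of n, where 'a='k]
  have "transpose_mat (map_mat \<sigma> (A + c \<cdot>\<^sub>m B)) = transpose_mat (map_mat \<sigma> A) + \<sigma> c \<cdot>\<^sub>m transpose_mat (map_mat \<sigma> B)"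
    by (rule eq_matI) (use assms in \<open>auto simp: \<sigma>_add \<sigma>_mult\<close>)
  then show ?thesis unfolding dag_def using assms i
    by (simp add: mult_add_distrib_mat[of _ "2 * n" "2 * n" _ "2 * n"] mult_smult_distrib[of _ "2 * n" "2 * n" _ "2 * n"]
      add_mult_distrib_mat[of _ "2 * n" "2 * n" _ _ "2 * n"] mult_smult_assoc_mat[of _ "2 * n" "2 * n" _ "2 * n"])
qed

lemma dag_smult:
  assumes "A \<in> carrier_mat (2 * n) (2 * n)" shows "dag \<sigma> n (c \<cdot>\<^sub>m A) = \<sigma> c \<cdot>\<^sub>m dag \<sigma> n A"
  using dag_combine[of "0\<^sub>m (2 * n) (2 * n)" n A c] assms by (simp add: dag_zero)

lemma dag_X0: "dag \<sigma> n (X0 n) = - X0 n"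
proof -
  have "transpose_mat (map_mat \<sigma> (X0 n)) = four_block_mat (0\<^sub>m n n) (0\<^sub>m n n) (1\<^sub>m n) (0\<^sub>m n n)"
    unfolding X0_def by (rule eq_matI) (auto simp: \<sigma>_1)
  then have "dag \<sigma> n (X0 n) = four_block_mat (0\<^sub>m n n) (- 1\<^sub>m n) (0\<^sub>m n n) (0\<^sub>m n n)"
    by (simp add: dag_def conj_E_block)
  also have "\<dots> = - X0 n" unfolding X0_def by (rule eq_matI) auto
  finally show ?thesis .
qed

lemma dag_W0: "dag \<sigma> n (W0 n) = - W0 n"
proof -
  have "transpose_mat (map_mat \<sigma> (W0 n)) = four_block_mat (0\<^sub>m n n) (1\<^sub>m n) (1\<^sub>m n) (0\<^sub>m n n)"
    unfolding W0_def by (rule eq_matI) (auto simp: \<sigma>_1)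
  then have "dag \<sigma> n (W0 n) = four_block_mat (0\<^sub>m n n) (- 1\<^sub>m n) (- 1\<^sub>m n) (0\<^sub>m n n)"
    by (simp add: dag_def conj_E_block)
  also have "\<dots> = - W0 n" unfolding W0_def by (rule eq_matI) auto
  finally show ?thesis .
qed

lemma dag_transpose:
  assumes "A \<in> carrier_mat (2 * n) (2 * n)" shows "dag \<sigma> n (transpose_mat A) = transpose_mat (dag \<sigma> n A)"
proof -
  let ?E = "E_mat n :: 'k mat"
  have t: "transpose_mat (- ?E) = ?E" using E_mat_transpose[of n, where 'a='k] by (metis uminus_uminus_sq transpose_transpose)
  have "transpose_mat (dag \<sigma> n A) = ?E * map_mat \<sigma> A * - ?E"
    unfolding dag_def E_mat_neg using assms
    by (simp add: transpose_mult[of _ "2 * n" "2 * n" _ "2 * n"] t E_mat_transpose sq_assoc[of _ "2 * n"]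
      del: uminus_mult_right_mat uminus_mult_left_mat)
  then show ?thesis unfolding dag_def E_mat_neg by (simp add: map_mat_transpose[symmetric])
qed

lemma unitaryD:
  assumes "A \<in> unitary \<sigma> n"
  shows "A \<in> carrier (GL (2 * n))" "dag \<sigma> n A * A = 1\<^sub>m (2 * n)" "ginv (2 * n) A = dag \<sigma> n A" "A * dag \<sigma> n A = 1\<^sub>m (2 * n)"
    "A \<in> carrier_mat (2 * n) (2 * n)"
proof -
  show 1: "A \<in> carrier (GL (2 * n))" "dag \<sigma> n A * A = 1\<^sub>m (2 * n)" using assms by (auto simp: unitary_def)
  show 2: "A \<in> carrier_mat (2 * n) (2 * n)" by (rule GL_in_carrier_mat[OF 1(1)])
  show 3: "ginv (2 * n) A = dag \<sigma> n A" by (rule GL_left_inverse[OF 1(1) _ 1(2)]) (use 2 in simp)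
  show "A * dag \<sigma> n A = 1\<^sub>m (2 * n)" using GL_inv(3)[OF 1(1)] 3 by simp
qed

lemma unitary_mult:
  assumes "A \<in> unitary \<sigma> n" "B \<in> unitary \<sigma> n" shows "A * B \<in> unitary \<sigma> n"
proof -
  note a = unitaryD[OF assms(1)] and b = unitaryD[OF assms(2)]
  have "dag \<sigma> n (A * B) * (A * B) = dag \<sigma> n B * (dag \<sigma> n A * (A * B))"
    using a(5) b(5) by (simp add: dag_mult sq_assoc[of _ "2 * n"])
  also have "\<dots> = 1\<^sub>m (2 * n)" using sq_cancel(1)[OF dag_carrier[OF a(5)] a(5) b(5) a(2)] b(2) by simp
  finally show ?thesis using GL_mult[OF a(1) b(1)] by (simp add: unitary_def)
qed

lemma unitary_inv:
  assumes "A \<in> unitary \<sigma> n" shows "ginv (2 * n) A \<in> unitary \<sigma> n"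
proof -
  note a = unitaryD[OF assms]
  show ?thesis using dag_GL(1)[OF a(1)] a(4) dag_dag[OF a(5)] by (simp add: unitary_def a(3))
qed

text \<open>\<open>W0 n\<close> is negated by \<open>dag\<close>; it occurs twice, so
  \<open>dag\<close> commutes with the anti-automorphism.\<close>

lemma unitary_tau:
  assumes A: "A \<in> unitary \<sigma> n" shows "W0 n * transpose_mat A * W0 n \<in> unitary \<sigma> n"
proof -
  let ?N = "2 * n"
  note u = unitaryD[OF A]
  note [simp] = u(5)
  have "dag \<sigma> n (W0 n * transpose_mat A * W0 n) = W0 n * transpose_mat (dag \<sigma> n A) * W0 n"
    by (simp add: dag_mult dag_W0 dag_transpose sq_assoc[of _ ?N] sq_uminus[of _ ?N])
  moreover have "W0 n * transpose_mat (dag \<sigma> n A) * W0 n * (W0 n * transpose_mat A * W0 n)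
    = W0 n * (transpose_mat (dag \<sigma> n A) * transpose_mat A) * W0 n"
    by (simp add: sq_assoc[of _ ?N] sq_cancel[OF W0_carrier W0_carrier _ W0_W0])
  moreover have "transpose_mat (dag \<sigma> n A) * transpose_mat A = 1\<^sub>m ?N"
    by (subst transpose_mult[of _ ?N ?N _ ?N, symmetric]) (simp_all add: u(4) transpose_one)
  moreover have "W0 n * transpose_mat A * W0 n \<in> carrier (GL ?N)"
    by (intro GL_mult W0_GL(1) transpose_GL(1) u(1))
  ultimately show ?thesis by (simp add: unitary_def W0_W0 right_mult_one_mat[OF W0_carrier])
qed

text \<open>Conjugation by \<open>E_mat n\<close> brings the transposed off-diagonal block back to
  the upper right with a minus sign, the source of the sign in the second claim.\<close>

lemma Shalika_dag:
  assumes s: "s \<in> carrier (Shalika n)"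
  shows "dag \<sigma> n s \<in> carrier (Shalika n)" "chiS n (dag \<sigma> n s) = - \<sigma> (chiS n s)"
proof -
  obtain g x where gx: "g \<in> carrier (GL n)" "x \<in> carrier_mat n n" "s = four_block_mat g x (0\<^sub>m n n) g"
    using s by (auto simp: Shalika_block)
  let ?g = "transpose_mat (map_mat \<sigma> g)" and ?x = "transpose_mat (map_mat \<sigma> x)"
  note gc = GL_in_carrier_mat[OF gx(1)] and gi = GL_inv[OF gx(1)]
  have "transpose_mat (map_mat \<sigma> s) = four_block_mat ?g (0\<^sub>m n n) ?x ?g"
    unfolding gx(3) by (rule eq_matI) (use gc gx(2) in auto)
  then have d: "dag \<sigma> n s = four_block_mat ?g (- ?x) (0\<^sub>m n n) ?g" using gc gx(2) by (simp add: dag_def conj_E_block)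
  have gG: "?g \<in> carrier (GL n)" "ginv n ?g = transpose_mat (map_mat \<sigma> (ginv n g))"
    using transpose_GL[OF \<sigma>h.GL_hom(1)[OF gx(1)]] \<sigma>h.GL_hom(2)[OF gx(1)] by simp_all
  show "dag \<sigma> n s \<in> carrier (Shalika n)" unfolding d Shalika_block
    by (rule exI[of _ ?g], rule exI[of _ "- ?x"]) (use gG(1) gx(2) in simp)
  have "chiS n (dag \<sigma> n s) = mat_trace (ginv n ?g * - ?x)" unfolding d by (rule chiS_block[OF gG(1)]) (use gx(2) in simp)
  also have "ginv n ?g * - ?x = - transpose_mat (map_mat \<sigma> (x * ginv n g))"
    unfolding gG(2) using gx(2) gi by (simp add: transpose_mult[of _ n n _ n] \<sigma>h.mat_hom_mult[of _ n n _ n])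
  also have "mat_trace \<dots> = - \<sigma> (mat_trace (x * ginv n g))"
    using gx(2) gi carrier_matD[OF gi(4)] by (auto simp: mat_trace_def sum_negf \<sigma>_sum simp del: index_mult_mat(1))
  also have "mat_trace (x * ginv n g) = mat_trace (ginv n g * x)"
    by (rule mat_trace_comm[of _ n n]) (use gx(2) gi in auto)
  finally show "chiS n (dag \<sigma> n s) = - \<sigma> (chiS n s)" using chiS_block[OF gx(1,2)] gx(3) by simp
qed

text \<open>For unitary \<open>s\<close> the adjoint is the inverse, whose logarithm also carries a
  minus sign.\<close>

lemma chiS_unitary:
  assumes "s \<in> carrier (Shalika n)" "s \<in> unitary \<sigma> n" shows "\<sigma> (chiS n s) = chiS n s"
  using Shalika_dag(2)[OF assms(1)] unitaryD(3)[OF assms(2)] chiS_inv[OF assms(1)] by simp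

end

section \<open>Polynomials in a matrix of finite order\<close>

lemma finite_carrier_mat: "finite (carrier_mat m k :: 'a::{zero,finite} mat set)"
proof -
  let ?F = "{f :: nat \<times> nat \<Rightarrow> 'a. \<forall>x. (x \<in> {..<m} \<times> {..<k} \<longrightarrow> f x \<in> UNIV) \<and> (x \<notin> {..<m} \<times> {..<k} \<longrightarrow> f x = 0)}"
  have "finite ?F" by (rule finite_set_of_finite_funs) auto
  moreover have "carrier_mat m k \<subseteq> mat m k ` ?F"
  proof
    fix A :: "'a mat" assume A: "A \<in> carrier_mat m k"
    have "A = mat m k (\<lambda>x. if x \<in> {..<m} \<times> {..<k} then A $$ x else 0)" using A by (intro eq_matI) auto
    then show "A \<in> mat m k ` ?F" by (rule image_eqI[of A "mat m k"]) auto
  qed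
  ultimately show ?thesis using finite_surj by blast
qed

lemma finite_GL: "finite (carrier (GL m :: 'a::{field,finite} mat monoid))"
  by (rule finite_subset[OF _ finite_carrier_mat[of m m]]) (auto simp: GL_carrier)

lemma ex_pow_eq_one:
  fixes A :: "'a::{field,finite} mat"
  assumes A: "A \<in> carrier (GL m)" shows "\<exists>M>0. A ^\<^sub>m M = 1\<^sub>m m"
proof -
  interpret group "GL m :: 'a mat monoid" by (rule group_GL)
  note Ac = GL_in_carrier_mat[OF A]
  have pow: "A [^]\<^bsub>GL m\<^esub> k = A ^\<^sub>m k" for k :: nat
  proof (induction k)
    case 0
    then show ?case using Ac by simp
  qed simp
  have "A [^]\<^bsub>GL m\<^esub> Coset.order (GL m :: 'a mat monoid) = 1\<^sub>m m" using pow_order_eq_1[OF A] by simp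
  moreover have "Coset.order (GL m :: 'a mat monoid) > 0" using finite_GL by (simp add: order_gt_0_iff_finite)
  ultimately show ?thesis using pow by auto
qed

definition pmat :: "nat \<Rightarrow> 'a::field poly \<Rightarrow> 'a mat \<Rightarrow> 'a mat" where
  "pmat m p A = fold_coeffs (\<lambda>a M. a \<cdot>\<^sub>m 1\<^sub>m m + A * M) p (0\<^sub>m m m)"

context
  fixes m :: nat and A :: "'a::field mat"
  assumes A [simp]: "A \<in> carrier_mat m m"
begin

lemma pmat_0 [simp]: "pmat m 0 A = 0\<^sub>m m m" by (simp add: pmat_def)

lemma pmat_pCons: "pmat m (pCons a p) A = a \<cdot>\<^sub>m 1\<^sub>m m + A * pmat m p A"
proof (cases "p = 0 \<and> a = 0")
  case True
  have "0 \<cdot>\<^sub>m 1\<^sub>m m = (0\<^sub>m m m :: 'a mat)" by (rule eq_matI) auto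
  then show ?thesis using True by (simp add: right_mult_zero_mat[OF A])
qed (auto simp: pmat_def)

lemma pmat_carrier [simp]: "pmat m p A \<in> carrier_mat m m"
  by (induction p) (simp_all add: pmat_pCons)

lemma pmat_smult: "pmat m (smult c p) A = c \<cdot>\<^sub>m pmat m p A"
proof (induction p)
  case (pCons a p)
  have "(c * a) \<cdot>\<^sub>m 1\<^sub>m m + c \<cdot>\<^sub>m (A * pmat m p A) = c \<cdot>\<^sub>m (a \<cdot>\<^sub>m 1\<^sub>m m + A * pmat m p A)"
    by (rule eq_matI) (use carrier_matD[OF A] carrier_matD[OF pmat_carrier] in \<open>auto simp: algebra_simps\<close>)
  then show ?case by (simp add: pmat_pCons pCons.IH mult_smult_distrib[of _ m m _ m])
qed simp

lemma pmat_add: "pmat m (p + q) A = pmat m p A + pmat m q A"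
proof (induction p q rule: poly_induct2)
  case (pCons a p b q)
  have "(a + b) \<cdot>\<^sub>m 1\<^sub>m m + (A * pmat m p A + A * pmat m q A)
    = (a \<cdot>\<^sub>m 1\<^sub>m m + A * pmat m p A) + (b \<cdot>\<^sub>m 1\<^sub>m m + A * pmat m q A)"
    by (rule eq_matI) (use carrier_matD[OF A] carrier_matD[OF pmat_carrier] in \<open>auto simp: algebra_simps\<close>)
  then show ?case by (simp add: pmat_pCons pCons.IH mult_add_distrib_mat[of _ m m _ m])
qed simp

lemma pmat_mult: "pmat m (p * q) A = pmat m p A * pmat m q A"
proof (induction p)
  case 0
  then show ?case by (simp add: left_mult_zero_mat[OF pmat_carrier])
next
  case (pCons a p)
  have z: "0 \<cdot>\<^sub>m 1\<^sub>m m = (0\<^sub>m m m :: 'a mat)" by (rule eq_matI) auto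
  have "pmat m (pCons a p * q) A = a \<cdot>\<^sub>m pmat m q A + A * (pmat m p A * pmat m q A)"
    by (simp add: pmat_add pmat_smult pmat_pCons pCons.IH z)
  also have "\<dots> = (a \<cdot>\<^sub>m 1\<^sub>m m + A * pmat m p A) * pmat m q A"
    by (simp add: add_mult_distrib_mat[of _ m m _ _ m] sq_assoc[of _ m] mult_smult_assoc_mat[of _ m m _ m]
      left_mult_one_mat[OF pmat_carrier])
  finally show ?case by (simp add: pmat_pCons)
qed

lemma pmat_commute:
  assumes B: "B \<in> carrier_mat m m" "A * B = B * A" shows "pmat m p A * B = B * pmat m p A"
proof (induction p)
  case 0
  then show ?case by (simp add: left_mult_zero_mat[OF B(1)] right_mult_zero_mat[OF B(1)])
next
  case (pCons a p)
  have "A * pmat m p A * B = A * (B * pmat m p A)" using B(1) by (simp add: sq_assoc[of _ m] pCons.IH)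
  also have "\<dots> = B * (A * pmat m p A)"
    using B by (simp add: B(2) flip: sq_assoc[of _ m])
  finally show ?case using B(1)
    by (simp add: pmat_pCons add_mult_distrib_mat[of _ m m _ _ m] mult_add_distrib_mat[of _ m m _ m]
      mult_smult_assoc_mat[of _ m m _ m] mult_smult_distrib[of _ m m _ m])
qed

text \<open>\<open>A\<close> fixes every column of \<open>B\<close>, so p(A) acts on it as the
  scalar p(1). With B = Delta^i this shows that the unitary correction is scalar on
  \<open>level i\<close>.\<close>

lemma pmat_fix:
  assumes B: "B \<in> carrier_mat m m" "A * B = B" shows "pmat m p A * B = poly p 1 \<cdot>\<^sub>m B"
proof (induction p)
  case 0
  have "0 \<cdot>\<^sub>m B = 0\<^sub>m m m" by (rule eq_matI) (use B(1) in auto)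
  then show ?case by (simp add: left_mult_zero_mat[OF B(1)])
next
  case (pCons a p)
  have "A * pmat m p A * B = poly p 1 \<cdot>\<^sub>m B"
    using B by (simp add: sq_assoc[of _ m] pCons.IH mult_smult_distrib[of _ m m _ m])
  moreover have "a \<cdot>\<^sub>m B + poly p 1 \<cdot>\<^sub>m B = (a + poly p 1) \<cdot>\<^sub>m B"
    by (rule eq_matI) (use B(1) in \<open>auto simp: algebra_simps\<close>)
  ultimately show ?case using B(1)
    by (simp add: pmat_pCons add_mult_distrib_mat[of _ m m _ _ m] mult_smult_assoc_mat[of _ m m _ m])
qed

lemma pmat_X: "pmat m [:0, 1:] A = A"
proof -
  have "0 \<cdot>\<^sub>m 1\<^sub>m m = (0\<^sub>m m m :: 'a mat)" "1 \<cdot>\<^sub>m 1\<^sub>m m = (1\<^sub>m m :: 'a mat)" by (rule eq_matI; auto)+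
  then show ?thesis by (simp add: pmat_pCons right_mult_zero_mat[OF A] right_mult_one_mat[OF A])
qed

lemma pmat_monom: "pmat m (monom 1 k) A = A ^\<^sub>m k"
proof (induction k)
  case 0
  have "1 \<cdot>\<^sub>m 1\<^sub>m m = (1\<^sub>m m :: 'a mat)" by (rule eq_matI; auto)
  then show ?case using carrier_matD[OF A] by (simp add: monom_0 pmat_pCons right_mult_zero_mat[OF A])
next
  case (Suc k)
  have "monom 1 (Suc k) = monom 1 k * [:0, 1 :: 'a:]" by (simp add: monom_Suc)
  then show ?case by (simp only: pmat_mult Suc pmat_X) simp
qed

lemma pmat_eqv:
  assumes k: "A ^\<^sub>m k = 1\<^sub>m m" and dvd: "(monom 1 k - 1) dvd (p - q)" shows "pmat m p A = pmat m q A"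
proof -
  obtain r where "p - q = (monom 1 k - 1) * r" using dvd by (auto simp: dvd_def)
  then have "p = q + (monom 1 k + smult (-1) 1) * r" by (simp add: algebra_simps)
  moreover have "pmat m (monom 1 k + smult (-1) 1) A = 0\<^sub>m m m"
  proof -
    have "pmat m 1 A = 1\<^sub>m m" using pmat_monom[of 0] carrier_matD[OF A] by (simp add: monom_0 one_pCons)
    then show ?thesis using k unfolding pmat_add pmat_smult pmat_monom by (simp, intro eq_matI) auto
  qed
  ultimately show ?thesis by (simp add: pmat_add pmat_mult left_mult_zero_mat[OF pmat_carrier])
qed

end

text \<open>\<open>dag\<close> reverses products, which is harmless among polynomials in one matrix,
  and conjugates scalars.\<close>

lemma (in quadratic_conjugation) dag_pmat:
  assumes A: "A \<in> carrier_mat (2 * n) (2 * n)"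
  shows "dag \<sigma> n (pmat (2 * n) p A) = pmat (2 * n) (bar p) (dag \<sigma> n A)"
proof (induction p)
  case 0
  then show ?case by (simp add: bar_def dag_zero A)
next
  case (pCons a p)
  let ?N = "2 * n"
  note [simp] = A pmat_carrier[OF A] pmat_carrier[OF dag_carrier[OF A]]
  have b: "bar (pCons a p) = pCons (\<sigma> a) (bar p)" by (rule poly_eqI) (simp add: coeff_bar coeff_pCons split: nat.split)
  have cm: "a \<cdot>\<^sub>m 1\<^sub>m ?N + A * pmat ?N p A = A * pmat ?N p A + a \<cdot>\<^sub>m 1\<^sub>m ?N"
    by (rule comm_add_mat[of _ ?N ?N]) auto
  have "dag \<sigma> n (pmat ?N (pCons a p) A) = dag \<sigma> n (pmat ?N p A) * dag \<sigma> n A + \<sigma> a \<cdot>\<^sub>m 1\<^sub>m ?N"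
    by (simp add: pmat_pCons cm dag_combine dag_one dag_mult)
  also have "dag \<sigma> n (pmat ?N p A) * dag \<sigma> n A = dag \<sigma> n A * pmat ?N (bar p) (dag \<sigma> n A)"
    unfolding pCons.IH by (rule pmat_commute) auto
  also have "dag \<sigma> n A * pmat ?N (bar p) (dag \<sigma> n A) + \<sigma> a \<cdot>\<^sub>m 1\<^sub>m ?N = \<sigma> a \<cdot>\<^sub>m 1\<^sub>m ?N + dag \<sigma> n A * pmat ?N (bar p) (dag \<sigma> n A)"
    by (rule comm_add_mat[of _ ?N ?N]) auto
  finally show ?case by (simp add: b pmat_pCons)
qed

section \<open>The dichotomy for the general linear group\<close>

context shalika_pair
begin

text \<open>\<open>H0 n\<close> and its conjugate by \<open>g\<close> are contracting homotopies of
  \<open>X0 n\<close> and \<open>Y\<close>. So a first failure of exactness can only occur at a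
  positive level.\<close>

lemma exact_V: "np.exact (fV (2 * n))"
proof -
  have ex: "u \<in> mv (2 * n) Z ` fV (2 * n)"
    if "H \<in> carrier_mat (2 * n) (2 * n)" "Z \<in> carrier_mat (2 * n) (2 * n)" "Z * H + H * Z = 1\<^sub>m (2 * n)" "u \<in> fV (2 * n)" "mv (2 * n) Z u = 0"
    for H Z u
  proof (rule image_eqI)
    have "u = mv (2 * n) (Z * H + H * Z) u" using that by (simp add: mv_one)
    also have "\<dots> = mv (2 * n) Z (mv (2 * n) H u)"
      using that(1,2,5) by (subst mv_plus) (auto simp: mv_mult)
    finally show "u = mv (2 * n) Z (mv (2 * n) H u)" .
  qed simp
  let ?H = "g * H0 n * ginv (2 * n) g"
  note [simp] = gi gc sq_cancel[OF gi(4) gc _ gi(2)]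
  have "Y * ?H + ?H * Y = g * (X0 n * H0 n) * ginv (2 * n) g + g * (H0 n * X0 n) * ginv (2 * n) g"
    unfolding Y_def by (simp add: sq_assoc[of _ "2 * n"])
  also have "\<dots> = g * (X0 n * H0 n + H0 n * X0 n) * ginv (2 * n) g"
    by (simp add: mult_add_distrib_mat[of _ "2 * n" "2 * n" _ "2 * n"] add_mult_distrib_mat[of _ "2 * n" "2 * n" _ _ "2 * n"])
  also have "\<dots> = 1\<^sub>m (2 * n)" by (simp add: X0_H0 right_mult_one_mat[OF gc])
  finally have "Y * ?H + ?H * Y = 1\<^sub>m (2 * n)" .
  then show ?thesis
    unfolding np.exact_def using ex[OF H0_carrier X0_carrier X0_H0] ex[of ?H Y] by auto
qed

lemma levels_cases:
  obtains "\<And>j. np.exact (np.level j)" | i where "\<forall>j\<le>i. np.exact (np.level j)" "\<not> np.exact (np.level (Suc i))"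
proof (cases "\<forall>j. np.exact (np.level j)")
  case False
  then obtain j where j: "\<not> np.exact (np.level j)" "\<And>l. l < j \<Longrightarrow> np.exact (np.level l)"
    using exists_least_iff[of "\<lambda>j. \<not> np.exact (np.level j)"] by blast
  have "j \<noteq> 0" using j(1) exact_V by (metis np.level_0)
  then obtain i where "j = Suc i" using not0_implies_Suc by blast
  then show thesis using that(2)[of i] j by auto
qed (use that in blast)

abbreviation tau :: "'k mat \<Rightarrow> 'k mat" where "tau A \<equiv> W0 n * transpose_mat A * W0 n"

text \<open>Transposing the hypothesis gives \<Phi> Y = X0^T \<Phi>. With W0 X0 = X0^T W0, this lets
  \<open>X0\<close> pass through both products, which puts them into the centraliser.\<close>

lemma ex_factorisation:
  assumes \<Phi>: "\<Phi> \<in> carrier (GL (2 * n))" "transpose_mat \<Phi> = \<Phi>" "\<Phi> * X0 n = transpose_mat Y * \<Phi>"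
  shows "\<exists>s\<in>carrier (Shalika n). \<exists>s'\<in>carrier (Shalika n). tau g * s' = s * g \<and> chiS n s = chiS n s'"
proof -
  let ?N = "2 * n"
  note Pc = GL_in_carrier_mat[OF \<Phi>(1)]
  note [simp] = Pc gi gc sq_assoc[of _ ?N] sq_cancel[OF gi(4) gc _ gi(2)] sq_cancel[OF W0_carrier W0_carrier _ W0_W0]
  let ?s = "W0 n * transpose_mat g * \<Phi>" and ?s' = "W0 n * \<Phi> * g"
  have WX: "X0 n * W0 n = W0 n * transpose_mat (X0 n)" "W0 n * X0 n = transpose_mat (X0 n) * W0 n"
    unfolding W0_X0[symmetric] by (simp_all add: W0_W0 right_mult_one_mat[OF X0_carrier])
  have WXc: "W0 n * (transpose_mat (X0 n) * A) = X0 n * (W0 n * A)" if "A \<in> carrier_mat ?N ?N" for A :: "'k mat"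
  proof -
    have "W0 n * (transpose_mat (X0 n) * A) = W0 n * transpose_mat (X0 n) * A" using that by simp
    also have "\<dots> = X0 n * W0 n * A" by (simp only: WX(1))
    finally show ?thesis using that by simp
  qed
  have gX: "transpose_mat g * transpose_mat Y = transpose_mat (X0 n) * transpose_mat g"
    unfolding Y_def by (simp add: transpose_mult[of _ ?N ?N _ ?N, symmetric] right_mult_one_mat[OF gc] right_mult_one_mat[OF X0_carrier])
  have PY: "\<Phi> * Y = transpose_mat (X0 n) * \<Phi>"
    using arg_cong[OF \<Phi>(3), of transpose_mat] \<Phi>(2) by (simp add: transpose_mult[of _ ?N ?N _ ?N])
  have gl: "?s \<in> carrier (GL ?N)" "?s' \<in> carrier (GL ?N)"
    using W0_GL(1)[of n, where 'a='k] transpose_GL(1)[OF g] \<Phi>(1) g by (auto intro!: GL_mult simp del: sq_assoc)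
  have "?s * X0 n = W0 n * (transpose_mat g * transpose_mat Y) * \<Phi>" by (simp add: \<Phi>(3))
  also have "\<dots> = X0 n * ?s" unfolding gX by (simp add: WXc)
  finally have s: "?s \<in> carrier (Shalika n)" using gl(1) by (simp add: Shalika_commute_X0)
  have Yg: "g * X0 n = Y * g" unfolding Y_def by (simp add: right_mult_one_mat[OF X0_carrier])
  have "?s' * X0 n = W0 n * (\<Phi> * Y) * g" by (simp add: Yg)
  also have "\<dots> = X0 n * ?s'" unfolding PY by (simp add: WXc)
  finally have s': "?s' \<in> carrier (Shalika n)" using gl(2) by (simp add: Shalika_commute_X0)
  have "tau g * ?s' = ?s * g" by simp
  moreover have "tau ?s' = ?s" by (simp add: transpose_mult[of _ ?N ?N _ ?N] \<Phi>(2) W0_transpose W0_W0 right_mult_one_mat[OF Pc])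
  then have "chiS n ?s = chiS n ?s'" using chiS_transpose[OF s'] by simp
  ultimately show ?thesis using s s' by blast
qed

lemma socle_functional:
  assumes T: "\<And>Z Z' c. Z \<in> Q i \<Longrightarrow> Z' \<in> Q i \<Longrightarrow> T (Z + c \<cdot>\<^sub>m Z') = T Z + c * T Z'" and Z: "Z \<in> Q i"
  shows "c \<cdot>\<^sub>m Z \<in> Q i" "T (c \<cdot>\<^sub>m Z) = c * T Z"
proof -
  have Zc: "Z \<in> carrier_mat (2 * n) (2 * n)" using Z by (simp add: Q_def)
  have z: "Z + (-1) \<cdot>\<^sub>m Z = 0\<^sub>m (2 * n) (2 * n)" "0\<^sub>m (2 * n) (2 * n) + c \<cdot>\<^sub>m Z = c \<cdot>\<^sub>m Z"
    by (rule eq_matI; use Zc in auto)+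
  have 0: "0\<^sub>m (2 * n) (2 * n) \<in> Q i" "T (0\<^sub>m (2 * n) (2 * n)) = 0"
    using Q_combine[OF Z Z, of "-1"] T[OF Z Z, of "-1"] unfolding z by simp_all
  show "c \<cdot>\<^sub>m Z \<in> Q i" "T (c \<cdot>\<^sub>m Z) = c * T Z"
    using Q_combine[OF 0(1) Z, of c] T[OF 0(1) Z, of c] 0(2) unfolding z by simp_all
qed

theorem linear_dichotomy:
  "(\<forall>c. \<exists>s\<in>C. chi s = c) \<or>
    (\<exists>s\<in>carrier (Shalika n). \<exists>s'\<in>carrier (Shalika n). tau g * s' = s * g \<and> chiS n s = chiS n s')"
proof (rule levels_cases)
  assume "\<And>j. np.exact (np.level j)"
  then obtain \<Phi> where "\<Phi> \<in> carrier (GL (2 * n))" "transpose_mat \<Phi> = \<Phi>" "\<Phi> * X0 n = transpose_mat Y * \<Phi>"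
    using exact_matrix by metis
  from ex_factorisation[OF this] show ?thesis ..
next
  fix i assume i: "\<forall>j\<le>i. np.exact (np.level j)" "\<not> np.exact (np.level (Suc i))"
  obtain T where T: "\<exists>Z\<in>Q i. T Z \<noteq> 0"
    "\<And>Z Z' c. Z \<in> Q i \<Longrightarrow> Z' \<in> Q i \<Longrightarrow> T (Z + c \<cdot>\<^sub>m Z') = T Z + c * T Z'"
    "\<And>Z. Z \<in> Q i \<Longrightarrow> \<exists>s\<in>C. s * Delta ^\<^sub>m i = Delta ^\<^sub>m i + Z \<and> chi s = T Z"
    by (rule inexact_matrix[OF i]) blast
  obtain Z where Z: "Z \<in> Q i" "T Z \<noteq> 0" using T(1) by blast
  \<comment> \<open>Multiples of a single \<open>Z\<close> with nonzero \<open>T Z\<close> already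
    reach every value.\<close>
  have "\<exists>s\<in>C. chi s = c" for c
    using T(3)[of "(c / T Z) \<cdot>\<^sub>m Z"] socle_functional[of i T, OF T(2) Z(1), of "c / T Z"] Z(2) by auto
  then show ?thesis by blast
qed

end

section \<open>The dichotomy for the unitary group\<close>

locale unitary_shalika_pair = shalika_pair n g + quadratic_conjugation \<sigma>
  for n and g :: "'k::{field,finite} mat" and \<sigma> :: "'k \<Rightarrow> 'k" +
  assumes unitary_g: "g \<in> unitary \<sigma> n"
begin

lemma dag_Y: "dag \<sigma> n Y = - Y"
proof -
  note u = unitaryD[OF unitary_g]
  have Yd: "Y = g * X0 n * dag \<sigma> n g" by (simp add: Y_def u(3))
  show ?thesis unfolding Yd using u(5) by (simp add: dag_mult dag_dag dag_X0 sq_uminus[of _ "2 * n"] sq_assoc[of _ "2 * n"])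
qed

lemma dag_Delta: "dag \<sigma> n Delta = - Delta"
proof -
  have "Delta = X0 n + (-1) \<cdot>\<^sub>m Y" unfolding Delta_def by (rule eq_matI) auto
  then have "dag \<sigma> n Delta = - X0 n + (-1) \<cdot>\<^sub>m (- Y)" by (simp add: dag_combine dag_X0 dag_Y \<sigma>_minus \<sigma>_1)
  also have "\<dots> = - Delta"
    unfolding Delta_def by (rule eq_matI) (use carrier_matD[OF X0_carrier[of n, where 'a='k]] carrier_matD[OF Y_carrier] in auto)
  finally show ?thesis .
qed

lemma dag_Delta_pow: "dag \<sigma> n (Delta ^\<^sub>m i) = (-1) ^ i \<cdot>\<^sub>m Delta ^\<^sub>m i"
proof (induction i)
  case 0
  have "1 \<cdot>\<^sub>m 1\<^sub>m (2 * n) = (1\<^sub>m (2 * n) :: 'k mat)" by (rule eq_matI) auto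
  then show ?case using carrier_matD[OF Delta_carrier] by (simp add: dag_one)
next
  case (Suc i)
  have "Delta * Delta ^\<^sub>m i = Delta ^\<^sub>m i * Delta"
    by (induction i) (simp_all add: left_mult_one_mat[OF Delta_carrier] right_mult_one_mat[OF Delta_carrier]
        carrier_matD[OF Delta_carrier] flip: sq_assoc[of _ "2 * n"])
  moreover have "dag \<sigma> n (Delta ^\<^sub>m Suc i) = - Delta * ((-1) ^ i \<cdot>\<^sub>m Delta ^\<^sub>m i)"
    by (simp add: dag_mult dag_Delta Suc)
  ultimately show ?case
    by (simp add: mult_smult_distrib[of _ "2 * n" "2 * n" _ "2 * n"] sq_uminus[of _ "2 * n"]) (rule eq_matI; auto)
qed

lemma C_dag:
  assumes s: "s \<in> C" shows "dag \<sigma> n s \<in> C"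
proof -
  note c = C_carrier[OF s]
  have "s * X0 n = X0 n * s" "s * Y = Y * s" using s by (auto simp: C_iff)
  then have "dag \<sigma> n (s * X0 n) = dag \<sigma> n (X0 n * s)" "dag \<sigma> n (s * Y) = dag \<sigma> n (Y * s)" by simp_all
  then have "- (X0 n * dag \<sigma> n s) = - (dag \<sigma> n s * X0 n)" "- (Y * dag \<sigma> n s) = - (dag \<sigma> n s * Y)"
    using c by (simp_all add: dag_mult dag_X0 dag_Y sq_uminus[of _ "2 * n"])
  then have "X0 n * dag \<sigma> n s = dag \<sigma> n s * X0 n" "Y * dag \<sigma> n s = dag \<sigma> n s * Y"
    by (metis uminus_uminus_sq)+
  then show ?thesis using dag_GL(1)[OF C_GL[OF s]] by (simp add: C_iff)
qed

lemma chi_unitary: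
  assumes "s \<in> C" "s \<in> unitary \<sigma> n" shows "\<sigma> (chi s) = chi s"
proof -
  have "ginv (2 * n) g * s * g \<in> unitary \<sigma> n" by (intro unitary_mult unitary_inv unitary_g assms)
  then show ?thesis using assms by (simp add: chi_def C_def \<sigma>_diff chiS_unitary)
qed

text \<open>\<open>dag\<close> negates \<open>X0\<close>, \<open>Y\<close> and \<open>Delta\<close>
  and reverses products; so it exchanges the left conditions in \<open>Q i\<close> with the right
  ones.\<close>

lemma Q_dag:
  assumes Z: "Z \<in> Q i" shows "dag \<sigma> n Z \<in> Q i"
proof -
  let ?N = "2 * n" and ?e = "(-1) ^ i :: 'k"
  have c: "Z \<in> carrier_mat (2 * n) (2 * n)" "X0 n * Z = 0\<^sub>m (2 * n) (2 * n)" "Y * Z = 0\<^sub>m (2 * n) (2 * n)"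
    "Z * X0 n = 0\<^sub>m (2 * n) (2 * n)" "Z * Y = 0\<^sub>m (2 * n) (2 * n)" using Z by (auto simp: Q_def)
  obtain A B where AB: "A \<in> carrier_mat (2 * n) (2 * n)" "Z = Delta ^\<^sub>m i * A"
    "B \<in> carrier_mat (2 * n) (2 * n)" "Z = B * Delta ^\<^sub>m i" using Z by (auto simp: Q_def)
  have z: "A = 0\<^sub>m ?N ?N" if "- A = 0\<^sub>m ?N ?N" for A :: "'k mat"
    using that by (metis uminus_uminus_sq uminus_mat_zero)
  have "X0 n * dag \<sigma> n Z = 0\<^sub>m ?N ?N"
    by (rule z) (use arg_cong[OF c(4), of "dag \<sigma> n"] c(1) in \<open>simp add: dag_mult dag_X0 dag_zero sq_uminus[of _ "2 * n"]\<close>)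
  moreover have "Y * dag \<sigma> n Z = 0\<^sub>m ?N ?N"
    by (rule z) (use arg_cong[OF c(5), of "dag \<sigma> n"] c(1) in \<open>simp add: dag_mult dag_Y dag_zero sq_uminus[of _ "2 * n"]\<close>)
  moreover have "dag \<sigma> n Z * X0 n = 0\<^sub>m ?N ?N"
    by (rule z) (use arg_cong[OF c(2), of "dag \<sigma> n"] c(1) in \<open>simp add: dag_mult dag_X0 dag_zero sq_uminus[of _ "2 * n"]\<close>)
  moreover have "dag \<sigma> n Z * Y = 0\<^sub>m ?N ?N"
    by (rule z) (use arg_cong[OF c(3), of "dag \<sigma> n"] c(1) in \<open>simp add: dag_mult dag_Y dag_zero sq_uminus[of _ "2 * n"]\<close>)
  moreover have 1: "dag \<sigma> n Z = Delta ^\<^sub>m i * (?e \<cdot>\<^sub>m dag \<sigma> n B)"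
    using AB(3) by (simp add: AB(4) dag_mult dag_Delta_pow mult_smult_distrib[of _ ?N ?N _ ?N] mult_smult_assoc_mat[of _ ?N ?N _ ?N])
  moreover have 2: "dag \<sigma> n Z = (?e \<cdot>\<^sub>m dag \<sigma> n A) * Delta ^\<^sub>m i"
    using AB(1) by (simp add: AB(2) dag_mult dag_Delta_pow mult_smult_distrib[of _ ?N ?N _ ?N] mult_smult_assoc_mat[of _ ?N ?N _ ?N])
  moreover have "\<exists>A\<in>carrier_mat ?N ?N. dag \<sigma> n Z = Delta ^\<^sub>m i * A" using 1 by (rule bexI) (use AB in simp)
  moreover have "\<exists>B\<in>carrier_mat ?N ?N. dag \<sigma> n Z = B * Delta ^\<^sub>m i" using 2 by (rule bexI) (use AB in simp)
  ultimately show ?thesis using dag_carrier[OF c(1)] unfolding Q_def by (intro CollectI conjI)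
qed

text \<open>\<open>c\<close> has finite order M, and b = P(c) for the polynomial of
  \<open>ex_poly_norm\<close>; its adjoint is (bar P)(c) because \<open>c\<close> is hermitian. As a
  polynomial in \<open>c\<close> it commutes with \<open>X0\<close> and \<open>Y\<close>, and where
  \<open>c\<close> acts as 1 it acts as the scalar P(1).\<close>

lemma ex_hermitian_norm:
  assumes c: "c \<in> C" "dag \<sigma> n c = c"
  shows "\<exists>b\<in>C. b * dag \<sigma> n b = c \<and> (\<forall>i. c * Delta ^\<^sub>m i = Delta ^\<^sub>m i \<longrightarrow> (\<exists>a. b * Delta ^\<^sub>m i = a \<cdot>\<^sub>m Delta ^\<^sub>m i))"
proof -
  let ?N = "2 * n"
  note cc [simp] = C_carrier[OF c(1)]
  obtain M where M: "M > 0" "c ^\<^sub>m M = 1\<^sub>m ?N" using ex_pow_eq_one[OF C_GL[OF c(1)]] by blast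
  obtain P where P: "(monom 1 M - 1) dvd (P * bar P - [:0, 1:])" using ex_poly_norm[OF M(1)] by blast
  define b where "b = pmat ?N P c"
  have bc [simp]: "b \<in> carrier_mat ?N ?N" by (simp add: b_def)
  have db: "dag \<sigma> n b = pmat ?N (bar P) c" by (simp add: b_def dag_pmat c(2))
  have bb: "b * dag \<sigma> n b = c" unfolding db unfolding b_def
    using pmat_eqv[OF cc M(2) P] by (simp add: pmat_mult pmat_X)
  have bb': "dag \<sigma> n b * b = c" unfolding db unfolding b_def
    using pmat_eqv[OF cc M(2) P] by (simp add: mult.commute[of P] pmat_X flip: pmat_mult)
  note ci = GL_inv[OF C_GL[OF c(1)]]
  have "b * (dag \<sigma> n b * ginv ?N c) = 1\<^sub>m ?N" using ci by (simp add: bb flip: sq_assoc[of _ ?N])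
  moreover have "ginv ?N c * dag \<sigma> n b * b = 1\<^sub>m ?N" using ci by (simp add: bb' sq_assoc[of _ ?N])
  moreover have "dag \<sigma> n b * ginv ?N c = ginv ?N c * dag \<sigma> n b"
    unfolding db by (rule pmat_commute[OF cc]) (use ci in simp_all)
  ultimately have "b \<in> carrier (GL ?N)" using GL_inv_unique(1)[of b ?N "dag \<sigma> n b * ginv ?N c"] ci by simp
  moreover have "b * X0 n = X0 n * b" "b * Y = Y * b"
    unfolding b_def by (rule pmat_commute[OF cc]; use c in \<open>simp add: C_iff\<close>)+
  ultimately have "b \<in> C" by (simp add: C_iff)
  moreover have "b * Delta ^\<^sub>m i = poly P 1 \<cdot>\<^sub>m Delta ^\<^sub>m i" if "c * Delta ^\<^sub>m i = Delta ^\<^sub>m i" for i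
    unfolding b_def by (rule pmat_fix[OF cc]) (use that in auto)
  ultimately show ?thesis using bb by blast
qed

text \<open>The expression is linear in \<mu> over the fixed field and takes values in it, so it is
  onto unless it vanishes identically. In that case \<mu> = 1 gives u = - t, and \<sigma> would be
  the identity.\<close>

lemma ex_skew_multiple:
  assumes t: "t \<noteq> 0" and fixed: "\<And>\<mu>. \<sigma> (\<mu> * t + \<sigma> \<mu> * u) = \<mu> * t + \<sigma> \<mu> * u" and c: "\<sigma> c = c"
  shows "\<exists>\<mu>. \<mu> * t + \<sigma> \<mu> * u = c"
proof -
  have "\<exists>\<mu>. \<mu> * t + \<sigma> \<mu> * u \<noteq> 0"
  proof (rule ccontr)
    assume "\<not> ?thesis"
    then have z: "\<mu> * t + \<sigma> \<mu> * u = 0" for \<mu> by blast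
    have "u = - t" using z[of 1] by (simp add: \<sigma>_1 eq_neg_iff_add_eq_0 add.commute)
    then have "(\<mu> - \<sigma> \<mu>) * t = 0" for \<mu> using z[of \<mu>] by (simp add: algebra_simps)
    then show False using t ex_nonfixed by (metis eq_iff_diff_eq_0 mult_eq_0_iff)
  qed
  then obtain \<mu> where \<mu>: "\<mu> * t + \<sigma> \<mu> * u \<noteq> 0" by blast
  let ?\<nu> = "\<mu> * t + \<sigma> \<mu> * u"
  let ?a = "c * inverse ?\<nu>"
  have "\<sigma> ?a = ?a" using fixed[of \<mu>] c by (simp only: \<sigma>_mult \<sigma>_inverse)
  then have "(?a * \<mu>) * t + \<sigma> (?a * \<mu>) * u = ?a * ?\<nu>" by (simp only: \<sigma>_mult) (simp only: ring_distribs mult.assoc)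
  also have "\<dots> = c" using \<mu> by (simp add: mult.assoc)
  finally show ?thesis by blast
qed

theorem unitary_dichotomy:
  "(\<forall>c. \<sigma> c = c \<longrightarrow> (\<exists>s\<in>C \<inter> unitary \<sigma> n. chi s = c)) \<or>
    (\<exists>s\<in>carrier (Shalika n) \<inter> unitary \<sigma> n. \<exists>s'\<in>carrier (Shalika n) \<inter> unitary \<sigma> n.
      tau g * s' = s * g \<and> chiS n s = chiS n s')"
proof (rule levels_cases)
  let ?N = "2 * n"
  note u = unitaryD[OF unitary_g]
  assume "\<And>j. np.exact (np.level j)"
  then obtain \<Phi> where \<Phi>: "\<Phi> \<in> carrier (GL ?N)" "transpose_mat \<Phi> = \<Phi>" "\<Phi> * X0 n = transpose_mat Y * \<Phi>"
    and chi0: "\<And>s. s \<in> C \<Longrightarrow> chi s = 0"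
    using exact_matrix by metis
  obtain s s' where s: "s \<in> carrier (Shalika n)" "s' \<in> carrier (Shalika n)" "tau g * s' = s * g" "chiS n s = chiS n s'"
    using ex_factorisation[OF \<Phi>] by blast
  note sG = Shalika_GL[OF s(1)] Shalika_GL[OF s(2)]
  note sc [simp] = GL_in_carrier_mat[OF sG(1)] GL_in_carrier_mat[OF sG(2)] u(5)
  have tauU: "tau g \<in> unitary \<sigma> n" by (rule unitary_tau[OF unitary_g])
  note tU = unitaryD[OF tauU]
  \<comment> \<open>Measures the failure of \<open>s\<close> to be unitary. As \<open>g\<close> and
    \<open>tau g\<close> are unitary, conjugating \<open>d\<close> by \<open>g\<close> gives the
    same expression for \<open>s'\<close>; so \<open>d\<close> lies in \<open>C\<close>, and one
    correction repairs both.\<close>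
  define d where "d = dag \<sigma> n s * s"
  have dS: "d \<in> carrier (Shalika n)" unfolding d_def by (intro Shalika_mult Shalika_dag s)
  have "dag \<sigma> n (t * s') * (t * s') = dag \<sigma> n s' * s'" if "t \<in> unitary \<sigma> n" for t
  proof -
    note t = unitaryD[OF that]
    show ?thesis using t(5) by (simp add: dag_mult sq_assoc[of _ ?N] sq_cancel[OF dag_carrier[OF t(5)] t(5) _ t(2)])
  qed
  from this[OF tauU] have "ginv ?N g * d * g = dag \<sigma> n s' * s'"
    unfolding s(3) d_def by (simp add: u(3) dag_mult sq_assoc[of _ ?N])
  moreover have "dag \<sigma> n s' * s' \<in> carrier (Shalika n)" by (intro Shalika_mult Shalika_dag s)
  ultimately have dC: "d \<in> C" using dS by (simp add: C_def)
  note dc [simp] = C_carrier[OF dC] GL_inv(4)[OF C_GL[OF dC]]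
  have dd: "dag \<sigma> n d = d" by (simp add: d_def dag_mult dag_dag)
  have "dag \<sigma> n (ginv ?N d) = ginv ?N d" using dag_GL(2)[OF C_GL[OF dC]] dd by simp
  then obtain b where b: "b \<in> C" "b * dag \<sigma> n b = ginv ?N d"
    using ex_hermitian_norm[OF C_inv[OF dC]] by blast
  note bG = C_GL[OF b(1)] and bc [simp] = C_carrier[OF b(1)]
  note bi = GL_inv[OF bG]
  have dinv: "d = ginv ?N (dag \<sigma> n b) * ginv ?N b"
    using arg_cong[OF b(2), of "ginv ?N"] GL_inv_inv[OF C_GL[OF dC]] GL_inv_mult[OF bG dag_GL(1)[OF bG]] by simp
  note dbi = GL_inv[OF dag_GL(1)[OF bG]]
  \<comment> \<open>The conjugate of \<open>b\<close> by \<open>g\<close> on the other side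
    preserves the factorisation, and \<open>chi b = 0\<close> keeps the two logarithms
    equal.\<close>
  let ?s = "s * b" and ?s' = "s' * (ginv ?N g * b * g)"
  have sbU: "?s \<in> unitary \<sigma> n"
  proof -
    have "dag \<sigma> n ?s * ?s = dag \<sigma> n b * d * b" by (simp add: dag_mult d_def sq_assoc[of _ ?N])
    also have "\<dots> = 1\<^sub>m ?N" unfolding dinv using bi dbi
      by (simp add: sq_assoc[of _ ?N] sq_cancel[OF dag_carrier[OF bc] dbi(4) _ dbi(3)])
    finally show ?thesis using GL_mult[OF sG(1) bG] by (simp add: unitary_def)
  qed
  have bS: "b \<in> carrier (Shalika n)" "ginv ?N g * b * g \<in> carrier (Shalika n)" using b(1) by (auto simp: C_def)
  have eq: "tau g * ?s' = ?s * g"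
  proof -
    have "tau g * ?s' = tau g * s' * (ginv ?N g * b * g)" using tU(5) gi by (simp add: sq_assoc[of _ ?N] del: mult_carrier_mat)
    also have "\<dots> = ?s * g" unfolding s(3) using gi by (simp add: sq_assoc[of _ ?N] sq_cancel[OF gc gi(4) _ gi(3)])
    finally show ?thesis .
  qed
  have s'c: "?s' \<in> carrier_mat ?N ?N" using gi by simp
  have "?s' = ginv ?N (tau g) * (?s * g)"
    unfolding eq[symmetric] using sq_cancel(1)[OF GL_inv(4)[OF tU(1)] tU(5) s'c GL_inv(2)[OF tU(1)]] by simp
  then have "?s' \<in> unitary \<sigma> n" using unitary_mult[OF unitary_inv[OF tauU] unitary_mult[OF sbU unitary_g]] by simp
  moreover have "?s \<in> carrier (Shalika n)" "?s' \<in> carrier (Shalika n)" using s bS by (simp_all add: Shalika_mult)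
  moreover have "chiS n ?s = chiS n ?s'"
    using chi0[OF b(1)] s bS by (simp add: chiS_mult chi_def)
  ultimately show ?thesis using eq sbU by blast
next
  let ?N = "2 * n"
  fix i assume i: "\<forall>j\<le>i. np.exact (np.level j)" "\<not> np.exact (np.level (Suc i))"
  obtain T where T: "\<exists>Z\<in>Q i. T Z \<noteq> 0"
    "\<And>Z Z' c. Z \<in> Q i \<Longrightarrow> Z' \<in> Q i \<Longrightarrow> T (Z + c \<cdot>\<^sub>m Z') = T Z + c * T Z'"
    "\<And>Z. Z \<in> Q i \<Longrightarrow> \<exists>s\<in>C. s * Delta ^\<^sub>m i = Delta ^\<^sub>m i + Z \<and> chi s = T Z"
    "\<And>s c. s \<in> C \<Longrightarrow> s * Delta ^\<^sub>m i = c \<cdot>\<^sub>m Delta ^\<^sub>m i \<Longrightarrow> chi s = 0"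
    by (rule inexact_matrix[OF i]) blast
  obtain Z0 where Z0: "Z0 \<in> Q i" "T Z0 \<noteq> 0" using T(1) by blast
  define e :: 'k where "e = (-1) ^ i"
  have ee: "e * e = 1" "\<sigma> e = e"
    unfolding e_def by (induction i) (simp_all add: \<sigma>_1 \<sigma>_minus)
  define u where "u = - e * T (dag \<sigma> n Z0)"
  have solve: "\<exists>s\<in>C \<inter> unitary \<sigma> n. chi s = \<mu> * T Z0 + \<sigma> \<mu> * u" for \<mu>
  proof -
    define \<zeta> where "\<zeta> = \<mu> \<cdot>\<^sub>m Z0"
    note z = socle_functional[of i T, OF T(2) Z0(1), of \<mu>, folded \<zeta>_def]
    have zc [simp]: "\<zeta> \<in> carrier_mat ?N ?N" "Z0 \<in> carrier_mat ?N ?N" using z(1) Z0(1) by (auto simp: Q_def)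
    \<comment> \<open>Skew-symmetrised with the sign \<open>e\<close> by which \<open>dag\<close>
      acts on Delta^i. Then \<open>s\<close> and its adjoint act on Delta^i by opposite first-order
      terms, Z and - Z, and their product has none.\<close>
    define Z where "Z = \<zeta> + (- e) \<cdot>\<^sub>m dag \<sigma> n \<zeta>"
    have ZQ: "Z \<in> Q i" unfolding Z_def by (rule Q_combine[OF z(1) Q_dag[OF z(1)]])
    have Zc [simp]: "Z \<in> carrier_mat ?N ?N" by (simp add: Z_def)
    have "T Z = \<mu> * T Z0 + (- e) * T (dag \<sigma> n \<zeta>)" unfolding Z_def using T(2)[OF z(1) Q_dag[OF z(1)]] z(2) by simp
    also have "T (dag \<sigma> n \<zeta>) = \<sigma> \<mu> * T (dag \<sigma> n Z0)"
      unfolding \<zeta>_def using socle_functional(2)[of i T, OF T(2) Q_dag[OF Z0(1)]] by (simp add: dag_smult)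
    finally have TZ: "T Z = \<mu> * T Z0 + \<sigma> \<mu> * u" by (simp add: u_def algebra_simps)
    have "dag \<sigma> n Z = dag \<sigma> n \<zeta> + (- e) \<cdot>\<^sub>m \<zeta>"
      unfolding Z_def by (simp add: dag_combine dag_dag \<sigma>_minus ee(2))
    then have dZ: "e \<cdot>\<^sub>m dag \<sigma> n Z = - Z"
      unfolding Z_def
      by (simp, intro eq_matI) (use carrier_matD[OF zc(1)] carrier_matD[OF dag_carrier[OF zc(1)]] ee(1) in \<open>auto simp: algebra_simps simp flip: mult.assoc\<close>)
    obtain s where s: "s \<in> C" "s * Delta ^\<^sub>m i = Delta ^\<^sub>m i + Z" "chi s = T Z" using T(3)[OF ZQ] by blast
    note sc [simp] = C_carrier[OF s(1)] and sG = C_GL[OF s(1)]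
    define c where "c = s * dag \<sigma> n s"
    have cC: "c \<in> C" unfolding c_def by (intro C_mult C_dag s(1))
    have dc: "dag \<sigma> n c = c" unfolding c_def by (simp add: dag_mult dag_dag)
    have ds: "dag \<sigma> n s * Delta ^\<^sub>m i = Delta ^\<^sub>m i * dag \<sigma> n s"
    proof -
      have "dag \<sigma> n s * Delta = Delta * dag \<sigma> n s" by (rule C_commute_Delta[OF C_dag[OF s(1)]])
      then show ?thesis
      proof (induction i)
        case (Suc i)
        have "dag \<sigma> n s * (Delta ^\<^sub>m i * Delta) = dag \<sigma> n s * Delta ^\<^sub>m i * Delta" by (simp add: sq_assoc[of _ ?N])
        also have "\<dots> = Delta ^\<^sub>m i * (dag \<sigma> n s * Delta)" using Suc by (simp add: sq_assoc[of _ ?N])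
        finally show ?case using Suc.prems by (simp add: sq_assoc[of _ ?N])
      qed (simp add: carrier_matD[OF Delta_carrier] left_mult_one_mat[OF dag_carrier[OF sc]] right_mult_one_mat[OF dag_carrier[OF sc]])
    qed
    have Ds: "Delta ^\<^sub>m i * dag \<sigma> n s = Delta ^\<^sub>m i - Z"
    proof -
      have "e \<cdot>\<^sub>m (Delta ^\<^sub>m i * dag \<sigma> n s) = dag \<sigma> n (s * Delta ^\<^sub>m i)"
        by (simp add: dag_mult dag_Delta_pow e_def mult_smult_assoc_mat[of _ ?N ?N _ ?N])
      also have "\<dots> = e \<cdot>\<^sub>m Delta ^\<^sub>m i + 1 \<cdot>\<^sub>m dag \<sigma> n Z"
      proof -
        have "Delta ^\<^sub>m i + Z = Delta ^\<^sub>m i + 1 \<cdot>\<^sub>m Z" by (rule eq_matI) auto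
        then show ?thesis unfolding s(2) by (simp only: dag_combine[OF Delta_pow_carrier Zc] \<sigma>_1 dag_Delta_pow e_def)
      qed
      finally have 1: "e \<cdot>\<^sub>m (Delta ^\<^sub>m i * dag \<sigma> n s) = e \<cdot>\<^sub>m Delta ^\<^sub>m i + 1 \<cdot>\<^sub>m dag \<sigma> n Z" .
      have e2: "e \<cdot>\<^sub>m (e \<cdot>\<^sub>m A) = A" "1 \<cdot>\<^sub>m A = A" for A using ee(1) by (intro eq_matI; auto simp flip: mult.assoc)+
      have "Delta ^\<^sub>m i * dag \<sigma> n s = e \<cdot>\<^sub>m (e \<cdot>\<^sub>m Delta ^\<^sub>m i + dag \<sigma> n Z)"
        using arg_cong[OF 1, of "\<lambda>A. e \<cdot>\<^sub>m A"] unfolding e2 .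
      also have "\<dots> = e \<cdot>\<^sub>m (e \<cdot>\<^sub>m Delta ^\<^sub>m i) + e \<cdot>\<^sub>m dag \<sigma> n Z"
        by (rule add_smult_distrib_left_mat[of _ ?N ?N]) simp_all
      also have "\<dots> = Delta ^\<^sub>m i - Z"
        unfolding dZ e2 by (rule eq_matI) (use carrier_matD[OF Zc] in auto)
      finally show ?thesis .
    qed
    obtain B where B: "B \<in> carrier_mat ?N ?N" "Z = B * Delta ^\<^sub>m i" using ZQ by (auto simp: Q_def)
    \<comment> \<open>The second-order term of c Delta^i; with it gone, \<open>c\<close> fixes
      Delta^i.\<close>
    have BZ: "B * Z = 0\<^sub>m ?N ?N"
    proof (rule Q_annihilate[OF _ _ B(1) ZQ])
      show "np.exact (np.level i)" using i(1) by blast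
      show "B * Delta ^\<^sub>m i \<in> Q i" using ZQ unfolding B(2) .
    qed
    have "c * Delta ^\<^sub>m i = s * Delta ^\<^sub>m i * dag \<sigma> n s"
      unfolding c_def by (simp add: sq_assoc[of _ ?N] ds)
    also have "\<dots> = Delta ^\<^sub>m i * dag \<sigma> n s + B * (Delta ^\<^sub>m i * dag \<sigma> n s)"
      unfolding s(2) using B by (simp add: add_mult_distrib_mat[of _ ?N ?N _ _ ?N] sq_assoc[of _ ?N])
    also have "\<dots> = Delta ^\<^sub>m i - Z + (B * Delta ^\<^sub>m i - B * Z)"
      unfolding Ds using B(1) by (simp add: mult_minus_distrib_mat[of _ ?N ?N _ ?N])
    also have "\<dots> = Delta ^\<^sub>m i"
      unfolding BZ B(2)[symmetric] by (rule eq_matI) (use carrier_matD[OF Zc] carrier_matD[OF Delta_pow_carrier] in auto)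
    finally have cD: "c * Delta ^\<^sub>m i = Delta ^\<^sub>m i" .
    obtain b where b: "b \<in> C" "b * dag \<sigma> n b = c"
      and "\<forall>j. c * Delta ^\<^sub>m j = Delta ^\<^sub>m j \<longrightarrow> (\<exists>a. b * Delta ^\<^sub>m j = a \<cdot>\<^sub>m Delta ^\<^sub>m j)"
      using ex_hermitian_norm[OF cC dc] by (elim bexE conjE)
    then obtain a where a: "b * Delta ^\<^sub>m i = a \<cdot>\<^sub>m Delta ^\<^sub>m i" using cD by (elim allE[of _ i]) blast
    note bc [simp] = C_carrier[OF b(1)] and bG = C_GL[OF b(1)] and bi = GL_inv[OF C_GL[OF b(1)]]
    have chib: "chi b = 0" by (rule T(4)[OF b(1) a])
    \<comment> \<open>Unitary because c = b (dag b), and with the logarithm of \<open>s\<close>,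
      because \<open>b\<close> is scalar on Delta^i and so has \<open>chi b = 0\<close>.\<close>
    let ?s = "ginv ?N b * s"
    have sC: "?s \<in> C" by (intro C_mult C_inv b s)
    have "?s * dag \<sigma> n ?s = ginv ?N b * c * dag \<sigma> n (ginv ?N b)"
      using bi by (simp add: dag_mult c_def sq_assoc[of _ ?N])
    also have "\<dots> = dag \<sigma> n b * dag \<sigma> n (ginv ?N b)"
      unfolding b(2)[symmetric] using bi by (simp add: sq_assoc[of _ ?N] sq_cancel[OF bi(4) bc _ bi(2)])
    also have "\<dots> = 1\<^sub>m ?N" using bi by (simp add: dag_one flip: dag_mult)
    finally have ss: "?s * dag \<sigma> n ?s = 1\<^sub>m ?N" .
    have "dag \<sigma> n ?s = ginv ?N ?s"
      using sq_cancel(1)[OF GL_inv(4)[OF C_GL[OF sC]] C_carrier[OF sC] dag_carrier[OF C_carrier[OF sC]] GL_inv(2)[OF C_GL[OF sC]]]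
        GL_inv(4)[OF C_GL[OF sC]] by (simp add: ss)
    then have "?s \<in> unitary \<sigma> n" using GL_inv(2)[OF C_GL[OF sC]] C_GL[OF sC] by (simp add: unitary_def)
    moreover have "chi ?s = T Z" using s b chib by (simp add: chi_mult C_inv chi_inv)
    ultimately show ?thesis using sC TZ by auto
  qed
  have "\<exists>s\<in>C \<inter> unitary \<sigma> n. chi s = c" if "\<sigma> c = c" for c
  proof -
    have "\<sigma> (\<mu> * T Z0 + \<sigma> \<mu> * u) = \<mu> * T Z0 + \<sigma> \<mu> * u" for \<mu>
      using solve[of \<mu>] chi_unitary by (metis IntE)
    from ex_skew_multiple[OF Z0(2) this that] show ?thesis using solve by metis
  qed
  then show ?thesis by blast
qed

end

section \<open>The Gelfand trick\<close>

text \<open>Version for an infinite field of scalars: one power more than the size of a spanning set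
  gives a linear dependence, unless two powers already agree on \<open>u\<close>.\<close>

lemma (in vs) ex_annihilating_poly_finite_span:
  assumes T: "finite T" "span T = UNIV" and M: "subspace M" and R: "lin M R" "R ` M \<subseteq> M" and u: "u \<in> M"
  shows "\<exists>p. p \<noteq> 0 \<and> pact R p u = 0"
proof (cases "inj_on (\<lambda>i. (R ^^ i) u) {..card T}")
  case False
  then obtain i j where ij: "(R ^^ i) u = (R ^^ j) u" "i \<noteq> j" by (auto simp: inj_on_def)
  have "pact R (monom 1 i - monom 1 j) u = 0" using ij(1) u by (simp add: pact_diff[OF M R] pact_monom[OF M R])
  moreover have "monom 1 i - monom 1 j \<noteq> (0 :: 'k poly)"
    using ij(2) by (metis eq_iff_diff_eq_0 monom_eq_iff' zero_neq_one)
  ultimately show ?thesis by blast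
next
  case True
  let ?S = "(\<lambda>i. (R ^^ i) u) ` {..card T}"
  have "card ?S = Suc (card T)" using card_image[OF True] by simp
  then have "dependent ?S" using independent_span_bound[OF T(1), of ?S] T(2) by auto
  then obtain c w where c: "w \<in> ?S" "c w \<noteq> 0" "(\<Sum>v\<in>?S. scale (c v) v) = 0"
    by (subst (asm) dependent_finite) auto
  define p where "p = (\<Sum>i\<le>card T. monom (c ((R ^^ i) u)) i)"
  have pm: "pact R (monom a i) u = scale a ((R ^^ i) u)" for a i
    using pact_smult[OF M R u, of a "monom 1 i"] u by (simp add: smult_monom pact_monom[OF M R])
  have "pact R (\<Sum>i\<in>A. monom (c ((R ^^ i) u)) i) u = (\<Sum>i\<in>A. scale (c ((R ^^ i) u)) ((R ^^ i) u))" for A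
    by (induction A rule: infinite_finite_induct) (simp_all add: pact_add[OF M R u] pm)
  then have "pact R p u = (\<Sum>i\<le>card T. scale (c ((R ^^ i) u)) ((R ^^ i) u))" by (simp add: p_def)
  also have "\<dots> = (\<Sum>v\<in>?S. scale (c v) v)" by (subst sum.reindex[OF True]) simp
  finally have "pact R p u = 0" using c(3) by simp
  moreover obtain i where i: "i \<le> card T" "w = (R ^^ i) u" using c(1) by auto
  have "coeff p i = (\<Sum>j\<le>card T. if j = i then c ((R ^^ j) u) else 0)"
    unfolding p_def coeff_sum by (intro sum.cong) (auto simp: coeff_monom)
  then have "coeff p i = c w" using i by simp
  then have "p \<noteq> 0" using c(2) by auto
  ultimately show ?thesis by blast
qed

text \<open>Take a polynomial of least degree that kills some nonzero vector. Splitting off a linear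
  factor leaves, by minimality, a nonzero vector, and it is an eigenvector.\<close>

lemma (in vs) ex_eigenvector:
  fixes R :: "'v \<Rightarrow> 'v"
  assumes ac: "\<And>p :: 'k poly. degree p > 0 \<Longrightarrow> \<exists>z. poly p z = 0"
    and T: "finite T" "span T = UNIV" and M: "subspace M" and R: "lin M R" "R ` M \<subseteq> M" and u: "u \<in> M" "u \<noteq> 0"
  shows "\<exists>z. \<exists>v\<in>M. v \<noteq> 0 \<and> R v = scale z v"
proof -
  let ?P = "\<lambda>d. \<exists>p. \<exists>v\<in>M. v \<noteq> 0 \<and> p \<noteq> 0 \<and> degree p = d \<and> pact R p v = 0"
  have "\<exists>d. ?P d" using ex_annihilating_poly_finite_span[OF T M R u(1)] u by blast
  then obtain d where d: "?P d" "\<And>d'. d' < d \<Longrightarrow> \<not> ?P d'" using exists_least_iff[of ?P] by blast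
  obtain p v where p: "v \<in> M" "v \<noteq> 0" "p \<noteq> 0" "degree p = d" "pact R p v = 0" using d(1) by blast
  have R0: "R 0 = 0" by (rule pact_R_0[OF M R])
  have "d \<noteq> 0"
  proof
    assume "d = 0"
    then obtain a where a: "p = [:a:]" using p(4) degree_eq_zeroE by blast
    then have "scale a v = 0" using p(5) by (simp add: pact_pCons[of R, OF R0] R0)
    then show False using p(2,3) a by simp
  qed
  then obtain z where "poly p z = 0" using ac[of p] p(4) by auto
  then obtain q where q: "p = [:- z, 1:] * q" by (auto simp: poly_eq_0_iff_dvd dvd_def)
  have q0: "q \<noteq> 0" using p(3) q by auto
  have "degree p = Suc (degree q)" unfolding q using q0 by (subst degree_mult_eq) auto
  then have "pact R q v \<noteq> 0" using d(2)[of "degree q"] p(1,2,4) q0 by auto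
  moreover have "scale (- z) (pact R q v) + R (pact R q v) = 0"
    using p(5) pact_mult[OF M R p(1), of "[:- z, 1:]" q] unfolding q by (simp add: pact_pCons[of R, OF R0] R0)
  then have "R (pact R q v) = scale z (pact R q v)" by (simp add: add_eq_0_iff)
  ultimately show ?thesis using pact_U[OF M R p(1)] by blast
qed

text \<open>In \<open>dichotomy\<close>, the first alternative says that the double coset of
  \<open>g\<close> carries no nonzero function that is \<theta>-equivariant on both sides, the
  second that \<tau> preserves the values of such a function at \<open>g\<close>.\<close>

locale gelfand_pair = irreducible_representation G scale \<pi>
  for G (structure) and scale :: "'c::{alg_closed_field, field_char_0} \<Rightarrow> 'v::ab_group_add \<Rightarrow> 'v" and \<pi> +
  fixes H \<theta> \<tau>
  assumes group_G: "group G" and finite_G: "finite (carrier G)" and H: "subgroup H G"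
    and \<theta>_mult: "\<And>h k. h \<in> H \<Longrightarrow> k \<in> H \<Longrightarrow> \<theta> (h \<otimes> k) = \<theta> h * (\<theta> k :: 'c)" and \<theta>_nonzero: "\<And>h. h \<in> H \<Longrightarrow> \<theta> h \<noteq> 0"
    and \<tau>_G: "\<And>g. g \<in> carrier G \<Longrightarrow> \<tau> g \<in> carrier G" and \<tau>_\<tau>: "\<And>g. g \<in> carrier G \<Longrightarrow> \<tau> (\<tau> g) = g"
    and \<tau>_mult: "\<And>a b. a \<in> carrier G \<Longrightarrow> b \<in> carrier G \<Longrightarrow> \<tau> (a \<otimes> b) = \<tau> b \<otimes> \<tau> a"
    and \<tau>_H: "\<And>h. h \<in> H \<Longrightarrow> \<tau> h \<in> H" and \<theta>_\<tau>: "\<And>h. h \<in> H \<Longrightarrow> \<theta> (\<tau> h) = \<theta> h"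
    and dichotomy: "\<And>g. g \<in> carrier G \<Longrightarrow> (\<exists>h\<in>H. \<exists>k\<in>H. h \<otimes> g = g \<otimes> k \<and> \<theta> h \<noteq> \<theta> k)
      \<or> (\<exists>h\<in>H. \<exists>k\<in>H. \<tau> g \<otimes> k = h \<otimes> g \<and> \<theta> h = \<theta> k)"
begin

sublocale vs scale by unfold_locales

lemma HG: "h \<in> H \<Longrightarrow> h \<in> carrier G" using subgroup.subset[OF H] by blast
lemma finite_H: "finite H" using finite_subset[OF subgroup.subset[OF H] finite_G] .
lemma H_mult: "h \<in> H \<Longrightarrow> k \<in> H \<Longrightarrow> h \<otimes> k \<in> H" by (rule subgroup.m_closed[OF H])
lemma G_mult: "h \<in> carrier G \<Longrightarrow> k \<in> carrier G \<Longrightarrow> h \<otimes> k \<in> carrier G"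
  by (rule monoid.m_closed[OF group.is_monoid[OF group_G]])
lemma G_assoc: "a \<in> carrier G \<Longrightarrow> b \<in> carrier G \<Longrightarrow> c \<in> carrier G \<Longrightarrow> a \<otimes> b \<otimes> c = a \<otimes> (b \<otimes> c)"
  by (rule monoid.m_assoc[OF group.is_monoid[OF group_G]])

lemma rep_add: "g \<in> carrier G \<Longrightarrow> \<pi> g (u + v) = \<pi> g u + \<pi> g v"
  and rep_scale: "g \<in> carrier G \<Longrightarrow> \<pi> g (scale c v) = scale c (\<pi> g v)"
  and rep_sum: "g \<in> carrier G \<Longrightarrow> \<pi> g (\<Sum>a\<in>A. f a) = (\<Sum>a\<in>A. \<pi> g (f a))"
proof -
  assume g: "g \<in> carrier G"
  interpret l: Vector_Spaces.linear scale scale "\<pi> g" by (rule linear_rep[OF g])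
  show "\<pi> g (u + v) = \<pi> g u + \<pi> g v" "\<pi> g (scale c v) = scale c (\<pi> g v)" by (rule l.add l.scale)+
  show "\<pi> g (\<Sum>a\<in>A. f a) = (\<Sum>a\<in>A. \<pi> g (f a))" by (rule l.sum)
qed

lemma rep_comp: "g \<in> carrier G \<Longrightarrow> h \<in> carrier G \<Longrightarrow> \<pi> g (\<pi> h v) = \<pi> (g \<otimes> h) v"
  by (simp add: rep_mult)

text \<open>\<open>card H\<close> times the projection onto the vectors on which \<open>H\<close>
  acts by \<theta>.\<close>

definition e :: "'v \<Rightarrow> 'v" where "e v = (\<Sum>h\<in>H. scale (inverse (\<theta> h)) (\<pi> h v))"

text \<open>The Hecke operator of the double coset of \<open>g\<close>.\<close>

definition B :: "'a \<Rightarrow> 'v \<Rightarrow> 'v" where "B g v = e (\<pi> g (e v))"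

abbreviation nH :: 'c where "nH \<equiv> of_nat (card H)"

lemma nH: "nH \<noteq> 0" using finite_H subgroup.one_closed[OF H] by auto

lemma e_add: "e (u + v) = e u + e v"
  by (simp add: e_def rep_add HG scale_right_distrib sum.distrib)

lemma e_scale: "e (scale c v) = scale c (e v)"
  by (simp add: e_def rep_scale HG scale_sum_right mult.commute)

lemma e_sum: "e (\<Sum>a\<in>A. f a) = (\<Sum>a\<in>A. e (f a))"
  using e_scale[of 0 0] by (induction A rule: infinite_finite_induct) (simp_all add: e_add)

lemma H_right: "h \<in> H \<Longrightarrow> bij_betw (\<lambda>k. k \<otimes> h) H H"
  by (rule bij_betw_byWitness[where f' = "\<lambda>k. k \<otimes> inv h"])
    (auto simp: HG H_mult G_assoc subgroup.m_inv_closed[OF H] group.l_inv[OF group_G] group.r_inv[OF group_G]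
      monoid.r_one[OF group.is_monoid[OF group_G]] group.inv_closed[OF group_G])

lemma H_left: "h \<in> H \<Longrightarrow> bij_betw (\<lambda>k. h \<otimes> k) H H"
  by (rule bij_betw_byWitness[where f' = "\<lambda>k. inv h \<otimes> k"])
    (auto simp: HG H_mult G_assoc[symmetric] subgroup.m_inv_closed[OF H] group.l_inv[OF group_G] group.r_inv[OF group_G]
      monoid.l_one[OF group.is_monoid[OF group_G]] group.inv_closed[OF group_G])

lemma e_rep:
  assumes h: "h \<in> H" shows "e (\<pi> h v) = scale (\<theta> h) (e v)"
proof -
  have "e (\<pi> h v) = (\<Sum>k\<in>H. scale (\<theta> h * inverse (\<theta> (k \<otimes> h))) (\<pi> (k \<otimes> h) v))"
    unfolding e_def using h by (intro sum.cong) (auto simp: rep_comp HG \<theta>_mult \<theta>_nonzero)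
  also have "\<dots> = (\<Sum>k\<in>H. scale (\<theta> h * inverse (\<theta> k)) (\<pi> k v))"
    by (rule sum.reindex_bij_betw[OF H_right[OF h]])
  finally show ?thesis by (simp add: e_def scale_sum_right)
qed

lemma rep_e:
  assumes h: "h \<in> H" shows "\<pi> h (e v) = scale (\<theta> h) (e v)"
proof -
  have "\<pi> h (e v) = (\<Sum>k\<in>H. scale (\<theta> h * inverse (\<theta> (h \<otimes> k))) (\<pi> (h \<otimes> k) v))"
    unfolding e_def rep_sum[OF HG[OF h]] using h by (intro sum.cong) (auto simp: rep_scale rep_comp HG \<theta>_mult \<theta>_nonzero)
  also have "\<dots> = (\<Sum>k\<in>H. scale (\<theta> h * inverse (\<theta> k)) (\<pi> k v))"
    by (rule sum.reindex_bij_betw[OF H_left[OF h]])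
  finally show ?thesis by (simp add: e_def scale_sum_right)
qed

lemma e_e: "e (e v) = scale nH (e v)"
proof -
  have "e (e v) = (\<Sum>h\<in>H. e v)"
    unfolding e_def[of "e v"] by (intro sum.cong) (auto simp: rep_e \<theta>_nonzero)
  then show ?thesis by (simp add: sum_constant_scale)
qed

lemma B_left: "h \<in> H \<Longrightarrow> g \<in> carrier G \<Longrightarrow> B (h \<otimes> g) v = scale (\<theta> h) (B g v)"
  by (simp add: B_def rep_comp[symmetric] HG e_rep)

lemma B_right: "h \<in> H \<Longrightarrow> g \<in> carrier G \<Longrightarrow> B (g \<otimes> h) v = scale (\<theta> h) (B g v)"
  by (simp add: B_def rep_comp[symmetric] HG rep_e rep_scale e_scale)

text \<open>The first alternative for \<open>g\<close> gives B g = 0, the second gives the claim. In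
  the first case the dichotomy is applied to \<tau> g: either its operator vanishes too, or its
  second alternative compares it with \<tau> (\<tau> g) = g.\<close>

lemma B_tau:
  assumes g: "g \<in> carrier G" shows "B (\<tau> g) v = B g v"
proof -
  have zero: "B a v = 0" if "a \<in> carrier G" "h \<in> H" "k \<in> H" "h \<otimes> a = a \<otimes> k" "\<theta> h \<noteq> \<theta> k" for a h k
    using B_left[OF that(2,1), of v] B_right[OF that(3,1), of v] that(4,5) by auto
  have same: "B (\<tau> a) v = B a v" if "a \<in> carrier G" "h \<in> H" "k \<in> H" "\<tau> a \<otimes> k = h \<otimes> a" "\<theta> h = \<theta> k" for a h k
    using B_left[OF that(2,1), of v] B_right[OF that(3) \<tau>_G[OF that(1)], of v] that(4,5) \<theta>_nonzero[OF that(2)] by auto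
  show ?thesis
    using dichotomy[OF g] dichotomy[OF \<tau>_G[OF g]] zero same g \<tau>_G[OF g] \<tau>_\<tau>[OF g] by metis
qed

lemma B_B:
  assumes "a \<in> carrier G" "b \<in> carrier G"
  shows "B a (B b v) = scale nH (\<Sum>h\<in>H. scale (inverse (\<theta> h)) (B (a \<otimes> h \<otimes> b) v))"
proof -
  have "B a (B b v) = scale nH (e (\<pi> a (e (\<pi> b (e v)))))"
    using assms by (simp add: B_def e_e rep_scale e_scale)
  also have "e (\<pi> a (e (\<pi> b (e v)))) = (\<Sum>h\<in>H. scale (inverse (\<theta> h)) (B (a \<otimes> h \<otimes> b) v))"
    unfolding e_def[of "\<pi> b (e v)"] rep_sum[OF assms(1)] e_sum
    by (intro sum.cong) (use assms in \<open>auto simp: rep_scale e_scale B_def rep_comp HG G_mult G_assoc\<close>)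
  finally show ?thesis .
qed

text \<open>The product expands into operators of a h b. By \<open>B_tau\<close> each may be
  replaced by that of \<tau> (a h b), whose factors come in reverse order, and \<tau> permutes
  \<open>H\<close> without changing \<theta>.\<close>

lemma B_commute:
  assumes a: "a \<in> carrier G" and b: "b \<in> carrier G"
  shows "B a (B b v) = B b (B a v)"
proof -
  have bij: "bij_betw \<tau> H H" by (rule bij_betw_byWitness[where f' = \<tau>]) (auto simp: \<tau>_H \<tau>_\<tau> HG)
  have "(\<Sum>h\<in>H. scale (inverse (\<theta> h)) (B (a \<otimes> h \<otimes> b) v))
    = (\<Sum>h\<in>H. scale (inverse (\<theta> (\<tau> h))) (B (\<tau> b \<otimes> \<tau> h \<otimes> \<tau> a) v))"
  proof (rule sum.cong)
    fix h assume h: "h \<in> H"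
    have "B (a \<otimes> h \<otimes> b) v = B (\<tau> (a \<otimes> h \<otimes> b)) v" using a b h by (simp add: B_tau G_mult HG)
    also have "\<tau> (a \<otimes> h \<otimes> b) = \<tau> b \<otimes> \<tau> h \<otimes> \<tau> a" using a b h by (simp add: \<tau>_mult G_mult HG G_assoc \<tau>_G)
    finally show "scale (inverse (\<theta> h)) (B (a \<otimes> h \<otimes> b) v) = scale (inverse (\<theta> (\<tau> h))) (B (\<tau> b \<otimes> \<tau> h \<otimes> \<tau> a) v)"
      by (simp add: \<theta>_\<tau>[OF h])
  qed simp
  also have "\<dots> = (\<Sum>h\<in>H. scale (inverse (\<theta> h)) (B (\<tau> b \<otimes> h \<otimes> \<tau> a) v))"
    by (rule sum.reindex_bij_betw[OF bij])
  finally have "B a (B b v) = B (\<tau> b) (B (\<tau> a) v)" using a b by (simp add: B_B \<tau>_G)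
  then show ?thesis using a b by (simp add: B_tau)
qed

text \<open>By irreducibility the translates of \<open>m\<close> span the space; applying
  \<open>e\<close> shows that the vectors \<open>B g m\<close> span the range of
  \<open>e\<close>.\<close>

lemma B_transitive:
  assumes m: "m \<in> range e" "m \<noteq> 0" and K: "subspace K" and BK: "\<And>g. g \<in> carrier G \<Longrightarrow> B g m \<in> K"
  shows "range e \<subseteq> K"
proof -
  let ?W = "span ((\<lambda>g. \<pi> g m) ` carrier G)"
  have "\<pi> h ` ?W \<subseteq> ?W" if h: "h \<in> carrier G" for h
  proof -
    have "w \<in> ?W \<Longrightarrow> \<pi> h w \<in> ?W" for w
    proof (induction rule: span_induct)
      case base
      show ?case
        by (rule subspaceI) (use rep_scale[OF h, of 0 0] in \<open>auto simp: subspace_0 span_add span_scale span_zero rep_add[OF h] rep_scale[OF h]\<close>)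
    next
      case (step w)
      then show ?case using h by (auto simp: rep_comp G_mult intro!: span_base)
    qed
    then show ?thesis by blast
  qed
  moreover have "m \<in> ?W"
    using monoid.one_closed[OF group.is_monoid[OF group_G]] by (intro span_base image_eqI[of _ _ \<one>]) (simp_all add: rep_one)
  ultimately have W: "?W = UNIV" using irreducible[OF subspace_span] m(2) by auto
  have em: "m = scale (inverse nH) (e m)" using m(1) nH by (auto simp: e_e)
  have "e w \<in> K" for w
  proof -
    have "w \<in> ?W" using W by simp
    then show ?thesis
    proof (induction rule: span_induct)
      case base
      show ?case
        by (rule subspaceI) (use e_scale[of 0 0] in \<open>auto simp: subspace_0[OF K] subspace_add[OF K] subspace_scale[OF K] e_add e_scale\<close>)
    next
      case (step w)
      then obtain g where g: "g \<in> carrier G" "w = \<pi> g m" by blast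
      have "e w = scale (inverse nH) (B g m)"
        unfolding g(2) B_def by (subst em) (simp add: rep_scale[OF g(1)] e_scale)
      then show ?case using subspace_scale[OF K BK[OF g(1)]] by simp
    qed
  qed
  then show ?thesis by blast
qed

text \<open>Each \<open>B g\<close> has an eigenvector in the range of \<open>e\<close>. Its
  eigenspace is stable under the other, commuting operators and hence contains the whole range. So
  all \<open>B g\<close> are scalar there, and the vectors \<open>B g m\<close>, which span the
  range, lie on one line.\<close>

lemma range_e_line: "\<exists>m. range e \<subseteq> span {m}"
proof (cases "\<forall>v. e v = 0")
  case True
  then have "range e \<subseteq> span {0}" by (auto simp: span_zero)
  then show ?thesis ..
next
  case False
  then obtain v0 where "e v0 \<noteq> 0" by blast
  then obtain m where m: "m \<in> range e" "m \<noteq> 0" by blast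
  have sub: "subspace (range e)"
  proof (rule subspaceI)
    show "0 \<in> range e" using e_scale[of 0 0] by (intro range_eqI[of _ _ 0]) simp
    fix x y c assume "x \<in> range e" "y \<in> range e"
    then obtain a b where ab: "x = e a" "y = e b" by blast
    show "x + y \<in> range e" by (rule range_eqI[of _ _ "a + b"]) (simp add: ab e_add)
    show "scale c x \<in> range e" by (rule range_eqI[of _ _ "scale c a"]) (simp add: ab e_scale)
  qed
  obtain T where T: "finite T" "span T = UNIV" using finite_dim by blast
  have Bm: "B g m \<in> span {m}" if g: "g \<in> carrier G" for g
  proof -
    have B_lin: "B g (u + v) = B g u + B g v" "B g (scale c v) = scale c (B g v)" for u v c
      by (simp_all add: B_def e_add e_scale rep_add[OF g] rep_scale[OF g])
    obtain z v where v: "v \<in> range e" "v \<noteq> 0" "B g v = scale z v"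
    proof -
      have "\<exists>z. \<exists>v\<in>range e. v \<noteq> 0 \<and> B g v = scale z v"

      proof (rule ex_eigenvector[OF alg_closed_imp_poly_has_root T sub _ _ m])
        show "lin (range e) (B g)" by (rule linI) (simp_all add: B_lin)
        show "B g ` range e \<subseteq> range e" unfolding B_def by blast
      qed
      then show ?thesis using that by blast
    qed
    let ?K = "{u. B g u = scale z u}"
    have "range e \<subseteq> ?K"
    proof (rule B_transitive[OF v(1,2)])
      show "subspace ?K"
        by (rule subspaceI) (use B_lin(2)[of 0 0] in \<open>auto simp: B_lin scale_right_distrib mult.commute\<close>)
      fix h assume "h \<in> carrier G"
      then show "B h v \<in> ?K" using B_commute[OF g, of h v] v(3)
        by (simp add: B_def e_scale rep_scale)
    qed
    then have "B g m = scale z m" using m(1) by blast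
    then show ?thesis by (simp add: span_scale span_base)
  qed
  have "range e \<subseteq> span {m}" by (rule B_transitive[OF m subspace_span Bm])
  then show ?thesis by blast
qed

text \<open>Averaging gives card H * f v = f (e v), so an equivariant \<open>f\<close> is determined
  by its value at the vector \<open>m\<close> that spans the range of \<open>e\<close>.\<close>

theorem dim_equivariant_functionals:
  assumes S: "S \<subseteq> {f. Vector_Spaces.linear scale (*) f \<and> (\<forall>h\<in>H. \<forall>v. f (\<pi> h v) = \<theta> h * f v)}"
  shows "vector_space.dim (\<lambda>c f v. c * f v) (S :: ('v \<Rightarrow> 'c) set) \<le> 1"
proof -
  interpret fs: vector_space "\<lambda>(c::'c) (f::'v \<Rightarrow> 'c) v. c * f v"
    by unfold_locales (auto simp: fun_eq_iff algebra_simps)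
  obtain m where m: "range e \<subseteq> span {m}" using range_e_line by blast
  have f_eq: "\<exists>c. e v = scale c m \<and> (\<forall>f\<in>S. f v = inverse nH * c * f m)" for v
  proof -
    obtain c where c: "e v = scale c m" using m by (auto simp: span_singleton)
    have "f v = inverse nH * c * f m" if f: "f \<in> S" for f
    proof -
      interpret l: Vector_Spaces.linear scale "(*)" f using S f by blast
      have fh: "f (\<pi> h v) = \<theta> h * f v" if "h \<in> H" for h v using S f that by blast
      have "f (e v) = (\<Sum>h\<in>H. f v)"
        unfolding e_def l.sum by (intro sum.cong) (auto simp: l.scale fh \<theta>_nonzero)
      then have "nH * f v = c * f m" by (simp add: c l.scale)
      then show ?thesis using nH by (simp add: field_simps)
    qed
    then show ?thesis using c by blast
  qed
  show ?thesis
  proof (cases "\<exists>f\<in>S. f m \<noteq> 0")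
    case True
    then obtain f0 where f0: "f0 \<in> S" "f0 m \<noteq> 0" by blast
    have "f \<in> fs.span {f0}" if f: "f \<in> S" for f
    proof -
      have "f = (\<lambda>v. (f m / f0 m) * f0 v)"
      proof
        fix v
        obtain c where "\<forall>f\<in>S. f v = inverse nH * c * f m" using f_eq[of v] by blast
        then have "f v = inverse nH * c * f m" "f0 v = inverse nH * c * f0 m" using f f0(1) by blast+
        then show "f v = (f m / f0 m) * f0 v" using f0(2) by simp
      qed
      then show ?thesis using fs.span_scale[OF fs.span_base[of f0 "{f0}"], of "f m / f0 m"] by simp
    qed
    then have "fs.dim S \<le> card {f0}" by (intro fs.dim_le_card) auto
    then show ?thesis by simp
  next
    case False
    have "f = 0" if f: "f \<in> S" for f
    proof
      fix v
      obtain c where "\<forall>f\<in>S. f v = inverse nH * c * f m" using f_eq[of v] by blast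
      then have "f v = inverse nH * c * f m" using f by blast
      moreover have "f m = 0" using f False by blast
      ultimately show "f v = 0 v" by simp
    qed
    then have "S \<subseteq> fs.span {}" using fs.span_zero by blast
    then have "fs.dim S \<le> card ({} :: ('v \<Rightarrow> 'c) set)" by (rule fs.dim_le_card) simp
    then show ?thesis by simp
  qed
qed

end

section \<open>Descent to matrices over a finite field\<close>

context field_hom
begin

lemma map_X0: "map_mat hom (X0 n) = X0 n"
  unfolding X0_def by (rule eq_matI) auto

lemma map_W0: "map_mat hom (W0 n) = W0 n"
  unfolding W0_def by (rule eq_matI) auto

lemma map_E: "map_mat hom (E_mat n) = E_mat n"
  unfolding E_mat_def by (rule eq_matI) (auto simp: hom_uminus)

lemma Shalika_hom:
  assumes s: "s \<in> carrier (GL (2 * n))"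
  shows "map_mat hom s \<in> carrier (Shalika n) \<longleftrightarrow> s \<in> carrier (Shalika n)"
proof -
  note c = GL_in_carrier_mat[OF s]
  have "map_mat hom (s * X0 n) = map_mat hom s * X0 n" "map_mat hom (X0 n * s) = X0 n * map_mat hom s"
    using mat_hom_mult[OF c X0_carrier] mat_hom_mult[OF X0_carrier c] unfolding map_X0 .
  then have "map_mat hom s * X0 n = X0 n * map_mat hom s \<longleftrightarrow> s * X0 n = X0 n * s"
    by (metis mat_hom_inj)
  then show ?thesis using s GL_hom(1)[OF s] unfolding Shalika_commute_X0 by blast
qed

lemma chiS_hom:
  assumes s: "s \<in> carrier (Shalika n)" shows "chiS n (map_mat hom s) = hom (chiS n s)"
proof -
  obtain g x where gx: "g \<in> carrier (GL n)" "x \<in> carrier_mat n n" "s = four_block_mat g x (0\<^sub>m n n) g"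
    using s by (auto simp: Shalika_block)
  note gc = GL_in_carrier_mat[OF gx(1)] and gi = GL_inv[OF gx(1)]
  have "map_mat hom s = four_block_mat (map_mat hom g) (map_mat hom x) (0\<^sub>m n n) (map_mat hom g)"
    unfolding gx(3) by (rule eq_matI) (use gc gx(2) in auto)
  then have "chiS n (map_mat hom s) = mat_trace (ginv n (map_mat hom g) * map_mat hom x)"
    using chiS_block[OF GL_hom(1)[OF gx(1)], of "map_mat hom x"] gx(2) by simp
  also have "\<dots> = mat_trace (map_mat hom (ginv n g * x))"
    using gi gx(2) by (simp add: GL_hom(2)[OF gx(1)] mat_hom_mult[of _ n n _ n])
  also have "\<dots> = hom (mat_trace (ginv n g * x))"
    using carrier_matD[OF gi(4)] gx(2) by (auto simp: mat_trace_def hom_sum simp del: index_mult_mat(1))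
  finally show ?thesis using chiS_block[OF gx(1,2)] gx(3) by simp
qed

end

text \<open>A vector in the kernel over the small field stays in the kernel over the large one,
  where it must vanish.\<close>

lemma GL_reflect:
  fixes A :: "'k::{field,finite} mat" and \<iota> :: "'k \<Rightarrow> 'a::field"
  assumes \<iota>: "field_hom \<iota>" and A: "A \<in> carrier_mat m m" and GL: "map_mat \<iota> A \<in> carrier (GL m)"
  shows "A \<in> carrier (GL m)"
proof (rule GL_injective[OF A])
  interpret field_hom \<iota> by (rule \<iota>)
  fix v :: "nat \<Rightarrow> 'k" assume v: "v \<in> fV m" "mv m A v = 0"
  let ?w = "\<lambda>i. \<iota> (v i)"
  have w: "?w \<in> fV m" using v(1) by (simp add: fV_def)
  have "mv m (map_mat \<iota> A) ?w i = \<iota> (mv m A v i)" for i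
    using A by (auto simp: mv_def hom_sum hom_mult)
  then have "mv m (map_mat \<iota> A) ?w = 0" using v(2) by (simp add: fun_eq_iff)
  then have "mv m (ginv m (map_mat \<iota> A) * map_mat \<iota> A) ?w = 0"
    using GL_inv(4)[OF GL] A by (simp add: mv_mult)
  then have "?w = 0" using mv_one[OF w] by (simp add: GL_inv(2)[OF GL])
  then show "v = 0" by (simp add: fun_eq_iff)
qed

text \<open>Characteristic 0 of the coefficients makes \<open>card H\<close> invertible in the
  averaging over the Shalika subgroup.\<close>

instance fract :: ("{idom,ring_char_0}") ring_char_0
proof
  show "inj (of_nat :: nat \<Rightarrow> 'a fract)"
    by (rule injI) (simp flip: Fract_of_nat_eq add: eq_fract)
qed

instance fract :: ("{idom,ring_char_0}") field_char_0 ..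

text \<open>The reduction common to both groups. \<open>U\<close> is the group of rational points
  rewritten over a finite field, where the linear algebra of the earlier sections is available, and
  \<iota> embeds it into matrices over the algebraic closure. The condition on traces places the
  logarithms in the field on which \<psi> is defined.\<close>

lemma shalika_multiplicity_le_one:
  fixes \<iota> :: "'k::{field,finite} \<Rightarrow> 'q::{field,finite} alg_closure" and \<psi> :: "'q \<Rightarrow> 'l::prime_card Q_l_bar"
    and scale :: "'l Q_l_bar \<Rightarrow> 'v::ab_group_add \<Rightarrow> 'v"
  assumes \<iota>: "field_hom \<iota>"
    and fixed: "{A \<in> carrier (GL (2 * n)). F A = A} = map_mat \<iota> ` U" and U: "U \<subseteq> carrier (GL (2 * n))"
    and U_mult: "\<And>A B. A \<in> U \<Longrightarrow> B \<in> U \<Longrightarrow> A * B \<in> U" and U_inv: "\<And>A. A \<in> U \<Longrightarrow> ginv (2 * n) A \<in> U"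
    and U_one: "1\<^sub>m (2 * n) \<in> U"
    and U_tau: "\<And>A. A \<in> U \<Longrightarrow> W0 n * transpose_mat A * W0 n \<in> U"
    and U_trace: "\<And>s. s \<in> carrier (Shalika n) \<Longrightarrow> s \<in> U \<Longrightarrow> \<iota> (chiS n s) \<in> range to_ac"
    and \<iota>_surj: "range to_ac \<subseteq> range \<iota>"
    and dich: "\<And>g. g \<in> U \<Longrightarrow>
      (\<forall>c. \<iota> c \<in> range to_ac \<longrightarrow> (\<exists>s\<in>carrier (Shalika n) \<inter> U.
        ginv (2 * n) g * s * g \<in> carrier (Shalika n) \<and> chiS n s - chiS n (ginv (2 * n) g * s * g) = c)) \<or>
      (\<exists>s\<in>carrier (Shalika n) \<inter> U. \<exists>s'\<in>carrier (Shalika n) \<inter> U.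
        W0 n * transpose_mat g * W0 n * s' = s * g \<and> chiS n s = chiS n s')"
    and \<psi>: "nontrivial_additive_character \<psi>"
    and irr: "irreducible_representation (fixed_points (GL (2 * n)) F) scale \<pi>"
  shows "shalika_multiplicity n F \<psi> scale \<pi> \<le> 1"
proof -
  let ?N = "2 * n" and ?m = "map_mat \<iota>"
  interpret \<iota>: field_hom \<iota> by (rule \<iota>)
  note [simp] = GL_in_carrier_mat
  let ?L = "GL ?N :: 'q alg_closure mat monoid"
  let ?G = "fixed_points ?L F" and ?H = "?m ` (carrier (Shalika n) \<inter> U)"
  have UG: "A \<in> carrier (GL ?N)" if "A \<in> U" for A using U that by blast
  have Uc [simp]: "A \<in> carrier_mat ?N ?N" if "A \<in> U" for A by (rule GL_in_carrier_mat[OF UG[OF that]])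
  have mm: "?m (A * B) = ?m A * ?m B" if "A \<in> carrier_mat ?N ?N" "B \<in> carrier_mat ?N ?N" for A B
    by (rule \<iota>.mat_hom_mult[OF that])
  have carG: "carrier ?G = ?m ` U" using fixed by (simp add: fixed_points_def)
  have carH: "carrier (fixed_points (Shalika n) F) = ?H"
  proof -
    have "carrier (fixed_points (Shalika n) F) = {A \<in> ?m ` U. A \<in> carrier (Shalika n)}"
      unfolding fixed[symmetric] by (auto simp: fixed_points_def Shalika_GL)
    also have "\<dots> = ?H" using \<iota>.Shalika_hom[OF UG] by blast
    finally show ?thesis .
  qed
  have mult_G: "x \<otimes>\<^bsub>?G\<^esub> y = x * y" and one_G: "\<one>\<^bsub>?G\<^esub> = 1\<^sub>m ?N" for x y by (simp_all add: fixed_points_def)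
  have sub: "subgroup (?m ` U) ?L"
  proof (rule group.subgroupI[OF group_GL])
    show "?m ` U \<subseteq> carrier ?L" using fixed by blast
    show "?m ` U \<noteq> {}" using U_one by blast
    show "ginv ?N a \<in> ?m ` U" if "a \<in> ?m ` U" for a using that \<iota>.GL_hom(2)[OF UG] U_inv by auto
    show "a \<otimes>\<^bsub>?L\<^esub> b \<in> ?m ` U" if "a \<in> ?m ` U" "b \<in> ?m ` U" for a b
      using that U_mult by (auto simp flip: mm)
  qed
  have G_eq: "?G = ?L\<lparr>carrier := ?m ` U\<rparr>" using fixed by (simp add: fixed_points_def)
  have grp: "group ?G" unfolding G_eq by (rule subgroup.subgroup_is_group[OF sub group_GL])
  have inv_G: "inv\<^bsub>?G\<^esub> (?m A) = ?m (ginv ?N A)" if "A \<in> U" for A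
    unfolding G_eq using group.m_inv_consistent[OF group_GL sub, of "?m A"] that \<iota>.GL_hom(2)[OF UG[OF that]] by simp
  have Hsub: "subgroup ?H ?G"
  proof (rule group.subgroupI[OF grp])
    show "?H \<subseteq> carrier ?G" unfolding carG by blast
    show "?H \<noteq> {}" using U_one Shalika_one by blast
    show "inv\<^bsub>?G\<^esub> a \<in> ?H" if "a \<in> ?H" for a using that by (auto simp: inv_G U_inv Shalika_inv)
    show "a \<otimes>\<^bsub>?G\<^esub> b \<in> ?H" if ab: "a \<in> ?H" "b \<in> ?H" for a b
    proof -
      obtain s t where st: "s \<in> carrier (Shalika n) \<inter> U" "t \<in> carrier (Shalika n) \<inter> U" "a = ?m s" "b = ?m t"
        using ab by blast
      have "a \<otimes>\<^bsub>?G\<^esub> b = ?m (s * t)" unfolding mult_G st(3,4) using st(1,2) by (simp add: mm)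
      moreover have "s * t \<in> carrier (Shalika n) \<inter> U" using st(1,2) by (simp add: U_mult Shalika_mult)
      ultimately show ?thesis by blast
    qed
  qed
  \<comment> \<open>The logarithm as an element of the field with q elements, pulled back along
    \<open>to_ac\<close>.\<close>
  define val where "val s = of_ac (\<iota> (chiS n s))" for s
  have val: "to_ac (val s) = \<iota> (chiS n s)" if "s \<in> carrier (Shalika n) \<inter> U" for s
    unfolding val_def using that U_trace by (intro to_ac_of_ac) auto
  have psi_val: "psi_S n \<psi> (?m s) = \<psi> (val s)" if "s \<in> carrier (Shalika n) \<inter> U" for s
  proof -
    have "psi_S n \<psi> (?m s) = \<psi> (of_ac (chiS n (?m s)))" by (simp add: psi_S_def chiS_def split: prod.split)
    then show ?thesis using \<iota>.chiS_hom[of s n] that by (simp add: val_def)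
  qed
  have \<psi>D: "\<psi> x \<noteq> 0" "\<psi> (x + y) = \<psi> x * \<psi> y" for x y using \<psi> by (auto simp: nontrivial_additive_character_def)
  obtain x0 where x0: "\<psi> x0 \<noteq> 1" using \<psi> by (auto simp: nontrivial_additive_character_def)
  let ?t = "\<lambda>A. W0 n * transpose_mat A * W0 n"
  have m_tau: "?t (?m A) = ?m (?t A)" if "A \<in> U" for A
    using that by (simp add: mm \<iota>.map_W0 map_mat_transpose[symmetric])
  have fin: "finite (carrier ?G)" unfolding carG by (intro finite_imageI finite_subset[OF U] finite_GL)
  interpret gp: gelfand_pair ?G scale \<pi> ?H "psi_S n \<psi>" ?t
  proof (intro gelfand_pair.intro gelfand_pair_axioms.intro)
    show "irreducible_representation ?G scale \<pi>" by (rule irr)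
    show "group ?G" "finite (carrier ?G)" "subgroup ?H ?G" by (rule grp fin Hsub)+
    show "psi_S n \<psi> (h \<otimes>\<^bsub>?G\<^esub> k) = psi_S n \<psi> h * psi_S n \<psi> k" if hk: "h \<in> ?H" "k \<in> ?H" for h k
    proof -
      obtain s t where st: "s \<in> carrier (Shalika n) \<inter> U" "t \<in> carrier (Shalika n) \<inter> U" "h = ?m s" "k = ?m t"
        using hk by blast
      have e: "h \<otimes>\<^bsub>?G\<^esub> k = ?m (s * t)" unfolding mult_G st(3,4) using st(1,2) by (simp add: mm)
      have stH: "s * t \<in> carrier (Shalika n) \<inter> U" using st(1,2) by (simp add: U_mult Shalika_mult)
      have "to_ac (val (s * t)) = to_ac (val s + val t)"
        using st(1,2) unfolding to_ac_add val[OF st(1)] val[OF st(2)] val[OF stH] by (simp add: chiS_mult \<iota>.hom_add)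
      then have "val (s * t) = val s + val t" by (simp only: to_ac_eq_iff)
      then show ?thesis unfolding e psi_val[OF stH] unfolding st(3,4) psi_val[OF st(1)] psi_val[OF st(2)] by (simp add: \<psi>D(2))
    qed
    show "psi_S n \<psi> h \<noteq> 0" if h: "h \<in> ?H" for h
    proof -
      obtain s where s: "s \<in> carrier (Shalika n) \<inter> U" "h = ?m s" using h by blast
      show ?thesis unfolding s(2) psi_val[OF s(1)] by (rule \<psi>D(1))
    qed
    show "?t g \<in> carrier ?G" if g: "g \<in> carrier ?G" for g
    proof -
      obtain A where A: "A \<in> U" "g = ?m A" using g unfolding carG by blast
      show ?thesis unfolding A(2) m_tau[OF A(1)] carG using U_tau[OF A(1)] by (rule imageI)
    qed
    show "?t (?t g) = g" if "g \<in> carrier ?G" for g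
    proof -
      have gc: "g \<in> carrier_mat ?N ?N" using that unfolding carG by auto
      then show ?thesis
        by (simp add: transpose_mult[of _ ?N ?N _ ?N] W0_transpose sq_assoc[of _ ?N] W0_W0 sq_cancel[OF W0_carrier W0_carrier _ W0_W0])
    qed
    show "?t (a \<otimes>\<^bsub>?G\<^esub> b) = ?t b \<otimes>\<^bsub>?G\<^esub> ?t a" if "a \<in> carrier ?G" "b \<in> carrier ?G" for a b
    proof -
      have "a \<in> carrier_mat ?N ?N" "b \<in> carrier_mat ?N ?N" using that unfolding carG by auto
      then show ?thesis unfolding mult_G
        by (simp add: transpose_mult[of _ ?N ?N _ ?N] sq_assoc[of _ ?N] sq_cancel[OF W0_carrier W0_carrier _ W0_W0])
    qed
    have tH: "?t s \<in> carrier (Shalika n) \<inter> U" if "s \<in> carrier (Shalika n) \<inter> U" for s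
    proof -
      have s: "s * X0 n = X0 n * s" "s \<in> U" "s \<in> carrier (GL ?N)" using that by (auto simp: Shalika_commute_X0)
      have "transpose_mat (s * X0 n) = transpose_mat (X0 n * s)" using s(1) by simp
      then have tr: "transpose_mat (X0 n) * transpose_mat s = transpose_mat s * transpose_mat (X0 n)"
        using s(2) by (simp add: transpose_mult[of _ ?N ?N _ ?N])
      have "?t s * X0 n = X0 n * ?t s"
      proof -
        have "?t s * X0 n = W0 n * (transpose_mat s * (W0 n * X0 n * W0 n)) * W0 n"
          using s(2) by (simp add: sq_assoc[of _ ?N] W0_W0 right_mult_one_mat[OF X0_carrier])
        also have "\<dots> = W0 n * (W0 n * X0 n * W0 n * transpose_mat s) * W0 n" unfolding W0_X0 tr ..
        also have "\<dots> = X0 n * ?t s"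
          using s(2) by (simp add: sq_assoc[of _ ?N] sq_cancel[OF W0_carrier W0_carrier _ W0_W0])
        finally show ?thesis .
      qed
      moreover have "?t s \<in> carrier (GL ?N)" by (intro UG U_tau s(2))
      ultimately show ?thesis using U_tau[OF s(2)] by (simp add: Shalika_commute_X0)
    qed
    show "?t h \<in> ?H" if h: "h \<in> ?H" for h
    proof -
      obtain s where s: "s \<in> carrier (Shalika n) \<inter> U" "h = ?m s" using h by blast
      show ?thesis using tH[OF s(1)] m_tau[of s] s by auto
    qed
    show "psi_S n \<psi> (?t h) = psi_S n \<psi> h" if h: "h \<in> ?H" for h
    proof -
      obtain s where s: "s \<in> carrier (Shalika n) \<inter> U" "h = ?m s" using h by blast
      have "val (?t s) = val s" using chiS_transpose[of s n] s(1) by (simp add: val_def)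
      then show ?thesis using psi_val[OF tH[OF s(1)]] psi_val[OF s(1)] m_tau[of s] s by simp
    qed
    show "(\<exists>h\<in>?H. \<exists>k\<in>?H. h \<otimes>\<^bsub>?G\<^esub> a = a \<otimes>\<^bsub>?G\<^esub> k \<and> psi_S n \<psi> h \<noteq> psi_S n \<psi> k)
      \<or> (\<exists>h\<in>?H. \<exists>k\<in>?H. ?t a \<otimes>\<^bsub>?G\<^esub> k = h \<otimes>\<^bsub>?G\<^esub> a \<and> psi_S n \<psi> h = psi_S n \<psi> k)" if a: "a \<in> carrier ?G" for a
    proof -
      obtain g where g: "g \<in> U" "a = ?m g" using a unfolding carG by blast
      note gi = GL_inv[OF UG[OF g(1)]]
      show ?thesis
      proof (rule disjE[OF dich[OF g(1)]])
        assume all: "\<forall>c. \<iota> c \<in> range to_ac \<longrightarrow> (\<exists>s\<in>carrier (Shalika n) \<inter> U.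
          ginv ?N g * s * g \<in> carrier (Shalika n) \<and> chiS n s - chiS n (ginv ?N g * s * g) = c)"
        \<comment> \<open>Aimed at an element where \<psi> is not 1, so that the two character
          values differ by the factor \<psi> x0.\<close>
        obtain c where c: "\<iota> c = to_ac x0" using \<iota>_surj by (metis rangeE rangeI subsetD)
        obtain s where s: "s \<in> carrier (Shalika n) \<inter> U" "ginv ?N g * s * g \<in> carrier (Shalika n)"
          "chiS n s - chiS n (ginv ?N g * s * g) = c" using all c by (metis rangeI)
        let ?s = "ginv ?N g * s * g"
        have s': "?s \<in> carrier (Shalika n) \<inter> U" using s g U_mult U_inv by simp
        have "chiS n s = chiS n ?s + c" using s(3) by (simp add: algebra_simps)
        then have "to_ac (val s) = to_ac (val ?s + x0)" using val[OF s(1)] val[OF s'] c by (simp add: \<iota>.hom_add)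
        then have "val s = val ?s + x0" by (simp only: to_ac_eq_iff)
        then have "psi_S n \<psi> (?m s) = psi_S n \<psi> (?m ?s) * \<psi> x0" by (simp add: psi_val[OF s(1)] psi_val[OF s'] \<psi>D)
        then have ne: "psi_S n \<psi> (?m s) \<noteq> psi_S n \<psi> (?m ?s)" using x0 psi_val[OF s'] \<psi>D(1) by auto
        have sc: "s \<in> carrier_mat ?N ?N" using s(1) by simp
        have "s * g = g * ?s" using sc g(1) gi by (simp add: sq_assoc[of _ ?N] sq_cancel[OF Uc[OF g(1)] gi(4) _ gi(3)])
        then have "?m s * a = a * ?m ?s" unfolding g(2) using sc g(1) s' by (simp flip: mm)
        then show ?thesis using ne s(1) s' unfolding mult_G by blast
      next
        assume "\<exists>s\<in>carrier (Shalika n) \<inter> U. \<exists>s'\<in>carrier (Shalika n) \<inter> U. ?t g * s' = s * g \<and> chiS n s = chiS n s'"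
        then obtain s s' where s: "s \<in> carrier (Shalika n) \<inter> U" "s' \<in> carrier (Shalika n) \<inter> U"
          "?t g * s' = s * g" "chiS n s = chiS n s'" by blast
        have "?t a * ?m s' = ?m (?t g * s')" unfolding g(2) m_tau[OF g(1)] using U_tau[OF g(1)] s(2) by (subst mm) auto
        also have "\<dots> = ?m s * a" unfolding s(3) g(2) using s(1) g(1) by (simp add: mm)
        finally have "?t a * ?m s' = ?m s * a" .
        moreover have "psi_S n \<psi> (?m s) = psi_S n \<psi> (?m s')" using psi_val[OF s(1)] psi_val[OF s(2)] s(4) by (simp add: val_def)
        ultimately show ?thesis using s(1,2) unfolding mult_G by blast
      qed
    qed
  qed
  show ?thesis
    unfolding shalika_multiplicity_def
    by (rule gp.dim_equivariant_functionals) (auto simp: rep_hom_def carH)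
qed

section \<open>Finite fields\<close>

text \<open>Multiplication by a nonzero \<open>x\<close> permutes the nonzero elements; compare
  their products.\<close>

lemma field_power_card:
  fixes x :: "'a::{field,finite}" shows "x ^ CARD('a) = x"
proof (cases "x = 0")
  case True
  then show ?thesis by simp
next
  case False
  have bij: "bij_betw (\<lambda>y. x * y) (UNIV - {0}) (UNIV - {0})"
    by (rule bij_betw_byWitness[where f' = "\<lambda>y. y / x"]) (use False in auto)
  have "(\<Prod>y\<in>UNIV - {0}. x * y) = \<Prod>(UNIV - {0})" by (rule prod.reindex_bij_betw[OF bij])
  then have "x ^ (CARD('a) - 1) * \<Prod>(UNIV - {0}) = \<Prod>(UNIV - {0})" by (simp add: prod.distrib)
  moreover have "\<Prod>(UNIV - {0 :: 'a}) \<noteq> 0" by simp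
  ultimately have "x ^ (CARD('a) - 1) = 1" by simp
  then show ?thesis using power_Suc[of x "CARD('a) - 1"] by simp
qed

lemma CARD_ge_2: "CARD('a::{field,finite}) \<ge> 2"
  using card_mono[of UNIV "{0, 1 :: 'a}"] by simp

lemma poly_eq_0_many_roots:
  fixes p :: "'a::idom poly"
  assumes "finite R" "\<And>x. x \<in> R \<Longrightarrow> poly p x = 0" "degree p < card R" shows "p = 0"
proof (rule ccontr)
  assume p: "p \<noteq> 0"
  have "card R \<le> card {x. poly p x = 0}" by (rule card_mono[OF poly_roots_finite[OF p]]) (use assms(2) in blast)
  also have "\<dots> \<le> degree p" by (rule poly_roots_degree[OF p])
  finally show False using assms(3) by simp
qed

text \<open>The polynomial \<open>(X + 1)\<^sup>q - X\<^sup>q - 1\<close> has degree below \<open>q\<close> and vanishes on the field with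
  \<open>q\<close> elements.\<close>
lemma of_nat_choose_CARD:
  assumes k: "0 < k" "k < CARD('q)" shows "of_nat (CARD('q) choose k) = (0 :: 'q::{field,finite})"
proof -
  let ?q = "CARD('q)"
  define p :: "'q poly" where "p = [:1, 1:] ^ ?q - monom 1 ?q - 1"
  have q: "?q \<ge> 2" by (rule CARD_ge_2)
  have cp: "coeff p i = of_nat (?q choose i) - (if i = ?q then 1 else 0) - (if i = 0 then 1 else 0)" if "i \<le> ?q" for i
    using that by (simp add: p_def coeff_linear_poly_power)
  have cp': "coeff p i = 0" if "i \<ge> ?q" for i
  proof (cases "i = ?q")
    case True
    then show ?thesis using q by (simp add: cp)
  next
    case False
    then have "i > degree ([:1, 1 :: 'q:] ^ ?q)" using that by (simp add: degree_linear_power)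
    then show ?thesis using that False q by (simp add: p_def coeff_eq_0)
  qed
  have "p = 0"
  proof (rule poly_eq_0_many_roots[of UNIV])
    show "poly p x = 0" for x by (simp add: p_def poly_monom field_power_card)
    have "degree p \<le> ?q - 1" by (rule degree_le) (use q in \<open>auto intro: cp'\<close>)
    then show "degree p < ?q" using q by simp
  qed simp
  then have "coeff p k = 0" by simp
  then show ?thesis using k by (simp add: cp)
qed

lemma power_CARD_add:
  fixes x y :: "'q::{field,finite} alg_closure"
  shows "(x + y) ^ CARD('q) = x ^ CARD('q) + y ^ CARD('q)"
proof -
  let ?q = "CARD('q)"
  have q: "?q \<ge> 2" by (rule CARD_ge_2)
  have z: "of_nat (?q choose k) = (0 :: 'q alg_closure)" if "0 < k" "k < ?q" for k
    using arg_cong[OF of_nat_choose_CARD[OF that], of to_ac] by simp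
  have "(x + y) ^ ?q = (\<Sum>k\<le>?q. of_nat (?q choose k) * x ^ k * y ^ (?q - k))" by (rule binomial_ring)
  also have "\<dots> = (\<Sum>k\<in>{0, ?q}. of_nat (?q choose k) * x ^ k * y ^ (?q - k))"
    by (rule sum.mono_neutral_right) (auto simp: z)
  finally show ?thesis using q by (simp add: add.commute)
qed

text \<open>The field with q elements supplies q roots of X^q - X, which cannot have more.\<close>

lemma range_to_ac: "range to_ac = {x :: 'q::{field,finite} alg_closure. x ^ CARD('q) = x}"
proof -
  let ?q = "CARD('q)"
  let ?p = "monom 1 ?q - [:0, 1 :: 'q alg_closure:]"
  have q: "?q \<ge> 2" by (rule CARD_ge_2)
  have "coeff [:0, 1 :: 'q alg_closure:] ?q = 0" using q by (auto simp: coeff_pCons split: nat.split)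
  then have "coeff ?p ?q = 1" by simp
  then have p: "?p \<noteq> 0" by (metis coeff_0 zero_neq_one)
  have deg: "degree ?p \<le> ?q" by (rule degree_le) (use q in \<open>auto simp: coeff_monom coeff_pCons split: nat.split\<close>)
  have roots: "{x. poly ?p x = 0} = {x. x ^ ?q = x}" by (simp add: poly_monom)
  have fin: "finite {x :: 'q alg_closure. x ^ ?q = x}" using poly_roots_finite[OF p] unfolding roots .
  have "card {x :: 'q alg_closure. x ^ ?q = x} \<le> card (range (to_ac :: 'q \<Rightarrow> _))"
    using poly_roots_degree[OF p] deg unfolding roots by (simp add: card_image[OF inj_to_ac])
  moreover have "range to_ac \<subseteq> {x :: 'q alg_closure. x ^ ?q = x}"
    by (auto simp: field_power_card simp flip: to_ac_power)
  ultimately show ?thesis using card_seteq[OF fin] by blast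
qed

lemma field_hom_to_ac: "field_hom (to_ac :: 'q::field \<Rightarrow> 'q alg_closure)"
  by unfold_locales auto

lemma field_hom_power_CARD: "field_hom (\<lambda>x :: 'q::{field,finite} alg_closure. x ^ CARD('q))"
  using CARD_ge_2[where 'a='q] by unfold_locales (auto simp: power_CARD_add power_mult_distrib)

lemma map_mat_image:
  assumes "A \<in> carrier_mat m k" "\<And>i j. i < m \<Longrightarrow> j < k \<Longrightarrow> A $$ (i, j) \<in> range f"
  shows "\<exists>B\<in>carrier_mat m k. A = map_mat f B"
proof
  show "mat m k (\<lambda>ij. inv_into UNIV f (A $$ ij)) \<in> carrier_mat m k" by simp
  show "A = map_mat f (mat m k (\<lambda>ij. inv_into UNIV f (A $$ ij)))"
    by (rule eq_matI) (use assms in \<open>auto simp: f_inv_into_f\<close>)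
qed

section \<open>The general linear group over the finite field\<close>

lemma multiplicity_GL:
  fixes \<psi> :: "'q::{finite,field} \<Rightarrow> 'l::prime_card Q_l_bar" and scale :: "'l Q_l_bar \<Rightarrow> 'v::ab_group_add \<Rightarrow> 'v"
  assumes \<psi>: "nontrivial_additive_character \<psi>" and irr: "irreducible_representation (fixed_points (GL (2 * n)) F_GL) scale \<pi>"
  shows "shalika_multiplicity n F_GL \<psi> scale \<pi> \<le> 1"
proof (rule shalika_multiplicity_le_one[OF field_hom_to_ac, where U = "carrier (GL (2 * n))"])
  let ?N = "2 * n"
  show "{A \<in> carrier (GL ?N). F_GL A = A} = map_mat to_ac ` carrier (GL ?N :: 'q mat monoid)"
  proof
    show "map_mat to_ac ` carrier (GL ?N :: 'q mat monoid) \<subseteq> {A \<in> carrier (GL ?N). F_GL A = A}"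
    proof
      fix A assume "A \<in> map_mat to_ac ` carrier (GL ?N :: 'q mat monoid)"
      then obtain B :: "'q mat" where B: "B \<in> carrier (GL ?N)" "A = map_mat to_ac B" by blast
      have "F_GL A = A" unfolding F_GL_def B(2) by (rule eq_matI) (auto simp: field_power_card simp flip: to_ac_power)
      then show "A \<in> {A \<in> carrier (GL ?N). F_GL A = A}" using field_hom.GL_hom(1)[OF field_hom_to_ac B(1)] B(2) by simp
    qed
    show "{A \<in> carrier (GL ?N). F_GL A = A} \<subseteq> map_mat to_ac ` carrier (GL ?N :: 'q mat monoid)"
    proof
      fix A :: "'q alg_closure mat" assume "A \<in> {A \<in> carrier (GL ?N). F_GL A = A}"
      then have A: "A \<in> carrier (GL ?N)" "F_GL A = A" by auto
      note Ac = GL_in_carrier_mat[OF A(1)]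
      have "A $$ (i, j) ^ CARD('q) = A $$ (i, j)" if "i < ?N" "j < ?N" for i j
        using arg_cong[OF A(2), of "\<lambda>A. A $$ (i, j)"] Ac that by (simp add: F_GL_def)
      then obtain B where B: "B \<in> carrier_mat ?N ?N" "A = map_mat to_ac B"
        using map_mat_image[OF Ac, of to_ac] unfolding range_to_ac by blast
      then show "A \<in> map_mat to_ac ` carrier (GL ?N :: 'q mat monoid)"
        using GL_reflect[OF field_hom_to_ac B(1)] A(1) by auto
    qed
  qed
  show "W0 n * transpose_mat A * W0 n \<in> carrier (GL ?N)" if "A \<in> carrier (GL ?N)" for A :: "'q mat"
    by (intro GL_mult W0_GL(1) transpose_GL(1) that)
  fix g :: "'q mat" assume g: "g \<in> carrier (GL ?N)"
  interpret shalika_pair n g by unfold_locales (rule g)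
  have int: "carrier (Shalika n) \<inter> carrier (GL ?N) = (carrier (Shalika n) :: 'q mat set)" using Shalika_GL by blast
  show "(\<forall>c. to_ac c \<in> range to_ac \<longrightarrow> (\<exists>s\<in>carrier (Shalika n) \<inter> carrier (GL ?N).
        ginv ?N g * s * g \<in> carrier (Shalika n) \<and> chiS n s - chiS n (ginv ?N g * s * g) = c)) \<or>
      (\<exists>s\<in>carrier (Shalika n) \<inter> carrier (GL ?N). \<exists>s'\<in>carrier (Shalika n) \<inter> carrier (GL ?N).
        W0 n * transpose_mat g * W0 n * s' = s * g \<and> chiS n s = chiS n s')"
    using linear_dichotomy unfolding int C_def chi_def by blast
qed (simp_all add: GL_mult GL_inv(1) GL_one \<psi> irr)

text \<open>The field with q^2 elements, realised inside the closure as the fixed points of the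
  squared Frobenius map. The entries of rational points of the unitary group lie in it.\<close>

typedef (overloaded) 'q quadratic_extension =
  "{x :: 'q::{field,finite} alg_closure. x ^ (CARD('q) * CARD('q)) = x}"
  by (rule exI[of _ 0]) simp

setup_lifting type_definition_quadratic_extension

lemma power_CARD_add2:
  fixes x y :: "'q::{field,finite} alg_closure"
  shows "(x + y) ^ (CARD('q) * CARD('q)) = x ^ (CARD('q) * CARD('q)) + y ^ (CARD('q) * CARD('q))"
  by (simp add: power_mult power_CARD_add)

lemma power_CARD_minus2:
  fixes x :: "'q::{field,finite} alg_closure"
  shows "(- x) ^ (CARD('q) * CARD('q)) = - (x ^ (CARD('q) * CARD('q)))"
  using power_CARD_add2[of x "- x"] CARD_ge_2[where 'a='q] by (simp add: power_0_left add_eq_0_iff split: if_splits)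

instantiation quadratic_extension :: ("{field,finite}") field
begin
lift_definition zero_quadratic_extension :: "'a quadratic_extension" is 0 by simp
lift_definition one_quadratic_extension :: "'a quadratic_extension" is 1 by simp
lift_definition uminus_quadratic_extension :: "'a quadratic_extension \<Rightarrow> 'a quadratic_extension" is uminus
  by (simp add: power_CARD_minus2)
lift_definition plus_quadratic_extension :: "'a quadratic_extension \<Rightarrow> 'a quadratic_extension \<Rightarrow> 'a quadratic_extension" is "(+)"
  by (simp add: power_CARD_add2)
lift_definition minus_quadratic_extension :: "'a quadratic_extension \<Rightarrow> 'a quadratic_extension \<Rightarrow> 'a quadratic_extension" is "(-)"
  by (simp add: power_CARD_add2 power_CARD_minus2 flip: add_uminus_conv_diff)
lift_definition times_quadratic_extension :: "'a quadratic_extension \<Rightarrow> 'a quadratic_extension \<Rightarrow> 'a quadratic_extension" is "(*)"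
  by (simp add: power_mult_distrib)
lift_definition inverse_quadratic_extension :: "'a quadratic_extension \<Rightarrow> 'a quadratic_extension" is inverse
  by (simp add: power_inverse)
lift_definition divide_quadratic_extension :: "'a quadratic_extension \<Rightarrow> 'a quadratic_extension \<Rightarrow> 'a quadratic_extension" is "(/)"
  by (simp add: power_divide)
instance by standard (transfer; simp add: algebra_simps divide_inverse)+
end

instance quadratic_extension :: ("{field,finite}") finite
proof
  let ?q = "CARD('a) * CARD('a)"
  let ?p = "monom 1 ?q - [:0, 1 :: 'a alg_closure:]"
  have "2 * 2 \<le> ?q" by (intro mult_le_mono CARD_ge_2)
  then have "coeff [:0, 1 :: 'a alg_closure:] ?q = 0" by (auto simp: coeff_pCons split: nat.split)
  then have "coeff ?p ?q = 1" by simp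
  then have "?p \<noteq> 0" by (metis coeff_0 zero_neq_one)
  then have "finite {x. poly ?p x = 0}" by (rule poly_roots_finite)
  then have "finite {x :: 'a alg_closure. x ^ ?q = x}" by (simp add: poly_monom)
  then have "finite (Abs_quadratic_extension ` {x :: 'a alg_closure. x ^ ?q = x})" by (rule finite_imageI)
  then show "finite (UNIV :: 'a quadratic_extension set)"
    unfolding type_definition.Abs_image[OF type_definition_quadratic_extension] .
qed

abbreviation \<iota>\<^sub>2 :: "'q::{field,finite} quadratic_extension \<Rightarrow> 'q alg_closure" where
  "\<iota>\<^sub>2 \<equiv> Rep_quadratic_extension"

lemma range_\<iota>2: "range \<iota>\<^sub>2 = {x :: 'q::{field,finite} alg_closure. x ^ (CARD('q) * CARD('q)) = x}"
  by (rule type_definition.Rep_range[OF type_definition_quadratic_extension])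

lemma field_hom_\<iota>2: "field_hom (\<iota>\<^sub>2 :: 'q::{field,finite} quadratic_extension \<Rightarrow> _)"
  by unfold_locales (transfer; simp)+

lift_definition conj2 :: "'q::{field,finite} quadratic_extension \<Rightarrow> 'q quadratic_extension" is "\<lambda>x. x ^ CARD('q)"
  by (metis power_mult mult.commute)

interpretation conj2: quadratic_conjugation "conj2 :: 'q::{field,finite} quadratic_extension \<Rightarrow> _"
proof
  let ?q = "CARD('q)"
  have q: "?q \<ge> 2" by (rule CARD_ge_2)
  have m: "(- x) ^ ?q = - (x ^ ?q)" for x :: "'q alg_closure"
    using power_CARD_add[of x "- x"] q by (simp add: power_0_left add_eq_0_iff split: if_splits)
  fix a b :: "'q quadratic_extension"
  show "conj2 (a + b) = conj2 a + conj2 b" by transfer (rule power_CARD_add)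
  show "conj2 (a * b) = conj2 a * conj2 b" by transfer (rule power_mult_distrib)
  show "conj2 (1 :: 'q quadratic_extension) = 1" by transfer simp
  show "conj2 (conj2 a) = a" by transfer (simp add: power_mult)
  show "\<exists>b. b * conj2 b = a" if "conj2 a = a" "a \<noteq> 0"
    using that
  proof transfer
    fix a :: "'q alg_closure" assume a: "a ^ ?q = a" "a \<noteq> 0"
    \<comment> \<open>The norm is b^(q+1). Raising to the power q fixes \<open>a\<close>, and
      cancelling b^q shows that \<open>b\<close> lies in the quadratic extension.\<close>
    obtain b where b: "b ^ Suc ?q = a" using nth_root_exists[of "Suc ?q" a] by auto
    have b0: "b \<noteq> 0" using b a(2) by auto
    have "(b ^ ?q) ^ Suc ?q = b ^ Suc ?q" using a(1) unfolding b[symmetric] by (metis power_mult mult.commute)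
    then have "b ^ (?q * ?q) * b ^ ?q = b * b ^ ?q" by (simp add: power_mult mult.commute)
    then have "b ^ (?q * ?q) = b" using b0 by simp
    then show "\<exists>b\<in>{x. x ^ (?q * ?q) = x}. b * b ^ ?q = a" using b by auto
  qed
  show "\<exists>b. b * b = a \<and> (conj2 b = b \<or> conj2 b = - b)" if "conj2 a = a"
    using that
  proof transfer
    fix a :: "'q alg_closure" assume a: "a ^ ?q = a"
    obtain b where b: "b * b = a" using nth_root_exists[of 2 a] by (auto simp: power2_eq_square)
    have "b ^ ?q * b ^ ?q = b * b" using a unfolding b[symmetric] by (simp add: power_mult_distrib)
    then have c: "b ^ ?q = b \<or> b ^ ?q = - b" by (simp add: square_eq_iff)
    then have "b ^ (?q * ?q) = b" by (auto simp: power_mult m)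
    then show "\<exists>b\<in>{x. x ^ (?q * ?q) = x}. b * b = a \<and> (b ^ ?q = b \<or> b ^ ?q = - b)" using b c by blast
  qed
  show "\<exists>a :: 'q quadratic_extension. conj2 a \<noteq> a"
  proof transfer
    show "\<exists>a\<in>{x :: 'q alg_closure. x ^ (?q * ?q) = x}. a ^ ?q \<noteq> a"
    proof (cases "(1 :: 'q alg_closure) = - 1")
      case False
      \<comment> \<open>Away from characteristic 2 an element with b^(q-1) = - 1 is sent to its
        negative and hence is not fixed.\<close>
      obtain b :: "'q alg_closure" where b: "b ^ (?q - 1) = - 1" using nth_root_exists[of "?q - 1" "- 1 :: 'q alg_closure"] q by auto
      have "b ^ Suc (?q - 1) = b * (- 1)" by (simp only: power_Suc b)
      then have bq: "b ^ ?q = - b" using q by simp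
      have "b \<noteq> 0" using b q by (auto simp: power_0_left split: if_splits)
      have "b + b \<noteq> 0"
      proof
        assume "b + b = 0"
        then have "b * (1 + 1) = 0" by (simp only: distrib_left mult_1_right)
        then show False using \<open>b \<noteq> 0\<close> False by (simp add: eq_neg_iff_add_eq_0)
      qed
      then have "b ^ ?q \<noteq> b" unfolding bq by (metis add.left_inverse)
      moreover have "b ^ (?q * ?q) = b" by (simp add: power_mult bq m)
      ultimately show ?thesis by blast
    next
      case True
      \<comment> \<open>The Artin-Schreier equation b^q = b + 1; in characteristic 2 a second
        application of Frobenius returns to \<open>b\<close>.\<close>
      let ?p = "monom 1 ?q - [:1, 1 :: 'q alg_closure:]"
      have "coeff ?p ?q = 1" using q by (auto simp: coeff_monom coeff_pCons split: nat.split)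
      then have "degree ?p \<ge> ?q" by (intro le_degree) simp
      then obtain b where "poly ?p b = 0" using alg_closed_imp_poly_has_root[of ?p] q by auto
      then have bq: "b ^ ?q = b + 1" by (simp add: poly_monom add.commute)
      have "b ^ (?q * ?q) = b + 1 + 1" by (simp add: power_mult bq power_CARD_add)
      also have "\<dots> = b" using True by (metis add.assoc add.right_neutral eq_neg_iff_add_eq_0)
      finally show ?thesis using bq by (intro bexI[of _ b]) auto
    qed
  qed
qed

section \<open>The unitary group over the quadratic extension\<close>

lemma map_dag_conj2:
  assumes A: "A \<in> carrier_mat (2 * n) (2 * n)"
  shows "map_mat \<iota>\<^sub>2 (dag conj2 n A) = dag (\<lambda>x. x ^ CARD('q)) n (map_mat \<iota>\<^sub>2 (A :: 'q::{field,finite} quadratic_extension mat))"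
proof -
  interpret field_hom "\<iota>\<^sub>2 :: 'q quadratic_extension \<Rightarrow> _" by (rule field_hom_\<iota>2)
  have e: "\<iota>\<^sub>2 (conj2 x) = \<iota>\<^sub>2 x ^ CARD('q)" for x :: "'q quadratic_extension" by transfer simp
  have t: "map_mat \<iota>\<^sub>2 (transpose_mat (map_mat conj2 A)) = transpose_mat (map_mat (\<lambda>x. x ^ CARD('q)) (map_mat \<iota>\<^sub>2 A))"
    by (rule eq_matI) (auto simp: e)
  show ?thesis
    unfolding dag_def using A E_inv(4)[of n, where 'a="'q quadratic_extension"]
    by (simp add: mat_hom_mult[of _ "2 * n" "2 * n" _ "2 * n"] map_E t GL_hom(2)[OF E_mat_GL(1), symmetric])
qed

text \<open>\<open>F_U n A\<close> is the inverse of the adjoint of \<open>A\<close> for the q-th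
  power map.\<close>

lemma F_U_fixed_iff:
  fixes A :: "'q::{field,finite} alg_closure mat"
  assumes A: "A \<in> carrier (GL (2 * n))"
  shows "F_U n A = A \<longleftrightarrow> dag (\<lambda>x. x ^ CARD('q)) n A * A = 1\<^sub>m (2 * n)"
proof -
  let ?N = "2 * n"
  interpret e: field_endomorphism "\<lambda>x :: 'q alg_closure. x ^ CARD('q)"
    unfolding field_endomorphism_def by (rule field_hom_power_CARD)
  let ?d = "dag (\<lambda>x :: 'q alg_closure. x ^ CARD('q)) n A"
  note Fg = transpose_GL[OF e.\<sigma>h.GL_hom(1)[OF A]]
  have F: "F_U n A = E_mat n * ginv ?N (transpose_mat (F_GL A)) * ginv ?N (E_mat n)" by (simp add: F_U_def)
  have dG: "?d \<in> carrier (GL ?N)" by (rule e.dag_GL(1)[OF A])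
  have "ginv ?N ?d = ginv ?N (ginv ?N (E_mat n)) * (ginv ?N (transpose_mat (F_GL A)) * ginv ?N (E_mat n))"
    unfolding dag_def F_GL_def
    using GL_inv_mult[OF GL_mult[OF E_mat_GL(1) Fg(1)] GL_inv(1)[OF E_mat_GL(1)]] GL_inv_mult[OF E_mat_GL(1) Fg(1)] by simp
  also have "\<dots> = F_U n A"
    unfolding F using GL_inv(4)[OF Fg(1)] E_inv(4)[of n, where 'a="'q alg_closure"]
    by (simp add: GL_inv_inv[OF E_mat_GL(1)] F_GL_def sq_assoc[of _ ?N])
  finally have eq: "F_U n A = ginv ?N ?d" by simp
  show ?thesis
  proof
    assume "F_U n A = A"
    then have "?d * A = ?d * ginv ?N ?d" using eq by simp
    then show "?d * A = 1\<^sub>m ?N" using GL_inv(3)[OF dG] by simp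
  next
    assume "?d * A = 1\<^sub>m ?N"
    then have "ginv ?N A = ?d" by (rule GL_left_inverse[OF A GL_in_carrier_mat[OF dG]])
    then show "F_U n A = A" using eq GL_inv_inv[OF A] by simp
  qed
qed

lemma multiplicity_U:
  fixes \<psi> :: "'q::{finite,field} \<Rightarrow> 'l::prime_card Q_l_bar" and scale :: "'l Q_l_bar \<Rightarrow> 'v::ab_group_add \<Rightarrow> 'v"
  assumes \<psi>: "nontrivial_additive_character \<psi>" and irr: "irreducible_representation (fixed_points (GL (2 * n)) (F_U n)) scale \<pi>"
  shows "shalika_multiplicity n (F_U n) \<psi> scale \<pi> \<le> 1"
proof (rule shalika_multiplicity_le_one[OF field_hom_\<iota>2, where U = "unitary conj2 n"])
  let ?N = "2 * n" and ?\<phi> = "\<lambda>x :: 'q alg_closure. x ^ CARD('q)"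
  interpret e: field_endomorphism ?\<phi>
    unfolding field_endomorphism_def by (rule field_hom_power_CARD)
  interpret \<iota>: field_hom "\<iota>\<^sub>2 :: 'q quadratic_extension \<Rightarrow> _" by (rule field_hom_\<iota>2)
  have conj: "\<iota>\<^sub>2 (conj2 x) = \<iota>\<^sub>2 x ^ CARD('q)" for x :: "'q quadratic_extension" by transfer simp
  have range1: "\<iota>\<^sub>2 x \<in> range to_ac \<longleftrightarrow> conj2 x = x" for x :: "'q quadratic_extension"
    unfolding range_to_ac mem_Collect_eq conj[symmetric] by simp
  show "{A \<in> carrier (GL ?N). F_U n A = A} = map_mat \<iota>\<^sub>2 ` (unitary conj2 n :: 'q quadratic_extension mat set)"
  proof
    show "map_mat \<iota>\<^sub>2 ` (unitary conj2 n :: 'q quadratic_extension mat set) \<subseteq> {A \<in> carrier (GL ?N). F_U n A = A}"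
    proof
      fix A assume "A \<in> map_mat \<iota>\<^sub>2 ` (unitary conj2 n :: 'q quadratic_extension mat set)"
      then obtain B :: "'q quadratic_extension mat" where B: "B \<in> unitary conj2 n" "A = map_mat \<iota>\<^sub>2 B" by blast
      note b = conj2.unitaryD[OF B(1)]
      have A: "A \<in> carrier (GL ?N)" unfolding B(2) by (rule \<iota>.GL_hom(1)[OF b(1)])
      have "dag ?\<phi> n A * A = map_mat \<iota>\<^sub>2 (dag conj2 n B * B)"
        unfolding B(2) map_dag_conj2[OF b(5), symmetric]
        by (rule \<iota>.mat_hom_mult[of _ ?N ?N _ ?N, symmetric]) (use b(5) in auto)
      then have "dag ?\<phi> n A * A = 1\<^sub>m ?N" by (simp add: b(2) \<iota>.mat_hom_one)
      then show "A \<in> {A \<in> carrier (GL ?N). F_U n A = A}" using A F_U_fixed_iff[OF A] by simp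
    qed
    show "{A \<in> carrier (GL ?N). F_U n A = A} \<subseteq> map_mat \<iota>\<^sub>2 ` (unitary conj2 n :: 'q quadratic_extension mat set)"
    proof
      fix A :: "'q alg_closure mat" assume "A \<in> {A \<in> carrier (GL ?N). F_U n A = A}"
      then have A: "A \<in> carrier (GL ?N)" and d: "dag ?\<phi> n A * A = 1\<^sub>m ?N" using F_U_fixed_iff[of A n] by auto
      note Ac = GL_in_carrier_mat[OF A]
      have inv_A: "ginv ?N A = dag ?\<phi> n A" by (rule GL_left_inverse[OF A _ d]) (use Ac in simp)
      \<comment> \<open>The adjoint applied twice is the q^2-power map on the entries. For a fixed
        point the adjoint is the inverse, so applying it twice gives \<open>A\<close> back, and the
        entries lie in the quadratic extension.\<close>
      have "map_mat ?\<phi> (map_mat ?\<phi> A) = dag ?\<phi> n (dag ?\<phi> n A)" by (rule e.dag_dag_map[OF Ac, symmetric])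
      also have "\<dots> = A" using e.dag_GL(2)[OF A] inv_A GL_inv_inv[OF A] by simp
      finally have AA: "map_mat ?\<phi> (map_mat ?\<phi> A) = A" .
      have "A $$ (i, j) ^ (CARD('q) * CARD('q)) = A $$ (i, j)" if "i < ?N" "j < ?N" for i j
        using arg_cong[OF AA, of "\<lambda>A. A $$ (i, j)"] Ac that by (simp add: power_mult)
      then obtain B where B: "B \<in> carrier_mat ?N ?N" "A = map_mat \<iota>\<^sub>2 B"
        using map_mat_image[OF Ac, of \<iota>\<^sub>2] unfolding range_\<iota>2 by blast
      have BG: "B \<in> carrier (GL ?N)" using GL_reflect[OF field_hom_\<iota>2 B(1)] A B(2) by simp
      have "map_mat \<iota>\<^sub>2 (dag conj2 n B * B) = dag ?\<phi> n A * A"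
        unfolding B(2) map_dag_conj2[OF B(1), symmetric]
        by (rule \<iota>.mat_hom_mult[of _ ?N ?N _ ?N]) (use B(1) in auto)
      then have "map_mat \<iota>\<^sub>2 (dag conj2 n B * B) = map_mat \<iota>\<^sub>2 (1\<^sub>m ?N)" using d by (simp add: \<iota>.mat_hom_one)
      then have "dag conj2 n B * B = 1\<^sub>m ?N" by (rule \<iota>.mat_hom_inj)
      then show "A \<in> map_mat \<iota>\<^sub>2 ` (unitary conj2 n :: 'q quadratic_extension mat set)"
        using B(2) BG by (auto simp: unitary_def)
    qed
  qed
  show "unitary conj2 n \<subseteq> carrier (GL ?N)" by (auto simp: unitary_def)
  show "1\<^sub>m ?N \<in> unitary conj2 n" by (simp add: unitary_def GL_one conj2.dag_one)
  show "\<iota>\<^sub>2 (chiS n s) \<in> range to_ac" if "s \<in> carrier (Shalika n)" "s \<in> unitary conj2 n" for s :: "'q quadratic_extension mat"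
    unfolding range1 by (rule conj2.chiS_unitary[OF that])
  show "range to_ac \<subseteq> range (\<iota>\<^sub>2 :: 'q quadratic_extension \<Rightarrow> _)"
    unfolding range_\<iota>2 range_to_ac by (auto simp: power_mult)
  fix g :: "'q quadratic_extension mat" assume g: "g \<in> unitary conj2 n"
  interpret unitary_shalika_pair n g conj2
    using conj2.unitaryD(1)[OF g] g by unfold_locales
  show "(\<forall>c. \<iota>\<^sub>2 c \<in> range to_ac \<longrightarrow> (\<exists>s\<in>carrier (Shalika n) \<inter> unitary conj2 n.
        ginv ?N g * s * g \<in> carrier (Shalika n) \<and> chiS n s - chiS n (ginv ?N g * s * g) = c)) \<or>
      (\<exists>s\<in>carrier (Shalika n) \<inter> unitary conj2 n. \<exists>s'\<in>carrier (Shalika n) \<inter> unitary conj2 n.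
        W0 n * transpose_mat g * W0 n * s' = s * g \<and> chiS n s = chiS n s')"
    using unitary_dichotomy unfolding C_def chi_def range1 by blast
qed (simp_all add: conj2.unitary_mult conj2.unitary_inv conj2.unitary_tau \<psi> irr)

theorem corollary5p23:
  fixes n :: nat
    and F :: "'q::{finite,field} alg_closure mat \<Rightarrow> 'q alg_closure mat"
    and \<psi> :: "'q \<Rightarrow> 'l::prime_card Q_l_bar"
    and scale :: "'l Q_l_bar \<Rightarrow> 'v::ab_group_add \<Rightarrow> 'v"
    and \<pi> :: "'q alg_closure mat \<Rightarrow> 'v \<Rightarrow> 'v"
  assumes "CARD('l) \<noteq> CHAR('q)"
    and "F = F_GL \<or> F = F_U n"
    and "nontrivial_additive_character \<psi>"
    and "irreducible_representation (fixed_points (GL (2 * n)) F) scale \<pi>"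
  shows "shalika_multiplicity n F \<psi> scale \<pi> \<le> 1"
  using assms(2-4) multiplicity_GL multiplicity_U by blast

end
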